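(* Let $\gamma\in(0,1)$ and let $z_0=(x_0,y_0)\in(0,\infty)^2$ be the starting point. Let $\alpha\in(0,\pi/2)$ and $z=(x,y)\in\mathbb{R}_+^2$. When $z\to\infty$ and $y/x\to\tan\alpha$ we have $$g_{z_0}(z)\sim\frac{h^{\alpha}(z_0)}{\sqrt{|z|}}\,\frac{e^{-z\cdot(p(\alpha),q(\alpha))}}{\sqrt{2\pi(\cos\alpha+\sin\alpha)}},$$ where the saddle point $(p(\alpha),q(\alpha))$ is defined by $$(p(\alpha),q(\alpha)):=\mathrm{argmax}\{p\cos\alpha+q\sin\alpha : (p,q)\in\mathbb{R}^2,\ K(p,q)=0\}=\left(\frac{\gamma^2}{2}-\frac{1}{2(1+\frac{1}{\tan\alpha})^2},\ \frac{(1-\gamma)^2}{2}-\frac{1}{2(1+\tan\alpha)^2}\right)$$ and $h^\alpha$ is a harmonic function for the killed process, i.e. (as a function of $z_0$) $\mathcal{G}h^\alpha=0$ on $\mathbb{R}_+^2$ and $h^\alpha=0$ on $\mathbb{R}_+\times\{0\}\cup\{0\}\times\mathbb{R}_+$, defined for $\alpha\in(0,\pi/2)$ by $$h^\alpha(z_0):=e^{p(\alpha)x_0+q(\alpha)y_0}-L_1(q(\alpha))-L_2(p(\alpha)).$$ We also have the asymptotics of the exit densities on the boundaries $$f_1(y)\underset{y\to\infty}{\sim}\frac{h^{\pi/2}(z_0)}{y^{3/2}}\frac{e^{-yq(\pi/2)}}{\sqrt{2\pi}}\quad\text{and}\quad f_2(x)\underset{x\to\infty}{\sim}\frac{h^0(z_0)}{x^{3/2}}\frac{e^{-xp(0)}}{\sqrt{2\pi}},$$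 where $$h^{\pi/2}(z_0):=x_0e^{x_0p(\pi/2)+y_0q(\pi/2)}-L_2'(p(\pi/2))\quad\text{and}\quad h^0(z_0):=y_0e^{x_0p(0)+y_0q(0)}-L_1'(q(0)).$$
   Context: Let $W$ be a standard one-dimensional Brownian motion, and let $Z(t)=(X(t),Y(t))=(x_0-W(t)+(1-\gamma)t,\ y_0+W(t)+\gamma t)$, $t\ge0$, a degenerate Brownian motion with drift started at $z_0=(x_0,y_0)$. Let $T_1=\inf\{t\ge0: Z(t)\in\{0\}\times\mathbb{R}_+\}$, $T_2=\inf\{t\ge0: Z(t)\in\mathbb{R}_+\times\{0\}\}$, and $T=T_1\wedge T_2$, the first exit time from $(0,\infty)^2$. The killed process is $Z$ killed at time $T$. The Green's density $g_{z_0}$ of the killed process is the density (assumed to exist) of the measure $S\mapsto\int_0^\infty\mathbb{P}(Z(t)\in S,\ t<T)\,dt$, $S\subset(0,\infty)^2$. The exit densities are: $f_1$ is the density of $S\mapsto\mathbb{P}(Y(T_1)\in S,\ T_1<T_2)$ and $f_2$ the density of $S\mapsto\mathbb{P}(X(T_2)\in S,\ T_2<T_1)$. Generator: $\mathcal{G}=\frac12\left(\partial_x-\partial_y\right)^2+(1-\gamma)\partial_x+\gamma\partial_y$. Kernel: $K(p,q)=\frac12(p-q)^2+(1-\gamma)p+\gamma q$. Laplace transforms (depending on $z_0$): $L_1(q)=\int_0^\infty f_1(y)e^{qy}dy=\mathbb{E}(e^{qY(T_1)}\mathbf{1}_{T_1<T_2})$ for $\Re q<0$, $L_2(p)=\int_0^\infty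 f_2(x)e^{px}dx=\mathbb{E}(e^{pX(T_2)}\mathbf{1}_{T_2<T_1})$ for $\Re p<0$. With $P^-(q)=\gamma-1+q-\sqrt{(1-\gamma)^2-2q}$ and $Q^-(p)=-\gamma+p-\sqrt{\gamma^2-2p}$, they are continued by $L_1(q)=e^{P^-(q)x_0+qy_0}-L_2(P^-(q))$ for $\Re q<(1-\gamma)^2/2$ and $L_2(p)=e^{px_0+Q^-(p)y_0}-L_1(Q^-(p))$ for $\Re p<\gamma^2/2$. Primes denote derivatives. At the endpoints, $(p(0),q(0))=(\gamma^2/2,\,-\gamma+\gamma^2/2)$ and $(p(\pi/2),q(\pi/2))=((\gamma^2-1)/2,\,(1-\gamma)^2/2)$.
   Formalization: The asymptotics of g are proved with (p,q) at the direction of z, and with fixed α if also (y−x tan α)/√|z|→0 (false otherwise, e.g. y=x tan α+x^{3/4}); densities are the continuous versions (g off z_0); at the corner, h^α=0 is meant as a limit from inside. *)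

theory Defs
  imports "HOL-Probability.Probability" "HOL-Library.Landau_Symbols"
begin

section \<open>Standard Brownian motion\<close>

text \<open>All paths, not just almost all, are continuous. Since \<open>M\<close> need not be complete,
  this is what makes the hitting times below measurable.\<close>

locale brownian_motion = prob_space M for M :: "'a measure" +
  fixes W :: "real \<Rightarrow> 'a \<Rightarrow> real"
  assumes start_zero: "\<And>\<omega>. \<omega> \<in> space M \<Longrightarrow> W 0 \<omega> = 0"
    and continuous_paths: "\<And>\<omega>. \<omega> \<in> space M \<Longrightarrow> continuous_on {0..} (\<lambda>t. W t \<omega>)"
    and normal_increments: "\<And>s t. 0 \<le> s \<Longrightarrow> s < t \<Longrightarrow>
      distributed M lborel (\<lambda>\<omega>. W t \<omega> - W s \<omega>) (normal_density 0 (sqrt (t - s)))"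
    and indep_increments: "\<And>(\<tau> :: nat \<Rightarrow> real) n. 0 \<le> \<tau> 0 \<Longrightarrow> strict_mono \<tau> \<Longrightarrow>
      indep_vars (\<lambda>_. borel) (\<lambda>i \<omega>. W (\<tau> (Suc i)) \<omega> - W (\<tau> i) \<omega>) {..<n}"

section \<open>The degenerate process and its exit from the quadrant\<close>

definition quadrant :: "(real \<times> real) set" where
  "quadrant = {0<..} \<times> {0<..}"

definition proc :: "real \<Rightarrow> (real \<Rightarrow> 'a \<Rightarrow> real) \<Rightarrow> real \<times> real \<Rightarrow> real \<Rightarrow> 'a \<Rightarrow> real \<times> real" where
  "proc \<gamma> W z\<^sub>0 t \<omega> = (fst z\<^sub>0 - W t \<omega> + (1 - \<gamma>) * t, snd z\<^sub>0 + W t \<omega> + \<gamma> * t)"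

text \<open>The infimum is taken in the extended reals, so it is \<open>\<infinity>\<close> if the axis is never hit.\<close>

definition hit1 :: "real \<Rightarrow> (real \<Rightarrow> 'a \<Rightarrow> real) \<Rightarrow> real \<times> real \<Rightarrow> 'a \<Rightarrow> ereal" where
  "hit1 \<gamma> W z\<^sub>0 \<omega> = (INF t \<in> {t. 0 \<le> t \<and> proc \<gamma> W z\<^sub>0 t \<omega> \<in> {0} \<times> {0..}}. ereal t)"

definition hit2 :: "real \<Rightarrow> (real \<Rightarrow> 'a \<Rightarrow> real) \<Rightarrow> real \<times> real \<Rightarrow> 'a \<Rightarrow> ereal" where
  "hit2 \<gamma> W z\<^sub>0 \<omega> = (INF t \<in> {t. 0 \<le> t \<and> proc \<gamma> W z\<^sub>0 t \<omega> \<in> {0..} \<times> {0}}. ereal t)"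

definition exit_time :: "real \<Rightarrow> (real \<Rightarrow> 'a \<Rightarrow> real) \<Rightarrow> real \<times> real \<Rightarrow> 'a \<Rightarrow> ereal" where
  "exit_time \<gamma> W z\<^sub>0 \<omega> = min (hit1 \<gamma> W z\<^sub>0 \<omega>) (hit2 \<gamma> W z\<^sub>0 \<omega>)"

text \<open>Ordinate of the process at the first hitting time, and abscissa at the second one; only used
  on events where the respective hitting time is finite.\<close>

definition exit_Y :: "real \<Rightarrow> (real \<Rightarrow> 'a \<Rightarrow> real) \<Rightarrow> real \<times> real \<Rightarrow> 'a \<Rightarrow> real" where
  "exit_Y \<gamma> W z\<^sub>0 \<omega> = snd (proc \<gamma> W z\<^sub>0 (real_of_ereal (hit1 \<gamma> W z\<^sub>0 \<omega>)) \<omega>)"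

definition exit_X :: "real \<Rightarrow> (real \<Rightarrow> 'a \<Rightarrow> real) \<Rightarrow> real \<times> real \<Rightarrow> 'a \<Rightarrow> real" where
  "exit_X \<gamma> W z\<^sub>0 \<omega> = fst (proc \<gamma> W z\<^sub>0 (real_of_ereal (hit2 \<gamma> W z\<^sub>0 \<omega>)) \<omega>)"

section \<open>Green's measure, exit measures and their densities\<close>

definition green_measure ::
  "'a measure \<Rightarrow> real \<Rightarrow> (real \<Rightarrow> 'a \<Rightarrow> real) \<Rightarrow> real \<times> real \<Rightarrow> (real \<times> real) set \<Rightarrow> ennreal" where
  "green_measure M \<gamma> W z\<^sub>0 S =
     (\<integral>\<^sup>+ t \<in> {0..}. emeasure M {\<omega> \<in> space M. proc \<gamma> W z\<^sub>0 t \<omega> \<in> S \<and> ereal t < exit_time \<gamma> W z\<^sub>0 \<omega>}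
        \<partial>lborel)"

definition exit_measure1 ::
  "'a measure \<Rightarrow> real \<Rightarrow> (real \<Rightarrow> 'a \<Rightarrow> real) \<Rightarrow> real \<times> real \<Rightarrow> real set \<Rightarrow> ennreal" where
  "exit_measure1 M \<gamma> W z\<^sub>0 S =
     emeasure M {\<omega> \<in> space M. exit_Y \<gamma> W z\<^sub>0 \<omega> \<in> S \<and> hit1 \<gamma> W z\<^sub>0 \<omega> < hit2 \<gamma> W z\<^sub>0 \<omega>}"

definition exit_measure2 ::
  "'a measure \<Rightarrow> real \<Rightarrow> (real \<Rightarrow> 'a \<Rightarrow> real) \<Rightarrow> real \<times> real \<Rightarrow> real set \<Rightarrow> ennreal" where
  "exit_measure2 M \<gamma> W z\<^sub>0 S =
     emeasure M {\<omega> \<in> space M. exit_X \<gamma> W z\<^sub>0 \<omega> \<in> S \<and> hit2 \<gamma> W z\<^sub>0 \<omega> < hit1 \<gamma> W z\<^sub>0 \<omega>}"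

definition is_density_on ::
  "'b::euclidean_space set \<Rightarrow> ('b set \<Rightarrow> ennreal) \<Rightarrow> ('b \<Rightarrow> real) \<Rightarrow> bool" where
  "is_density_on D \<mu> f \<longleftrightarrow>
     f \<in> borel_measurable (restrict_space borel D) \<and> (\<forall>x\<in>D. 0 \<le> f x) \<and>
     (\<forall>S \<in> sets borel. S \<subseteq> D \<longrightarrow> \<mu> S = (\<integral>\<^sup>+ x \<in> S. ennreal (f x) \<partial>lborel))"

section \<open>Laplace transforms of the exit measures\<close>

definition P_minus :: "real \<Rightarrow> real \<Rightarrow> real" where
  "P_minus \<gamma> q = \<gamma> - 1 + q - sqrt ((1 - \<gamma>)\<^sup>2 - 2 * q)"

definition Q_minus :: "real \<Rightarrow> real \<Rightarrow> real" where
  "Q_minus \<gamma> p = - \<gamma> + p - sqrt (\<gamma>\<^sup>2 - 2 * p)"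

definition exit_laplace1 ::
  "'a measure \<Rightarrow> real \<Rightarrow> (real \<Rightarrow> 'a \<Rightarrow> real) \<Rightarrow> real \<times> real \<Rightarrow> real \<Rightarrow> real" where
  "exit_laplace1 M \<gamma> W z\<^sub>0 q =
     (LINT \<omega>|M. exp (q * exit_Y \<gamma> W z\<^sub>0 \<omega>) * indicator {\<omega>. hit1 \<gamma> W z\<^sub>0 \<omega> < hit2 \<gamma> W z\<^sub>0 \<omega>} \<omega>)"

definition exit_laplace2 ::
  "'a measure \<Rightarrow> real \<Rightarrow> (real \<Rightarrow> 'a \<Rightarrow> real) \<Rightarrow> real \<times> real \<Rightarrow> real \<Rightarrow> real" where
  "exit_laplace2 M \<gamma> W z\<^sub>0 p =
     (LINT \<omega>|M. exp (p * exit_X \<gamma> W z\<^sub>0 \<omega>) * indicator {\<omega>. hit2 \<gamma> W z\<^sub>0 \<omega> < hit1 \<gamma> W z\<^sub>0 \<omega>} \<omega>)"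

text \<open>Restrictions to the real axis of the continued Laplace transforms, meaningful for
  \<open>q < (1 - \<gamma>)\<^sup>2 / 2\<close> and \<open>p < \<gamma>\<^sup>2 / 2\<close>. On these ranges \<open>P_minus\<close> and \<open>Q_minus\<close> are negative,
  so the continuation only refers to values in the domain of the defining integral.\<close>

definition L1 :: "'a measure \<Rightarrow> real \<Rightarrow> (real \<Rightarrow> 'a \<Rightarrow> real) \<Rightarrow> real \<times> real \<Rightarrow> real \<Rightarrow> real" where
  "L1 M \<gamma> W z\<^sub>0 q =
     (if q < 0 then exit_laplace1 M \<gamma> W z\<^sub>0 q
      else exp (P_minus \<gamma> q * fst z\<^sub>0 + q * snd z\<^sub>0) - exit_laplace2 M \<gamma> W z\<^sub>0 (P_minus \<gamma> q))"

definition L2 :: "'a measure \<Rightarrow> real \<Rightarrow> (real \<Rightarrow> 'a \<Rightarrow> real) \<Rightarrow> real \<times> real \<Rightarrow> real \<Rightarrow> real" where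
  "L2 M \<gamma> W z\<^sub>0 p =
     (if p < 0 then exit_laplace2 M \<gamma> W z\<^sub>0 p
      else exp (p * fst z\<^sub>0 + Q_minus \<gamma> p * snd z\<^sub>0) - exit_laplace1 M \<gamma> W z\<^sub>0 (Q_minus \<gamma> p))"

section \<open>Kernel, saddle point and the functions \<open>h\<close>\<close>

definition kernel :: "real \<Rightarrow> real \<Rightarrow> real \<Rightarrow> real" where
  "kernel \<gamma> p q = (p - q)\<^sup>2 / 2 + (1 - \<gamma>) * p + \<gamma> * q"

definition is_saddle :: "real \<Rightarrow> real \<Rightarrow> real \<times> real \<Rightarrow> bool" where
  "is_saddle \<gamma> \<alpha> =
     is_arg_max (\<lambda>(p, q). p * cos \<alpha> + q * sin \<alpha>) (\<lambda>(p, q). kernel \<gamma> p q = 0)"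

definition saddle :: "real \<Rightarrow> real \<Rightarrow> real \<times> real" where
  "saddle \<gamma> \<alpha> = arg_max (\<lambda>(p, q). p * cos \<alpha> + q * sin \<alpha>) (\<lambda>(p, q). kernel \<gamma> p q = 0)"

definition h_dir ::
  "'a measure \<Rightarrow> real \<Rightarrow> (real \<Rightarrow> 'a \<Rightarrow> real) \<Rightarrow> real \<Rightarrow> real \<times> real \<Rightarrow> real" where
  "h_dir M \<gamma> W \<alpha> z\<^sub>0 =
     (let (p, q) = saddle \<gamma> \<alpha>
      in exp (p * fst z\<^sub>0 + q * snd z\<^sub>0) - L1 M \<gamma> W z\<^sub>0 q - L2 M \<gamma> W z\<^sub>0 p)"

definition h_pi2 :: "'a measure \<Rightarrow> real \<Rightarrow> (real \<Rightarrow> 'a \<Rightarrow> real) \<Rightarrow> real \<times> real \<Rightarrow> real" where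
  "h_pi2 M \<gamma> W z\<^sub>0 =
     (let (p, q) = saddle \<gamma> (pi / 2)
      in fst z\<^sub>0 * exp (fst z\<^sub>0 * p + snd z\<^sub>0 * q) - deriv (L2 M \<gamma> W z\<^sub>0) p)"

definition h_0 :: "'a measure \<Rightarrow> real \<Rightarrow> (real \<Rightarrow> 'a \<Rightarrow> real) \<Rightarrow> real \<times> real \<Rightarrow> real" where
  "h_0 M \<gamma> W z\<^sub>0 =
     (let (p, q) = saddle \<gamma> 0
      in snd z\<^sub>0 * exp (fst z\<^sub>0 * p + snd z\<^sub>0 * q) - deriv (L1 M \<gamma> W z\<^sub>0) q)"

section \<open>Harmonic functions for the killed process\<close>

definition partial_x :: "(real \<times> real \<Rightarrow> real) \<Rightarrow> real \<times> real \<Rightarrow> real" where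
  "partial_x u z = deriv (\<lambda>s. u (s, snd z)) (fst z)"

definition partial_y :: "(real \<times> real \<Rightarrow> real) \<Rightarrow> real \<times> real \<Rightarrow> real" where
  "partial_y u z = deriv (\<lambda>s. u (fst z, s)) (snd z)"

definition partial_diff :: "(real \<times> real \<Rightarrow> real) \<Rightarrow> real \<times> real \<Rightarrow> real" where
  "partial_diff u z = partial_x u z - partial_y u z"

definition generator :: "real \<Rightarrow> (real \<times> real \<Rightarrow> real) \<Rightarrow> real \<times> real \<Rightarrow> real" where
  "generator \<gamma> u z =
     partial_diff (partial_diff u) z / 2 + (1 - \<gamma>) * partial_x u z + \<gamma> * partial_y u z"

text \<open>Differentiability is demanded explicitly because \<open>deriv\<close> is total. At a corner start both
  hitting times are zero, so both exit events are empty and the formula for \<open>h\<close> has no intended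
  value there; hence the boundary condition is stated both pointwise on the open axes and as a
  limit from inside at every boundary point, the corner included.\<close>

definition killed_harmonic :: "real \<Rightarrow> (real \<times> real \<Rightarrow> real) \<Rightarrow> bool" where
  "killed_harmonic \<gamma> u \<longleftrightarrow>
     u differentiable_on quadrant \<and> partial_x u differentiable_on quadrant \<and>
     partial_y u differentiable_on quadrant \<and>
     (\<forall>z \<in> quadrant. generator \<gamma> u z = 0) \<and>
     (\<forall>z \<in> {0<..} \<times> {0} \<union> {0} \<times> {0<..}. u z = 0) \<and>
     (\<forall>z \<in> {0..} \<times> {0} \<union> {0} \<times> {0..}. (u \<longlongrightarrow> 0) (at z within quadrant))"

section \<open>Going to infinity in a direction\<close>

definition angle :: "real \<times> real \<Rightarrow> real" where
  "angle z = arctan (snd z / fst z)"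

definition to_infinity_dir :: "real \<Rightarrow> (real \<times> real) filter" where
  "to_infinity_dir \<alpha> =
     inf (inf at_infinity (principal quadrant)) (filtercomap (\<lambda>z. snd z / fst z) (nhds (tan \<alpha>)))"

end

theory Submission
  imports Defs
begin

text \<open>
  The real zeros of the kernel form a parabola, parametrised by \<open>v \<mapsto> (par_p \<gamma> v, par_q \<gamma> v)\<close>,
  and \<open>par_exp \<gamma> v\<close> is the exponential with that exponent. It is harmonic for the generator, so
  \<open>par_exp \<gamma> v\<close> along the process is a martingale; stopping it at the exit gives
  \<open>lap1 (par_q \<gamma> v) + lap2 (par_p \<gamma> v) = par_exp \<gamma> v z\<close> for \<open>v > 1\<close> and for \<open>v < 0\<close>
  (\<open>laplace_functional_equation\<close>), where \<open>lap1\<close> and \<open>lap2\<close> are the transforms of the two exit laws.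
  Stopping needs the strong Markov property, which is built from the independence of increments:
  survival up to a time is a limit of events about dyadic times (\<open>survival_grid\<close>), and the hitting time is
  approximated from the right on a grid (\<open>strong_markov\<close>).

  The harmonic function is the defect \<open>hfun v\<close> of that equation for \<open>0 < v < 1\<close>, with
  \<open>v = sin \<alpha> / (cos \<alpha> + sin \<alpha>)\<close>. The reflection \<open>v \<mapsto> 2 - v\<close> preserves \<open>par_q\<close> and \<open>v \<mapsto> - v\<close>
  preserves \<open>par_p\<close>. Alternating them, the functional equation turns \<open>hfun v\<close> into an alternating sum of
  \<open>par_exp\<close> over the orbit of \<open>v\<close> (\<open>hfun_series\<close>). The terms decay like a Gaussian in \<open>n\<close>, so the series may be
  differentiated termwise and \<open>hfun v\<close> is harmonic in the starting point (\<open>harmonic_exp_sum\<close>). It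
  vanishes on the boundary because it lies between 0 and differences of exponentials that
  vanish there (\<open>hfun_le\<close>).

  The asymptotic equivalences need \<open>hfun v > 0\<close>. Completing the square, \<open>hfun v\<close> is a
  positive factor times the difference of a sum of Gaussians over a lattice of period \<open>2 * s0\<close> at two points.
  That sum decreases strictly on half a period (\<open>periodic_gauss_decreasing\<close>). Its derivative is a negative
  factor times \<open>theta_slope\<close>, which solves the backward heat equation on the triangle \<open>0 < a < s\<close>, vanishes
  on the two sides, and is nonnegative for large \<open>s\<close>, where one or two terms of the series dominate; a
  minimum principle carries the sign down to all \<open>s\<close> and makes it strict (\<open>theta_slope_pos\<close>).

  The sum of the two coordinates equals its initial value plus the time. Hence the free process
  from \<open>z\<close> has an explicit occupation density, a Gaussian evaluated at the only time at which the
  point \<open>w\<close> can be visited, and the strong Markov property shows that the Green's density is the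
  free density from \<open>z\<close> minus its averages over the starting points distributed as the exit position
  (\<open>green_density_formula\<close>). After division by the common Gaussian factor, the free density from \<open>(a, b)\<close> tends
  to \<open>par_exp \<gamma> v (a, b)\<close>, and dominated convergence yields \<open>hfun v\<close>
  (\<open>green_normalised_tendsto\<close>).

  Likewise the exit density on the vertical axis is a first passage density from \<open>z\<close> minus its average over starting
  points on the horizontal axis; this is checked on Laplace transforms (\<open>exit_density_formula\<close>). First passage densities
  decay like \<open>y powr (- 3 / 2)\<close> times an exponential, and dominated convergence gives the
  constant. It is positive because, up to a positive factor, it is minus a derivative of the periodic
  sum above (\<open>h_end_pos\<close>). Exchanging the coordinates and changing \<open>W\<close> to \<open>- W\<close> gives the other exit density.
\<close>

section \<open>The Markov property of Brownian motion at fixed times\<close>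

text \<open>The transition operator of Brownian motion over time \<open>r\<close>, written as an integral
  against one fixed law so that it can be studied as a function of \<open>r\<close> and
  \<open>w\<close>.\<close>

definition gauss_avg :: "real \<Rightarrow> (real \<Rightarrow> real) \<Rightarrow> real \<Rightarrow> real" where
  "gauss_avg r f w = (LINT x|std_normal_distribution. f (w + sqrt r * x))"

lemma prob_space_std_normal: "prob_space std_normal_distribution"
  by (rule prob_space_normal_density) simp

context brownian_motion
begin

lemma W_measurable [measurable]:
  assumes "0 \<le> t" shows "W t \<in> borel_measurable M"
proof (cases "t = 0")
  case True
  have "W 0 \<in> borel_measurable M \<longleftrightarrow> (\<lambda>_. 0 :: real) \<in> borel_measurable M"
    by (rule measurable_cong) (simp add: start_zero)
  then show ?thesis using True by simp
next
  case False
  with assms have "0 < t" by simp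
  from normal_increments[of 0 t] this have "(\<lambda>\<omega>. W t \<omega> - W 0 \<omega>) \<in> borel_measurable M"
    by (auto simp: distributed_def)
  moreover have "(\<lambda>\<omega>. W t \<omega> - W 0 \<omega>) \<in> borel_measurable M \<longleftrightarrow> W t \<in> borel_measurable M"
    by (rule measurable_cong) (simp add: start_zero)
  ultimately show ?thesis by simp
qed

lemma scaled_increment:
  assumes "0 \<le> s" "s < t"
  shows "distr M borel (\<lambda>\<omega>. (W t \<omega> - W s \<omega>) / sqrt (t - s)) = std_normal_distribution"
proof -
  have "distributed M lborel (\<lambda>\<omega>. (W t \<omega> - W s \<omega>) / sqrt (t - s)) std_normal_density"
    using normal_increments[OF assms] normal_standard_normal_convert[of "sqrt (t-s)" "\<lambda>\<omega>. W t \<omega> - W s \<omega>" 0] assms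
    by simp
  then have "distr M lborel (\<lambda>\<omega>. (W t \<omega> - W s \<omega>) / sqrt (t - s)) = std_normal_distribution"
    by (simp add: distributed_def)
  moreover have "distr M lborel (\<lambda>\<omega>. (W t \<omega> - W s \<omega>) / sqrt (t - s)) = distr M borel (\<lambda>\<omega>. (W t \<omega> - W s \<omega>) / sqrt (t - s))"
    by (rule distr_cong) auto
  ultimately show ?thesis by simp
qed

text \<open>The values at grid times up to \<open>s\<close> are sums of the increments before
  \<open>s\<close>, and these are independent of the increment from \<open>s\<close> to
  \<open>t\<close>, which is a centred Gaussian of variance \<open>t - s\<close>.\<close>

lemma markov_grid:
  fixes f :: "real \<Rightarrow> real"
  assumes f[measurable]: "f \<in> borel_measurable borel" and bound: "\<And>x. \<bar>f x\<bar> \<le> B"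
    and N: "0 < N" and s: "0 < s" "s < t" and C[measurable]: "\<And>i. C i \<in> sets borel"
  defines "A \<equiv> {\<omega> \<in> space M. \<forall>i\<le>N. W (real i * s / real N) \<omega> \<in> C i}"
  shows "(LINT \<omega>|M. f (W t \<omega>) * indicator A \<omega>)
    = (LINT \<omega>|M. gauss_avg (t - s) f (W s \<omega>) * indicator A \<omega>)"
proof -
  \<comment> \<open>The grid on the interval from 0 to \<open>s\<close>, then \<open>t\<close>; later values
      only make \<open>\<tau>\<close> strictly increasing.\<close>
  define \<tau> where "\<tau> i = (if i \<le> N then real i * s / real N else t + real (i - Suc N))" for i :: nat
  have mono: "strict_mono \<tau>"
  proof (subst strict_mono_Suc_iff, rule allI)
    fix n show "\<tau> n < \<tau> (Suc n)"
    proof (cases "n < N")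
      case True then show ?thesis using s N by (simp add: \<tau>_def field_simps)
    next
      case False
      then show ?thesis using s N by (cases "n = N") (auto simp: \<tau>_def)
    qed
  qed
  have \<tau>0: "\<tau> 0 = 0" "\<tau> N = s" "\<tau> (Suc N) = t" using N by (auto simp: \<tau>_def)
  define X where "X i \<omega> = W (\<tau> (Suc i)) \<omega> - W (\<tau> i) \<omega>" for i \<omega>
  have ind: "indep_vars (\<lambda>_. borel) X {..<Suc N}"
    using indep_increments[OF _ mono, of "Suc N"] by (simp add: X_def[abs_def] \<tau>0)
  have iv: "indep_var (PiM {..<N} (\<lambda>_. borel)) (\<lambda>\<omega>. restrict (\<lambda>i. X i \<omega>) {..<N})
      (PiM {N} (\<lambda>_. borel)) (\<lambda>\<omega>. restrict (\<lambda>i. X i \<omega>) {N})"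
    by (rule indep_var_restrict[OF ind]) auto
  define Y1 :: "(nat \<Rightarrow> real) \<Rightarrow> real \<times> real" where
    "Y1 u = (\<Sum>j<N. u j, if \<forall>i\<in>{..N}. (\<Sum>j<i. u j) \<in> C i then 1 else 0)" for u
  define Y2 :: "(nat \<Rightarrow> real) \<Rightarrow> real" where "Y2 v = v N / sqrt (t - s)" for v
  have meas_sum: "(\<lambda>u. \<Sum>j<i. u j) \<in> borel_measurable (PiM {..<N} (\<lambda>_. borel :: real measure))" if "i \<le> N" for i
    using that by (intro borel_measurable_sum measurable_component_singleton) auto
  have Y1: "Y1 \<in> measurable (PiM {..<N} (\<lambda>_. borel)) (borel \<Otimes>\<^sub>M borel)"
    unfolding Y1_def
    apply (intro measurable_Pair meas_sum order_refl measurable_If measurable_const; simp?)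
    done
  have Y2: "Y2 \<in> measurable (PiM {N} (\<lambda>_. borel)) borel"
    unfolding Y2_def by measurable
  define U where "U \<omega> = restrict (\<lambda>i. X i \<omega>) {..<N}" for \<omega>
  define V where "V \<omega> = restrict (\<lambda>i. X i \<omega>) {N}" for \<omega>
  have sumX: "(\<Sum>j<i. X j \<omega>) = W (\<tau> i) \<omega>" if "\<omega> \<in> space M" for i \<omega>
  proof (induction i)
    case 0 show ?case using \<tau>0(1) start_zero that by simp
  qed (simp add: X_def)
  have P: "Y1 (U \<omega>) = (W s \<omega>, indicator A \<omega>)" if "\<omega> \<in> space M" for \<omega>
  proof -
    have "(\<Sum>j<i. if j < N then X j \<omega> else undefined) = W (\<tau> i) \<omega>" if "i \<le> N" for i
      using that sumX[OF \<open>\<omega> \<in> space M\<close>, of i, symmetric] by (auto intro!: sum.cong)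
    then show ?thesis using that N by (auto simp: U_def Y1_def A_def \<tau>0 \<tau>_def indicator_def)
  qed
  have Z: "Y2 (V \<omega>) = (W t \<omega> - W s \<omega>) / sqrt (t - s)" for \<omega>
    by (simp add: V_def Y2_def X_def \<tau>0)
  let ?PU = "PiM {..<N} (\<lambda>_. borel :: real measure)" and ?PV = "PiM {N} (\<lambda>_. borel :: real measure)"
  have [measurable]: "U \<in> measurable M ?PU" "V \<in> measurable M ?PV"
    using iv unfolding U_def[abs_def] V_def[abs_def] by (auto dest: indep_var_rv1 indep_var_rv2)
  have distZ: "distr (distr M ?PV V) borel Y2 = std_normal_distribution"
    using scaled_increment[of s t] s by (simp add: distr_distr Y2 comp_def Z)
  have prod: "distr M ?PU U \<Otimes>\<^sub>M distr M ?PV V = distr M (?PU \<Otimes>\<^sub>M ?PV) (\<lambda>\<omega>. (U \<omega>, V \<omega>))"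
    using iv unfolding indep_var_distribution_eq U_def[symmetric, abs_def] V_def[symmetric, abs_def] by simp
  note [measurable] = Y1 Y2
  define h :: "(nat \<Rightarrow> real) \<times> (nat \<Rightarrow> real) \<Rightarrow> real" where
    "h = (\<lambda>(u, v). f (fst (Y1 u) + sqrt (t - s) * Y2 v) * snd (Y1 u))"
  have h[measurable]: "h \<in> borel_measurable (?PU \<Otimes>\<^sub>M ?PV)"
    unfolding h_def by measurable
  have hb: "norm (h x) \<le> B" for x
    using bound order_trans[OF abs_ge_zero bound] by (auto simp: h_def Y1_def split: prod.split)
  interpret PU: prob_space "distr M ?PU U" by (rule prob_space_distr) simp
  interpret PV: prob_space "distr M ?PV V" by (rule prob_space_distr) simp
  interpret pair_prob_space "distr M ?PU U" "distr M ?PV V" ..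
  have inth: "integrable (distr M ?PU U \<Otimes>\<^sub>M distr M ?PV V) h"
    by (rule P.integrable_const_bound[where B=B]) (use hb in auto)
  have inner: "(LINT v|distr M ?PV V. h (u, v)) = gauss_avg (t - s) f (fst (Y1 u)) * snd (Y1 u)" for u
  proof -
    have "(LINT v|distr M ?PV V. f (fst (Y1 u) + sqrt (t - s) * Y2 v))
        = (LINT x|distr (distr M ?PV V) borel Y2. f (fst (Y1 u) + sqrt (t - s) * x))"
      by (subst (2) integral_distr) auto
    then show ?thesis unfolding distZ by (simp add: h_def gauss_avg_def)
  qed
  have "(LINT \<omega>|M. f (W t \<omega>) * indicator A \<omega>) = (LINT \<omega>|M. h (U \<omega>, V \<omega>))"
    using s by (intro Bochner_Integration.integral_cong) (auto simp: h_def P Z)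
  also have "\<dots> = integral\<^sup>L (distr M ?PU U \<Otimes>\<^sub>M distr M ?PV V) h"
    unfolding prod by (subst integral_distr) auto
  also have "\<dots> = (LINT u|distr M ?PU U. (LINT v|distr M ?PV V. h (u, v)))"
    by (rule integral_fst'[symmetric]) (rule inth)
  also have "\<dots> = (LINT \<omega>|M. (LINT v|distr M ?PV V. h (U \<omega>, v)))"
    by (rule integral_distr) measurable
  also have "\<dots> = (LINT \<omega>|M. gauss_avg (t - s) f (W s \<omega>) * indicator A \<omega>)"
    unfolding inner by (intro Bochner_Integration.integral_cong) (auto simp: P)
  finally show ?thesis .
qed

text \<open>Transfers the Markov property from events about finitely many times to limits of such events.\<close>

lemma restriction_identity_limit:
  fixes a b :: "'a \<Rightarrow> real"
  assumes [measurable]: "a \<in> borel_measurable M" "b \<in> borel_measurable M"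
    and bounds: "\<And>\<omega>. \<bar>a \<omega>\<bar> \<le> B" "\<And>\<omega>. \<bar>b \<omega>\<bar> \<le> B"
    and [measurable]: "\<And>n. A n \<in> events" "A' \<in> events"
    and eq: "\<And>n :: nat. (LINT \<omega>|M. a \<omega> * indicator (A n) \<omega>) = (LINT \<omega>|M. b \<omega> * indicator (A n) \<omega>)"
    and lim: "\<And>\<omega>. (\<lambda>n. indicator (A n) \<omega> :: real) \<longlonglongrightarrow> indicator A' \<omega>"
  shows "(LINT \<omega>|M. a \<omega> * indicator A' \<omega>) = (LINT \<omega>|M. b \<omega> * indicator A' \<omega>)"
proof -
  have *: "(\<lambda>n. LINT \<omega>|M. c \<omega> * indicator (A n) \<omega>) \<longlonglongrightarrow> (LINT \<omega>|M. c \<omega> * indicator A' \<omega>)"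
    if [measurable]: "c \<in> borel_measurable M" and b: "\<And>\<omega>. \<bar>c \<omega>\<bar> \<le> B" for c
  proof (rule integral_dominated_convergence[where w="\<lambda>_. B"])
    show "AE \<omega> in M. norm (c \<omega> * indicator (A n) \<omega>) \<le> B" for n
      using b order_trans[OF abs_ge_zero b] by (auto simp: indicator_def)
  qed (auto intro!: tendsto_mult lim)
  show ?thesis
    using LIMSEQ_unique[OF *[of a] ] *[of b] bounds eq by auto
qed

lemma gauss_avg_measurable [measurable]:
  assumes [measurable]: "f \<in> borel_measurable borel"
    "r \<in> borel_measurable N" "w \<in> borel_measurable N"
  shows "(\<lambda>x. gauss_avg (r x) f (w x)) \<in> borel_measurable N"
proof -
  interpret G: prob_space std_normal_distribution by (rule prob_space_std_normal)
  show ?thesis unfolding gauss_avg_def by measurable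
qed

lemma gauss_avg_bound:
  assumes [measurable]: "f \<in> borel_measurable borel" and b: "\<And>x. \<bar>f x\<bar> \<le> B"
  shows "\<bar>gauss_avg r f w\<bar> \<le> B"
proof -
  interpret G: prob_space std_normal_distribution by (rule prob_space_std_normal)
  have "\<bar>gauss_avg r f w\<bar> \<le> (LINT x|std_normal_distribution. B)"
    unfolding gauss_avg_def
  proof (rule integral_abs_bound_integral)
    show "integrable std_normal_distribution (\<lambda>x. f (w + sqrt r * x))"
      by (rule G.integrable_const_bound[where B=B]) (auto simp: b)
  qed (auto simp: b)
  then show ?thesis using G.prob_space by simp
qed

end

section \<open>Hitting times of closed sets\<close>

context brownian_motion
begin

lemma proc_continuous:
  assumes "\<omega> \<in> space M"
  shows "continuous_on {0..} (\<lambda>t. proc \<gamma> W z t \<omega>)"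
  unfolding proc_def by (intro continuous_intros continuous_paths assms)

end

definition hit :: "real \<Rightarrow> (real \<Rightarrow> 'a \<Rightarrow> real) \<Rightarrow> real \<times> real \<Rightarrow> (real \<times> real) set \<Rightarrow> 'a \<Rightarrow> ereal" where
  "hit \<gamma> W z C \<omega> = (INF t \<in> {t. 0 \<le> t \<and> proc \<gamma> W z t \<omega> \<in> C}. ereal t)"

lemma hit_nonneg: "0 \<le> hit \<gamma> W z C \<omega>"
  unfolding hit_def by (rule INF_greatest) auto

context brownian_motion
begin

text \<open>Closedness of \<open>C\<close> and continuity of the path make the infimum attained.\<close>

lemma hit_le_iff:
  assumes C: "closed C" and \<omega>: "\<omega> \<in> space M"
  shows "hit \<gamma> W z C \<omega> \<le> ereal s \<longleftrightarrow> (\<exists>u\<in>{0..s}. proc \<gamma> W z u \<omega> \<in> C)"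
proof
  assume "\<exists>u\<in>{0..s}. proc \<gamma> W z u \<omega> \<in> C"
  then show "hit \<gamma> W z C \<omega> \<le> ereal s"
    unfolding hit_def by (auto intro: INF_lower2)
next
  assume le: "hit \<gamma> W z C \<omega> \<le> ereal s"
  define S where "S = {t. 0 \<le> t \<and> proc \<gamma> W z t \<omega> \<in> C}"
  have "S = {0..} \<inter> (\<lambda>t. proc \<gamma> W z t \<omega>) -` C" by (auto simp: S_def)
  then have "closed S"
    using continuous_closed_preimage[OF proc_continuous[OF \<omega>] _ C] by (simp add: closed_atLeast)
  have "S \<noteq> {}"
  proof
    assume "S = {}"
    then have "hit \<gamma> W z C \<omega> = \<infinity>" by (simp add: hit_def S_def[symmetric] top_ereal_def)
    with le show False by simp
  qed
  moreover have bdd: "bdd_below S" by (auto simp: S_def bdd_below_def)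
  ultimately have "Inf S \<in> S" using \<open>closed S\<close> by (intro closed_contains_Inf)
  moreover have "ereal (Inf S) \<le> hit \<gamma> W z C \<omega>"
    unfolding hit_def S_def[symmetric] using cInf_lower[OF _ bdd] by (intro INF_greatest) auto
  ultimately show "\<exists>u\<in>{0..s}. proc \<gamma> W z u \<omega> \<in> C"
    using order_trans[OF _ le, of "ereal (Inf S)"] by (intro bexI[of _ "Inf S"]) (auto simp: S_def)
qed

lemma hit_pos:
  assumes "closed C" "\<omega> \<in> space M" "z \<notin> C"
  shows "0 < hit \<gamma> W z C \<omega>"
proof -
  have "proc \<gamma> W z 0 \<omega> = z" using assms by (simp add: proc_def start_zero)
  then have "\<not> hit \<gamma> W z C \<omega> \<le> ereal 0"
    using assms by (subst hit_le_iff) auto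
  then show ?thesis by (simp add: zero_ereal_def)
qed

lemma proc_measurable [measurable]:
  "0 \<le> t \<Longrightarrow> proc \<gamma> W z t \<in> borel_measurable M"
  unfolding proc_def[abs_def] by measurable

text \<open>A path avoids the closed set \<open>C\<close> on a compact time interval exactly when its
  distance to \<open>C\<close> has a positive minimum there, and by continuity this can be read
  off at dyadic times. This expresses survival through countably many events of the kind treated
  in \<open>markov_grid\<close>.\<close>

lemma survival_grid:
  assumes C: "closed C" "C \<noteq> {}" and \<omega>: "\<omega> \<in> space M" and s: "0 \<le> s'" "s' \<le> s" "0 < s"
  shows "ereal s' < hit \<gamma> W z C \<omega> \<longleftrightarrow>
    (\<exists>m. \<forall>n. \<forall>i\<le>2^n. real i * s / 2^n \<le> s' \<longrightarrow>
       1 / real (Suc m) \<le> infdist (proc \<gamma> W z (real i * s / 2^n) \<omega>) C)" (is "?L \<longleftrightarrow> ?R")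
proof -
  define d where "d u = infdist (proc \<gamma> W z u \<omega>) C" for u
  have cont: "continuous_on {0..} d"
    unfolding d_def by (intro continuous_on_infdist proc_continuous \<omega>)
  have L: "?L \<longleftrightarrow> (\<forall>u\<in>{0..s'}. 0 < d u)"
  proof -
    have "0 < d u \<longleftrightarrow> proc \<gamma> W z u \<omega> \<notin> C" for u
      using in_closed_iff_infdist_zero[OF C, of "proc \<gamma> W z u \<omega>"] infdist_nonneg[of "proc \<gamma> W z u \<omega>" C]
      by (simp add: d_def less_le)
    then show ?thesis
      using hit_le_iff[OF C(1) \<omega>, of \<gamma> z s'] by (simp add: not_le[symmetric])
  qed
  show ?thesis
  proof
    assume ?L
    have "continuous_on {0..s'} d" by (rule continuous_on_subset[OF cont]) auto
    then obtain u where u: "u \<in> {0..s'}" "\<And>v. v \<in> {0..s'} \<Longrightarrow> d u \<le> d v"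
      using continuous_attains_inf[of "{0..s'}" d] s by auto
    with \<open>?L\<close> L have "0 < d u" by blast
    then obtain m where "1 / real (Suc m) < d u"
      using reals_Archimedean by (metis inverse_eq_divide)
    then have "1 / real (Suc m) \<le> d (real i * s / 2^n)" if "real i * s / 2^n \<le> s'" for n i
      using u(2)[of "real i * s / 2^n"] that s by auto
    then show ?R by (auto simp: d_def)
  next
    assume ?R
    then obtain m where m: "\<And>n i. i \<le> 2^n \<Longrightarrow> real i * s / 2^n \<le> s' \<Longrightarrow> 1 / real (Suc m) \<le> d (real i * s / 2^n)"
      by (auto simp: d_def)
    have "1 / real (Suc m) \<le> d u" if u: "u \<in> {0..s'}" for u
    proof -
      define k where "k n = nat \<lfloor>u * 2^n / s\<rfloor>" for n :: nat
      define q where "q n = real (k n) * s / 2^n" for n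
      have k: "real (k n) \<le> u * 2^n / s" "u * 2^n / s < real (k n) + 1" for n
        using u s by (auto simp: k_def)
      have q: "q n \<le> u" "u - s / 2^n \<le> q n" "0 \<le> q n" for n
      proof -
        have pos: "0 \<le> s / 2^n" using s by simp
        have eq: "u * 2^n / s * (s / 2^n) = u" using s by simp
        have "u * 2^n / s * (s / 2^n) \<le> (real (k n) + 1) * (s / 2^n)"
          by (rule mult_right_mono[OF less_imp_le[OF k(2)] pos])
        then show "u - s / 2^n \<le> q n" unfolding eq by (simp add: q_def distrib_right add_divide_distrib)
        have "real (k n) * (s / 2^n) \<le> u * 2^n / s * (s / 2^n)" by (rule mult_right_mono[OF k(1) pos])
        then show "q n \<le> u" unfolding eq by (simp add: q_def)
        show "0 \<le> q n" using s by (simp add: q_def)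
      qed
      have "(\<lambda>n. u - s / 2^n) \<longlonglongrightarrow> u - s * 0"
        unfolding divide_inverse power_inverse[symmetric]
        by (intro tendsto_intros LIMSEQ_realpow_zero) auto
      then have "q \<longlonglongrightarrow> u"
        using q by (intro tendsto_sandwich[of "\<lambda>n. u - s / 2^n" q _ "\<lambda>_. u"]) auto
      then have lim: "(\<lambda>n. d (q n)) \<longlonglongrightarrow> d u"
        using u q by (intro continuous_on_tendsto_compose[OF cont]) auto
      have "k n \<le> 2^n" for n
      proof -
        have "u * 2^n / s \<le> 2^n" using u s by (simp add: field_simps)
        then have "real (k n) \<le> 2^n" using k(1)[of n] by linarith
        then show ?thesis by (metis of_nat_le_iff of_nat_numeral of_nat_power)
      qed
      then have "1 / real (Suc m) \<le> d (q n)" for n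
        using m[of "k n" n] q(1)[of n] u unfolding q_def by auto
      then show ?thesis by (intro LIMSEQ_le_const[OF lim]) auto
    qed
    moreover have "0 < 1 / real (Suc m)" by simp
    ultimately show ?L unfolding L using less_le_trans by blast
  qed
qed

end

section \<open>The strong Markov property at a hitting time\<close>

context brownian_motion
begin

context
  fixes \<gamma> :: real and z :: "real \<times> real" and C :: "(real \<times> real) set"
  assumes C: "closed C" "C \<noteq> {}" "z \<notin> C"
begin

lemma hit_measurable [measurable]: "hit \<gamma> W z C \<in> borel_measurable M"
proof -
  have surv: "{\<omega> \<in> space M. ereal s < hit \<gamma> W z C \<omega>} \<in> events" if "0 \<le> s" for s
  proof -
    have "{\<omega> \<in> space M. ereal s < hit \<gamma> W z C \<omega>} =
      {\<omega> \<in> space M. \<exists>m. \<forall>n. \<forall>i\<in>{..2^n}. real i * (s+1) / 2^n \<le> s \<longrightarrow>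
        1 / real (Suc m) \<le> infdist (proc \<gamma> W z (real i * (s+1) / 2^n) \<omega>) C}"
      using survival_grid[OF C(1,2), of _ s "s+1" \<gamma> z] that by (auto simp: Ball_def)
    also have "\<dots> \<in> events"
    proof -
      have "(\<lambda>\<omega>. infdist (proc \<gamma> W z (real i * (s+1) / 2^n) \<omega>) C) \<in> borel_measurable M" for i n :: nat
        using that by (intro borel_measurable_continuous_on[of "\<lambda>x. infdist x C"] proc_measurable continuous_intros) auto
      note this[measurable]
      show ?thesis by measurable
    qed
    finally show ?thesis .
  qed
  show ?thesis
  proof (rule borel_measurableI_greater)
    fix a :: ereal
    show "{\<omega> \<in> space M. a < hit \<gamma> W z C \<omega>} \<in> events"
    proof (cases a)
      case (real r)
      show ?thesis
      proof (cases "0 \<le> r")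
        case True then show ?thesis using surv real by simp
      next
        case False
        then have "a < hit \<gamma> W z C \<omega>" for \<omega>
          using hit_nonneg[of \<gamma> W z C \<omega>] real by (metis ereal_less(2) less_le_trans linorder_not_le ereal_less_eq(5) zero_ereal_def ereal_less_eq(3))
        then show ?thesis by simp
      qed
    next
      case MInf
      then have "a < hit \<gamma> W z C \<omega>" for \<omega>
        using hit_nonneg[of \<gamma> W z C \<omega>] by auto
      then show ?thesis by simp
    qed simp
  qed
qed

text \<open>The Markov property for the event of not having hit \<open>C\<close> by an earlier time: the
  events in \<open>survival_grid\<close> form a decreasing sequence in \<open>n\<close> and an
  increasing one in \<open>m\<close>, so \<open>restriction_identity_limit\<close> applies
  twice.\<close>

lemma markov_survival:
  assumes f[measurable]: "f \<in> borel_measurable borel" and bound: "\<And>x. \<bar>f x\<bar> \<le> B"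
    and s: "0 \<le> s'" "s' \<le> s" "0 < s" "s \<le> t"
  defines "A \<equiv> {\<omega> \<in> space M. ereal s' < hit \<gamma> W z C \<omega>}"
  shows "(LINT \<omega>|M. f (W t \<omega>) * indicator A \<omega>)
    = (LINT \<omega>|M. gauss_avg (t - s) f (W s \<omega>) * indicator A \<omega>)"
proof (cases "s = t")
  case True
  interpret G: prob_space std_normal_distribution by (rule prob_space_std_normal)
  have "gauss_avg 0 f w = f w" for w using G.prob_space by (simp add: gauss_avg_def)
  then show ?thesis using True by simp
next
  case False
  with s have st: "s < t" by simp
  define u where "u n i = real i * s / 2^n" for n i :: nat
  define S where "S m n i = {w. u n i \<le> s' \<longrightarrow>
      1 / real (Suc m) \<le> infdist (fst z - w + (1 - \<gamma>) * u n i, snd z + w + \<gamma> * u n i) C}" for m n i :: nat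
  define E where "E m n = {\<omega> \<in> space M. \<forall>i\<le>2^n. W (u n i) \<omega> \<in> S m n i}" for m n :: nat
  have S[measurable]: "S m n i \<in> sets borel" for m n i
  proof -
    have "closed (S m n i)"
    proof (cases "u n i \<le> s'")
      case True
      then show ?thesis unfolding S_def by (auto intro!: closed_Collect_le continuous_intros)
    qed (simp add: S_def)
    then show ?thesis by (rule borel_closed)
  qed
  have [measurable]: "W t \<in> borel_measurable M" "W s \<in> borel_measurable M" "W (u n i) \<in> borel_measurable M" for n i
    using s by (auto intro!: W_measurable simp: u_def)
  have E[measurable]: "E m n \<in> events" for m n
    unfolding E_def by (auto simp: atMost_iff[symmetric] simp del: atMost_iff intro!: sets.sets_Collect_finite_All measurable_sets_Collect)
  have grid: "(LINT \<omega>|M. f (W t \<omega>) * indicator (E m n) \<omega>)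
    = (LINT \<omega>|M. gauss_avg (t - s) f (W s \<omega>) * indicator (E m n) \<omega>)" for m n
    using markov_grid[OF f bound, of "2^n" s t "S m n"] s st S by (simp add: E_def u_def)
  have dec: "decseq (E m)" for m
  proof (rule decseq_SucI)
    fix n show "E m (Suc n) \<subseteq> E m n"
    proof
      fix \<omega> assume e: "\<omega> \<in> E m (Suc n)"
      have uu: "u (Suc n) (2 * i) = u n i" for i by (simp add: u_def)
      then have "S m (Suc n) (2 * i) = S m n i" for i by (simp add: S_def)
      then show "\<omega> \<in> E m n"
        using e uu unfolding E_def by (auto) (metis mult_le_mono2)
    qed
  qed
  have inc: "incseq (\<lambda>m. \<Inter>n. E m n)"
  proof (rule incseq_SucI)
    fix m
    have "1 / real (Suc (Suc m)) \<le> 1 / real (Suc m)" by (simp add: frac_le)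
    then have "S m n i \<subseteq> S (Suc m) n i" for n i unfolding S_def by (auto intro: order_trans)
    then show "(\<Inter>n. E m n) \<subseteq> (\<Inter>n. E (Suc m) n)" unfolding E_def by blast
  qed
  have A: "A = (\<Union>m. \<Inter>n. E m n)"
    using survival_grid[OF C(1,2), of _ s' s \<gamma> z] s
    by (auto simp: A_def E_def S_def u_def proc_def)
  have "(LINT \<omega>|M. f (W t \<omega>) * indicator (\<Inter>n. E m n) \<omega>)
    = (LINT \<omega>|M. gauss_avg (t - s) f (W s \<omega>) * indicator (\<Inter>n. E m n) \<omega>)" for m
  proof (rule restriction_identity_limit[where B=B and A="E m"])
    show "(\<lambda>n. indicator (E m n) \<omega> :: real) \<longlonglongrightarrow> indicator (\<Inter>n. E m n) \<omega>" for \<omega>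
      by (rule LIMSEQ_indicator_decseq[OF dec])
  qed (use bound gauss_avg_bound[OF f bound] grid in \<open>simp_all\<close>)
  note eq = this
  show ?thesis unfolding A
  proof (rule restriction_identity_limit[where B=B and A="\<lambda>m. \<Inter>n. E m n"])
    show "(\<lambda>m. indicator (\<Inter>n. E m n) \<omega> :: real) \<longlonglongrightarrow> indicator (\<Union>m. \<Inter>n. E m n) \<omega>" for \<omega>
      by (rule LIMSEQ_indicator_incseq[OF inc])
  qed (use bound gauss_avg_bound[OF f bound] eq in \<open>simp_all\<close>)
qed

lemma grid_point_le: "real k * t / real (Suc n) \<le> t" if "k \<le> Suc n" "0 \<le> t"
  using mult_right_mono[of "real k" "real (Suc n)" t] that by (simp add: divide_le_eq mult.commute)

text \<open>The hitting time falls into the \<open>k\<close>-th of the \<open>n + 1\<close> cells that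
  divide the interval from 0 to \<open>t\<close>.\<close>

definition slice :: "real \<Rightarrow> nat \<Rightarrow> nat \<Rightarrow> 'a set" where
  "slice t n k = {\<omega> \<in> space M. ereal (real (k - 1) * t / real (Suc n)) < hit \<gamma> W z C \<omega> \<and>
     hit \<gamma> W z C \<omega> \<le> ereal (real k * t / real (Suc n))}"

lemma slice_measurable [measurable]: "slice t n k \<in> events"
  unfolding slice_def by measurable

text \<open>The sum evaluates \<open>G\<close> at the right end of the cell containing the hitting time, and
  this grid point converges to the hitting time.\<close>

lemma slice_sum_tendsto:
  fixes G :: "real \<Rightarrow> 'a \<Rightarrow> real"
  assumes t: "0 < t" and \<omega>: "\<omega> \<in> space M" and G: "continuous_on {0..t} (\<lambda>u. G u \<omega>)"
  shows "(\<lambda>n. \<Sum>k = 1..Suc n. G (real k * t / real (Suc n)) \<omega> * indicator (slice t n k) \<omega>)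
    \<longlonglongrightarrow> G (real_of_ereal (hit \<gamma> W z C \<omega>)) \<omega> * indicator {\<omega> \<in> space M. hit \<gamma> W z C \<omega> \<le> ereal t} \<omega>"
proof (cases "hit \<gamma> W z C \<omega> \<le> ereal t")
  case False
  then have "\<omega> \<notin> slice t n k" if "k \<in> {1..Suc n}" for n k
  proof -
    have "real k * t / real (Suc n) \<le> t" using that t by (intro grid_point_le) auto
    then show ?thesis using False by (auto simp: slice_def intro: order_trans)
  qed
  then show ?thesis using False by (simp add: indicator_def)
next
  case True
  define \<tau> where "\<tau> = real_of_ereal (hit \<gamma> W z C \<omega>)"
  have hit: "hit \<gamma> W z C \<omega> = ereal \<tau>"
    using True hit_nonneg[of \<gamma> W z C \<omega>] unfolding \<tau>_def by (cases "hit \<gamma> W z C \<omega>") auto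
  have \<tau>: "0 < \<tau>" "\<tau> \<le> t" using True hit_pos[OF C(1) \<omega> C(3), of \<gamma>] by (auto simp: hit)
  \<comment> \<open>The index of the cell that contains the hitting time.\<close>
  define \<kappa> where "\<kappa> n = nat \<lceil>\<tau> * real (Suc n) / t\<rceil>" for n
  have pos: "0 < \<tau> * real (Suc n) / t" for n using \<tau> t by simp
  have \<kappa>: "real (\<kappa> n) - 1 < \<tau> * real (Suc n) / t" "\<tau> * real (Suc n) / t \<le> real (\<kappa> n)" for n
    using pos[of n] unfolding \<kappa>_def by linarith+
  have \<kappa>1: "\<kappa> n \<in> {1..Suc n}" for n
  proof -
    have "\<tau> * real (Suc n) / t \<le> real (Suc n)"
      using mult_right_mono[OF \<tau>(2), of "real (Suc n)"] t by (simp add: divide_le_eq mult.commute)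
    then have "real (\<kappa> n) < real (Suc n) + 1" using \<kappa>(1)[of n] by linarith
    moreover have "0 < real (\<kappa> n)" using \<kappa>(2)[of n] pos[of n] by linarith
    ultimately show ?thesis by simp
  qed
  have slice: "\<omega> \<in> slice t n k \<longleftrightarrow> k = \<kappa> n" if "k \<in> {1..Suc n}" for n k
  proof -
    have "\<omega> \<in> slice t n k \<longleftrightarrow> real k - 1 < \<tau> * real (Suc n) / t \<and> \<tau> * real (Suc n) / t \<le> real k"
      using that t \<omega> by (simp add: slice_def hit of_nat_diff field_simps)
    also have "\<dots> \<longleftrightarrow> k = \<kappa> n" using \<kappa>[of n] by auto
    finally show ?thesis .
  qed
  have sum: "(\<Sum>k = 1..Suc n. G (real k * t / real (Suc n)) \<omega> * indicator (slice t n k) \<omega>)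
     = G (real (\<kappa> n) * t / real (Suc n)) \<omega>" for n
  proof -
    have "(\<Sum>k = 1..Suc n. G (real k * t / real (Suc n)) \<omega> * indicator (slice t n k) \<omega>)
      = (\<Sum>k = 1..Suc n. if k = \<kappa> n then G (real k * t / real (Suc n)) \<omega> else 0)"
      using slice by (intro sum.cong) (auto simp: indicator_def)
    also have "\<dots> = G (real (\<kappa> n) * t / real (Suc n)) \<omega>" using \<kappa>1[of n] by (subst sum.delta) auto
    finally show ?thesis .
  qed
  have "(\<lambda>n. real (\<kappa> n) * t / real (Suc n)) \<longlonglongrightarrow> \<tau>"
  proof (rule tendsto_sandwich)
    show "\<forall>\<^sub>F n in sequentially. \<tau> \<le> real (\<kappa> n) * t / real (Suc n)"
      using \<kappa>(2) t by (intro always_eventually allI) (simp add: field_simps)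
    show "\<forall>\<^sub>F n in sequentially. real (\<kappa> n) * t / real (Suc n) \<le> \<tau> + t * inverse (real (Suc n))"
    proof (intro always_eventually allI)
      fix n
      have "real (\<kappa> n) \<le> \<tau> * real (Suc n) / t + 1" using \<kappa>(1)[of n] by linarith
      then have "real (\<kappa> n) * (t / real (Suc n)) \<le> (\<tau> * real (Suc n) / t + 1) * (t / real (Suc n))"
        using t by (intro mult_right_mono) auto
      also have "\<dots> = \<tau> + t * inverse (real (Suc n))"
      proof -
        have "(\<tau> * N / t + 1) * (t / N) = \<tau> + t * inverse N" if "0 < N" for N
          using t that by (simp add: field_simps)
        then show ?thesis by simp
      qed
      finally show "real (\<kappa> n) * t / real (Suc n) \<le> \<tau> + t * inverse (real (Suc n))" by simp
    qed
    show "(\<lambda>n. \<tau> + t * inverse (real (Suc n))) \<longlonglongrightarrow> \<tau>"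
      using tendsto_add[OF tendsto_const tendsto_mult[OF tendsto_const LIMSEQ_inverse_real_of_nat], of \<tau> t] by simp
  qed auto
  moreover have "real (\<kappa> n) * t / real (Suc n) \<in> {0..t}" for n
    using \<kappa>1[of n] t grid_point_le[of "\<kappa> n" n t] by auto
  ultimately have "(\<lambda>n. G (real (\<kappa> n) * t / real (Suc n)) \<omega>) \<longlonglongrightarrow> G \<tau> \<omega>"
    using \<tau> by (intro continuous_on_tendsto_compose[OF G]) auto
  then show ?thesis unfolding sum using True \<omega> by (simp add: \<tau>_def)
qed

lemma stopped_measurable:
  assumes t: "0 < t" and G: "\<And>\<omega>. \<omega> \<in> space M \<Longrightarrow> continuous_on {0..t} (\<lambda>u. G u \<omega>)"
    and [measurable]: "\<And>u. 0 \<le> u \<Longrightarrow> u \<le> t \<Longrightarrow> G u \<in> borel_measurable M"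
  shows "(\<lambda>\<omega>. G (real_of_ereal (hit \<gamma> W z C \<omega>)) \<omega> * indicator {\<omega> \<in> space M. hit \<gamma> W z C \<omega> \<le> ereal t} \<omega> :: real)
    \<in> borel_measurable M"
proof (rule borel_measurable_LIMSEQ_real[OF slice_sum_tendsto])
  fix n
  have "G (real k * t / real (Suc n)) \<in> borel_measurable M" if "k \<in> {1..Suc n}" for k
    using that t grid_point_le[of k n t] by (intro assms(3)) auto
  then show "(\<lambda>\<omega>. \<Sum>k = 1..Suc n. G (real k * t / real (Suc n)) \<omega> * indicator (slice t n k) \<omega>) \<in> borel_measurable M"
    by (intro borel_measurable_sum borel_measurable_times borel_measurable_indicator slice_measurable) auto
qed (use assms in auto)

lemma slice_disjoint:
  assumes "0 \<le> t" "\<omega> \<in> slice t n j" "\<omega> \<in> slice t n k"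
  shows "j = k"
proof -
  have False if "\<omega> \<in> slice t n j" "\<omega> \<in> slice t n k" "j < k" for j k
  proof -
    have "hit \<gamma> W z C \<omega> \<le> ereal (real j * t / real (Suc n))" using that by (simp add: slice_def)
    also have "real j * t / real (Suc n) \<le> real (k - 1) * t / real (Suc n)"
      using that assms(1) by (intro divide_right_mono mult_right_mono) auto
    finally show False using that by (auto simp: slice_def)
  qed
  then show ?thesis using assms by (metis nat_neq_iff)
qed

lemma slice_sum_bound:
  fixes a :: "nat \<Rightarrow> real"
  assumes "\<And>k. \<bar>a k\<bar> \<le> B" "0 \<le> t"
  shows "\<bar>\<Sum>k = 1..Suc n. a k * indicator (slice t n k) \<omega>\<bar> \<le> B"
proof (cases "\<exists>j \<in> {1..Suc n}. \<omega> \<in> slice t n j")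
  case True
  then obtain j where j: "j \<in> {1..Suc n}" "\<omega> \<in> slice t n j" by blast
  have iff: "\<omega> \<in> slice t n k \<longleftrightarrow> k = j" for k
    using slice_disjoint[OF assms(2) j(2)] j(2) by blast
  have "(\<Sum>k = 1..Suc n. a k * indicator (slice t n k) \<omega>) = (\<Sum>k = 1..Suc n. if k = j then a k else 0)"
    unfolding iff indicator_def mem_Collect_eq by (intro sum.cong) auto
  also have "\<dots> = a j" using j(1) by (subst sum.delta) auto
  finally show ?thesis using assms(1) by simp
next
  case False
  then have "(\<Sum>k = 1..Suc n. a k * indicator (slice t n k) \<omega>) = 0"
    by (intro sum.neutral) (auto simp: indicator_def)
  then show ?thesis using order_trans[OF abs_ge_zero assms(1)] by simp
qed

text \<open>A cell is the difference of two survival events, both decided by the time at its right end.\<close>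

lemma markov_slice:
  assumes f[measurable]: "f \<in> borel_measurable borel" and bound: "\<And>x. \<bar>f x\<bar> \<le> B"
    and t: "0 < t" and k: "k \<in> {1..Suc n}"
  defines "s \<equiv> real k * t / real (Suc n)"
  shows "(LINT \<omega>|M. f (W t \<omega>) * indicator (slice t n k) \<omega>)
    = (LINT \<omega>|M. gauss_avg (t - s) f (W s \<omega>) * indicator (slice t n k) \<omega>)"
proof -
  define s' where "s' = real (k - 1) * t / real (Suc n)"
  define A where "A r = {\<omega> \<in> space M. ereal r < hit \<gamma> W z C \<omega>}" for r
  have s: "0 \<le> s'" "s' \<le> s" "0 < s" "s \<le> t"
    using t k grid_point_le[of k n t] by (auto simp: s_def s'_def intro!: divide_right_mono mult_right_mono)
  have [measurable]: "A r \<in> events" for r unfolding A_def by measurable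
  have [measurable]: "W t \<in> borel_measurable M" "W s \<in> borel_measurable M"
    using s t by (auto intro!: W_measurable)
  have "A s \<subseteq> A s'" using s le_less_trans[of "ereal s'" "ereal s"] by (auto simp: A_def)
  then have ind: "indicator (slice t n k) \<omega> = indicator (A s') \<omega> - (indicator (A s) \<omega> :: real)" for \<omega>
    by (auto simp: slice_def A_def s_def s'_def indicator_def not_le)
  have int: "integrable M (\<lambda>\<omega>. a \<omega> * indicator (A r) \<omega>)"
    if [measurable]: "a \<in> borel_measurable M" and "\<And>\<omega>. \<bar>a \<omega>\<bar> \<le> B" for a :: "'a \<Rightarrow> real" and r
    using that(2) order_trans[OF abs_ge_zero that(2)]
    by (intro integrable_const_bound[where B=B]) (auto simp: indicator_def)
  have "(LINT \<omega>|M. f (W t \<omega>) * indicator (A r) \<omega>)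
    = (LINT \<omega>|M. gauss_avg (t - s) f (W s \<omega>) * indicator (A r) \<omega>)" if "0 \<le> r" "r \<le> s" for r
    unfolding A_def by (rule markov_survival[OF f bound that s(3,4)])
  then show ?thesis
    unfolding ind right_diff_distrib using s gauss_avg_bound[OF f bound] bound
    by (subst (1 2) Bochner_Integration.integral_diff) (auto intro!: int)
qed

lemma gauss_avg_tendsto:
  assumes f: "continuous_on UNIV f" and bound: "\<And>x. \<bar>f x\<bar> \<le> B"
    and lim: "r \<longlonglongrightarrow> r'" "w \<longlonglongrightarrow> w'"
  shows "(\<lambda>n. gauss_avg (r n) f (w n)) \<longlonglongrightarrow> gauss_avg r' f w'"
proof -
  interpret G: prob_space std_normal_distribution by (rule prob_space_std_normal)
  have [measurable]: "f \<in> borel_measurable borel" using f by (rule borel_measurable_continuous_onI)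
  show ?thesis unfolding gauss_avg_def
  proof (rule integral_dominated_convergence[where w="\<lambda>_. B"])
    have "(\<lambda>n. f (w n + sqrt (r n) * x)) \<longlonglongrightarrow> f (w' + sqrt r' * x)" for x
      by (rule continuous_on_tendsto_compose[OF f]) (auto intro!: tendsto_intros lim)
    then show "AE x in std_normal_distribution. (\<lambda>n. f (w n + sqrt (r n) * x)) \<longlonglongrightarrow> f (w' + sqrt r' * x)"
      by simp
  qed (auto simp: bound)
qed

text \<open>Summing \<open>markov_slice\<close> over all cells gives the identity with the hitting time
  rounded up to the grid; the grid is then refined by dominated convergence. Continuity of
  \<open>f\<close> makes the integrand continuous along the path.\<close>

lemma strong_markov_continuous:
  assumes f: "continuous_on UNIV f" and bound: "\<And>x. \<bar>f x\<bar> \<le> B" and t: "0 < t"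
  defines "A \<equiv> {\<omega> \<in> space M. hit \<gamma> W z C \<omega> \<le> ereal t}"
    and "\<tau> \<equiv> \<lambda>\<omega>. real_of_ereal (hit \<gamma> W z C \<omega>)"
  shows "(LINT \<omega>|M. f (W t \<omega>) * indicator A \<omega>)
    = (LINT \<omega>|M. gauss_avg (t - \<tau> \<omega>) f (W (\<tau> \<omega>) \<omega>) * indicator A \<omega>)"
proof -
  have fm[measurable]: "f \<in> borel_measurable borel" using f by (rule borel_measurable_continuous_onI)
  have gb: "\<bar>gauss_avg r f w\<bar> \<le> B" for r w by (rule gauss_avg_bound[OF fm bound])
  have conv: "(\<lambda>n. LINT \<omega>|M. (\<Sum>k = 1..Suc n. G (real k * t / real (Suc n)) \<omega> * indicator (slice t n k) \<omega>))
      \<longlonglongrightarrow> (LINT \<omega>|M. G (\<tau> \<omega>) \<omega> * indicator A \<omega>)"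
    if G: "\<And>\<omega>. \<omega> \<in> space M \<Longrightarrow> continuous_on {0..t} (\<lambda>u. G u \<omega>)"
      "\<And>u. 0 \<le> u \<Longrightarrow> u \<le> t \<Longrightarrow> G u \<in> borel_measurable M" "\<And>u \<omega>. \<bar>G u \<omega>\<bar> \<le> B"
    for G :: "real \<Rightarrow> 'a \<Rightarrow> real"
  proof (rule integral_dominated_convergence[where w="\<lambda>_. B"])
    show "(\<lambda>\<omega>. G (\<tau> \<omega>) \<omega> * indicator A \<omega>) \<in> borel_measurable M"
      unfolding A_def \<tau>_def using t G by (intro stopped_measurable) auto
    show "(\<lambda>\<omega>. \<Sum>k = 1..Suc n. G (real k * t / real (Suc n)) \<omega> * indicator (slice t n k) \<omega>) \<in> borel_measurable M" for n
      using t grid_point_le by (intro borel_measurable_sum borel_measurable_times G borel_measurable_indicator slice_measurable) auto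
    show "AE \<omega> in M. (\<lambda>n. \<Sum>k = 1..Suc n. G (real k * t / real (Suc n)) \<omega> * indicator (slice t n k) \<omega>)
      \<longlonglongrightarrow> G (\<tau> \<omega>) \<omega> * indicator A \<omega>"
      unfolding A_def \<tau>_def using G t by (intro AE_I2 slice_sum_tendsto) auto
    show "AE \<omega> in M. norm (\<Sum>k = 1..Suc n. G (real k * t / real (Suc n)) \<omega> * indicator (slice t n k) \<omega>) \<le> B" for n
      unfolding real_norm_def using t G by (intro AE_I2 slice_sum_bound) auto
  qed simp
  have Wt[measurable]: "W t \<in> borel_measurable M" using t by simp
  have int: "integrable M (\<lambda>\<omega>. a \<omega> * indicator (slice t n k) \<omega>)"
    if [measurable]: "a \<in> borel_measurable M" and "\<And>\<omega>. \<bar>a \<omega>\<bar> \<le> B" for a :: "'a \<Rightarrow> real" and n k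
    using that(2) order_trans[OF abs_ge_zero that(2)]
    by (intro integrable_const_bound[where B=B]) (auto simp: indicator_def)
  have eq: "(LINT \<omega>|M. (\<Sum>k = 1..Suc n. f (W t \<omega>) * indicator (slice t n k) \<omega>))
    = (LINT \<omega>|M. (\<Sum>k = 1..Suc n. gauss_avg (t - real k * t / real (Suc n)) f (W (real k * t / real (Suc n)) \<omega>)
        * indicator (slice t n k) \<omega>))" (is "?l = ?r") for n
  proof -
    have "?l = (\<Sum>k = 1..Suc n. LINT \<omega>|M. f (W t \<omega>) * indicator (slice t n k) \<omega>)"
      by (rule Bochner_Integration.integral_sum, rule int) (use bound in auto)
    also have "\<dots> = (\<Sum>k = 1..Suc n. LINT \<omega>|M. gauss_avg (t - real k * t / real (Suc n)) f
        (W (real k * t / real (Suc n)) \<omega>) * indicator (slice t n k) \<omega>)"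
      by (intro sum.cong refl markov_slice[OF fm bound t])
    also have "\<dots> = ?r"
      using gb t by (intro Bochner_Integration.integral_sum[symmetric] int gauss_avg_measurable W_measurable) auto
    finally show ?thesis .
  qed
  have lim1: "(\<lambda>n. LINT \<omega>|M. (\<Sum>k = 1..Suc n. f (W t \<omega>) * indicator (slice t n k) \<omega>))
      \<longlonglongrightarrow> (LINT \<omega>|M. f (W t \<omega>) * indicator A \<omega>)"
    by (rule conv[of "\<lambda>u \<omega>. f (W t \<omega>)"]) (auto simp: bound)
  have "(\<lambda>n. LINT \<omega>|M. (\<Sum>k = 1..Suc n. gauss_avg (t - real k * t / real (Suc n)) f (W (real k * t / real (Suc n)) \<omega>)
        * indicator (slice t n k) \<omega>)) \<longlonglongrightarrow> (LINT \<omega>|M. gauss_avg (t - \<tau> \<omega>) f (W (\<tau> \<omega>) \<omega>) * indicator A \<omega>)"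
  proof (rule conv[of "\<lambda>u \<omega>. gauss_avg (t - u) f (W u \<omega>)"])
    fix \<omega> assume "\<omega> \<in> space M"
    then have cW: "continuous_on {0..t} (\<lambda>u. W u \<omega>)" by (intro continuous_on_subset[OF continuous_paths]) auto
    show "continuous_on {0..t} (\<lambda>u. gauss_avg (t - u) f (W u \<omega>))"
    proof (subst continuous_on_sequentially, intro allI ballI impI, unfold comp_def)
      fix x a assume "a \<in> {0..t}" and x: "(\<forall>n. x n \<in> {0..t}) \<and> x \<longlonglongrightarrow> a"
      then have "(\<lambda>n. W (x n) \<omega>) \<longlonglongrightarrow> W a \<omega>"
        by (intro continuous_on_tendsto_compose[OF cW]) auto
      then show "(\<lambda>n. gauss_avg (t - x n) f (W (x n) \<omega>)) \<longlonglongrightarrow> gauss_avg (t - a) f (W a \<omega>)"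
        using x by (intro gauss_avg_tendsto[OF f bound] tendsto_diff tendsto_const) auto
    qed
  qed (auto simp: gb)
  then show ?thesis using LIMSEQ_unique[OF lim1[unfolded eq]] by simp
qed

end

end

text \<open>Continuous approximations of the indicator of a ray; they determine finite measures on the line.\<close>

definition ramp :: "real \<Rightarrow> nat \<Rightarrow> real \<Rightarrow> real" where
  "ramp a k y = min 1 (max 0 (real k * (y - a)))"

lemma ramp_continuous: "continuous_on UNIV (ramp a k)"
  unfolding ramp_def by (intro continuous_intros)

lemma ramp_measurable [measurable]: "ramp a k \<in> borel_measurable borel"
  by (rule borel_measurable_continuous_onI[OF ramp_continuous])

lemma ramp_bounds: "0 \<le> ramp a k y" "ramp a k y \<le> 1" "\<bar>ramp a k y\<bar> \<le> 1"
  by (auto simp: ramp_def)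

lemma ramp_tendsto: "(\<lambda>k. ramp a k y) \<longlonglongrightarrow> indicator {a<..} y"
proof (cases "a < y")
  case True
  obtain K :: nat where K: "1 / (y - a) < real K" using reals_Archimedean2 by blast
  have "ramp a k y = 1" if "K \<le> k" for k
  proof -
    have "1 / (y - a) < real k" using K that by (meson less_le_trans of_nat_le_iff)
    then show ?thesis using True by (simp add: ramp_def field_simps)
  qed
  then have "\<forall>\<^sub>F k in sequentially. ramp a k y = 1" by (auto simp: eventually_sequentially)
  then show ?thesis using True by (simp add: tendsto_eventually)
next
  case False
  then have "ramp a k y = 0" for k by (simp add: ramp_def mult_nonneg_nonpos)
  then show ?thesis using False by simp
qed

lemma finite_measure_eqI_ramp:
  fixes \<mu> \<nu> :: "real measure"
  assumes sets: "sets \<mu> = sets borel" "sets \<nu> = sets borel"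
    and fin: "finite_measure \<mu>" "finite_measure \<nu>"
    and eq: "\<And>a k. (LINT y|\<mu>. ramp a k y) = (LINT y|\<nu>. ramp a k y)"
  shows "\<mu> = \<nu>"
proof (rule measure_eqI_lessThan[OF sets])
  have lim: "(\<lambda>k. LINT y|\<rho>. ramp a k y) \<longlonglongrightarrow> measure \<rho> {a<..}"
    if "sets \<rho> = sets borel" "finite_measure \<rho>" for \<rho> a
  proof -
    interpret finite_measure \<rho> by fact
    note [measurable_cong] = that(1)
    have "(\<lambda>k. LINT y|\<rho>. ramp a k y) \<longlonglongrightarrow> (LINT y|\<rho>. indicator {a<..} y)"
      by (rule integral_dominated_convergence[where w="\<lambda>_. 1"]) (auto simp: ramp_tendsto ramp_bounds)
    then show ?thesis using that sets_eq_imp_space_eq[OF that(1)] by simp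
  qed
  fix x
  show "emeasure \<mu> {x<..} < \<infinity>" using finite_measure.emeasure_finite[OF fin(1)] by (simp add: less_top)
  have "measure \<mu> {x<..} = measure \<nu> {x<..}"
    using LIMSEQ_unique lim[OF sets(1) fin(1), of x] lim[OF sets(2) fin(2), of x] by (simp add: eq)
  then show "emeasure \<mu> {x<..} = emeasure \<nu> {x<..}"
    using fin by (simp add: finite_measure.emeasure_eq_measure)
qed

lemma gaussian_mgf:
  assumes "0 \<le> r"
  shows "(\<integral>\<^sup>+x. ennreal (exp (a * (w + sqrt r * x))) \<partial>std_normal_distribution) = ennreal (exp (a * w + a\<^sup>2 * r / 2))"
proof -
  define m where "m = a * sqrt r"
  have m2: "m\<^sup>2 = a\<^sup>2 * r" using assms by (simp add: m_def power_mult_distrib)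
  have "(\<integral>\<^sup>+x. ennreal (exp (a * (w + sqrt r * x))) \<partial>std_normal_distribution)
    = (\<integral>\<^sup>+x. ennreal (std_normal_density x) * ennreal (exp (a * (w + sqrt r * x))) \<partial>lborel)"
    by (subst nn_integral_density) auto
  also have "\<dots> = (\<integral>\<^sup>+x. ennreal (exp (a * w + a\<^sup>2 * r / 2)) * ennreal (normal_density m 1 x) \<partial>lborel)"
  proof (rule nn_integral_cong)
    fix x :: real
    have "a * (w + sqrt r * x) = a * w + m * x" by (simp add: m_def algebra_simps)
    moreover have "exp (- x\<^sup>2 / 2) * exp (a * w + m * x) = exp (a * w + m\<^sup>2 / 2) * exp (- (x - m)\<^sup>2 / 2)"
      unfolding mult_exp_exp by (rule arg_cong[where f=exp]) (simp add: power2_eq_square field_simps)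
    ultimately have "std_normal_density x * exp (a * (w + sqrt r * x)) = exp (a * w + a\<^sup>2 * r / 2) * normal_density m 1 x"
      by (simp add: normal_density_def m2)
    then show "ennreal (std_normal_density x) * ennreal (exp (a * (w + sqrt r * x)))
      = ennreal (exp (a * w + a\<^sup>2 * r / 2)) * ennreal (normal_density m 1 x)"
      by (simp add: ennreal_mult'[symmetric])
  qed
  also have "\<dots> = ennreal (exp (a * w + a\<^sup>2 * r / 2)) * (\<integral>\<^sup>+x. ennreal (normal_density m 1 x) \<partial>lborel)"
    by (rule nn_integral_cmult) auto
  also have "(\<integral>\<^sup>+x. ennreal (normal_density m 1 x) \<partial>lborel) = emeasure (density lborel (\<lambda>x. ennreal (normal_density m 1 x))) UNIV"
    by (simp add: emeasure_density)
  also have "\<dots> = 1"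
    using prob_space.emeasure_space_1[OF prob_space_normal_density[of 1 m]] by simp
  finally show ?thesis by simp
qed

context brownian_motion
begin

lemma law_of_W:
  fixes f :: "real \<Rightarrow> ennreal"
  assumes [measurable]: "f \<in> borel_measurable borel" and t: "0 \<le> t"
  shows "(\<integral>\<^sup>+\<omega>. f (W t \<omega>) \<partial>M) = (\<integral>\<^sup>+x. f (sqrt t * x) \<partial>std_normal_distribution)"
proof (cases "t = 0")
  case True
  interpret G: prob_space std_normal_distribution by (rule prob_space_std_normal)
  have "(\<integral>\<^sup>+\<omega>. f (W t \<omega>) \<partial>M) = (\<integral>\<^sup>+\<omega>. f 0 \<partial>M)"
    using True by (intro nn_integral_cong) (simp add: start_zero)
  then show ?thesis using True G.emeasure_space_1 emeasure_space_1 by simp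
next
  case False
  with t have t: "0 < t" by simp
  have [measurable]: "W t \<in> borel_measurable M" "W 0 \<in> borel_measurable M" using t by auto
  have "(\<integral>\<^sup>+x. f (sqrt t * x) \<partial>std_normal_distribution)
      = (\<integral>\<^sup>+\<omega>. f (sqrt t * ((W t \<omega> - W 0 \<omega>) / sqrt (t - 0))) \<partial>M)"
    unfolding scaled_increment[OF order_refl t, symmetric] by (subst nn_integral_distr) auto
  also have "\<dots> = (\<integral>\<^sup>+\<omega>. f (W t \<omega>) \<partial>M)"
    using t by (intro nn_integral_cong) (simp add: start_zero)
  finally show ?thesis by simp
qed

lemma W_mgf:
  assumes "0 \<le> t"
  shows "(\<integral>\<^sup>+\<omega>. ennreal (exp (a * W t \<omega>)) \<partial>M) = ennreal (exp (a\<^sup>2 * t / 2))"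
  using law_of_W[of "\<lambda>w. ennreal (exp (a * w))" t] gaussian_mgf[OF assms, of a 0] assms by simp

text \<open>Both sides of \<open>strong_markov_continuous\<close> integrate \<open>f\<close> against finite
  measures on the line; these agree on the functions \<open>ramp\<close>, hence on all
  measurable sets.\<close>

lemma strong_markov:
  fixes f :: "real \<Rightarrow> ennreal" and \<gamma> :: real and z :: "real \<times> real"
  assumes C: "closed C" "C \<noteq> {}" "z \<notin> C" and f[measurable]: "f \<in> borel_measurable borel" and t: "0 < t"
  defines "A \<equiv> {\<omega> \<in> space M. hit \<gamma> W z C \<omega> \<le> ereal t}"
    and "\<tau> \<equiv> \<lambda>\<omega>. real_of_ereal (hit \<gamma> W z C \<omega>)"
  shows "(\<integral>\<^sup>+\<omega>. f (W t \<omega>) * indicator A \<omega> \<partial>M)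
    = (\<integral>\<^sup>+\<omega>. (\<integral>\<^sup>+x. f (W (\<tau> \<omega>) \<omega> + sqrt (t - \<tau> \<omega>) * x) \<partial>std_normal_distribution) * indicator A \<omega> \<partial>M)"
proof -
  have [measurable]: "hit \<gamma> W z C \<in> borel_measurable M" by (rule hit_measurable[OF C])
  have A[measurable]: "A \<in> events" unfolding A_def by measurable
  have [measurable]: "W t \<in> borel_measurable M" using t by simp
  define w where "w \<omega> = W (\<tau> \<omega>) \<omega> * indicator A \<omega>" for \<omega>
  define r where "r \<omega> = t - \<tau> \<omega>" for \<omega>
  have w[measurable]: "w \<in> borel_measurable M"
    unfolding w_def[abs_def] A_def \<tau>_def
    by (rule stopped_measurable[OF C t])
       (auto intro!: continuous_on_subset[OF continuous_paths] W_measurable)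
  have r[measurable]: "r \<in> borel_measurable M" unfolding r_def[abs_def] \<tau>_def by measurable
  define D where "D = density M (\<lambda>\<omega>. ennreal (indicator A \<omega>))"
  have [measurable_cong]: "sets D = sets M" by (simp add: D_def)
  interpret G: prob_space std_normal_distribution by (rule prob_space_std_normal)
  interpret D: finite_measure D
    by (rule finite_measureI) (simp add: D_def emeasure_density ennreal_indicator less_top[symmetric])
  interpret DG: pair_sigma_finite D std_normal_distribution ..
  interpret DG: finite_measure "D \<Otimes>\<^sub>M std_normal_distribution"
    by (rule finite_measure_pair_measure) (auto intro: D.finite_measure_axioms G.finite_measure_axioms)
  define \<mu> where "\<mu> = distr D borel (W t)"
  define \<nu> where "\<nu> = distr (D \<Otimes>\<^sub>M std_normal_distribution) borel (\<lambda>(\<omega>, x). w \<omega> + sqrt (r \<omega>) * x)"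
  have "\<mu> = \<nu>"
  proof (rule finite_measure_eqI_ramp)
    show "finite_measure \<mu>" unfolding \<mu>_def by (rule D.finite_measure_distr) simp
    show "finite_measure \<nu>" unfolding \<nu>_def by (rule DG.finite_measure_distr) measurable
    fix a k
    let ?f = "ramp a k"
    have "(LINT y|\<mu>. ?f y) = (LINT \<omega>|D. ?f (W t \<omega>))"
      unfolding \<mu>_def by (rule integral_distr) auto
    also have "\<dots> = (LINT \<omega>|M. indicator A \<omega> *\<^sub>R ?f (W t \<omega>))"
      unfolding D_def by (rule integral_density) auto
    also have "\<dots> = (LINT \<omega>|M. ?f (W t \<omega>) * indicator A \<omega>)" by (simp add: mult.commute)
    also have "\<dots> = (LINT \<omega>|M. gauss_avg (t - \<tau> \<omega>) ?f (W (\<tau> \<omega>) \<omega>) * indicator A \<omega>)"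
      unfolding A_def \<tau>_def by (rule strong_markov_continuous[OF C ramp_continuous ramp_bounds(3) t])
    also have "\<dots> = (LINT \<omega>|M. indicator A \<omega> *\<^sub>R gauss_avg (r \<omega>) ?f (w \<omega>))"
      by (intro Bochner_Integration.integral_cong) (auto simp: w_def r_def indicator_def)
    also have "\<dots> = (LINT \<omega>|D. gauss_avg (r \<omega>) ?f (w \<omega>))"
      unfolding D_def by (rule integral_density[symmetric]) auto
    also have "\<dots> = (LINT p|(D \<Otimes>\<^sub>M std_normal_distribution). ?f (w (fst p) + sqrt (r (fst p)) * snd p))"
      unfolding gauss_avg_def
      by (subst DG.integral_fst'[symmetric])
         (auto intro!: DG.integrable_const_bound[where B=1] simp: ramp_bounds)
    also have "\<dots> = (LINT y|\<nu>. ?f y)"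
      unfolding \<nu>_def by (subst integral_distr) (auto simp: case_prod_beta)
    finally show "(LINT y|\<mu>. ?f y) = (LINT y|\<nu>. ?f y)" .
  qed (simp_all add: \<mu>_def \<nu>_def)
  have "(\<integral>\<^sup>+\<omega>. f (W t \<omega>) * indicator A \<omega> \<partial>M) = (\<integral>\<^sup>+y. f y \<partial>\<mu>)"
    unfolding \<mu>_def D_def by (simp add: nn_integral_distr nn_integral_density ennreal_indicator mult.commute)
  also have "\<dots> = (\<integral>\<^sup>+y. f y \<partial>\<nu>)" by (simp add: \<open>\<mu> = \<nu>\<close>)
  also have "\<dots> = (\<integral>\<^sup>+p. f (w (fst p) + sqrt (r (fst p)) * snd p) \<partial>(D \<Otimes>\<^sub>M std_normal_distribution))"
    unfolding \<nu>_def by (subst nn_integral_distr) (auto simp: case_prod_beta)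
  also have "\<dots> = (\<integral>\<^sup>+\<omega>. (\<integral>\<^sup>+x. f (w \<omega> + sqrt (r \<omega>) * x) \<partial>std_normal_distribution) \<partial>D)"
    using G.nn_integral_fst[of "\<lambda>p. f (w (fst p) + sqrt (r (fst p)) * snd p)" D] by simp
  also have "\<dots> = (\<integral>\<^sup>+\<omega>. indicator A \<omega> * (\<integral>\<^sup>+x. f (w \<omega> + sqrt (r \<omega>) * x) \<partial>std_normal_distribution) \<partial>M)"
    unfolding D_def by (subst nn_integral_density) (auto simp: ennreal_indicator)
  also have "\<dots> = (\<integral>\<^sup>+\<omega>. (\<integral>\<^sup>+x. f (W (\<tau> \<omega>) \<omega> + sqrt (t - \<tau> \<omega>) * x) \<partial>std_normal_distribution) * indicator A \<omega> \<partial>M)"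
    by (intro nn_integral_cong) (auto simp: w_def r_def indicator_def)
  finally show ?thesis .
qed

end

section \<open>The parabola of zeros of the kernel and the exit laws\<close>

text \<open>With \<open>par_q\<close>, a parametrisation of the parabola of zeros of the kernel by \<open>v
  = q - p + \<gamma>\<close>. It is polynomial, and the roots \<open>P_minus\<close> and
  \<open>Q_minus\<close> correspond to \<open>v > 1\<close> and \<open>v < 0\<close>.\<close>

definition par_p :: "real \<Rightarrow> real \<Rightarrow> real" where "par_p \<gamma> v = (\<gamma>\<^sup>2 - v\<^sup>2) / 2"
definition par_q :: "real \<Rightarrow> real \<Rightarrow> real" where "par_q \<gamma> v = ((1 - \<gamma>)\<^sup>2 - (1 - v)\<^sup>2) / 2"
definition par_exp :: "real \<Rightarrow> real \<Rightarrow> real \<times> real \<Rightarrow> real" where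
  "par_exp \<gamma> v z = exp (par_p \<gamma> v * fst z + par_q \<gamma> v * snd z)"

lemma kernel_par: "kernel \<gamma> (par_p \<gamma> v) (par_q \<gamma> v) = 0"
  unfolding kernel_def par_p_def par_q_def by (simp add: power2_eq_square field_simps)

lemma par_q_minus_p: "par_q \<gamma> v - par_p \<gamma> v = v - \<gamma>"
  unfolding par_p_def par_q_def by (simp add: power2_eq_square field_simps)

definition y_axis :: "(real \<times> real) set" where "y_axis = {0} \<times> {0..}"
definition x_axis :: "(real \<times> real) set" where "x_axis = {0..} \<times> {0}"

lemma closed_axes: "closed y_axis" "closed x_axis" "closed (y_axis \<union> x_axis)"
  by (auto simp: y_axis_def x_axis_def intro!: closed_Times)

lemma hit1_eq: "hit1 \<gamma> W z = hit \<gamma> W z y_axis"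
  by (auto simp: fun_eq_iff hit1_def hit_def y_axis_def)

lemma hit2_eq: "hit2 \<gamma> W z = hit \<gamma> W z x_axis"
  by (auto simp: fun_eq_iff hit2_def hit_def x_axis_def)

lemma exit_time_eq: "exit_time \<gamma> W z = hit \<gamma> W z (y_axis \<union> x_axis)"
proof
  fix \<omega>
  have "{t. 0 \<le> t \<and> proc \<gamma> W z t \<omega> \<in> y_axis \<union> x_axis}
    = {t. 0 \<le> t \<and> proc \<gamma> W z t \<omega> \<in> y_axis} \<union> {t. 0 \<le> t \<and> proc \<gamma> W z t \<omega> \<in> x_axis}" by auto
  then show "exit_time \<gamma> W z \<omega> = hit \<gamma> W z (y_axis \<union> x_axis) \<omega>"
    by (simp add: exit_time_def hit1_eq hit2_eq hit_def INF_union inf_min)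
qed

lemma proc_sum: "fst (proc \<gamma> W z t \<omega>) + snd (proc \<gamma> W z t \<omega>) = fst z + snd z + t"
  by (simp add: proc_def algebra_simps)

text \<open>Position after time \<open>r\<close> of the unrestricted process started at \<open>z\<close>, as
  a function of a standard normal variable.\<close>

definition free_pos :: "real \<Rightarrow> real \<times> real \<Rightarrow> real \<Rightarrow> real \<Rightarrow> real \<times> real" where
  "free_pos \<gamma> z r x = (fst z - sqrt r * x + (1 - \<gamma>) * r, snd z + sqrt r * x + \<gamma> * r)"

locale quadrant_process = brownian_motion M W for M :: "'a measure" and W +
  fixes \<gamma> :: real and z :: "real \<times> real"
  assumes gamma: "0 < \<gamma>" "\<gamma> < 1" and z: "z \<in> quadrant"
begin

definition s0 :: real where "s0 = fst z + snd z"
definition exit1 :: "'a set" where "exit1 = {\<omega> \<in> space M. hit1 \<gamma> W z \<omega> < hit2 \<gamma> W z \<omega>}"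
definition exit2 :: "'a set" where "exit2 = {\<omega> \<in> space M. hit2 \<gamma> W z \<omega> < hit1 \<gamma> W z \<omega>}"
definition tau :: "'a \<Rightarrow> real" where "tau \<omega> = real_of_ereal (exit_time \<gamma> W z \<omega>)"
text \<open>The two coordinates of the process always sum to the initial sum plus the time. On the exit axis
  one of them vanishes, so the exit position is a function of the exit time and both exit laws
  can be described by \<open>s0 + tau\<close>.\<close>

definition law1 :: "real measure" where
  "law1 = distr (density M (indicator exit1)) borel (\<lambda>\<omega>. s0 + tau \<omega>)"
definition law2 :: "real measure" where
  "law2 = distr (density M (indicator exit2)) borel (\<lambda>\<omega>. s0 + tau \<omega>)"

lemma z_pos: "0 < fst z" "0 < snd z" "0 < s0"
  using z by (auto simp: quadrant_def s0_def)

lemma z_notin: "z \<notin> y_axis" "z \<notin> x_axis" "z \<notin> y_axis \<union> x_axis"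
  using z_pos by (auto simp: y_axis_def x_axis_def)

lemma axes_nonempty: "y_axis \<noteq> {}" "x_axis \<noteq> {}" "y_axis \<union> x_axis \<noteq> {}"
  by (auto simp: y_axis_def x_axis_def)

lemma hit_times_measurable [measurable]:
  "hit1 \<gamma> W z \<in> borel_measurable M" "hit2 \<gamma> W z \<in> borel_measurable M"
  "exit_time \<gamma> W z \<in> borel_measurable M"
  unfolding hit1_eq hit2_eq exit_time_eq
  by (rule hit_measurable; rule closed_axes axes_nonempty z_notin)+

lemma tau_measurable [measurable]: "tau \<in> borel_measurable M"
  unfolding tau_def[abs_def] by measurable

lemma exits_measurable [measurable]: "exit1 \<in> events" "exit2 \<in> events"
  unfolding exit1_def exit2_def by measurable

lemma exit_time_pos: "\<omega> \<in> space M \<Longrightarrow> 0 < exit_time \<gamma> W z \<omega>"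
  unfolding exit_time_eq by (rule hit_pos[OF closed_axes(3) _ z_notin(3)])

lemma alive_quadrant:
  assumes \<omega>: "\<omega> \<in> space M" and t: "0 \<le> t" "ereal t < exit_time \<gamma> W z \<omega>"
  shows "proc \<gamma> W z t \<omega> \<in> quadrant"
proof (rule ccontr)
  assume out: "proc \<gamma> W z t \<omega> \<notin> quadrant"
  define m where "m u = min (fst (proc \<gamma> W z u \<omega>)) (snd (proc \<gamma> W z u \<omega>))" for u
  have cont: "continuous_on {0..t} m"
    unfolding m_def by (intro continuous_intros continuous_on_subset[OF proc_continuous[OF \<omega>]]) auto
  have "0 < m 0" using z_pos \<omega> by (simp add: m_def proc_def start_zero)
  moreover have "m t \<le> 0" using out by (auto simp: m_def quadrant_def mem_Times_iff not_less min_le_iff_disj)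
  ultimately obtain u where u: "0 \<le> u" "u \<le> t" "m u = 0"
    using IVT2'[of m t 0 0] cont t by auto
  then have "proc \<gamma> W z u \<omega> \<in> y_axis \<union> x_axis"
    by (cases "proc \<gamma> W z u \<omega>") (auto simp: m_def y_axis_def x_axis_def min_def split: if_splits)
  then have "exit_time \<gamma> W z \<omega> \<le> ereal t"
    unfolding exit_time_eq hit_le_iff[OF closed_axes(3) \<omega>] using u by auto
  then show False using t by simp
qed

lemma hit_attained:
  assumes "\<omega> \<in> space M" "closed C" "hit \<gamma> W z C \<omega> \<noteq> \<infinity>"
  shows "0 \<le> real_of_ereal (hit \<gamma> W z C \<omega>)" "hit \<gamma> W z C \<omega> = ereal (real_of_ereal (hit \<gamma> W z C \<omega>))"
    "proc \<gamma> W z (real_of_ereal (hit \<gamma> W z C \<omega>)) \<omega> \<in> C"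
proof -
  define r where "r = real_of_ereal (hit \<gamma> W z C \<omega>)"
  have r: "hit \<gamma> W z C \<omega> = ereal r"
    using hit_nonneg[of \<gamma> W z C \<omega>] assms(3) unfolding r_def by (cases "hit \<gamma> W z C \<omega>") auto
  then have "\<exists>u\<in>{0..r}. proc \<gamma> W z u \<omega> \<in> C" using hit_le_iff[OF assms(2,1), of \<gamma> z r] by simp
  then obtain u where u: "u \<in> {0..r}" "proc \<gamma> W z u \<omega> \<in> C" by blast
  have "hit \<gamma> W z C \<omega> \<le> ereal u" using u hit_le_iff[OF assms(2,1), of \<gamma> z u] by auto
  then have "u = r" using u r by simp
  then show "0 \<le> real_of_ereal (hit \<gamma> W z C \<omega>)" "hit \<gamma> W z C \<omega> = ereal (real_of_ereal (hit \<gamma> W z C \<omega>))"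
    "proc \<gamma> W z (real_of_ereal (hit \<gamma> W z C \<omega>)) \<omega> \<in> C"
    unfolding r_def[symmetric] using u r by auto
qed

lemma on_exit1:
  assumes "\<omega> \<in> exit1"
  shows "exit_time \<gamma> W z \<omega> = ereal (tau \<omega>)" "0 < tau \<omega>"
    "proc \<gamma> W z (tau \<omega>) \<omega> = (0, s0 + tau \<omega>)" "exit_Y \<gamma> W z \<omega> = s0 + tau \<omega>"
proof -
  have \<omega>: "\<omega> \<in> space M" and less: "hit1 \<gamma> W z \<omega> < hit2 \<gamma> W z \<omega>" using assms by (auto simp: exit1_def)
  have eq: "exit_time \<gamma> W z \<omega> = hit \<gamma> W z y_axis \<omega>" using less by (simp add: exit_time_def hit1_eq)
  note h = hit_attained[OF \<omega> closed_axes(1), unfolded eq[symmetric] tau_def[symmetric]]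
  have fin: "exit_time \<gamma> W z \<omega> \<noteq> \<infinity>" using less by (auto simp: eq hit1_eq)
  show 1: "exit_time \<gamma> W z \<omega> = ereal (tau \<omega>)" using h(2)[OF fin] .
  show "0 < tau \<omega>" using exit_time_pos[OF \<omega>] by (simp add: 1)
  show 3: "proc \<gamma> W z (tau \<omega>) \<omega> = (0, s0 + tau \<omega>)"
    using h(3)[OF fin] proc_sum[of \<gamma> W z "tau \<omega>" \<omega>]
    by (cases "proc \<gamma> W z (tau \<omega>) \<omega>") (auto simp: y_axis_def s0_def)
  show "exit_Y \<gamma> W z \<omega> = s0 + tau \<omega>"
    unfolding exit_Y_def hit1_eq eq[symmetric] tau_def[symmetric] 3 by simp
qed

lemma on_exit2:
  assumes "\<omega> \<in> exit2"
  shows "exit_time \<gamma> W z \<omega> = ereal (tau \<omega>)" "0 < tau \<omega>"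
    "proc \<gamma> W z (tau \<omega>) \<omega> = (s0 + tau \<omega>, 0)" "exit_X \<gamma> W z \<omega> = s0 + tau \<omega>"
proof -
  have \<omega>: "\<omega> \<in> space M" and less: "hit2 \<gamma> W z \<omega> < hit1 \<gamma> W z \<omega>" using assms by (auto simp: exit2_def)
  have eq: "exit_time \<gamma> W z \<omega> = hit \<gamma> W z x_axis \<omega>" using less by (simp add: exit_time_def hit2_eq)
  note h = hit_attained[OF \<omega> closed_axes(2), unfolded eq[symmetric] tau_def[symmetric]]
  have fin: "exit_time \<gamma> W z \<omega> \<noteq> \<infinity>" using less by (auto simp: eq hit2_eq)
  show 1: "exit_time \<gamma> W z \<omega> = ereal (tau \<omega>)" using h(2)[OF fin] .
  show "0 < tau \<omega>" using exit_time_pos[OF \<omega>] by (simp add: 1)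
  show 3: "proc \<gamma> W z (tau \<omega>) \<omega> = (s0 + tau \<omega>, 0)"
    using h(3)[OF fin] proc_sum[of \<gamma> W z "tau \<omega>" \<omega>]
    by (cases "proc \<gamma> W z (tau \<omega>) \<omega>") (auto simp: x_axis_def s0_def)
  show "exit_X \<gamma> W z \<omega> = s0 + tau \<omega>"
    unfolding exit_X_def hit2_eq eq[symmetric] tau_def[symmetric] 3 by simp
qed

lemma exits_disjoint: "exit1 \<inter> exit2 = {}"
  by (auto simp: exit1_def exit2_def)

text \<open>The two axes meet only in the origin, where the sum of the coordinates would be zero, so exactly
  one axis is reached at a finite exit time.\<close>

lemma exit_finite_iff:
  assumes "\<omega> \<in> space M"
  shows "exit_time \<gamma> W z \<omega> \<noteq> \<infinity> \<longleftrightarrow> \<omega> \<in> exit1 \<union> exit2"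
proof
  assume fin: "exit_time \<gamma> W z \<omega> \<noteq> \<infinity>"
  show "\<omega> \<in> exit1 \<union> exit2"
  proof (rule ccontr)
    assume "\<omega> \<notin> exit1 \<union> exit2"
    then have eq: "hit \<gamma> W z y_axis \<omega> = hit \<gamma> W z x_axis \<omega>"
      using assms by (auto simp: exit1_def exit2_def hit1_eq hit2_eq not_less)
    with fin have fin': "hit \<gamma> W z y_axis \<omega> \<noteq> \<infinity>" "hit \<gamma> W z x_axis \<omega> \<noteq> \<infinity>"
      by (auto simp: exit_time_def hit1_eq hit2_eq)
    define r where "r = real_of_ereal (hit \<gamma> W z y_axis \<omega>)"
    have "proc \<gamma> W z r \<omega> \<in> y_axis" "proc \<gamma> W z r \<omega> \<in> x_axis" "0 \<le> r"
      using hit_attained[OF assms closed_axes(1) fin'(1)] hit_attained[OF assms closed_axes(2) fin'(2)]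
      by (auto simp: r_def eq)
    then show False using proc_sum[of \<gamma> W z r \<omega>] z_pos by (auto simp: y_axis_def x_axis_def s0_def)
  qed
next
  assume "\<omega> \<in> exit1 \<union> exit2"
  then show "exit_time \<gamma> W z \<omega> \<noteq> \<infinity>" using on_exit1(1) on_exit2(1) by auto
qed

lemma nn_integral_law1:
  assumes [measurable]: "f \<in> borel_measurable borel"
  shows "(\<integral>\<^sup>+y. f y \<partial>law1) = (\<integral>\<^sup>+\<omega>. f (s0 + tau \<omega>) * indicator exit1 \<omega> \<partial>M)"
  unfolding law1_def by (simp add: nn_integral_distr nn_integral_density mult.commute)

lemma nn_integral_law2:
  assumes [measurable]: "f \<in> borel_measurable borel"
  shows "(\<integral>\<^sup>+y. f y \<partial>law2) = (\<integral>\<^sup>+\<omega>. f (s0 + tau \<omega>) * indicator exit2 \<omega> \<partial>M)"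
  unfolding law2_def by (simp add: nn_integral_distr nn_integral_density mult.commute)

lemma sets_laws [simp, measurable_cong]: "sets law1 = sets borel" "sets law2 = sets borel"
  by (auto simp: law1_def law2_def)

lemma space_laws [simp]: "space law1 = UNIV" "space law2 = UNIV"
  by (auto simp: law1_def law2_def)

lemma finite_laws: "finite_measure law1" "finite_measure law2"
proof -
  have "emeasure law1 UNIV \<noteq> \<infinity>"
    using nn_integral_law1[of "\<lambda>_. 1"] by (simp add: less_top[symmetric])
  then show "finite_measure law1" by (intro finite_measureI) simp
  have "emeasure law2 UNIV \<noteq> \<infinity>"
    using nn_integral_law2[of "\<lambda>_. 1"] by (simp add: less_top[symmetric])
  then show "finite_measure law2" by (intro finite_measureI) simp
qed

lemma AE_laws: "AE y in law1. s0 < y" "AE y in law2. s0 < y"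
proof -
  have "AE \<omega> in density M (indicator exit1). s0 < s0 + tau \<omega>"
    by (subst AE_density) (auto simp: indicator_def on_exit1(2) intro!: AE_I2)
  then show "AE y in law1. s0 < y" unfolding law1_def by (subst AE_distr_iff) auto
  have "AE \<omega> in density M (indicator exit2). s0 < s0 + tau \<omega>"
    by (subst AE_density) (auto simp: indicator_def on_exit2(2) intro!: AE_I2)
  then show "AE y in law2. s0 < y" unfolding law2_def by (subst AE_distr_iff) auto
qed

lemma integral_laws:
  fixes f :: "real \<Rightarrow> real"
  assumes [measurable]: "f \<in> borel_measurable borel"
  shows "(LINT y|law1. f y) = (LINT \<omega>|M. f (s0 + tau \<omega>) * indicator exit1 \<omega>)"
    "(LINT y|law2. f y) = (LINT \<omega>|M. f (s0 + tau \<omega>) * indicator exit2 \<omega>)"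
proof -
  have *: "density M (indicator A) = density M (\<lambda>\<omega>. ennreal (indicator A \<omega>))" for A :: "'a set"
    by (simp add: ennreal_indicator)
  show "(LINT y|law1. f y) = (LINT \<omega>|M. f (s0 + tau \<omega>) * indicator exit1 \<omega>)"
    "(LINT y|law2. f y) = (LINT \<omega>|M. f (s0 + tau \<omega>) * indicator exit2 \<omega>)"
    unfolding law1_def law2_def * by (simp_all add: integral_distr integral_density mult.commute)
qed

lemma exit_laplace_law:
  "exit_laplace1 M \<gamma> W z q = (LINT y|law1. exp (q * y))"
  "exit_laplace2 M \<gamma> W z p = (LINT x|law2. exp (p * x))"
  unfolding exit_laplace1_def exit_laplace2_def integral_laws
  by (subst integral_laws; (intro Bochner_Integration.integral_cong)?;
      auto simp: indicator_def on_exit1 on_exit2 exit1_def exit2_def; fail)+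

lemma exit_measure_law:
  assumes [measurable]: "S \<in> sets borel"
  shows "exit_measure1 M \<gamma> W z S = emeasure law1 S" "exit_measure2 M \<gamma> W z S = emeasure law2 S"
proof -
  have "emeasure law1 S = (\<integral>\<^sup>+\<omega>. indicator S (s0 + tau \<omega>) * indicator exit1 \<omega> \<partial>M)"
    using nn_integral_law1[of "indicator S"] by simp
  also have "\<dots> = (\<integral>\<^sup>+\<omega>. indicator {\<omega> \<in> space M. s0 + tau \<omega> \<in> S \<and> \<omega> \<in> exit1} \<omega> \<partial>M)"
    by (intro nn_integral_cong) (auto simp: indicator_def)
  also have "\<dots> = emeasure M {\<omega> \<in> space M. s0 + tau \<omega> \<in> S \<and> \<omega> \<in> exit1}"
    by (rule nn_integral_indicator) measurable
  also have "{\<omega> \<in> space M. s0 + tau \<omega> \<in> S \<and> \<omega> \<in> exit1}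
    = {\<omega> \<in> space M. exit_Y \<gamma> W z \<omega> \<in> S \<and> hit1 \<gamma> W z \<omega> < hit2 \<gamma> W z \<omega>}"
    using on_exit1(4) by (auto simp: exit1_def)
  finally show "exit_measure1 M \<gamma> W z S = emeasure law1 S" by (simp add: exit_measure1_def)
  have "emeasure law2 S = (\<integral>\<^sup>+\<omega>. indicator S (s0 + tau \<omega>) * indicator exit2 \<omega> \<partial>M)"
    using nn_integral_law2[of "indicator S"] by simp
  also have "\<dots> = (\<integral>\<^sup>+\<omega>. indicator {\<omega> \<in> space M. s0 + tau \<omega> \<in> S \<and> \<omega> \<in> exit2} \<omega> \<partial>M)"
    by (intro nn_integral_cong) (auto simp: indicator_def)
  also have "\<dots> = emeasure M {\<omega> \<in> space M. s0 + tau \<omega> \<in> S \<and> \<omega> \<in> exit2}"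
    by (rule nn_integral_indicator) measurable
  also have "{\<omega> \<in> space M. s0 + tau \<omega> \<in> S \<and> \<omega> \<in> exit2}
    = {\<omega> \<in> space M. exit_X \<gamma> W z \<omega> \<in> S \<and> hit2 \<gamma> W z \<omega> < hit1 \<gamma> W z \<omega>}"
    using on_exit2(4) by (auto simp: exit2_def)
  finally show "exit_measure2 M \<gamma> W z S = emeasure law2 S" by (simp add: exit_measure2_def)
qed

end

section \<open>Stopping exponential functionals at the exit\<close>

context quadrant_process
begin

text \<open>The exponent is affine in a centred Gaussian variable of variance \<open>t\<close>; the variance
  term and the drift add up to the kernel.\<close>

lemma exp_functional_mean:
  assumes "0 \<le> t"
  shows "(\<integral>\<^sup>+\<omega>. ennreal (exp (p * fst (proc \<gamma> W z t \<omega>) + q * snd (proc \<gamma> W z t \<omega>))) \<partial>M)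
    = ennreal (exp (p * fst z + q * snd z + t * kernel \<gamma> p q))"
proof -
  let ?c = "p * fst z + q * snd z + t * ((1 - \<gamma>) * p + \<gamma> * q)"
  have "(\<integral>\<^sup>+\<omega>. ennreal (exp (p * fst (proc \<gamma> W z t \<omega>) + q * snd (proc \<gamma> W z t \<omega>))) \<partial>M)
    = (\<integral>\<^sup>+\<omega>. ennreal (exp ?c) * ennreal (exp ((q - p) * W t \<omega>)) \<partial>M)"
    by (intro nn_integral_cong) (simp add: proc_def ennreal_mult'[symmetric] mult_exp_exp algebra_simps)
  also have "\<dots> = ennreal (exp ?c) * ennreal (exp ((q - p)\<^sup>2 * t / 2))"
    using assms by (subst nn_integral_cmult) (simp_all add: W_mgf)
  also have "\<dots> = ennreal (exp (p * fst z + q * snd z + t * kernel \<gamma> p q))"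
    by (simp add: ennreal_mult'[symmetric] mult_exp_exp kernel_def power2_eq_square algebra_simps)
  finally show ?thesis .
qed

definition exits_by :: "real \<Rightarrow> 'a set" where
  "exits_by t = {\<omega> \<in> space M. exit_time \<gamma> W z \<omega> \<le> ereal t}"

lemma exits_by_measurable [measurable]: "exits_by t \<in> events"
  unfolding exits_by_def by measurable

lemma indicator_exits_by:
  assumes "\<omega> \<in> space M"
  shows "(indicator (exits_by t) \<omega> :: ennreal)
    = indicator {..s0 + t} (s0 + tau \<omega>) * indicator exit1 \<omega> + indicator {..s0 + t} (s0 + tau \<omega>) * indicator exit2 \<omega>"
proof -
  have "\<omega> \<in> exits_by t \<longleftrightarrow> (\<omega> \<in> exit1 \<or> \<omega> \<in> exit2) \<and> tau \<omega> \<le> t"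
    using exit_finite_iff[OF assms] on_exit1(1)[of \<omega>] on_exit2(1)[of \<omega>] assms
    by (auto simp: exits_by_def)
  then show ?thesis using exits_disjoint by (auto simp: indicator_def)
qed

lemma split_exits_by:
  fixes F :: "'a \<Rightarrow> ennreal" and f1 f2 :: "real \<Rightarrow> ennreal"
  assumes [measurable]: "f1 \<in> borel_measurable borel" "f2 \<in> borel_measurable borel"
    and F1: "\<And>\<omega>. \<omega> \<in> exit1 \<Longrightarrow> tau \<omega> \<le> t \<Longrightarrow> F \<omega> = f1 (s0 + tau \<omega>)"
    and F2: "\<And>\<omega>. \<omega> \<in> exit2 \<Longrightarrow> tau \<omega> \<le> t \<Longrightarrow> F \<omega> = f2 (s0 + tau \<omega>)"
  shows "(\<integral>\<^sup>+\<omega>. F \<omega> * indicator (exits_by t) \<omega> \<partial>M)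
    = (\<integral>\<^sup>+y. f1 y * indicator {..s0 + t} y \<partial>law1) + (\<integral>\<^sup>+x. f2 x * indicator {..s0 + t} x \<partial>law2)"
proof -
  have "(\<integral>\<^sup>+\<omega>. F \<omega> * indicator (exits_by t) \<omega> \<partial>M)
    = (\<integral>\<^sup>+\<omega>. f1 (s0 + tau \<omega>) * indicator {..s0 + t} (s0 + tau \<omega>) * indicator exit1 \<omega>
        + f2 (s0 + tau \<omega>) * indicator {..s0 + t} (s0 + tau \<omega>) * indicator exit2 \<omega> \<partial>M)"
  proof (rule nn_integral_cong)
    fix \<omega> assume "\<omega> \<in> space M"
    note i = indicator_exits_by[OF this, of t]
    show "F \<omega> * indicator (exits_by t) \<omega> = f1 (s0 + tau \<omega>) * indicator {..s0 + t} (s0 + tau \<omega>) * indicator exit1 \<omega>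
        + f2 (s0 + tau \<omega>) * indicator {..s0 + t} (s0 + tau \<omega>) * indicator exit2 \<omega>"
      unfolding i using F1[of \<omega>] F2[of \<omega>] exits_disjoint by (auto simp: indicator_def)
  qed
  also have "\<dots> = (\<integral>\<^sup>+y. f1 y * indicator {..s0 + t} y \<partial>law1) + (\<integral>\<^sup>+x. f2 x * indicator {..s0 + t} x \<partial>law2)"
    by (subst nn_integral_add) (auto simp: nn_integral_law1 nn_integral_law2)
  finally show ?thesis .
qed

text \<open>The strong Markov property at the exit time, rewritten as an average over the exit position; the
  remaining time is determined by that position.\<close>

lemma proc_after_exit:
  assumes h[measurable]: "h \<in> borel_measurable borel" and t: "0 < t"
  shows "(\<integral>\<^sup>+\<omega>. h (proc \<gamma> W z t \<omega>) * indicator (exits_by t) \<omega> \<partial>M)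
    = (\<integral>\<^sup>+y. (\<integral>\<^sup>+x. h (free_pos \<gamma> (0, y) (s0 + t - y) x) \<partial>std_normal_distribution) * indicator {..s0 + t} y \<partial>law1)
    + (\<integral>\<^sup>+a. (\<integral>\<^sup>+x. h (free_pos \<gamma> (a, 0) (s0 + t - a) x) \<partial>std_normal_distribution) * indicator {..s0 + t} a \<partial>law2)"
proof -
  interpret G: prob_space std_normal_distribution by (rule prob_space_std_normal)
  have [measurable]: "(\<lambda>p. free_pos \<gamma> (a (fst p), b (fst p)) (r (fst p)) (snd p)) \<in> borel_measurable (borel \<Otimes>\<^sub>M std_normal_distribution)"
    if [measurable]: "a \<in> borel_measurable borel" "b \<in> borel_measurable borel" "r \<in> borel_measurable borel"
    for a b r :: "real \<Rightarrow> real"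
    unfolding free_pos_def by measurable
  have meas: "(\<lambda>y. \<integral>\<^sup>+x. h (free_pos \<gamma> (a y, b y) (r y) x) \<partial>std_normal_distribution) \<in> borel_measurable borel"
    if [measurable]: "a \<in> borel_measurable borel" "b \<in> borel_measurable borel" "r \<in> borel_measurable borel"
    for a b r :: "real \<Rightarrow> real"
    by (rule G.borel_measurable_nn_integral) (simp add: case_prod_beta)
  define f where "f w = h (fst z - w + (1 - \<gamma>) * t, snd z + w + \<gamma> * t)" for w
  have f[measurable]: "f \<in> borel_measurable borel" unfolding f_def[abs_def] by measurable
  have "(\<integral>\<^sup>+\<omega>. h (proc \<gamma> W z t \<omega>) * indicator (exits_by t) \<omega> \<partial>M)
    = (\<integral>\<^sup>+\<omega>. f (W t \<omega>) * indicator (exits_by t) \<omega> \<partial>M)"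
    by (simp add: f_def proc_def)
  also have "\<dots> = (\<integral>\<^sup>+\<omega>. (\<integral>\<^sup>+x. f (W (tau \<omega>) \<omega> + sqrt (t - tau \<omega>) * x) \<partial>std_normal_distribution) * indicator (exits_by t) \<omega> \<partial>M)"
    unfolding exits_by_def tau_def exit_time_eq
    by (rule strong_markov[OF closed_axes(3) axes_nonempty(3) z_notin(3) f t])
  also have "\<dots> = (\<integral>\<^sup>+y. (\<integral>\<^sup>+x. h (free_pos \<gamma> (0, y) (s0 + t - y) x) \<partial>std_normal_distribution) * indicator {..s0 + t} y \<partial>law1)
    + (\<integral>\<^sup>+a. (\<integral>\<^sup>+x. h (free_pos \<gamma> (a, 0) (s0 + t - a) x) \<partial>std_normal_distribution) * indicator {..s0 + t} a \<partial>law2)"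
  proof (rule split_exits_by)
    fix \<omega> assume "\<omega> \<in> exit1"
    note e = on_exit1(3)[OF this]
    show "(\<integral>\<^sup>+x. f (W (tau \<omega>) \<omega> + sqrt (t - tau \<omega>) * x) \<partial>std_normal_distribution)
       = (\<integral>\<^sup>+x. h (free_pos \<gamma> (0, s0 + tau \<omega>) (s0 + t - (s0 + tau \<omega>)) x) \<partial>std_normal_distribution)"
    proof (rule nn_integral_cong)
      fix x
      have "W (tau \<omega>) \<omega> = fst z + (1 - \<gamma>) * tau \<omega>" using e by (auto simp: proc_def)
      note w = this
      show "f (W (tau \<omega>) \<omega> + sqrt (t - tau \<omega>) * x) = h (free_pos \<gamma> (0, s0 + tau \<omega>) (s0 + t - (s0 + tau \<omega>)) x)"
        unfolding f_def w free_pos_def s0_def by (rule arg_cong[where f=h]) (simp add: algebra_simps)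
    qed
  next
    fix \<omega> assume "\<omega> \<in> exit2"
    note e = on_exit2(3)[OF this]
    show "(\<integral>\<^sup>+x. f (W (tau \<omega>) \<omega> + sqrt (t - tau \<omega>) * x) \<partial>std_normal_distribution)
       = (\<integral>\<^sup>+x. h (free_pos \<gamma> (s0 + tau \<omega>, 0) (s0 + t - (s0 + tau \<omega>)) x) \<partial>std_normal_distribution)"
    proof (rule nn_integral_cong)
      fix x
      have "W (tau \<omega>) \<omega> = - snd z - \<gamma> * tau \<omega>" using e by (auto simp: proc_def)
      note w = this
      show "f (W (tau \<omega>) \<omega> + sqrt (t - tau \<omega>) * x) = h (free_pos \<gamma> (s0 + tau \<omega>, 0) (s0 + t - (s0 + tau \<omega>)) x)"
        unfolding f_def w free_pos_def s0_def by (rule arg_cong[where f=h]) (simp add: algebra_simps)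
    qed
  qed (auto intro!: meas)
  finally show ?thesis .
qed

text \<open>At time \<open>t\<close> the martingale has mean \<open>par_exp \<gamma> v z\<close>. On the
  event that the exit occurred before, restarting at the exit position and using that the mean
  is constant replaces the value at time \<open>t\<close> by the value at the exit.\<close>

lemma optional_stopping:
  assumes t: "0 < t"
  shows "ennreal (par_exp \<gamma> v z) = (\<integral>\<^sup>+y. ennreal (exp (par_q \<gamma> v * y)) * indicator {..s0 + t} y \<partial>law1)
    + (\<integral>\<^sup>+x. ennreal (exp (par_p \<gamma> v * x)) * indicator {..s0 + t} x \<partial>law2)
    + (\<integral>\<^sup>+\<omega>. ennreal (par_exp \<gamma> v (proc \<gamma> W z t \<omega>)) * indicator (space M - exits_by t) \<omega> \<partial>M)"
proof -
  have [measurable]: "proc \<gamma> W z t \<in> borel_measurable M" using t by simp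
  have pe[measurable]: "par_exp \<gamma> v \<in> borel_measurable borel" 
    unfolding par_exp_def[abs_def] by (intro borel_measurable_continuous_onI continuous_intros)
  have "(\<integral>\<^sup>+\<omega>. ennreal (par_exp \<gamma> v (proc \<gamma> W z t \<omega>)) \<partial>M) = ennreal (par_exp \<gamma> v z)"
    using exp_functional_mean[of t "par_p \<gamma> v" "par_q \<gamma> v"] t by (simp add: kernel_par par_exp_def)
  moreover have "(\<integral>\<^sup>+\<omega>. ennreal (par_exp \<gamma> v (proc \<gamma> W z t \<omega>)) \<partial>M)
    = (\<integral>\<^sup>+\<omega>. ennreal (par_exp \<gamma> v (proc \<gamma> W z t \<omega>)) * indicator (exits_by t) \<omega>
       + ennreal (par_exp \<gamma> v (proc \<gamma> W z t \<omega>)) * indicator (space M - exits_by t) \<omega> \<partial>M)"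
    by (intro nn_integral_cong) (auto simp: indicator_def)
  moreover have "\<dots> = (\<integral>\<^sup>+\<omega>. ennreal (par_exp \<gamma> v (proc \<gamma> W z t \<omega>)) * indicator (exits_by t) \<omega> \<partial>M)
       + (\<integral>\<^sup>+\<omega>. ennreal (par_exp \<gamma> v (proc \<gamma> W z t \<omega>)) * indicator (space M - exits_by t) \<omega> \<partial>M)"
    by (rule nn_integral_add) auto
  moreover have "(\<integral>\<^sup>+\<omega>. ennreal (par_exp \<gamma> v (proc \<gamma> W z t \<omega>)) * indicator (exits_by t) \<omega> \<partial>M)
    = (\<integral>\<^sup>+y. ennreal (exp (par_q \<gamma> v * y)) * indicator {..s0 + t} y \<partial>law1)
    + (\<integral>\<^sup>+x. ennreal (exp (par_p \<gamma> v * x)) * indicator {..s0 + t} x \<partial>law2)"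
  proof -
    have mg: "(\<integral>\<^sup>+x. ennreal (par_exp \<gamma> v (free_pos \<gamma> (a, b) r x)) \<partial>std_normal_distribution)
      = ennreal (exp (par_p \<gamma> v * a + par_q \<gamma> v * b))" if "0 \<le> r" for a b r
    proof -
      let ?c = "exp (par_p \<gamma> v * a + par_q \<gamma> v * b - (v - \<gamma>)\<^sup>2 * r / 2)"
      have "par_exp \<gamma> v (free_pos \<gamma> (a, b) r x) = ?c * exp ((v - \<gamma>) * (0 + sqrt r * x))" for x
        unfolding par_exp_def free_pos_def mult_exp_exp
        by (rule arg_cong[where f=exp]) (simp add: par_p_def par_q_def power2_eq_square field_simps)
      then have "(\<integral>\<^sup>+x. ennreal (par_exp \<gamma> v (free_pos \<gamma> (a, b) r x)) \<partial>std_normal_distribution)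
        = (\<integral>\<^sup>+x. ennreal ?c * ennreal (exp ((v - \<gamma>) * (0 + sqrt r * x))) \<partial>std_normal_distribution)"
        by (simp add: ennreal_mult')
      also have "\<dots> = ennreal ?c * ennreal (exp ((v - \<gamma>) * 0 + (v - \<gamma>)\<^sup>2 * r / 2))"
        by (subst nn_integral_cmult) (auto simp only: gaussian_mgf[OF that] intro!: borel_measurable_continuous_onI continuous_intros, measurable)
      also have "\<dots> = ennreal (exp (par_p \<gamma> v * a + par_q \<gamma> v * b))"
        by (simp add: ennreal_mult'[symmetric] mult_exp_exp)
      finally show ?thesis .
    qed
    show ?thesis
      by (subst proc_after_exit[OF _ t]) (auto simp: mg indicator_def intro!: arg_cong2[where f="(+)"] nn_integral_cong)
  qed
  ultimately show ?thesis by simp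
qed

end

section \<open>The functional equation of the exit transforms\<close>

context quadrant_process
begin

text \<open>While the process is alive both coordinates are positive, so enlarging \<open>p\<close> or
  \<open>q\<close> only increases the exponential. For \<open>v > 1\<close> it suffices to
  enlarge \<open>p\<close> by \<open>v - 1\<close>, for \<open>v < 0\<close> to enlarge
  \<open>q\<close> by \<open>- v\<close>: the enlarged exponent has a negative kernel, and the
  mean decays exponentially.\<close>

lemma alive_mass_bound:
  assumes t: "0 < t" and v: "1 < v \<or> v < 0"
  shows "(\<integral>\<^sup>+\<omega>. ennreal (par_exp \<gamma> v (proc \<gamma> W z t \<omega>)) * indicator (space M - exits_by t) \<omega> \<partial>M)
    \<le> ennreal (exp ((\<bar>par_p \<gamma> v\<bar> + \<bar>v\<bar> + 1) * fst z + (\<bar>par_q \<gamma> v\<bar> + \<bar>v\<bar>) * snd z) * exp (- (min ((v - 1)\<^sup>2) (v\<^sup>2) / 2) * t))"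
proof -
  \<comment> \<open>These increments minimise the kernel in the admissible direction.\<close>
  define a b where "a = (if 1 < v then v - 1 else 0)" and "b = (if 1 < v then 0 else - v)"
  have ab: "0 \<le> a" "0 \<le> b" "a \<le> \<bar>v\<bar> + 1" "b \<le> \<bar>v\<bar>" using v by (auto simp: a_def b_def)
  let ?p = "par_p \<gamma> v + a" and ?q = "par_q \<gamma> v + b"
  have "kernel \<gamma> ?p ?q = kernel \<gamma> (par_p \<gamma> v) (par_q \<gamma> v) + (a - b)\<^sup>2 / 2 + a * (1 - v) + b * v"
    unfolding kernel_def par_p_def par_q_def by (simp add: power2_eq_square field_simps)
  also have "\<dots> \<le> - (min ((v - 1)\<^sup>2) (v\<^sup>2) / 2)"
    unfolding kernel_par using v
    by (auto simp: a_def b_def min_def power2_eq_square field_simps)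
  finally have K: "kernel \<gamma> ?p ?q \<le> - (min ((v - 1)\<^sup>2) (v\<^sup>2) / 2)" .
  have "(\<integral>\<^sup>+\<omega>. ennreal (par_exp \<gamma> v (proc \<gamma> W z t \<omega>)) * indicator (space M - exits_by t) \<omega> \<partial>M)
    \<le> (\<integral>\<^sup>+\<omega>. ennreal (exp (?p * fst (proc \<gamma> W z t \<omega>) + ?q * snd (proc \<gamma> W z t \<omega>))) \<partial>M)"
  proof (rule nn_integral_mono)
    fix \<omega> assume \<omega>: "\<omega> \<in> space M"
    show "ennreal (par_exp \<gamma> v (proc \<gamma> W z t \<omega>)) * indicator (space M - exits_by t) \<omega>
      \<le> ennreal (exp (?p * fst (proc \<gamma> W z t \<omega>) + ?q * snd (proc \<gamma> W z t \<omega>)))"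
    proof (cases "\<omega> \<in> exits_by t")
      case False
      then have "proc \<gamma> W z t \<omega> \<in> quadrant"
        using \<omega> t by (intro alive_quadrant) (auto simp: exits_by_def)
      then have "0 \<le> a * fst (proc \<gamma> W z t \<omega>)" "0 \<le> b * snd (proc \<gamma> W z t \<omega>)"
        using ab by (auto simp: quadrant_def)
      then show ?thesis using False \<omega> by (simp add: par_exp_def distrib_right)
    qed simp
  qed
  also have "\<dots> = ennreal (exp (?p * fst z + ?q * snd z + t * kernel \<gamma> ?p ?q))"
    using t by (intro exp_functional_mean) simp
  also have "\<dots> \<le> ennreal (exp ((\<bar>par_p \<gamma> v\<bar> + \<bar>v\<bar> + 1) * fst z + (\<bar>par_q \<gamma> v\<bar> + \<bar>v\<bar>) * snd z) * exp (- (min ((v - 1)\<^sup>2) (v\<^sup>2) / 2) * t))"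
  proof -
    have "?p * fst z \<le> (\<bar>par_p \<gamma> v\<bar> + \<bar>v\<bar> + 1) * fst z" "?q * snd z \<le> (\<bar>par_q \<gamma> v\<bar> + \<bar>v\<bar>) * snd z"
      using z_pos ab by (auto intro!: mult_right_mono)
    moreover have "t * kernel \<gamma> ?p ?q \<le> - (min ((v - 1)\<^sup>2) (v\<^sup>2) / 2) * t"
      using mult_right_mono[OF K, of t] t by (simp add: mult.commute)
    ultimately show ?thesis unfolding mult_exp_exp by (intro ennreal_leI) simp
  qed
  finally show ?thesis .
qed

text \<open>Letting \<open>t\<close> grow in \<open>optional_stopping\<close>, the contribution of the paths
  still alive tends to zero by \<open>alive_mass_bound\<close>.\<close>

theorem laplace_functional_equation:
  assumes v: "1 < v \<or> v < 0"
  shows "ennreal (par_exp \<gamma> v z) = (\<integral>\<^sup>+y. ennreal (exp (par_q \<gamma> v * y)) \<partial>law1)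
    + (\<integral>\<^sup>+x. ennreal (exp (par_p \<gamma> v * x)) \<partial>law2)"
proof -
  let ?i1 = "\<lambda>n. \<integral>\<^sup>+y. ennreal (exp (par_q \<gamma> v * y)) * indicator {..s0 + real (Suc n)} y \<partial>law1"
  let ?i2 = "\<lambda>n. \<integral>\<^sup>+y. ennreal (exp (par_p \<gamma> v * y)) * indicator {..s0 + real (Suc n)} y \<partial>law2"
  let ?i3 = "\<lambda>n. \<integral>\<^sup>+\<omega>. ennreal (par_exp \<gamma> v (proc \<gamma> W z (real (Suc n)) \<omega>)) * indicator (space M - exits_by (real (Suc n))) \<omega> \<partial>M"
  have ind: "(\<lambda>n. indicator {..s0 + real (Suc n)} y :: ennreal) \<longlonglongrightarrow> 1" for y
  proof (rule tendsto_eventually)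
    obtain N :: nat where "y - s0 < real N" using reals_Archimedean2 by blast
    then show "\<forall>\<^sub>F n in sequentially. indicator {..s0 + real (Suc n)} y = (1 :: ennreal)"
      unfolding eventually_sequentially by (intro exI[of _ N]) (auto simp: indicator_def)
  qed
  have lim: "(\<lambda>n. \<integral>\<^sup>+y. ennreal (exp (c * y)) * indicator {..s0 + real (Suc n)} y \<partial>\<rho>)
      \<longlonglongrightarrow> (\<integral>\<^sup>+y. ennreal (exp (c * y)) \<partial>\<rho>)" if [measurable_cong]: "sets \<rho> = sets borel" for c and \<rho> :: "real measure"
  proof (rule nn_integral_LIMSEQ)
    show "incseq (\<lambda>n y. ennreal (exp (c * y)) * indicator {..s0 + real (Suc n)} y)"
      by (auto simp: incseq_def le_fun_def indicator_def)
    show "(\<lambda>n. ennreal (exp (c * y)) * indicator {..s0 + real (Suc n)} y) \<longlonglongrightarrow> ennreal (exp (c * y))" for y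
      using tendsto_mult_ennreal[OF tendsto_const ind[of y], of "ennreal (exp (c * y))"] by simp
  qed measurable
  define \<kappa> where "\<kappa> = min ((v - 1)\<^sup>2) (v\<^sup>2) / 2"
  define c where "c = exp ((\<bar>par_p \<gamma> v\<bar> + \<bar>v\<bar> + 1) * fst z + (\<bar>par_q \<gamma> v\<bar> + \<bar>v\<bar>) * snd z)"
  have "0 < \<kappa>" using v by (auto simp: \<kappa>_def)
  have "(\<lambda>n. c * exp (- \<kappa> * real (Suc n))) \<longlonglongrightarrow> c * 0"
  proof (intro tendsto_mult tendsto_const)
    have "(\<lambda>n. exp (- \<kappa>) ^ Suc n) \<longlonglongrightarrow> 0"
      using \<open>0 < \<kappa>\<close> by (intro LIMSEQ_Suc LIMSEQ_realpow_zero) auto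
    then show "(\<lambda>n. exp (- \<kappa> * real (Suc n))) \<longlonglongrightarrow> 0"
      unfolding exp_of_nat_mult[symmetric] by (simp add: mult.commute)
  qed
  then have "(\<lambda>n. ennreal (c * exp (- \<kappa> * real (Suc n)))) \<longlonglongrightarrow> ennreal 0"
    by (intro tendsto_ennrealI) simp
  then have l0: "(\<lambda>n. ennreal (c * exp (- \<kappa> * real (Suc n)))) \<longlonglongrightarrow> 0" by simp
  have bnd: "?i3 n \<le> ennreal (c * exp (- \<kappa> * real (Suc n)))" for n
    unfolding c_def \<kappa>_def by (rule alive_mass_bound) (use v in auto)
  have "?i3 \<longlonglongrightarrow> 0"
    by (rule tendsto_sandwich[OF _ _ tendsto_const l0]) (use bnd in auto)
  then have "(\<lambda>n. ?i1 n + ?i2 n + ?i3 n) \<longlonglongrightarrow> (\<integral>\<^sup>+y. ennreal (exp (par_q \<gamma> v * y)) \<partial>law1)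
    + (\<integral>\<^sup>+x. ennreal (exp (par_p \<gamma> v * x)) \<partial>law2) + 0"
    by (intro tendsto_add lim) simp_all
  moreover have "?i1 n + ?i2 n + ?i3 n = ennreal (par_exp \<gamma> v z)" for n
    by (rule optional_stopping[symmetric]) simp
  ultimately have "(\<lambda>n :: nat. ennreal (par_exp \<gamma> v z)) \<longlonglongrightarrow> (\<integral>\<^sup>+y. ennreal (exp (par_q \<gamma> v * y)) \<partial>law1)
    + (\<integral>\<^sup>+x. ennreal (exp (par_p \<gamma> v * x)) \<partial>law2)"
    by simp
  then show ?thesis by (rule LIMSEQ_unique[OF tendsto_const])
qed

definition lap1 :: "real \<Rightarrow> real" where "lap1 q = (LINT y|law1. exp (q * y))"
definition lap2 :: "real \<Rightarrow> real" where "lap2 p = (LINT x|law2. exp (p * x))"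

lemma par_roots:
  assumes "q < (1 - \<gamma>)\<^sup>2 / 2"
  obtains v where "1 < v" "par_q \<gamma> v = q" "par_p \<gamma> v = P_minus \<gamma> q"
proof -
  define r where "r = sqrt ((1 - \<gamma>)\<^sup>2 - 2 * q)"
  have r: "0 < r" "r\<^sup>2 = (1 - \<gamma>)\<^sup>2 - 2 * q" using assms by (auto simp: r_def)
  have q: "par_q \<gamma> (1 + r) = q" using r by (simp add: par_q_def)
  show thesis
  proof (rule that[of "1 + r"])
    show "par_p \<gamma> (1 + r) = P_minus \<gamma> q"
      using par_q_minus_p[of \<gamma> "1 + r"] q by (simp add: P_minus_def r_def[symmetric])
  qed (use r q in auto)
qed

lemma par_roots':
  assumes "p < \<gamma>\<^sup>2 / 2"
  obtains v where "v < 0" "par_p \<gamma> v = p" "par_q \<gamma> v = Q_minus \<gamma> p"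
proof -
  define r where "r = sqrt (\<gamma>\<^sup>2 - 2 * p)"
  have r: "0 < r" "r\<^sup>2 = \<gamma>\<^sup>2 - 2 * p" using assms by (auto simp: r_def)
  have p: "par_p \<gamma> (- r) = p" using r by (simp add: par_p_def)
  show thesis
  proof (rule that[of "- r"])
    show "par_q \<gamma> (- r) = Q_minus \<gamma> p"
      using par_q_minus_p[of \<gamma> "- r"] p by (simp add: Q_minus_def r_def[symmetric])
  qed (use r p in auto)
qed

text \<open>The functional equation bounds the moments by a finite exponential, up to the end of the range
  where \<open>P_minus\<close> and \<open>Q_minus\<close> are real.\<close>

lemma exp_moment_integrable:
  "q < (1 - \<gamma>)\<^sup>2 / 2 \<Longrightarrow> integrable law1 (\<lambda>y. exp (q * y))"
  "p < \<gamma>\<^sup>2 / 2 \<Longrightarrow> integrable law2 (\<lambda>x. exp (p * x))"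
proof -
  assume "q < (1 - \<gamma>)\<^sup>2 / 2"
  then obtain v where v: "1 < v" "par_q \<gamma> v = q" by (rule par_roots)
  have "(\<integral>\<^sup>+y. ennreal (exp (q * y)) \<partial>law1) \<le> ennreal (par_exp \<gamma> v z)"
    using laplace_functional_equation[of v] v by simp
  also have "\<dots> < \<infinity>" by simp
  finally show "integrable law1 (\<lambda>y. exp (q * y))" by (intro integrableI_nonneg) auto
next
  assume "p < \<gamma>\<^sup>2 / 2"
  then obtain v where v: "v < 0" "par_p \<gamma> v = p" by (rule par_roots')
  have "(\<integral>\<^sup>+y. ennreal (exp (p * y)) \<partial>law2) \<le> ennreal (par_exp \<gamma> v z)"
    using laplace_functional_equation[of v] v by simp
  also have "\<dots> < \<infinity>" by simp
  finally show "integrable law2 (\<lambda>y. exp (p * y))" by (intro integrableI_nonneg) auto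
qed

lemma par_less: "v \<noteq> 1 \<Longrightarrow> par_q \<gamma> v < (1 - \<gamma>)\<^sup>2 / 2" "v \<noteq> 0 \<Longrightarrow> par_p \<gamma> v < \<gamma>\<^sup>2 / 2"
  by (auto simp: par_q_def par_p_def)

lemma lap_functional_equation:
  assumes v: "1 < v \<or> v < 0"
  shows "lap1 (par_q \<gamma> v) + lap2 (par_p \<gamma> v) = par_exp \<gamma> v z"
proof -
  have i: "integrable law1 (\<lambda>y. exp (par_q \<gamma> v * y))" "integrable law2 (\<lambda>y. exp (par_p \<gamma> v * y))"
    using v by (auto intro!: exp_moment_integrable par_less)
  have "0 \<le> lap1 (par_q \<gamma> v)" "0 \<le> lap2 (par_p \<gamma> v)"
    unfolding lap1_def lap2_def by (auto intro!: Bochner_Integration.integral_nonneg)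
  moreover have "ennreal (par_exp \<gamma> v z) = ennreal (lap1 (par_q \<gamma> v)) + ennreal (lap2 (par_p \<gamma> v))"
    using laplace_functional_equation[OF v] i by (simp add: nn_integral_eq_integral lap1_def lap2_def)
  ultimately show ?thesis by (simp add: ennreal_plus[symmetric] par_exp_def del: ennreal_plus)
qed

text \<open>The continuation of \<open>L1\<close> is again the transform of the exit law, because the
  functional equation holds for the convergent integrals.\<close>

lemma L1_eq_lap1:
  assumes "q < (1 - \<gamma>)\<^sup>2 / 2" shows "L1 M \<gamma> W z q = lap1 q"
proof -
  from assms obtain v where v: "1 < v" "par_q \<gamma> v = q" "par_p \<gamma> v = P_minus \<gamma> q" by (rule par_roots)
  then show ?thesis using lap_functional_equation[of v]
    by (simp add: L1_def exit_laplace_law lap1_def lap2_def par_exp_def)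
qed

lemma L2_eq_lap2:
  assumes "p < \<gamma>\<^sup>2 / 2" shows "L2 M \<gamma> W z p = lap2 p"
proof -
  from assms obtain v where v: "v < 0" "par_p \<gamma> v = p" "par_q \<gamma> v = Q_minus \<gamma> p" by (rule par_roots')
  then show ?thesis using lap_functional_equation[of v]
    by (simp add: L2_def exit_laplace_law lap1_def lap2_def par_exp_def)
qed

end

section \<open>Series of exponentials along the parabola\<close>

text \<open>The exponent is quadratic in \<open>v\<close> with leading coefficient minus half the sum of the
  coordinates; this is the source of the Gaussian decay of the series below.\<close>

lemma par_exp_alt:
  "par_exp \<gamma> v z = exp ((\<gamma>\<^sup>2 * fst z + ((1 - \<gamma>)\<^sup>2 - 1) * snd z) / 2 + v * snd z - v\<^sup>2 * (fst z + snd z) / 2)"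
  unfolding par_exp_def par_p_def par_q_def
  by (rule arg_cong[where f=exp]) (simp add: power2_eq_square field_simps)

definition poly_bounded :: "(nat \<Rightarrow> real) \<Rightarrow> (nat \<Rightarrow> real) \<Rightarrow> bool" where
  "poly_bounded v c \<longleftrightarrow> (\<exists>C m. \<forall>n. \<bar>c n\<bar> \<le> C * (1 + \<bar>v n\<bar>) ^ m)"

text \<open>A linear lower bound on the growth of the nodes; it is all that the convergence arguments use.\<close>

definition spread :: "(nat \<Rightarrow> real) \<Rightarrow> bool" where
  "spread v \<longleftrightarrow> (\<forall>n. real n \<le> \<bar>v n\<bar> + 1)"

lemma poly_bounded_mult:
  assumes "poly_bounded v c" "poly_bounded v d"
  shows "poly_bounded v (\<lambda>n. c n * d n)"
proof -
  obtain C m where C: "\<And>n. \<bar>c n\<bar> \<le> C * (1 + \<bar>v n\<bar>) ^ m" using assms(1) by (auto simp: poly_bounded_def)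
  obtain D k where D: "\<And>n. \<bar>d n\<bar> \<le> D * (1 + \<bar>v n\<bar>) ^ k" using assms(2) by (auto simp: poly_bounded_def)
  have "\<bar>c n * d n\<bar> \<le> (C * D) * (1 + \<bar>v n\<bar>) ^ (m + k)" for n
  proof -
    have "\<bar>c n\<bar> * \<bar>d n\<bar> \<le> (C * (1 + \<bar>v n\<bar>) ^ m) * (D * (1 + \<bar>v n\<bar>) ^ k)"
      using C[of n] D[of n] order_trans[OF abs_ge_zero C[of n]] by (intro mult_mono) auto
    then show ?thesis by (simp add: abs_mult power_add algebra_simps)
  qed
  then show ?thesis unfolding poly_bounded_def by blast
qed

lemma poly_bounded_add:
  assumes "poly_bounded v c" "poly_bounded v d"
  shows "poly_bounded v (\<lambda>n. c n + d n)"
proof -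
  obtain C m where C: "\<And>n. \<bar>c n\<bar> \<le> C * (1 + \<bar>v n\<bar>) ^ m" using assms(1) by (auto simp: poly_bounded_def)
  obtain D k where D: "\<And>n. \<bar>d n\<bar> \<le> D * (1 + \<bar>v n\<bar>) ^ k" using assms(2) by (auto simp: poly_bounded_def)
  have "\<bar>c n + d n\<bar> \<le> (\<bar>C\<bar> + \<bar>D\<bar>) * (1 + \<bar>v n\<bar>) ^ (m + k)" for n
  proof -
    have "C * (1 + \<bar>v n\<bar>) ^ m \<le> \<bar>C\<bar> * (1 + \<bar>v n\<bar>) ^ (m + k)"
      "D * (1 + \<bar>v n\<bar>) ^ k \<le> \<bar>D\<bar> * (1 + \<bar>v n\<bar>) ^ (m + k)"
      by (intro mult_mono power_increasing; simp)+
    then show ?thesis using C[of n] D[of n] abs_triangle_ineq[of "c n" "d n"] by (simp add: distrib_right)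
  qed
  then show ?thesis unfolding poly_bounded_def by blast
qed

lemma poly_bounded_quadratic:
  assumes "\<And>n. \<bar>c n\<bar> \<le> C * (1 + (v n)\<^sup>2)"
  shows "poly_bounded v c"
proof -
  have "0 \<le> C * (1 + (v 0)\<^sup>2)" using order_trans[OF abs_ge_zero assms] .
  then have "0 \<le> C" using zero_le_mult_iff[of C "1 + (v 0)\<^sup>2"] sum_power2_gt_zero_iff[of 1 "v 0"] by (auto simp: not_le)
  have "\<bar>c n\<bar> \<le> C * (1 + \<bar>v n\<bar>) ^ 2" for n
  proof -
    have "1 + (v n)\<^sup>2 \<le> (1 + \<bar>v n\<bar>)\<^sup>2" by (simp add: power2_sum)
    then show ?thesis using assms[of n] \<open>0 \<le> C\<close> by (meson mult_left_mono order_trans)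
  qed
  then show ?thesis unfolding poly_bounded_def by blast
qed

lemma poly_bounded_const: "poly_bounded v (\<lambda>_. k)"
  by (rule poly_bounded_quadratic[of _ "\<bar>k\<bar>"]) (simp add: distrib_left)

lemma poly_bounded_id: "poly_bounded v v"
proof (rule poly_bounded_quadratic[of _ 1])
  fix n show "\<bar>v n\<bar> \<le> 1 * (1 + (v n)\<^sup>2)"
    using zero_le_power2[of "\<bar>v n\<bar> - 1/2"] by (simp add: power2_eq_square algebra_simps)
qed

lemma poly_bounded_par:
  "poly_bounded v (\<lambda>n. par_p \<gamma> (v n))" "poly_bounded v (\<lambda>n. par_q \<gamma> (v n))"
proof -
  show "poly_bounded v (\<lambda>n. par_p \<gamma> (v n))"
  proof (rule poly_bounded_quadratic[of _ "1 + \<gamma>\<^sup>2"])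
    fix n
    have "\<bar>par_p \<gamma> (v n)\<bar> \<le> \<gamma>\<^sup>2 + (v n)\<^sup>2"
      unfolding par_p_def by (rule abs_leI) (simp_all add: field_simps)
    also have "\<dots> \<le> (1 + \<gamma>\<^sup>2) * (1 + (v n)\<^sup>2)" by (simp add: algebra_simps)
    finally show "\<bar>par_p \<gamma> (v n)\<bar> \<le> (1 + \<gamma>\<^sup>2) * (1 + (v n)\<^sup>2)" .
  qed
  show "poly_bounded v (\<lambda>n. par_q \<gamma> (v n))"
  proof (rule poly_bounded_quadratic[of _ "2 + (1 - \<gamma>)\<^sup>2"])
    fix n
    have "(1 - v n)\<^sup>2 \<le> 2 * (1 + (v n)\<^sup>2)"
      using zero_le_power2[of "1 + v n"] by (simp add: power2_eq_square algebra_simps)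
    then have "\<bar>par_q \<gamma> (v n)\<bar> \<le> (1 - \<gamma>)\<^sup>2 + 2 * (1 + (v n)\<^sup>2)"
    proof -
      have *: "\<bar>(a - b) / 2\<bar> \<le> a + c" if "b \<le> c" "0 \<le> a" "0 \<le> b" for a b c :: real
        using that by (simp add: abs_le_iff field_simps)
      show ?thesis unfolding par_q_def by (rule *) (use \<open>(1 - v n)\<^sup>2 \<le> 2 * (1 + (v n)\<^sup>2)\<close> in auto)
    qed
    also have "\<dots> \<le> (2 + (1 - \<gamma>)\<^sup>2) * (1 + (v n)\<^sup>2)" by (simp add: distrib_right distrib_left)
    finally show "\<bar>par_q \<gamma> (v n)\<bar> \<le> (2 + (1 - \<gamma>)\<^sup>2) * (1 + (v n)\<^sup>2)" .
  qed
qed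

definition region :: "real \<Rightarrow> real \<Rightarrow> (real \<times> real) set" where
  "region d B = {z. d < fst z + snd z \<and> \<bar>fst z\<bar> < B \<and> \<bar>snd z\<bar> < B}"

lemma region_convex: "convex (region d B)"
proof -
  have "region d B = ((\<lambda>z. fst z + snd z) -` {d<..}) \<inter> (fst -` {-B<..<B}) \<inter> (snd -` {-B<..<B})"
    by (auto simp: region_def abs_less_iff)
  then show ?thesis
    by (auto intro!: convex_Int convex_linear_vimage bounded_linear.linear bounded_linear_intros)
qed

lemma region_open: "open (region d B)"
  unfolding region_def by (intro open_Collect_conj open_Collect_less continuous_intros)

lemma in_region:
  assumes "0 < fst z + snd z"
  obtains d B where "0 < d" "0 \<le> B" "z \<in> region d B"
  by (rule that[of "(fst z + snd z) / 2" "\<bar>fst z\<bar> + \<bar>snd z\<bar> + 1"]) (use assms in \<open>auto simp: region_def\<close>)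

text \<open>A polynomially bounded coefficient costs at most \<open>exp (m * \<bar>v\<bar>)\<close>, and
  \<open>- v\<^sup>2 * d / 2\<close> beats every linear term in \<open>\<bar>v\<bar>\<close>.
  The bound is uniform on the regions, which cover the half plane of positive coordinate sum.\<close>

lemma par_exp_region_bound:
  assumes v: "spread v" and c: "poly_bounded v c" and d: "0 < d" and B: "0 \<le> B"
  obtains K where "\<And>n z. z \<in> region d B \<Longrightarrow> \<bar>c n * par_exp \<gamma> (v n) z\<bar> \<le> K * exp (- real n)"
proof -
  obtain C m where C: "\<And>n. \<bar>c n\<bar> \<le> C * (1 + \<bar>v n\<bar>) ^ m" using c by (auto simp: poly_bounded_def)
  have "0 \<le> C * (1 + \<bar>v 0\<bar>) ^ m" by (rule order_trans[OF abs_ge_zero C])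
  moreover have "0 < (1 + \<bar>v 0\<bar>) ^ m" by (simp add: zero_less_power)
  ultimately have C0: "0 \<le> C" by (metis mult.commute zero_le_mult_iff not_le)
  define K0 where "K0 = \<gamma>\<^sup>2 * B + ((1 - \<gamma>)\<^sup>2 + 1) * B"
  define K where "K = C * exp (K0 + 1 + (B + real m + 1)\<^sup>2 / (2 * d))"
  show thesis
  proof (rule that[of K])
    fix n z assume z: "z \<in> region d B"
    define t where "t = \<bar>v n\<bar>"
    have t: "0 \<le> t" "real n \<le> t + 1" using v by (auto simp: t_def spread_def)
    have p: "(1 + t) ^ m \<le> exp (real m * t)"
      unfolding exp_of_nat_mult using t by (intro power_mono) auto
    have l: "(\<gamma>\<^sup>2 * fst z + ((1 - \<gamma>)\<^sup>2 - 1) * snd z) / 2 \<le> K0"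
    proof -
      have "\<gamma>\<^sup>2 * fst z \<le> \<gamma>\<^sup>2 * B" using z by (intro mult_left_mono) (auto simp: region_def)
      moreover have "((1 - \<gamma>)\<^sup>2 - 1) * snd z \<le> ((1 - \<gamma>)\<^sup>2 + 1) * B"
      proof -
        have "((1 - \<gamma>)\<^sup>2 - 1) * snd z \<le> \<bar>(1 - \<gamma>)\<^sup>2 - 1\<bar> * \<bar>snd z\<bar>" unfolding abs_mult[symmetric] by (rule abs_ge_self)
        also have "\<dots> \<le> ((1 - \<gamma>)\<^sup>2 + 1) * B"
          using z zero_le_power2[of "1-\<gamma>"] by (intro mult_mono) (auto simp: region_def abs_le_iff)
        finally show ?thesis .
      qed
      moreover have "0 \<le> \<gamma>\<^sup>2 * B + ((1 - \<gamma>)\<^sup>2 + 1) * B" using B by simp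
      ultimately show ?thesis by (simp add: K0_def)
    qed
    have vs: "v n * snd z \<le> B * t"
    proof -
      have "v n * snd z \<le> \<bar>v n\<bar> * \<bar>snd z\<bar>" unfolding abs_mult[symmetric] by (rule abs_ge_self)
      also have "\<dots> \<le> t * B" using z by (intro mult_mono) (auto simp: region_def t_def)
      finally show ?thesis by (simp add: mult.commute)
    qed
    have vv: "d * t\<^sup>2 \<le> (v n)\<^sup>2 * (fst z + snd z)"
      using z mult_right_mono[of d "fst z + snd z" "t\<^sup>2"] by (simp add: region_def t_def mult.commute)
    have sq: "(B + real m + 1) * t - d * t\<^sup>2 / 2 \<le> (B + real m + 1)\<^sup>2 / (2 * d)"
    proof -
      have "0 \<le> (d * t - (B + real m + 1))\<^sup>2 / (2 * d)" using d by simp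
      also have "\<dots> = d * t\<^sup>2 / 2 - (B + real m + 1) * t + (B + real m + 1)\<^sup>2 / (2 * d)"
        using d by (simp add: power2_eq_square field_simps)
      finally show ?thesis by simp
    qed
    have "par_exp \<gamma> (v n) z \<le> exp (K0 + B * t - d * t\<^sup>2 / 2)"
      unfolding par_exp_alt exp_le_cancel_iff using l vs vv by linarith
    moreover have "\<bar>c n\<bar> \<le> C * exp (real m * t)"
      using C[of n] mult_left_mono[OF p C0] by (simp add: t_def)
    moreover have "\<bar>par_exp \<gamma> (v n) z\<bar> = par_exp \<gamma> (v n) z" by (simp add: par_exp_def)
    ultimately have "\<bar>c n * par_exp \<gamma> (v n) z\<bar> \<le> (C * exp (real m * t)) * exp (K0 + B * t - d * t\<^sup>2 / 2)"
      unfolding abs_mult using C0 by (intro mult_mono) auto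
    also have "\<dots> = C * exp (real m * t + (K0 + B * t - d * t\<^sup>2 / 2))" by (simp add: exp_add)
    also have "\<dots> \<le> C * exp (K0 + 1 + (B + real m + 1)\<^sup>2 / (2 * d) - real n)"
      using C0 sq t by (intro mult_left_mono) (auto simp: algebra_simps)
    also have "\<dots> = K * exp (- real n)" by (simp add: K_def exp_diff exp_minus field_simps)
    finally show "\<bar>c n * par_exp \<gamma> (v n) z\<bar> \<le> K * exp (- real n)" .
  qed
qed

lemma summable_exp_neg: "summable (\<lambda>n. K * exp (- real n))"
proof -
  have "summable (\<lambda>n. exp (-1 :: real) ^ n)" by (rule summable_geometric) simp
  moreover have "exp (-1 :: real) ^ n = exp (- real n)" for n by (simp add: exp_of_nat_mult[symmetric])
  ultimately show ?thesis by (intro summable_mult) simp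
qed

definition exp_series :: "real \<Rightarrow> (nat \<Rightarrow> real) \<Rightarrow> (nat \<Rightarrow> real) \<Rightarrow> real \<times> real \<Rightarrow> real" where
  "exp_series \<gamma> v c z = (\<Sum>n. c n * par_exp \<gamma> (v n) z)"

lemma exp_series_uniform_limit:
  assumes "spread v" "poly_bounded v c" "0 < d" "0 \<le> B"
  shows "uniform_limit (region d B) (\<lambda>n z. \<Sum>i<n. c i * par_exp \<gamma> (v i) z) (exp_series \<gamma> v c) sequentially"
proof -
  obtain K where K: "\<And>n z. z \<in> region d B \<Longrightarrow> \<bar>c n * par_exp \<gamma> (v n) z\<bar> \<le> K * exp (- real n)"
    using par_exp_region_bound[OF assms] by blast
  show ?thesis unfolding exp_series_def[abs_def]
    by (rule Weierstrass_m_test[OF _ summable_exp_neg[of K]]) (use K in auto)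
qed

lemma exp_series_summable:
  assumes "spread v" "poly_bounded v c" "0 < fst z + snd z"
  shows "summable (\<lambda>n. c n * par_exp \<gamma> (v n) z)"
proof -
  obtain d B where d: "0 < d" "0 \<le> B" "z \<in> region d B" using in_region[OF assms(3)] .
  obtain K where K: "\<And>n z. z \<in> region d B \<Longrightarrow> \<bar>c n * par_exp \<gamma> (v n) z\<bar> \<le> K * exp (- real n)"
    using par_exp_region_bound[OF assms(1,2) d(1,2)] by blast
  show ?thesis by (rule summable_comparison_test'[OF summable_exp_neg[of K]]) (use K d in auto)
qed

lemma par_exp_has_derivative:
  "(par_exp \<gamma> v has_derivative (\<lambda>h. par_exp \<gamma> v z * (par_p \<gamma> v * fst h + par_q \<gamma> v * snd h))) (at z within S)"
  unfolding par_exp_def[abs_def] by (auto intro!: derivative_eq_intros simp: algebra_simps)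

lemma linear_form_bound:
  fixes P Q a b e r :: real
  assumes "\<bar>P\<bar> \<le> e / 2" "\<bar>Q\<bar> \<le> e / 2" "\<bar>a\<bar> \<le> r" "\<bar>b\<bar> \<le> r"
  shows "norm (P * a + Q * b) \<le> e * r"
proof -
  have "\<bar>P * a\<bar> \<le> e / 2 * r" "\<bar>Q * b\<bar> \<le> e / 2 * r"
    unfolding abs_mult
    by (rule mult_mono[OF assms(1,3)] mult_mono[OF assms(2,4)]; use assms in linarith)+
  then show ?thesis using abs_triangle_ineq[of "P * a" "Q * b"] by simp
qed

text \<open>Termwise differentiation: differentiating multiplies the coefficients by \<open>par_p\<close>
  and \<open>par_q\<close>, which keeps them polynomially bounded, so the series of derivatives
  converges locally uniformly as well.\<close>

lemma exp_series_has_derivative: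
  assumes v: "spread v" and c: "poly_bounded v c" and z: "0 < fst z + snd z"
  shows "(exp_series \<gamma> v c has_derivative
    (\<lambda>h. exp_series \<gamma> v (\<lambda>n. c n * par_p \<gamma> (v n)) z * fst h
        + exp_series \<gamma> v (\<lambda>n. c n * par_q \<gamma> (v n)) z * snd h)) (at z)"
proof -
  obtain d B where d: "0 < d" "0 \<le> B" "z \<in> region d B" using in_region[OF z] .
  let ?S = "region d B"
  let ?cp = "\<lambda>n. c n * par_p \<gamma> (v n)" and ?cq = "\<lambda>n. c n * par_q \<gamma> (v n)"
  have cp: "poly_bounded v ?cp" "poly_bounded v ?cq"
    using c by (auto intro!: poly_bounded_mult poly_bounded_par)
  have "\<exists>g. \<forall>x\<in>?S. (\<lambda>n. c n * par_exp \<gamma> (v n) x) sums (g x) \<and>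
    (g has_derivative (\<lambda>h. exp_series \<gamma> v ?cp x * fst h + exp_series \<gamma> v ?cq x * snd h)) (at x within ?S)"
  proof (rule has_derivative_series[OF region_convex])
    fix n x assume "x \<in> ?S"
    show "((\<lambda>x. c n * par_exp \<gamma> (v n) x) has_derivative
      (\<lambda>h. c n * (par_exp \<gamma> (v n) x * (par_p \<gamma> (v n) * fst h + par_q \<gamma> (v n) * snd h)))) (at x within ?S)"
      by (intro has_derivative_mult_right par_exp_has_derivative)
  next
    fix e :: real assume "0 < e"
    then have e: "0 < e / 2" by simp
    have u: "\<forall>\<^sub>F n in sequentially. \<forall>x\<in>?S. dist (\<Sum>i<n. ?cp i * par_exp \<gamma> (v i) x) (exp_series \<gamma> v ?cp x) < e / 2"
      "\<forall>\<^sub>F n in sequentially. \<forall>x\<in>?S. dist (\<Sum>i<n. ?cq i * par_exp \<gamma> (v i) x) (exp_series \<gamma> v ?cq x) < e / 2"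
      using exp_series_uniform_limit[OF v cp(1) d(1,2), THEN uniform_limitD, OF e]
        exp_series_uniform_limit[OF v cp(2) d(1,2), THEN uniform_limitD, OF e] by auto
    show "\<forall>\<^sub>F n in sequentially. \<forall>x\<in>?S. \<forall>h. norm ((\<Sum>i<n. c i * (par_exp \<gamma> (v i) x * (par_p \<gamma> (v i) * fst h + par_q \<gamma> (v i) * snd h)))
       - (exp_series \<gamma> v ?cp x * fst h + exp_series \<gamma> v ?cq x * snd h)) \<le> e * norm h"
      using u
    proof eventually_elim
      case (elim n)
      show ?case
      proof (intro ballI allI)
        fix x and h :: "real \<times> real" assume x: "x \<in> ?S"
        let ?P = "(\<Sum>i<n. ?cp i * par_exp \<gamma> (v i) x) - exp_series \<gamma> v ?cp x"
        let ?Q = "(\<Sum>i<n. ?cq i * par_exp \<gamma> (v i) x) - exp_series \<gamma> v ?cq x"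
        have PQ: "\<bar>?P\<bar> \<le> e / 2" "\<bar>?Q\<bar> \<le> e / 2" using elim x by (auto simp: dist_real_def less_imp_le)
        have h: "\<bar>fst h\<bar> \<le> norm h" "\<bar>snd h\<bar> \<le> norm h"
          using norm_fst_le[of "fst h" "snd h"] norm_snd_le[of "snd h" "fst h"] by auto
        have "(\<Sum>i<n. c i * (par_exp \<gamma> (v i) x * (par_p \<gamma> (v i) * fst h + par_q \<gamma> (v i) * snd h)))
          - (exp_series \<gamma> v ?cp x * fst h + exp_series \<gamma> v ?cq x * snd h) = ?P * fst h + ?Q * snd h"
        proof -
          have "c i * (par_exp \<gamma> (v i) x * (par_p \<gamma> (v i) * fst h + par_q \<gamma> (v i) * snd h))
            = ?cp i * par_exp \<gamma> (v i) x * fst h + ?cq i * par_exp \<gamma> (v i) x * snd h" for i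
            by (simp add: algebra_simps)
          then show ?thesis by (simp only: sum.distrib sum_distrib_right left_diff_distrib)
        qed
        also have "norm \<dots> \<le> e * norm h"
          by (rule linear_form_bound[OF PQ h])
        finally show "norm ((\<Sum>i<n. c i * (par_exp \<gamma> (v i) x * (par_p \<gamma> (v i) * fst h + par_q \<gamma> (v i) * snd h)))
       - (exp_series \<gamma> v ?cp x * fst h + exp_series \<gamma> v ?cq x * snd h)) \<le> e * norm h" .
      qed
    qed
  next
    show "z \<in> ?S" by (rule d)
    show "(\<lambda>n. c n * par_exp \<gamma> (v n) z) sums exp_series \<gamma> v c z"
      unfolding exp_series_def by (rule summable_sums[OF exp_series_summable[OF v c z]])
  qed
  then obtain g where g: "\<And>x. x \<in> ?S \<Longrightarrow> (\<lambda>n. c n * par_exp \<gamma> (v n) x) sums (g x)"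
    "\<And>x. x \<in> ?S \<Longrightarrow> (g has_derivative (\<lambda>h. exp_series \<gamma> v ?cp x * fst h + exp_series \<gamma> v ?cq x * snd h)) (at x within ?S)"
    by blast
  have "(g has_derivative (\<lambda>h. exp_series \<gamma> v ?cp z * fst h + exp_series \<gamma> v ?cq z * snd h)) (at z)"
    using g(2)[OF d(3)] at_within_open[OF d(3) region_open] by simp
  then show ?thesis
  proof (rule has_derivative_transform_within_open[OF _ region_open d(3)])
    fix x assume "x \<in> ?S"
    then show "g x = exp_series \<gamma> v c x" using g(1) by (simp add: exp_series_def sums_iff)
  qed
qed

lemma exp_series_add:
  assumes "spread v" "poly_bounded v c" "poly_bounded v d" "0 < fst z + snd z"
  shows "exp_series \<gamma> v (\<lambda>n. c n + d n) z = exp_series \<gamma> v c z + exp_series \<gamma> v d z"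
  unfolding exp_series_def distrib_right
  by (rule suminf_add[symmetric]) (intro exp_series_summable assms)+

lemma exp_series_cmult:
  assumes "spread v" "poly_bounded v c" "0 < fst z + snd z"
  shows "exp_series \<gamma> v (\<lambda>n. k * c n) z = k * exp_series \<gamma> v c z"
  unfolding exp_series_def mult.assoc
  by (rule suminf_mult) (intro exp_series_summable assms)

definition exp_sum :: "real \<Rightarrow> nat \<Rightarrow> (nat \<Rightarrow> nat \<Rightarrow> real) \<Rightarrow> (nat \<Rightarrow> nat \<Rightarrow> real) \<Rightarrow> real \<times> real \<Rightarrow> real" where
  "exp_sum \<gamma> m v c z = (\<Sum>j<m. exp_series \<gamma> (v j) (c j) z)"

lemma exp_sum_has_derivative:
  assumes "\<And>j. spread (v j)" "\<And>j. poly_bounded (v j) (c j)" "0 < fst z + snd z"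
  shows "(exp_sum \<gamma> m v c has_derivative
    (\<lambda>h. exp_sum \<gamma> m v (\<lambda>j n. c j n * par_p \<gamma> (v j n)) z * fst h
       + exp_sum \<gamma> m v (\<lambda>j n. c j n * par_q \<gamma> (v j n)) z * snd h)) (at z)"
  unfolding exp_sum_def[abs_def] sum_distrib_right sum.distrib[symmetric]
  by (intro has_derivative_sum exp_series_has_derivative assms)

lemma open_quadrant: "open quadrant"
  unfolding quadrant_def by (intro open_Times) auto

lemma partial_of_has_derivative:
  assumes "(u has_derivative (\<lambda>h. a * fst h + b * snd h)) (at z)"
  shows "partial_x u z = a" "partial_y u z = b"
    "((\<lambda>s. u (s, snd z)) has_real_derivative a) (at (fst z))"
    "((\<lambda>s. u (fst z, s)) has_real_derivative b) (at (snd z))"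
proof -
  have 1: "((\<lambda>s. (s, snd z)) has_derivative (\<lambda>h. (h, 0))) (at (fst z))"
    by (auto intro!: derivative_eq_intros)
  show x: "((\<lambda>s. u (s, snd z)) has_real_derivative a) (at (fst z))"
    using has_derivative_compose[OF 1, of u "\<lambda>h. a * fst h + b * snd h"] assms
    by (simp add: has_field_derivative_def)
  have 2: "((\<lambda>s. (fst z, s)) has_derivative (\<lambda>h. (0, h))) (at (snd z))"
    by (auto intro!: derivative_eq_intros)
  show y: "((\<lambda>s. u (fst z, s)) has_real_derivative b) (at (snd z))"
    using has_derivative_compose[OF 2, of u "\<lambda>h. a * fst h + b * snd h"] assms
    by (simp add: has_field_derivative_def)
  show "partial_x u z = a" "partial_y u z = b"
    unfolding partial_x_def partial_y_def using x y by (auto intro: DERIV_imp_deriv)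
qed

lemma partials_of_exp_sum:
  assumes v: "\<And>j. spread (v j)" and c: "\<And>j. poly_bounded (v j) (c j)"
    and u: "\<And>z. z \<in> quadrant \<Longrightarrow> u z = exp_sum \<gamma> m v c z"
  shows "u differentiable_on quadrant"
    "\<And>z. z \<in> quadrant \<Longrightarrow> partial_x u z = exp_sum \<gamma> m v (\<lambda>j n. c j n * par_p \<gamma> (v j n)) z"
    "\<And>z. z \<in> quadrant \<Longrightarrow> partial_y u z = exp_sum \<gamma> m v (\<lambda>j n. c j n * par_q \<gamma> (v j n)) z"
proof -
  have d: "(u has_derivative (\<lambda>h. exp_sum \<gamma> m v (\<lambda>j n. c j n * par_p \<gamma> (v j n)) z * fst h
       + exp_sum \<gamma> m v (\<lambda>j n. c j n * par_q \<gamma> (v j n)) z * snd h)) (at z)" if "z \<in> quadrant" for z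
  proof (rule has_derivative_transform_within_open[OF _ open_quadrant that])
    show "(exp_sum \<gamma> m v c has_derivative (\<lambda>h. exp_sum \<gamma> m v (\<lambda>j n. c j n * par_p \<gamma> (v j n)) z * fst h
       + exp_sum \<gamma> m v (\<lambda>j n. c j n * par_q \<gamma> (v j n)) z * snd h)) (at z)"
      using that by (intro exp_sum_has_derivative v c) (auto simp: quadrant_def)
  qed (simp add: u)
  show "u differentiable_on quadrant"
    unfolding differentiable_on_def using d has_derivative_at_withinI differentiableI by blast
  fix z assume "z \<in> quadrant"
  from partial_of_has_derivative(1,2)[OF d[OF this]]
  show "partial_x u z = exp_sum \<gamma> m v (\<lambda>j n. c j n * par_p \<gamma> (v j n)) z"
    "partial_y u z = exp_sum \<gamma> m v (\<lambda>j n. c j n * par_q \<gamma> (v j n)) z" by auto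
qed

lemma exp_sum_linear:
  assumes "\<And>j. spread (v j)" "\<And>j. poly_bounded (v j) (c j)" "\<And>j. poly_bounded (v j) (d j)" "0 < fst z + snd z"
  shows "a * exp_sum \<gamma> m v c z + b * exp_sum \<gamma> m v d z = exp_sum \<gamma> m v (\<lambda>j n. a * c j n + b * d j n) z"
  unfolding exp_sum_def sum_distrib_left sum.distrib[symmetric]
  by (intro sum.cong refl, subst exp_series_add, (intro assms poly_bounded_mult poly_bounded_const)+,
      subst (1 2) exp_series_cmult, (intro assms refl)+)

text \<open>The generator acts on each exponential as multiplication by the kernel, which vanishes on the
  parabola. The partial derivatives are series of the same kind, so the differentiation theorem
  can be applied twice.\<close>

lemma harmonic_exp_sum:
  assumes v: "\<And>j. spread (v j)" and c: "\<And>j. poly_bounded (v j) (c j)"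
    and u: "\<And>z. z \<in> quadrant \<Longrightarrow> u z = exp_sum \<gamma> m v c z"
  shows "u differentiable_on quadrant" "partial_x u differentiable_on quadrant"
    "partial_y u differentiable_on quadrant" "\<And>z. z \<in> quadrant \<Longrightarrow> generator \<gamma> u z = 0"
proof -
  define p q where "p j n = par_p \<gamma> (v j n)" and "q j n = par_q \<gamma> (v j n)" for j n
  have u1: "u differentiable_on quadrant"
    "\<And>z. z \<in> quadrant \<Longrightarrow> partial_x u z = exp_sum \<gamma> m v (\<lambda>j n. c j n * p j n) z"
    "\<And>z. z \<in> quadrant \<Longrightarrow> partial_y u z = exp_sum \<gamma> m v (\<lambda>j n. c j n * q j n) z"
    unfolding p_def q_def by (rule partials_of_exp_sum[OF v c], erule u, assumption?)+
  have pq: "poly_bounded (v j) (p j)" "poly_bounded (v j) (q j)" for j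
    unfolding p_def q_def by (rule poly_bounded_par)+
  have cp: "poly_bounded (v j) (\<lambda>n. c j n * p j n)" "poly_bounded (v j) (\<lambda>n. c j n * q j n)" for j
    by (intro poly_bounded_mult c pq)+
  have pos: "0 < fst z + snd z" if "z \<in> quadrant" for z using that by (auto simp: quadrant_def)
  show "u differentiable_on quadrant" by (rule u1)
  show "partial_x u differentiable_on quadrant" by (rule partials_of_exp_sum(1)[OF v cp(1)], erule u1(2))
  show "partial_y u differentiable_on quadrant" by (rule partials_of_exp_sum(1)[OF v cp(2)], erule u1(3))
  define c1 where "c1 j n = 1 * (c j n * p j n) + (-1) * (c j n * q j n)" for j n
  have c1: "poly_bounded (v j) (c1 j)" for j
    unfolding c1_def[abs_def] by (intro poly_bounded_add poly_bounded_mult poly_bounded_const c pq)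
  have d1: "partial_diff u z = exp_sum \<gamma> m v c1 z" if "z \<in> quadrant" for z
    using exp_sum_linear[of v "\<lambda>j n. c j n * p j n" "\<lambda>j n. c j n * q j n" z 1 \<gamma> m "-1"] v cp pos[OF that] u1(2,3)[OF that]
    by (simp add: partial_diff_def c1_def[abs_def])
  have u2: "\<And>z. z \<in> quadrant \<Longrightarrow> partial_x (partial_diff u) z = exp_sum \<gamma> m v (\<lambda>j n. c1 j n * p j n) z"
    "\<And>z. z \<in> quadrant \<Longrightarrow> partial_y (partial_diff u) z = exp_sum \<gamma> m v (\<lambda>j n. c1 j n * q j n) z"
    unfolding p_def q_def by (rule partials_of_exp_sum[OF v c1], erule d1, assumption?)+
  have c1p: "poly_bounded (v j) (\<lambda>n. c1 j n * p j n)" "poly_bounded (v j) (\<lambda>n. c1 j n * q j n)" for j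
    by (intro poly_bounded_mult c1 pq)+
  fix z assume z: "z \<in> quadrant"
  let ?A = "exp_sum \<gamma> m v (\<lambda>j n. (1/2) * (c1 j n * p j n) + (-1/2) * (c1 j n * q j n)) z"
  let ?B = "exp_sum \<gamma> m v (\<lambda>j n. (1 - \<gamma>) * (c j n * p j n) + \<gamma> * (c j n * q j n)) z"
  have A: "partial_diff (partial_diff u) z / 2 = ?A"
    using u2[OF z] exp_sum_linear[of v "\<lambda>j n. c1 j n * p j n" "\<lambda>j n. c1 j n * q j n" z "1/2" \<gamma> m "-1/2"] v c1p pos[OF z]
    by (simp add: partial_diff_def[of "partial_diff u"])
  have B: "(1 - \<gamma>) * partial_x u z + \<gamma> * partial_y u z = ?B"
    using u1(2,3)[OF z] exp_sum_linear[of v "\<lambda>j n. c j n * p j n" "\<lambda>j n. c j n * q j n" z "1-\<gamma>" \<gamma> m "\<gamma>"] v cp pos[OF z]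
    by simp
  have "generator \<gamma> u z = 1 * ?A + 1 * ?B" unfolding generator_def by (simp only: A B add.assoc mult_1)
  also have "\<dots> = exp_sum \<gamma> m v (\<lambda>j n. 1 * ((1/2) * (c1 j n * p j n) + (-1/2) * (c1 j n * q j n))
      + 1 * ((1 - \<gamma>) * (c j n * p j n) + \<gamma> * (c j n * q j n))) z"
    by (rule exp_sum_linear)
       (intro v pos z poly_bounded_add poly_bounded_mult poly_bounded_const c pq c1)+
  also have "\<dots> = exp_sum \<gamma> m v (\<lambda>j n. 0) z"
  proof -
    have "1 * ((1/2) * (c1 j n * p j n) + (-1/2) * (c1 j n * q j n))
      + 1 * ((1 - \<gamma>) * (c j n * p j n) + \<gamma> * (c j n * q j n)) = c j n * kernel \<gamma> (p j n) (q j n)" for j n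
      unfolding c1_def kernel_def by (simp add: power2_eq_square field_simps)
    then show ?thesis by (simp only: p_def q_def kernel_par mult_zero_right)
  qed
  also have "\<dots> = 0" by (simp add: exp_sum_def exp_series_def)
  finally show "generator \<gamma> u z = 0" .
qed

section \<open>A minimum principle for the backward heat equation\<close>

text \<open>The derivative vanishes at the minimum, and a negative second derivative would make the point a
  strict local maximum.\<close>

lemma second_derivative_at_min_nonneg:
  fixes f f' :: "real \<Rightarrow> real"
  assumes r: "0 < r"
    and min: "\<And>y. \<bar>y - x\<bar> < r \<Longrightarrow> f x \<le> f y"
    and f': "\<And>y. \<bar>y - x\<bar> < r \<Longrightarrow> (f has_real_derivative f' y) (at y)"
    and f'': "(f' has_real_derivative d) (at x)"
  shows "0 \<le> d"
proof (rule ccontr)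
  assume "\<not> 0 \<le> d"
  then obtain e where e: "0 < e" "\<And>h. 0 < h \<Longrightarrow> h < e \<Longrightarrow> f' (x + h) < f' x"
    using DERIV_neg_dec_right[OF f''] by auto
  have zero: "f' x = 0"
    by (rule DERIV_local_min[OF f' r]) (use r min in \<open>auto simp: abs_minus_commute\<close>)
  define h where "h = min e r / 2"
  have h: "0 < h" "h < e" "h < r" using e r by (auto simp: h_def)
  obtain w where w: "x < w" "w < x + h" "f (x + h) - f x = (x + h - x) * f' w"
    using MVT2[of x "x + h" f f'] f' h by force
  have "f' (x + (w - x)) < f' x" using w h by (intro e) auto
  then have "f' w < 0" using zero by simp
  then have "f (x + h) < f x" using w h mult_pos_neg[of h "f' w"] by simp
  then show False using min[of "x + h"] h by simp
qed

text \<open>The equation runs backwards in \<open>s\<close>: the values at the upper end \<open>s2\<close>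
  control those at smaller \<open>s\<close>. Adding \<open>e * (s2 - s)\<close> makes the
  inequality strict, so a negative minimum can lie neither in the interior nor on the lower
  edge.\<close>

lemma backward_heat_minimum_principle:
  fixes f fs fy fyy :: "real \<Rightarrow> real \<Rightarrow> real"
  assumes s: "0 < s1" "s1 \<le> s2"
    and cont: "continuous_on {(s, y). s1 \<le> s \<and> s \<le> s2 \<and> 0 \<le> y \<and> y \<le> s} (\<lambda>(s, y). f s y)"
    and fs: "\<And>s y. s1 \<le> s \<Longrightarrow> s < s2 \<Longrightarrow> 0 < y \<Longrightarrow> y < s \<Longrightarrow> ((\<lambda>s. f s y) has_real_derivative fs s y) (at s)"
    and fy: "\<And>s y. s1 \<le> s \<Longrightarrow> s < s2 \<Longrightarrow> 0 < y \<Longrightarrow> y < s \<Longrightarrow> (f s has_real_derivative fy s y) (at y)"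
    and fyy: "\<And>s y. s1 \<le> s \<Longrightarrow> s < s2 \<Longrightarrow> 0 < y \<Longrightarrow> y < s \<Longrightarrow> (fy s has_real_derivative fyy s y) (at y)"
    and heat: "\<And>s y. s1 \<le> s \<Longrightarrow> s < s2 \<Longrightarrow> 0 < y \<Longrightarrow> y < s \<Longrightarrow> fs s y + fyy s y / 2 = 0"
    and sides: "\<And>s. s1 \<le> s \<Longrightarrow> s \<le> s2 \<Longrightarrow> 0 \<le> f s 0 \<and> 0 \<le> f s s"
    and top: "\<And>y. 0 \<le> y \<Longrightarrow> y \<le> s2 \<Longrightarrow> 0 \<le> f s2 y"
    and point: "s1 \<le> s" "s \<le> s2" "0 \<le> y" "y \<le> s"
  shows "0 \<le> f s y"
proof -
  define K where "K = {(s, y). s1 \<le> s \<and> s \<le> s2 \<and> 0 \<le> y \<and> y \<le> s}"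
  have "closed K"
    unfolding K_def case_prod_unfold by (intro closed_Collect_conj closed_Collect_le continuous_intros)
  moreover have "K \<subseteq> {s1..s2} \<times> {0..s2}" by (auto simp: K_def)
  then have "bounded K" by (rule bounded_subset[rotated]) (intro bounded_Times bounded_closed_interval)
  ultimately have "compact K" by (simp add: compact_eq_bounded_closed)
  have le: "- (e * (s2 - s)) \<le> f s y" if e: "0 < e" for e
  proof -
    \<comment> \<open>The perturbation turns the equation into a strict inequality.\<close>
    define g where "g = (\<lambda>(s, y). f s y + e * (s2 - s))"
    have "continuous_on K g"
      unfolding g_def case_prod_unfold using cont
      by (intro continuous_intros) (auto simp: K_def case_prod_unfold)
    moreover have "K \<noteq> {}" using point by (auto simp: K_def)
    ultimately obtain w where w: "w \<in> K" "\<And>w'. w' \<in> K \<Longrightarrow> g w \<le> g w'"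
      using continuous_attains_inf[OF \<open>compact K\<close>, of g] by blast
    obtain a b where "w = (a, b)" by (cases w)
    with w have ab: "(a, b) \<in> K" "\<And>w. w \<in> K \<Longrightarrow> g (a, b) \<le> g w" by auto
    have "0 \<le> g (a, b)"
    proof (cases "b = 0 \<or> b = a \<or> a = s2")
      case True
      have "0 \<le> e * (s2 - a)" using e ab by (auto simp: K_def)
      moreover have "0 \<le> f a b" using True ab(1) sides[of a] top[of b] by (auto simp: K_def)
      ultimately show ?thesis by (simp add: g_def)
    next
      case False
      then have ins: "s1 \<le> a" "a < s2" "0 < b" "b < a" using ab(1) by (auto simp: K_def)
      have "0 \<le> fyy a b"
      proof (rule second_derivative_at_min_nonneg)
        show "0 < min b (a - b)" using ins by auto
        show "f a b \<le> f a y" if "\<bar>y - b\<bar> < min b (a - b)" for y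
        proof -
          have "0 \<le> y \<and> y \<le> a" using that unfolding min_less_iff_conj abs_less_iff by linarith
          then show ?thesis using ab(2)[of "(a, y)"] ins by (auto simp: K_def g_def)
        qed
        show "(f a has_real_derivative fy a y) (at y)" if "\<bar>y - b\<bar> < min b (a - b)" for y
          using that ins by (intro fy) auto
        show "(fy a has_real_derivative fyy a b) (at b)" using ins by (intro fyy)
      qed
      then have neg: "fs a b - e < 0" using heat[OF ins] e by linarith
      have "((\<lambda>s. f s b + e * (s2 - s)) has_real_derivative fs a b - e) (at a)"
        using fs[OF ins] by (auto intro!: derivative_eq_intros)
      from DERIV_neg_dec_right[OF this neg] obtain d where d: "0 < d"
        "\<And>h. 0 < h \<Longrightarrow> h < d \<Longrightarrow> f (a + h) b + e * (s2 - (a + h)) < f a b + e * (s2 - a)" by blast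
      define h where "h = min d (s2 - a) / 2"
      have h: "0 < h" "h < d" "h < s2 - a" using d(1) ins by (auto simp: h_def)
      have "g (a, b) \<le> g (a + h, b)" using ins h by (intro ab(2)) (auto simp: K_def)
      then show ?thesis using d(2)[OF h(1,2)] by (simp add: g_def)
    qed
    also have "g (a, b) \<le> g (s, y)" using point by (intro ab(2)) (auto simp: K_def)
    finally show ?thesis by (simp add: g_def)
  qed
  show ?thesis
  proof (rule ccontr)
    assume neg: "\<not> 0 \<le> f s y"
    show False
    proof (cases "s = s2")
      case True then show False using neg top[of y] point by simp
    next
      case False
      then have "0 < s2 - s" using point by simp
      then have "0 < - f s y / (2 * (s2 - s))" using neg by (intro divide_pos_pos) auto
      from le[OF this] have "- (- f s y / (2 * (s2 - s)) * (s2 - s)) \<le> f s y" .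
      moreover have "- (- c / (2 * x) * x) = c / 2" if "0 < x" for c x :: real using that by simp
      ultimately have "f s y / 2 \<le> f s y" using \<open>0 < s2 - s\<close> by metis
      then show False using neg by linarith
    qed
  qed
qed

definition even_nodes :: "nat \<Rightarrow> nat \<Rightarrow> real" where
  "even_nodes j n = (if j = 0 then 2 * real n else - 2 - 2 * real n)"

text \<open>The sum over even integers \<open>v\<close> of \<open>v ^ k * exp (v * a - v\<^sup>2 * s /
  2)\<close>: a Jacobi theta series and its derivatives in \<open>a\<close>, obtained from
  \<open>exp_sum\<close> by specialisation. Each term solves the backward heat equation.\<close>

definition theta_moment :: "nat \<Rightarrow> real \<Rightarrow> real \<Rightarrow> real" where
  "theta_moment k s a = exp_sum 0 2 even_nodes (\<lambda>j n. even_nodes j n ^ k) (s - a, a)"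

lemma spread_even_nodes: "spread (even_nodes j)"
  by (auto simp: spread_def even_nodes_def)

lemma poly_bounded_power: "poly_bounded v (\<lambda>n. v n ^ k)"
  by (induction k) (auto intro!: poly_bounded_const poly_bounded_mult poly_bounded_id)

lemma theta_moment_has_derivative:
  assumes "0 < s"
  shows "((\<lambda>(s, a). theta_moment k s a) has_derivative
    (\<lambda>h. - (theta_moment (k + 2) s a / 2) * fst h + theta_moment (k + 1) s a * snd h)) (at (s, a))"
proof -
  have 1: "((\<lambda>w :: real \<times> real. (fst w - snd w, snd w)) has_derivative (\<lambda>h. (fst h - snd h, snd h))) (at (s, a))"
    by (auto intro!: derivative_eq_intros)
  have 2: "(exp_sum 0 2 even_nodes (\<lambda>j n. even_nodes j n ^ k) has_derivative
    (\<lambda>h. exp_sum 0 2 even_nodes (\<lambda>j n. even_nodes j n ^ k * par_p 0 (even_nodes j n)) (s - a, a) * fst h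
       + exp_sum 0 2 even_nodes (\<lambda>j n. even_nodes j n ^ k * par_q 0 (even_nodes j n)) (s - a, a) * snd h)) (at (s - a, a))"
    using assms by (intro exp_sum_has_derivative spread_even_nodes poly_bounded_power) simp
  have lin: "A * theta_moment (k + 2) s a + B * theta_moment (k + 1) s a
    = exp_sum 0 2 even_nodes (\<lambda>j n. A * even_nodes j n ^ (k + 2) + B * even_nodes j n ^ (k + 1)) (s - a, a)" for A B
    unfolding theta_moment_def using assms by (intro exp_sum_linear spread_even_nodes poly_bounded_power) simp
  have pp: "v ^ k * par_p 0 v = (- 1/2) * v ^ (k + 2) + 0 * v ^ (k + 1)"
    "v ^ k * par_q 0 v = (- 1/2) * v ^ (k + 2) + 1 * v ^ (k + 1)" for v
    by (simp_all add: par_p_def par_q_def power2_eq_square field_simps)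
  have e: "exp_sum 0 2 even_nodes (\<lambda>j n. even_nodes j n ^ k * par_p 0 (even_nodes j n)) (s - a, a)
      = - (theta_moment (k + 2) s a / 2)"
    "exp_sum 0 2 even_nodes (\<lambda>j n. even_nodes j n ^ k * par_q 0 (even_nodes j n)) (s - a, a)
      = - (theta_moment (k + 2) s a / 2) + theta_moment (k + 1) s a"
    unfolding pp lin[symmetric] by simp_all
  let ?F = "exp_sum 0 2 even_nodes (\<lambda>j n. even_nodes j n ^ k)"
  have "((\<lambda>w. ?F (fst w - snd w, snd w)) has_derivative
     (\<lambda>h. - (theta_moment (k + 2) s a / 2) * (fst h - snd h) + (- (theta_moment (k + 2) s a / 2) + theta_moment (k + 1) s a) * snd h)) (at (s, a))"
    using has_derivative_compose[OF 1, of ?F "\<lambda>h. - (theta_moment (k + 2) s a / 2) * fst h + (- (theta_moment (k + 2) s a / 2) + theta_moment (k + 1) s a) * snd h"] 2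
    unfolding e by (simp only: fst_conv snd_conv)
  then have "((\<lambda>(s, a). theta_moment k s a) has_derivative
     (\<lambda>h. - (theta_moment (k + 2) s a / 2) * (fst h - snd h) + (- (theta_moment (k + 2) s a / 2) + theta_moment (k + 1) s a) * snd h)) (at (s, a))"
    by (simp only: theta_moment_def case_prod_unfold)
  then show ?thesis by (rule has_derivative_eq_rhs) (simp add: fun_eq_iff field_simps)
qed

section \<open>Monotonicity of periodic Gaussian sums\<close>

lemma theta_moment_partial:
  assumes "0 < s"
  shows "((\<lambda>s. theta_moment k s a) has_real_derivative - (theta_moment (k + 2) s a / 2)) (at s)"
    "(theta_moment k s has_real_derivative theta_moment (k + 1) s a) (at a)"
  using partial_of_has_derivative(3,4)[OF theta_moment_has_derivative[OF assms, of k a]] by simp_all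

text \<open>Up to a negative factor, the derivative in \<open>a\<close> of \<open>periodic_gauss\<close>.
  Its terms \<open>(a - s * v) * exp (v * a - v\<^sup>2 * s / 2)\<close> are derivatives in
  \<open>v\<close> of solutions of the backward heat equation, hence solutions themselves.\<close>

definition theta_slope :: "real \<Rightarrow> real \<Rightarrow> real" where
  "theta_slope s a = a * theta_moment 0 s a - s * theta_moment 1 s a"

text \<open>The contribution of the even integer \<open>2 * k\<close> to \<open>theta_slope\<close>.\<close>

definition slope_term :: "real \<Rightarrow> real \<Rightarrow> real \<Rightarrow> real" where
  "slope_term s a k = (a - 2 * s * k) * exp (2 * k * a - 2 * s * k\<^sup>2)"

lemma theta_slope_series:
  assumes "0 < s"
  shows "theta_slope s a = (\<Sum>n. slope_term s a (real n)) + (\<Sum>n. slope_term s a (- 1 - real n))"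
    "summable (\<lambda>n. slope_term s a (real n))" "summable (\<lambda>n. slope_term s a (- 1 - real n))"
proof -
  have sum: "summable (\<lambda>n. even_nodes j n ^ k * par_exp 0 (even_nodes j n) (s - a, a))" for j k
    using assms by (intro exp_series_summable spread_even_nodes poly_bounded_power) simp
  have trm: "slope_term s a (even_nodes j n / 2)
    = a * (even_nodes j n ^ 0 * par_exp 0 (even_nodes j n) (s - a, a)) - s * (even_nodes j n ^ 1 * par_exp 0 (even_nodes j n) (s - a, a))" for j n
    by (simp add: slope_term_def par_exp_alt power2_eq_square field_simps)
  have sm: "summable (\<lambda>n. slope_term s a (even_nodes j n / 2))" for j
    unfolding trm by (intro summable_diff summable_mult sum)
  have su: "(\<Sum>n. slope_term s a (even_nodes j n / 2))
    = a * (\<Sum>n. even_nodes j n ^ 0 * par_exp 0 (even_nodes j n) (s - a, a)) - s * (\<Sum>n. even_nodes j n ^ 1 * par_exp 0 (even_nodes j n) (s - a, a))" for j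
    unfolding trm by (subst suminf_diff[symmetric], (intro summable_mult sum)+, subst (1 2) suminf_mult, (intro sum refl)+)
  have e: "even_nodes 0 n / 2 = real n" "even_nodes 1 n / 2 = - 1 - real n" for n
    by (auto simp: even_nodes_def)
  show "summable (\<lambda>n. slope_term s a (real n))" "summable (\<lambda>n. slope_term s a (- 1 - real n))"
    using sm[of 0] sm[of 1] unfolding e by auto
  show "theta_slope s a = (\<Sum>n. slope_term s a (real n)) + (\<Sum>n. slope_term s a (- 1 - real n))"
    using su[of 0] su[of 1] unfolding e
    by (simp only: theta_slope_def theta_moment_def exp_sum_def exp_series_def numeral_2_eq_2 sum.lessThan_Suc)
       (simp add: algebra_simps)
qed

text \<open>The terms cancel in pairs: \<open>k\<close> against \<open>- k\<close> at \<open>a = 0\<close>,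
  and \<open>k\<close> against \<open>1 - k\<close> at \<open>a = s\<close>.\<close>

lemma theta_slope_sides:
  assumes "0 < s"
  shows "theta_slope s 0 = 0" "theta_slope s s = 0"
proof -
  note ser = theta_slope_series[OF assms]
  have "slope_term s 0 (- 1 - real n) = - slope_term s 0 (real (Suc n))" for n
    by (simp add: slope_term_def power2_eq_square algebra_simps)
  then have "(\<Sum>n. slope_term s 0 (- 1 - real n)) = - (\<Sum>n. slope_term s 0 (real (Suc n)))"
    using suminf_minus[of "\<lambda>n. slope_term s 0 (real (Suc n))"] ser(2)[of 0]
    by (simp add: summable_Suc_iff[of "\<lambda>n. slope_term s 0 (real n)"] del: of_nat_Suc)
  then show "theta_slope s 0 = 0"
    using ser(1)[of 0] suminf_split_head[OF ser(2)[of 0]] by (simp add: slope_term_def)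
  have "slope_term s s (- 1 - real n) = - slope_term s s (real (Suc (Suc n)))" for n
    unfolding slope_term_def by (simp add: power2_eq_square algebra_simps)
  moreover have "summable (\<lambda>n. slope_term s s (real (Suc n)))" "summable (\<lambda>n. slope_term s s (real (Suc (Suc n))))"
    using ser(2)[of s] summable_Suc_iff[of "\<lambda>n. slope_term s s (real n)"]
      summable_Suc_iff[of "\<lambda>n. slope_term s s (real (Suc n))"] by auto
  ultimately have "(\<Sum>n. slope_term s s (- 1 - real n)) = - (\<Sum>n. slope_term s s (real (Suc (Suc n))))"
    using suminf_minus[of "\<lambda>n. slope_term s s (real (Suc (Suc n)))"] by simp
  then show "theta_slope s s = 0"
    using ser(1)[of s] suminf_split_head[OF ser(2)[of s]]
      suminf_split_head[OF \<open>summable (\<lambda>n. slope_term s s (real (Suc n)))\<close>]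
    by (simp add: slope_term_def)
qed

lemma sinh_le: "0 \<le> x \<Longrightarrow> exp x - exp (- x) \<le> 2 * x * exp (x :: real)"
proof -
  assume "0 \<le> x"
  have "1 - 2 * x \<le> exp (- (2 * x))" using exp_ge_add_one_self[of "- (2 * x)"] by simp
  then have "exp x * (1 - 2 * x) \<le> exp x * exp (- (2 * x))" by (intro mult_left_mono) auto
  also have "\<dots> = exp (- x)" by (simp add: mult_exp_exp)
  finally show ?thesis by (simp add: algebra_simps)
qed

text \<open>The term \<open>k = 0\<close> equals \<open>a\<close>. Pairing \<open>k\<close> with \<open>-
  k\<close> gives at least \<open>- 8 * a * r ^ k\<close> with \<open>r = exp (- s / 2)\<close>,
  so the sum of the pairs is at least \<open>- a / 2\<close> once \<open>s\<close> is large.\<close>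

lemma theta_slope_ge_near_0:
  assumes s: "32 \<le> s" and a: "0 \<le> a" "a \<le> s / 2"
  shows "a / 2 \<le> theta_slope s a"
proof -
  have s0: "0 < s" using s by simp
  note ser = theta_slope_series[OF s0, of a]
  define r where "r = exp (- s / 2)"
  have "17 \<le> exp (s / 2)" using exp_ge_add_one_self[of "s / 2"] s by linarith
  then have r: "0 < r" "r \<le> 1 / 17" by (auto simp: r_def exp_minus field_simps)
  have pair: "- (8 * a) * r ^ Suc n \<le> slope_term s a (real (Suc n)) + slope_term s a (- 1 - real n)" for n
  proof -
    define k where "k = real (Suc n)"
    have k: "1 \<le> k" by (simp add: k_def)
    have ka: "0 \<le> 2 * k * a" using k a by simp
    have "2 * k * a \<le> s * k" using a k by (simp add: field_simps)
    also have "s * k * 1 \<le> s * k * k" using k s0 by (intro mult_left_mono) auto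
    finally have ka2: "2 * k * a \<le> s * k\<^sup>2" by (simp add: power2_eq_square)
    let ?E = "exp (- (2 * s * k\<^sup>2))"
    have "slope_term s a k + slope_term s a (- k)
      = ?E * (a * (exp (2 * k * a) + exp (- (2 * k * a)))) - ?E * (2 * s * k * (exp (2 * k * a) - exp (- (2 * k * a))))"
      unfolding slope_term_def by (simp add: exp_diff exp_minus field_simps)
    moreover have "?E * (2 * s * k * (exp (2 * k * a) - exp (- (2 * k * a)))) \<le> ?E * (2 * s * k * (2 * (2 * k * a) * exp (2 * k * a)))"
      using sinh_le[OF ka] s0 k by (intro mult_left_mono) auto
    moreover have "0 \<le> ?E * (a * (exp (2 * k * a) + exp (- (2 * k * a))))" using a by simp
    ultimately have "- (?E * (2 * s * k * (2 * (2 * k * a) * exp (2 * k * a)))) \<le> slope_term s a k + slope_term s a (- k)"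
      by linarith
    moreover have "?E * (2 * s * k * (2 * (2 * k * a) * exp (2 * k * a))) \<le> 8 * a * r ^ Suc n"
    proof -
      have "?E * exp (2 * k * a) \<le> exp (- (s * k\<^sup>2))" using ka2 by (simp add: mult_exp_exp)
      then have "8 * a * (s * k\<^sup>2) * (?E * exp (2 * k * a)) \<le> 8 * a * (s * k\<^sup>2) * exp (- (s * k\<^sup>2))"
        using a s0 by (intro mult_left_mono) auto
      also have "\<dots> = 8 * a * ((s * k\<^sup>2) * exp (- (s * k\<^sup>2)))" by simp
      also have "\<dots> \<le> 8 * a * exp (- (s * k / 2))"
      proof (rule mult_left_mono)
        define u where "u = s * k\<^sup>2"
        have u: "0 \<le> u" "s * k \<le> u" using \<open>s * k * 1 \<le> s * k * k\<close> s0 by (auto simp: u_def power2_eq_square)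
        have "u \<le> 1 + u / 2 + (u / 2)\<^sup>2 / 2"
          using zero_le_power2[of "u / 2 - 1"] by (simp add: power2_eq_square field_simps)
        also have "\<dots> \<le> exp (u / 2)" using exp_lower_Taylor_quadratic[of "u / 2"] u by simp
        finally have "u * exp (- u) \<le> exp (u / 2) * exp (- u)" by (intro mult_right_mono) auto
        also have "\<dots> = exp (- (u / 2))" by (simp add: mult_exp_exp)
        also have "\<dots> \<le> exp (- (s * k / 2))" using u by simp
        finally show "s * k\<^sup>2 * exp (- (s * k\<^sup>2)) \<le> exp (- (s * k / 2))" by (simp add: u_def)
      qed (use a in simp)
      also have "exp (- (s * k / 2)) = r ^ Suc n"
        unfolding r_def k_def exp_of_nat_mult[symmetric] by (simp add: field_simps)
      finally show ?thesis by (simp add: power2_eq_square algebra_simps)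
    qed
    ultimately have "- (8 * a * r ^ Suc n) \<le> slope_term s a k + slope_term s a (- k)" by linarith
    then show ?thesis by (simp add: k_def algebra_simps)
  qed
  have sr: "summable (\<lambda>n. - (8 * a) * r ^ Suc n)"
    using r by (intro summable_mult) (simp add: summable_Suc_iff[of "\<lambda>n. r ^ n"] summable_geometric del: power_Suc)
  have ss: "summable (\<lambda>n. slope_term s a (real (Suc n)))"
    using ser(2) summable_Suc_iff[of "\<lambda>n. slope_term s a (real n)"] by simp
  have "(\<Sum>n. - (8 * a) * r ^ Suc n) = - (8 * a) * (r / (1 - r))"
  proof -
    have "(\<Sum>n. r ^ Suc n) = r * (\<Sum>n. r ^ n)" using r by (simp add: suminf_mult summable_geometric)
    also have "\<dots> = r / (1 - r)" using r by (simp add: suminf_geometric)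
    finally show ?thesis using r
      by (subst suminf_mult) (auto simp: summable_Suc_iff[of "\<lambda>n. r ^ n"] summable_geometric simp del: power_Suc)
  qed
  moreover have "8 * (r / (1 - r)) \<le> 1 / 2" using r by (simp add: field_simps)
  then have "- (8 * a) * (r / (1 - r)) \<ge> - (a / 2)" using mult_left_mono[of "8 * (r / (1 - r))" "1/2" a] a by simp
  moreover have "(\<Sum>n. - (8 * a) * r ^ Suc n) \<le> (\<Sum>n. slope_term s a (real (Suc n)) + slope_term s a (- 1 - real n))"
    by (intro suminf_le pair sr summable_add ss ser(3))
  moreover have "theta_slope s a = slope_term s a 0 + (\<Sum>n. slope_term s a (real (Suc n)) + slope_term s a (- 1 - real n))"
    using suminf_split_head[OF ser(2)] suminf_add[OF ss ser(3)] ser(1) by simp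
  moreover have "slope_term s a 0 = a" by (simp add: slope_term_def)
  ultimately show ?thesis by linarith
qed

text \<open>The same estimate at the other side of the triangle, where \<open>- k\<close> is paired with
  \<open>k + 1\<close> and all terms are compared with the distance \<open>s - a\<close>.\<close>

lemma theta_slope_ge_near_s:
  assumes s: "32 \<le> s" and a: "s / 2 \<le> a" "a \<le> s"
  shows "(s - a) / 2 \<le> theta_slope s a"
proof -
  have s0: "0 < s" using s by simp
  note ser = theta_slope_series[OF s0, of a]
  have ss: "summable (\<lambda>n. slope_term s a (real (Suc n)))"
    using ser(2) summable_Suc_iff[of "\<lambda>n. slope_term s a (real n)"] by simp
  have sn: "summable (\<lambda>n. slope_term s a (- real n))"
    using ser(3) summable_Suc_iff[of "\<lambda>n. slope_term s a (- real n)"] by (simp add: algebra_simps)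
  have eq: "theta_slope s a = (\<Sum>n. slope_term s a (- real n) + slope_term s a (real (Suc n)))"
    using suminf_split_head[OF ser(2)] suminf_split_head[OF sn] suminf_add[OF sn ss] ser(1)
    by (simp add: algebra_simps)
  have pair0: "(s - a) / 2 \<le> slope_term s a (- real 0) + slope_term s a (real (Suc 0))"
  proof -
    define d where "d = s - a"
    have d: "0 \<le> d" "d \<le> s / 2" "a = s - d" using a by (auto simp: d_def)
    have "exp (- (2 * d)) \<le> 1 / (1 + 2 * d)"
    proof -
      have "1 + 2 * d \<le> exp (2 * d)" by (rule exp_ge_add_one_self)
      then show ?thesis using d by (simp add: exp_minus field_simps)
    qed
    then have le: "(s + d) * exp (- (2 * d)) \<le> (s + d) * (1 / (1 + 2 * d))" using d s0 by (intro mult_left_mono) auto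
    have "d / 2 \<le> (s - d) - (s + d) * (1 / (1 + 2 * d))"
    proof -
      have "(s + d) + d / 2 * (1 + 2 * d) \<le> (s - d) * (1 + 2 * d)"
      proof -
        have "0 \<le> d * (2 * s - 5 / 2 - 3 * d)" using d s by (intro mult_nonneg_nonneg) auto
        then show ?thesis by (simp add: algebra_simps)
      qed
      then have "((s + d) + d / 2 * (1 + 2 * d)) / (1 + 2 * d) \<le> s - d"
        using d by (subst pos_divide_le_eq) auto
      moreover have "((s + d) + d / 2 * x) / x = (s + d) * (1 / x) + d / 2" if "0 < x" for x
        using that by (simp add: add_divide_distrib)
      ultimately show ?thesis using d by (smt (verit))
    qed
    also have "\<dots> \<le> (s - d) - (s + d) * exp (- (2 * d))" by (rule diff_left_mono[OF le])
    also have "(s - d) - (s + d) * exp (- (2 * d)) = slope_term s a (- real 0) + slope_term s a (real (Suc 0))"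
      by (simp add: slope_term_def d(3) algebra_simps)
    finally show ?thesis by (simp add: d_def)
  qed
  have pairs: "0 \<le> slope_term s a (- real n) + slope_term s a (real (Suc n))" if "n \<noteq> 0" for n
  proof -
    have n: "1 \<le> real n" using that by simp
    define u1 u2 where "u1 = a + 2 * s * real n" and "u2 = 2 * s * (real n + 1) - a"
    have u: "2 * s \<le> u1" "u1 \<le> u2"
    proof -
      have "2 * s * 1 \<le> 2 * s * real n" using n s0 by (intro mult_left_mono) auto
      then show "2 * s \<le> u1" unfolding u1_def using a s0 by linarith
      show "u1 \<le> u2" unfolding u1_def u2_def using a by (simp add: algebra_simps)
    qed
    let ?e = "\<lambda>u. exp (a\<^sup>2 / (2 * s) - u\<^sup>2 / (2 * s))"
    have t1: "slope_term s a (- real n) = u1 * ?e u1" and t2: "slope_term s a (real (Suc n)) = - (u2 * ?e u2)"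
    proof -
      have "a\<^sup>2 / (2 * s) - u1\<^sup>2 / (2 * s) = 2 * (- real n) * a - 2 * s * (- real n)\<^sup>2"
        "a\<^sup>2 / (2 * s) - u2\<^sup>2 / (2 * s) = 2 * real (Suc n) * a - 2 * s * (real (Suc n))\<^sup>2"
        using s0 by (simp_all add: u1_def u2_def power2_eq_square field_simps)
      then show "slope_term s a (- real n) = u1 * ?e u1" "slope_term s a (real (Suc n)) = - (u2 * ?e u2)"
        by (simp_all only: slope_term_def) (simp_all add: u1_def u2_def algebra_simps)
    qed
    have "u2 / u1 \<le> 1 + (u2\<^sup>2 - u1\<^sup>2) / (2 * s)"
    proof -
      have "(u2 - u1) * (2 * s) \<le> (u2 - u1) * ((u2 + u1) * u1)"
      proof (rule mult_left_mono)
        have "1 * (2 * s) \<le> (u2 + u1) * u1" using u s by (intro mult_mono) auto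
        then show "2 * s \<le> (u2 + u1) * u1" by simp
      qed (use u in simp)
      then have "(u2 - u1) / u1 \<le> (u2 - u1) * (u2 + u1) / (2 * s)"
        using u s0 by (simp add: field_simps)
      then show ?thesis using u s0 by (simp add: power2_eq_square diff_divide_distrib algebra_simps)
    qed
    also have "\<dots> \<le> exp ((u2\<^sup>2 - u1\<^sup>2) / (2 * s))" by (rule exp_ge_add_one_self)
    finally have "u2 \<le> u1 * exp ((u2\<^sup>2 - u1\<^sup>2) / (2 * s))" using u s0 by (simp add: field_simps)
    then have "u2 * ?e u2 \<le> u1 * exp ((u2\<^sup>2 - u1\<^sup>2) / (2 * s)) * ?e u2" by (intro mult_right_mono) auto
    also have "\<dots> = u1 * ?e u1" by (simp add: mult_exp_exp mult.assoc diff_divide_distrib)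
    finally show ?thesis unfolding t1 t2 by simp
  qed
  have "slope_term s a (- real 0) + slope_term s a (real (Suc 0)) \<le> theta_slope s a"
    unfolding eq using pairs sum_le_suminf[OF summable_add[OF sn ss], of "{0}"] by simp
  with pair0 show ?thesis by linarith
qed

text \<open>A positive solution of the backward heat equation on the triangle \<open>0 < a < s\<close> that
  vanishes on both sides: the first Dirichlet mode of an interval that widens linearly.\<close>

definition sine_barrier :: "real \<Rightarrow> real \<Rightarrow> real" where
  "sine_barrier s a = exp ((a\<^sup>2 - pi\<^sup>2) / (2 * s)) * sin (pi * a / s) / sqrt s"

lemma product_rule_identity:
  fixes E r w k S C i :: real
  shows "E * w / r * (w * S + k * C) + (i * S + C * k * w + k * (- S * k)) * (E / r)
    = E / r * ((w * w + i - k * k) * S + 2 * (k * w) * C)"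
  by (simp add: divide_inverse algebra_simps)

lemma sine_barrier_heat:
  assumes "0 < s"
  shows "((\<lambda>s. sine_barrier s a) has_real_derivative
      exp ((a\<^sup>2 - pi\<^sup>2) / (2 * s)) / sqrt s * ((- (a\<^sup>2 - pi\<^sup>2) / (2 * s\<^sup>2) - 1 / (2 * s)) * sin (pi * a / s) - pi * a / s\<^sup>2 * cos (pi * a / s))) (at s)"
    "((\<lambda>a. sine_barrier s a) has_real_derivative
      exp ((a\<^sup>2 - pi\<^sup>2) / (2 * s)) / sqrt s * (a / s * sin (pi * a / s) + pi / s * cos (pi * a / s))) (at a)"
    "((\<lambda>a. exp ((a\<^sup>2 - pi\<^sup>2) / (2 * s)) / sqrt s * (a / s * sin (pi * a / s) + pi / s * cos (pi * a / s))) has_real_derivative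
      exp ((a\<^sup>2 - pi\<^sup>2) / (2 * s)) / sqrt s * ((a\<^sup>2 / s\<^sup>2 + 1 / s - pi\<^sup>2 / s\<^sup>2) * sin (pi * a / s) + 2 * pi * a / s\<^sup>2 * cos (pi * a / s))) (at a)"
proof -
  have sq: "sqrt s * sqrt s = s" "sqrt s > 0" using assms by auto
  have d: "((\<lambda>s. 1 / sqrt s) has_real_derivative - 1 / (2 * s) / sqrt s) (at s)"
    by (rule derivative_eq_intros refl | use assms sq in \<open>simp add: field_simps\<close>)+
  have "((\<lambda>s. exp ((a\<^sup>2 - pi\<^sup>2) / (2 * s)) * sin (pi * a / s)) has_real_derivative
     exp ((a\<^sup>2 - pi\<^sup>2) / (2 * s)) * (- (a\<^sup>2 - pi\<^sup>2) / (2 * s\<^sup>2)) * sin (pi * a / s)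
     + exp ((a\<^sup>2 - pi\<^sup>2) / (2 * s)) * (cos (pi * a / s) * (- (pi * a) / s\<^sup>2))) (at s)"
    by (rule derivative_eq_intros refl | use assms in \<open>simp add: power2_eq_square field_simps\<close>)+
  from DERIV_mult[OF this d]
  show "((\<lambda>s. sine_barrier s a) has_real_derivative
      exp ((a\<^sup>2 - pi\<^sup>2) / (2 * s)) / sqrt s * ((- (a\<^sup>2 - pi\<^sup>2) / (2 * s\<^sup>2) - 1 / (2 * s)) * sin (pi * a / s) - pi * a / s\<^sup>2 * cos (pi * a / s))) (at s)"
    unfolding sine_barrier_def by (simp add: algebra_simps) 
  let ?E = "\<lambda>a. exp ((a\<^sup>2 - pi\<^sup>2) / (2 * s))" and ?S = "\<lambda>a. sin (pi * a / s)" and ?C = "\<lambda>a. cos (pi * a / s)"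
  have E: "(?E has_real_derivative ?E a * (a / s)) (at a)"
    by (rule derivative_eq_intros refl | use assms in simp)+
  have S: "(?S has_real_derivative ?C a * (pi / s)) (at a)"
    by (rule derivative_eq_intros refl | use assms in simp)+
  have C: "(?C has_real_derivative - ?S a * (pi / s)) (at a)"
    by (rule derivative_eq_intros refl | use assms in simp)+
  have id: "((\<lambda>a. a / s) has_real_derivative 1 / s) (at a)"
    by (rule derivative_eq_intros refl | use assms in simp)+
  show "((\<lambda>a. sine_barrier s a) has_real_derivative
      exp ((a\<^sup>2 - pi\<^sup>2) / (2 * s)) / sqrt s * (a / s * sin (pi * a / s) + pi / s * cos (pi * a / s))) (at a)"
    unfolding sine_barrier_def
    by (rule DERIV_cong[OF DERIV_cdivide[OF DERIV_mult[OF E S]]]) (simp add: add_divide_distrib distrib_left mult_ac)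
  have ss: "a\<^sup>2 / s\<^sup>2 = a / s * (a / s)" "pi\<^sup>2 / s\<^sup>2 = pi / s * (pi / s)" "2 * pi * a / s\<^sup>2 = 2 * (pi / s * (a / s))"
    by (simp_all add: power2_eq_square)
  show "((\<lambda>a. exp ((a\<^sup>2 - pi\<^sup>2) / (2 * s)) / sqrt s * (a / s * sin (pi * a / s) + pi / s * cos (pi * a / s))) has_real_derivative
      exp ((a\<^sup>2 - pi\<^sup>2) / (2 * s)) / sqrt s * ((a\<^sup>2 / s\<^sup>2 + 1 / s - pi\<^sup>2 / s\<^sup>2) * sin (pi * a / s) + 2 * pi * a / s\<^sup>2 * cos (pi * a / s))) (at a)"
    unfolding ss
    by (rule DERIV_cong[OF DERIV_mult[OF DERIV_cdivide[OF E] DERIV_add[OF DERIV_mult[OF id S] DERIV_cmult[OF C]]]])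
       (rule product_rule_identity)
qed

lemma theta_moment_continuous_on:
  assumes "\<And>w. w \<in> K \<Longrightarrow> 0 < fst w"
  shows "continuous_on K (\<lambda>(s, a). theta_moment k s a)"
proof (rule continuous_at_imp_continuous_on, rule ballI)
  fix w assume "w \<in> K"
  then show "isCont (\<lambda>(s, a). theta_moment k s a) w"
    using has_derivative_continuous[OF theta_moment_has_derivative[of "fst w" k "snd w"]] assms by simp
qed

lemma barrier_balance:
  fixes Q A A' B S C :: real
  assumes "A + A' / 2 = 0"
  shows "Q * (A * S - B * C) + Q * (A' * S + 2 * B * C) / 2 = 0"
proof -
  have "A' = - 2 * A" using assms by simp
  then show ?thesis by (simp add: field_simps)
qed

lemma slope_balance:
  fixes y s c P1 P2 T1 T2 T3 :: real
  assumes "P1 + P2 / 2 = 0"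
  shows "y * (- (T2 / 2)) - (T1 + s * (- (T3 / 2))) - c * P1 + (2 * T1 + y * T2 - s * T3 - c * P2) / 2 = 0"
proof -
  have "P2 = - 2 * P1" using assms by simp
  then show ?thesis by (simp add: field_simps)
qed

text \<open>The minimum principle applied to \<open>theta_slope\<close> minus a small multiple of
  \<open>sine_barrier\<close>. Both vanish on the sides of the triangle, and at a large time
  \<open>s2\<close> the lower bounds above dominate the barrier. The barrier makes the resulting
  inequality strict.\<close>

theorem theta_slope_pos:
  assumes a: "0 < a" "a < s"
  shows "0 < theta_slope s a"
proof -
  have s: "0 < s" using a by simp
  \<comment> \<open>A time at which the lower bounds for large \<open>s\<close> are available.\<close>
  define s2 where "s2 = max 32 s + 1"
  have s2: "32 \<le> s2" "s \<le> s2" "0 < s2" by (auto simp: s2_def)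
  define c where "c = 1 / (2 * (exp (s2 / 2) * pi))"
  have c: "0 < c" by (simp add: c_def)
  have barrier_top: "c * sine_barrier s2 y \<le> m / 2"
    if y: "0 \<le> y" "y \<le> s2" and m: "0 \<le> m" "sin (pi * y / s2) \<le> pi * m" for y m
  proof -
    have "y\<^sup>2 \<le> s2\<^sup>2" using y by (intro power_mono) auto
    then have "y\<^sup>2 - pi\<^sup>2 \<le> s2\<^sup>2" using zero_le_power2[of pi] by linarith
    then have "(y\<^sup>2 - pi\<^sup>2) / (2 * s2) \<le> s2\<^sup>2 / (2 * s2)" using s2 by (intro divide_right_mono) auto
    then have e: "exp ((y\<^sup>2 - pi\<^sup>2) / (2 * s2)) \<le> exp (s2 / 2)" using s2 by (simp add: power2_eq_square)
    have "0 \<le> pi * y / s2" "pi * y / s2 \<le> pi" using y s2 by (auto simp: field_simps)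
    then have sin: "0 \<le> sin (pi * y / s2)" by (rule sin_ge_zero)
    have "1 \<le> sqrt s2" using s2 by simp
    then have "sine_barrier s2 y \<le> exp ((y\<^sup>2 - pi\<^sup>2) / (2 * s2)) * sin (pi * y / s2) / 1"
      unfolding sine_barrier_def using sin by (intro divide_left_mono) auto
    also have "\<dots> \<le> exp (s2 / 2) * (pi * m)" using e m sin by (simp add: mult_mono)
    finally have "c * sine_barrier s2 y \<le> c * (exp (s2 / 2) * (pi * m))" using c by (intro mult_left_mono) auto
    then show ?thesis by (simp add: c_def)
  qed
  have "0 \<le> theta_slope s a - c * sine_barrier s a"
  proof (rule backward_heat_minimum_principle[where ?s1.0 = s and ?s2.0 = s2 and f="\<lambda>s a. theta_slope s a - c * sine_barrier s a"])
    let ?Q = "\<lambda>s y. exp ((y\<^sup>2 - pi\<^sup>2) / (2 * s)) / sqrt s"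
    let ?fs = "\<lambda>s y. y * (- (theta_moment 2 s y / 2)) - (theta_moment 1 s y + s * (- (theta_moment 3 s y / 2)))
       - c * (?Q s y * ((- (y\<^sup>2 - pi\<^sup>2) / (2 * s\<^sup>2) - 1 / (2 * s)) * sin (pi * y / s) - pi * y / s\<^sup>2 * cos (pi * y / s)))"
    let ?fy = "\<lambda>s y. theta_moment 0 s y + y * theta_moment 1 s y - s * theta_moment 2 s y
       - c * (?Q s y * (y / s * sin (pi * y / s) + pi / s * cos (pi * y / s)))"
    let ?fyy = "\<lambda>s y. 2 * theta_moment 1 s y + y * theta_moment 2 s y - s * theta_moment 3 s y
       - c * (?Q s y * ((y\<^sup>2 / s\<^sup>2 + 1 / s - pi\<^sup>2 / s\<^sup>2) * sin (pi * y / s) + 2 * pi * y / s\<^sup>2 * cos (pi * y / s)))"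
    fix s' y assume "s \<le> s'" "s' < s2" "0 < y" "y < s'"
    then have s': "0 < s'" using s by simp
    note d = theta_moment_partial[OF s', of 0 y] theta_moment_partial[OF s', of 1 y] theta_moment_partial[OF s', of 2 y]
    note b = sine_barrier_heat[OF s', of y]
    show "((\<lambda>s. theta_slope s y - c * sine_barrier s y) has_real_derivative ?fs s' y) (at s')"
      unfolding theta_slope_def
      by (rule DERIV_cong[OF DERIV_diff[OF DERIV_diff[OF DERIV_cmult[OF d(1)] DERIV_mult[OF DERIV_ident d(3)]] DERIV_cmult[OF b(1)]]])
         (simp add: numeral_2_eq_2 numeral_3_eq_3)
    show "((\<lambda>y. theta_slope s' y - c * sine_barrier s' y) has_real_derivative ?fy s' y) (at y)"
      unfolding theta_slope_def
      by (rule DERIV_cong[OF DERIV_diff[OF DERIV_diff[OF DERIV_mult[OF DERIV_ident d(2)] DERIV_cmult[OF d(4)]] DERIV_cmult[OF b(2)]]])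
         (simp add: numeral_2_eq_2)
    show "(?fy s' has_real_derivative ?fyy s' y) (at y)"
      by (rule DERIV_cong[OF DERIV_diff[OF DERIV_diff[OF DERIV_add[OF d(2) DERIV_mult[OF DERIV_ident d(4)]] DERIV_cmult[OF d(6)]] DERIV_cmult[OF b(3)]]])
         (simp add: numeral_2_eq_2 numeral_3_eq_3)
    have "(- (y\<^sup>2 - pi\<^sup>2) / (2 * s'\<^sup>2) - 1 / (2 * s')) + (y\<^sup>2 / s'\<^sup>2 + 1 / s' - pi\<^sup>2 / s'\<^sup>2) / 2 = 0"
      using s' by (simp add: field_simps)
    moreover have "2 * pi * y / s'\<^sup>2 = 2 * (pi * y / s'\<^sup>2)" by simp
    ultimately have "?Q s' y * ((- (y\<^sup>2 - pi\<^sup>2) / (2 * s'\<^sup>2) - 1 / (2 * s')) * sin (pi * y / s') - pi * y / s'\<^sup>2 * cos (pi * y / s'))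
      + ?Q s' y * ((y\<^sup>2 / s'\<^sup>2 + 1 / s' - pi\<^sup>2 / s'\<^sup>2) * sin (pi * y / s') + 2 * pi * y / s'\<^sup>2 * cos (pi * y / s')) / 2 = 0"
      by (simp only: barrier_balance)
    then show "?fs s' y + ?fyy s' y / 2 = 0" by (rule slope_balance)
  next
    show "0 < s" "s \<le> s2" "s \<le> s" "s \<le> s2" "0 \<le> a" "a \<le> s" using s s2 a by auto
  next
    let ?K = "{(s', y). s \<le> s' \<and> s' \<le> s2 \<and> 0 \<le> y \<and> y \<le> s'}"
    have pos: "0 < fst w" if "w \<in> ?K" for w using that s by auto
    show "continuous_on ?K (\<lambda>(s, y). theta_slope s y - c * sine_barrier s y)"
      unfolding theta_slope_def sine_barrier_def case_prod_unfold
      using theta_moment_continuous_on[of ?K 0] theta_moment_continuous_on[of ?K 1] pos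
      unfolding case_prod_unfold
      by (intro continuous_intros) (auto simp: less_imp_neq[symmetric] dest: pos)
  next
    fix s' assume "s \<le> s'" "s' \<le> s2"
    then show "0 \<le> theta_slope s' 0 - c * sine_barrier s' 0 \<and> 0 \<le> theta_slope s' s' - c * sine_barrier s' s'"
      using s theta_slope_sides[of s'] by (simp add: sine_barrier_def)
  next
    fix y assume y: "0 \<le> y" "y \<le> s2"
    have shrink: "pi * m / s2 \<le> pi * m" if "0 \<le> m" for m
      using that s2 mult_left_mono[of 1 s2 "pi * m"] by (simp add: field_simps)
    show "0 \<le> theta_slope s2 y - c * sine_barrier s2 y"
    proof (cases "y \<le> s2 / 2")
      case True
      have "sin (pi * y / s2) \<le> pi * y / s2" using y s2 by (intro sin_x_le_x) simp
      then have "c * sine_barrier s2 y \<le> y / 2" using shrink[of y] y by (intro barrier_top) auto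
      then show ?thesis using theta_slope_ge_near_0[of s2 y] y True s2 by simp
    next
      case False
      have "sin (pi * y / s2) = sin (pi * (s2 - y) / s2)"
      proof -
        have "pi * (s2 - y) / s2 = pi - pi * y / s2" using s2 by (simp add: field_simps)
        then show ?thesis by simp
      qed
      also have "\<dots> \<le> pi * (s2 - y) / s2" using y s2 by (intro sin_x_le_x) simp
      finally have "c * sine_barrier s2 y \<le> (s2 - y) / 2" using shrink[of "s2 - y"] y by (intro barrier_top) auto
      then show ?thesis using theta_slope_ge_near_s[of s2 y] y False s2 by simp
    qed
  qed
  moreover have "0 < sine_barrier s a"
  proof -
    have "0 < sin (pi * a / s)" using a by (intro sin_gt_zero) (auto simp: field_simps)
    then show ?thesis using s by (simp add: sine_barrier_def)
  qed
  ultimately show ?thesis using c mult_pos_pos[of c "sine_barrier s a"] by linarith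
qed

text \<open>The sum of the Gaussians \<open>exp (- (a - 2 * s * k)\<^sup>2 / (2 * s))\<close> over all
  integers \<open>k\<close>, which has period \<open>2 * s\<close>.\<close>

definition periodic_gauss :: "real \<Rightarrow> real \<Rightarrow> real" where
  "periodic_gauss s a = exp (- a\<^sup>2 / (2 * s)) * theta_moment 0 s a"

lemma periodic_gauss_series:
  assumes "0 < s"
  shows "summable (\<lambda>n. exp (- (a - 2 * s * real n)\<^sup>2 / (2 * s)))"
    "summable (\<lambda>n. exp (- (a + 2 * s + 2 * s * real n)\<^sup>2 / (2 * s)))"
    "periodic_gauss s a = (\<Sum>n. exp (- (a - 2 * s * real n)\<^sup>2 / (2 * s))) + (\<Sum>n. exp (- (a + 2 * s + 2 * s * real n)\<^sup>2 / (2 * s)))"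
proof -
  have sum: "summable (\<lambda>n. par_exp 0 (even_nodes j n) (s - a, a))" for j
    using exp_series_summable[OF spread_even_nodes[of j] poly_bounded_const[of _ 1], of "(s - a, a)" 0] assms by simp
  have e: "exp (- a\<^sup>2 / (2 * s)) * par_exp 0 v (s - a, a) = exp (- (a - s * v)\<^sup>2 / (2 * s))" for v
    unfolding par_exp_alt mult_exp_exp using assms
    by (intro arg_cong[where f=exp]) (simp add: power2_eq_square field_simps)
  have nodes: "a - s * even_nodes 0 n = a - 2 * s * real n" "a - s * even_nodes 1 n = a + 2 * s + 2 * s * real n" for n
    by (auto simp: even_nodes_def algebra_simps)
  have sm: "summable (\<lambda>n. exp (- (a - s * even_nodes j n)\<^sup>2 / (2 * s)))" for j
    unfolding e[symmetric] by (rule summable_mult[OF sum])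
  have su: "(\<Sum>n. exp (- (a - s * even_nodes j n)\<^sup>2 / (2 * s)))
     = exp (- a\<^sup>2 / (2 * s)) * (\<Sum>n. par_exp 0 (even_nodes j n) (s - a, a))" for j
    unfolding e[symmetric] by (rule suminf_mult[OF sum])
  show "summable (\<lambda>n. exp (- (a - 2 * s * real n)\<^sup>2 / (2 * s)))"
    "summable (\<lambda>n. exp (- (a + 2 * s + 2 * s * real n)\<^sup>2 / (2 * s)))"
    using sm[of 0] sm[of 1] unfolding nodes by auto
  show "periodic_gauss s a = (\<Sum>n. exp (- (a - 2 * s * real n)\<^sup>2 / (2 * s))) + (\<Sum>n. exp (- (a + 2 * s + 2 * s * real n)\<^sup>2 / (2 * s)))"
    using su[of 0] su[of 1] unfolding nodes
    by (simp only: periodic_gauss_def theta_moment_def exp_sum_def exp_series_def numeral_2_eq_2 sum.lessThan_Suc)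
       (simp add: distrib_left)
qed

lemma periodic_gauss_reflect:
  assumes "0 < s"
  shows "periodic_gauss s (2 * s - a) = periodic_gauss s a" "periodic_gauss s (- a) = periodic_gauss s a"
proof -
  note ser = periodic_gauss_series[OF assms]
  define f where "f a n = exp (- (a - 2 * s * real n)\<^sup>2 / (2 * s))" for a n
  define g where "g a n = exp (- (a + 2 * s + 2 * s * real n)\<^sup>2 / (2 * s))" for a n
  have sf1: "summable (f b)" for b using ser(1)[of b] by (simp only: f_def[abs_def])
  then have sf: "summable (f b)" "summable (\<lambda>n. f b (Suc n))" for b
    by (simp_all only: summable_Suc_iff[of "f b"])
  have G: "periodic_gauss s b = suminf (f b) + suminf (g b)" for b
    using ser(3)[of b] by (simp add: f_def[abs_def] g_def[abs_def])
  have sqr: "x = y \<or> x = - y \<Longrightarrow> exp (- x\<^sup>2 / (2 * s)) = exp (- y\<^sup>2 / (2 * s))" for x y :: real by auto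
  have r: "f (2 * s - a) (Suc (Suc n)) = g a n" "g (2 * s - a) n = f a (Suc (Suc n))"
    "f (2 * s - a) 0 = f a (Suc 0)" "f (2 * s - a) (Suc 0) = f a 0"
    "f (- a) (Suc n) = g a n" "g (- a) n = f a (Suc n)" "f (- a) 0 = f a 0" for n
    unfolding f_def g_def by (rule sqr, simp add: algebra_simps)+
  have h: "suminf (f b) = f b 0 + (\<Sum>n. f b (Suc n))" "(\<Sum>n. f b (Suc n)) = f b (Suc 0) + (\<Sum>n. f b (Suc (Suc n)))" for b
    using suminf_split_head[OF sf(1)[of b]] suminf_split_head[OF sf(2)[of b]] by auto
  show "periodic_gauss s (2 * s - a) = periodic_gauss s a"
    unfolding G h(1)[of "2 * s - a"] h(2)[of "2 * s - a"] r h(1)[of a] h(2)[of a] by simp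
  show "periodic_gauss s (- a) = periodic_gauss s a"
    unfolding G h(1)[of "- a"] r h(1)[of a] by simp
qed

lemma periodic_gauss_deriv:
  assumes "0 < s"
  shows "(periodic_gauss s has_real_derivative - (exp (- a\<^sup>2 / (2 * s)) * theta_slope s a / s)) (at a)"
proof -
  have "((\<lambda>a. exp (- a\<^sup>2 / (2 * s))) has_real_derivative exp (- a\<^sup>2 / (2 * s)) * (- a / s)) (at a)"
    by (rule derivative_eq_intros refl | use assms in simp)+
  from DERIV_mult[OF this theta_moment_partial(2)[OF assms, of 0 a]]
  show ?thesis unfolding periodic_gauss_def[abs_def]
    by (rule DERIV_cong) (use assms in \<open>simp add: theta_slope_def field_simps\<close>)
qed

lemma periodic_gauss_decreasing:
  assumes "0 \<le> a" "a < b" "b \<le> s"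
  shows "periodic_gauss s b < periodic_gauss s a"
proof (rule DERIV_neg_imp_decreasing_open[OF assms(2)])
  have s: "0 < s" using assms by simp
  show "continuous_on {a..b} (periodic_gauss s)"
    using DERIV_isCont[OF periodic_gauss_deriv[OF s]] by (intro continuous_at_imp_continuous_on) auto
  fix x assume x: "a < x" "x < b"
  have "0 < exp (- x\<^sup>2 / (2 * s)) * theta_slope s x / s"
    using theta_slope_pos[of x s] x assms s by (intro divide_pos_pos mult_pos_pos) auto
  then show "\<exists>y. (periodic_gauss s has_real_derivative y) (at x) \<and> y < 0"
    using periodic_gauss_deriv[OF s, of x] by (intro exI[of _ "- (exp (- x\<^sup>2 / (2 * s)) * theta_slope s x / s)"]) auto
qed

text \<open>By periodicity and symmetry both arguments can be moved into the half period from 0 to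
  \<open>s\<close>, where the sum decreases; the image of \<open>y - s * v\<close> is the
  smaller one.\<close>

lemma periodic_gauss_compare:
  assumes y: "0 < y" "y < s" and v: "0 < v" "v < 1"
  shows "periodic_gauss s (y + s * v) < periodic_gauss s (y - s * v)"
proof -
  have s: "0 < s" using y by simp
  define w where "w = s * v"
  have sv: "0 < w" "w < s" using s v by (auto simp: w_def)
  note refl = periodic_gauss_reflect[OF s]
  have "periodic_gauss s (y - w) = periodic_gauss s \<bar>y - w\<bar>"
    using refl(2)[of "y - w"] by (cases "0 \<le> y - w") auto
  moreover have "periodic_gauss s (y + w) = periodic_gauss s (min (y + w) (2 * s - (y + w)))"
    using refl(1)[of "y + w"] by (auto simp: min_def)
  moreover have "periodic_gauss s (min (y + w) (2 * s - (y + w))) < periodic_gauss s \<bar>y - w\<bar>"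
    using y sv by (intro periodic_gauss_decreasing) (auto simp: min_def abs_if)
  ultimately show ?thesis by (simp add: w_def)
qed

section \<open>Series, sign and bounds for the harmonic functions\<close>

text \<open>The orbit of \<open>v\<close> under the reflections \<open>v \<mapsto> 2 - v\<close> and
  \<open>v \<mapsto> - v\<close>, in four families. The first two come from an even number of
  reflections, the last two from an odd number, which fixes the signs in \<open>h_coeff\<close>.\<close>

definition h_nodes :: "real \<Rightarrow> nat \<Rightarrow> nat \<Rightarrow> real" where
  "h_nodes v j n = (if j = 0 then v + 2 * real n else if j = 1 then v - 2 - 2 * real n
    else if j = 2 then 2 - v + 2 * real n else - v - 2 * real n)"

definition h_coeff :: "nat \<Rightarrow> nat \<Rightarrow> real" where
  "h_coeff j n = (if j < 2 then 1 else - 1)"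

lemma spread_h_nodes: "0 \<le> v \<Longrightarrow> v \<le> 1 \<Longrightarrow> spread (h_nodes v j)"
  by (auto simp: spread_def h_nodes_def)

lemma poly_bounded_h_coeff: "poly_bounded w (h_coeff j)"
  unfolding h_coeff_def[abs_def] by (cases "j < 2") (auto intro: poly_bounded_const)

lemma par_reflect: "par_q \<gamma> (2 - v) = par_q \<gamma> v" "par_p \<gamma> (- v) = par_p \<gamma> v"
  by (simp_all add: par_q_def par_p_def power2_eq_square algebra_simps)

text \<open>Completing the square in \<open>v\<close>; the first factor does not depend on \<open>v\<close>.\<close>

lemma par_exp_gauss:
  assumes "0 < fst z + snd z"
  shows "par_exp \<gamma> v z = exp ((\<gamma>\<^sup>2 * fst z + ((1 - \<gamma>)\<^sup>2 - 1) * snd z) / 2 + (snd z)\<^sup>2 / (2 * (fst z + snd z)))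
    * exp (- (snd z - (fst z + snd z) * v)\<^sup>2 / (2 * (fst z + snd z)))"
proof -
  define s where "s = fst z + snd z"
  have s: "s \<noteq> 0" using assms by (simp add: s_def)
  have "v * snd z - v\<^sup>2 * s / 2 = (snd z)\<^sup>2 / (2 * s) + - (snd z - s * v)\<^sup>2 / (2 * s)"
    using s by (simp add: power2_eq_square field_simps)
  then show ?thesis unfolding par_exp_alt mult_exp_exp s_def[symmetric] by simp
qed

lemma abs_exp_diff_le: "\<bar>exp b - exp a\<bar> \<le> \<bar>b - a\<bar> * exp (max a b)" for a b :: real
proof -
  have *: "exp b - exp a \<le> (b - a) * exp b" for a b :: real
  proof -
    have "1 + (a - b) \<le> exp (a - b)" by (rule exp_ge_add_one_self)
    then have "exp b * (1 + (a - b)) \<le> exp b * exp (a - b)" by (intro mult_left_mono) auto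
    then show ?thesis by (simp add: mult_exp_exp algebra_simps)
  qed
  show ?thesis
  proof (cases "a \<le> b")
    case True then show ?thesis using *[of b a] by (simp add: max_def)
  next
    case False
    then have "exp b < exp a" "a - b > 0" by auto
    then show ?thesis using *[of a b] False by (simp add: max_def)
  qed
qed

lemma mult_exp_neg_le: "0 < c \<Longrightarrow> x * exp (- c * x) \<le> 1 / c" for c x :: real
proof -
  assume c: "0 < c"
  have "c * x \<le> exp (c * x)" using exp_ge_add_one_self[of "c * x"] by linarith
  then have "c * x * exp (- c * x) \<le> exp (c * x) * exp (- c * x)" by (intro mult_right_mono) auto
  also have "\<dots> = 1" by (simp add: mult_exp_exp)
  finally show ?thesis using c by (simp add: field_simps)
qed

context quadrant_process
begin

lemma nonpos_in_range: "q \<le> 0 \<Longrightarrow> q < (1 - \<gamma>)\<^sup>2 / 2" "p \<le> 0 \<Longrightarrow> p < \<gamma>\<^sup>2 / 2"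
  using zero_less_power[of "1 - \<gamma>" 2] zero_less_power[of \<gamma> 2] gamma by linarith+

text \<open>The exit law gives no mass to points below \<open>s0 > 0\<close>, so its transform is at most a
  constant times \<open>exp (q * s0)\<close>.\<close>

lemma lap1_tendsto_0: "(\<lambda>N. lap1 (par_q \<gamma> (v - 2 * real N))) \<longlonglongrightarrow> 0"
  if v: "v \<le> 1"
proof -
  interpret L: finite_measure law1 by (rule finite_laws)
  define m where "m = measure law1 UNIV"
  have bound: "lap1 q \<le> exp (q * s0) * m" if "q \<le> 0" for q
  proof -
    have "lap1 q \<le> (LINT y|law1. exp (q * s0))"
      unfolding lap1_def
    proof (rule integral_mono_AE)
      show "integrable law1 (\<lambda>y. exp (q * y))" using that by (intro exp_moment_integrable nonpos_in_range)
      show "AE y in law1. exp (q * y) \<le> exp (q * s0)"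
        using AE_laws(1) by eventually_elim (use that in \<open>auto intro: mult_left_mono_neg\<close>)
    qed simp
    then show ?thesis by (simp add: m_def mult.commute)
  qed
  have q: "par_q \<gamma> (v - 2 * real N) \<le> 1 / 2 - real N" for N
  proof -
    have "(2 * real N)\<^sup>2 \<le> (1 - (v - 2 * real N))\<^sup>2" using v by (intro power_mono) auto
    moreover have "real N * 2 \<le> (2 * real N)\<^sup>2"
    proof (cases N)
      case (Suc n)
      then have "1 \<le> 2 * real N" by simp
      then have "1 * (2 * real N) \<le> 2 * real N * (2 * real N)" by (intro mult_right_mono) auto
      then show ?thesis by (simp add: power2_eq_square)
    qed simp
    moreover have "(1 - \<gamma>)\<^sup>2 \<le> 1" using gamma by (simp add: power_le_one)
    ultimately show ?thesis by (simp add: par_q_def)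
  qed
  have "(\<lambda>N. exp ((1 / 2 - real N) * s0) * m) \<longlonglongrightarrow> exp (s0 / 2) * 0 * m"
  proof -
    have "exp ((1 / 2 - real N) * s0) = exp (s0 / 2) * exp (- s0) ^ N" for N
      by (simp add: exp_of_nat_mult[symmetric] mult_exp_exp algebra_simps)
    then show ?thesis using z_pos
      by (simp only:) (intro tendsto_mult tendsto_const LIMSEQ_realpow_zero, auto)
  qed
  then have lim: "(\<lambda>N. exp ((1 / 2 - real N) * s0) * m) \<longlonglongrightarrow> 0" by simp
  show ?thesis
  proof (rule tendsto_sandwich[OF _ _ tendsto_const lim])
    show "\<forall>\<^sub>F N in sequentially. 0 \<le> lap1 (par_q \<gamma> (v - 2 * real N))"
      unfolding lap1_def by (auto intro!: always_eventually Bochner_Integration.integral_nonneg)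
    show "\<forall>\<^sub>F N in sequentially. lap1 (par_q \<gamma> (v - 2 * real N)) \<le> exp ((1 / 2 - real N) * s0) * m"
      unfolding eventually_sequentially
    proof (intro exI[of _ 1] allI impI)
      fix N :: nat assume "1 \<le> N"
      then have "par_q \<gamma> (v - 2 * real N) \<le> 0" using q[of N] by simp
      then have "lap1 (par_q \<gamma> (v - 2 * real N)) \<le> exp (par_q \<gamma> (v - 2 * real N) * s0) * m" by (rule bound)
      also have "\<dots> \<le> exp ((1 / 2 - real N) * s0) * m"
        using q[of N] z_pos by (intro mult_right_mono) (auto simp: m_def)
      finally show "lap1 (par_q \<gamma> (v - 2 * real N)) \<le> exp ((1 / 2 - real N) * s0) * m" .
    qed
  qed
qed

lemma lap2_tendsto_0: "(\<lambda>N. lap2 (par_p \<gamma> (v + 2 * real N))) \<longlonglongrightarrow> 0"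
  if v: "0 \<le> v"
proof -
  interpret L: finite_measure law2 by (rule finite_laws)
  define m where "m = measure law2 UNIV"
  have bound: "lap2 q \<le> exp (q * s0) * m" if "q \<le> 0" for q
  proof -
    have "lap2 q \<le> (LINT y|law2. exp (q * s0))"
      unfolding lap2_def
    proof (rule integral_mono_AE)
      show "integrable law2 (\<lambda>y. exp (q * y))" using that by (intro exp_moment_integrable nonpos_in_range)
      show "AE y in law2. exp (q * y) \<le> exp (q * s0)"
        using AE_laws(2) by eventually_elim (use that in \<open>auto intro: mult_left_mono_neg\<close>)
    qed simp
    then show ?thesis by (simp add: m_def mult.commute)
  qed
  have q: "par_p \<gamma> (v + 2 * real N) \<le> 1 / 2 - real N" for N
  proof -
    have "(2 * real N)\<^sup>2 \<le> (v + 2 * real N)\<^sup>2" using v by (intro power_mono) auto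
    moreover have "real N * 2 \<le> (2 * real N)\<^sup>2"
    proof (cases N)
      case (Suc n)
      then have "1 \<le> 2 * real N" by simp
      then have "1 * (2 * real N) \<le> 2 * real N * (2 * real N)" by (intro mult_right_mono) auto
      then show ?thesis by (simp add: power2_eq_square)
    qed simp
    moreover have "\<gamma>\<^sup>2 \<le> 1" using gamma by (simp add: power_le_one)
    ultimately show ?thesis by (simp add: par_p_def)
  qed
  have "(\<lambda>N. exp ((1 / 2 - real N) * s0) * m) \<longlonglongrightarrow> exp (s0 / 2) * 0 * m"
  proof -
    have "exp ((1 / 2 - real N) * s0) = exp (s0 / 2) * exp (- s0) ^ N" for N
      by (simp add: exp_of_nat_mult[symmetric] mult_exp_exp algebra_simps)
    then show ?thesis using z_pos
      by (simp only:) (intro tendsto_mult tendsto_const LIMSEQ_realpow_zero, auto)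
  qed
  then have lim: "(\<lambda>N. exp ((1 / 2 - real N) * s0) * m) \<longlonglongrightarrow> 0" by simp
  show ?thesis
  proof (rule tendsto_sandwich[OF _ _ tendsto_const lim])
    show "\<forall>\<^sub>F N in sequentially. 0 \<le> lap2 (par_p \<gamma> (v + 2 * real N))"
      unfolding lap2_def by (auto intro!: always_eventually Bochner_Integration.integral_nonneg)
    show "\<forall>\<^sub>F N in sequentially. lap2 (par_p \<gamma> (v + 2 * real N)) \<le> exp ((1 / 2 - real N) * s0) * m"
      unfolding eventually_sequentially
    proof (intro exI[of _ 1] allI impI)
      fix N :: nat assume "1 \<le> N"
      then have "par_p \<gamma> (v + 2 * real N) \<le> 0" using q[of N] by simp
      then have "lap2 (par_p \<gamma> (v + 2 * real N)) \<le> exp (par_p \<gamma> (v + 2 * real N) * s0) * m" by (rule bound)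
      also have "\<dots> \<le> exp ((1 / 2 - real N) * s0) * m"
        using q[of N] z_pos by (intro mult_right_mono) (auto simp: m_def)
      finally show "lap2 (par_p \<gamma> (v + 2 * real N)) \<le> exp ((1 / 2 - real N) * s0) * m" .
    qed
  qed
qed

definition hfun :: "real \<Rightarrow> real" where
  "hfun v = par_exp \<gamma> v z - lap1 (par_q \<gamma> v) - lap2 (par_p \<gamma> v)"

text \<open>Two applications of the functional equation, at \<open>2 - v > 1\<close> and at \<open>v - 2 <
  0\<close>. They share the value of \<open>lap2\<close>, because the two parameters are
  opposite.\<close>

lemma lap1_step: "lap1 (par_q \<gamma> v) = par_exp \<gamma> (2 - v) z - par_exp \<gamma> (v - 2) z + lap1 (par_q \<gamma> (v - 2))" if "v < 1"
  using lap_functional_equation[of "2 - v"] lap_functional_equation[of "v - 2"] that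
    par_reflect(1)[of \<gamma> v] par_reflect(2)[of \<gamma> "v - 2"] by simp

lemma lap2_step: "lap2 (par_p \<gamma> v) = par_exp \<gamma> (- v) z - par_exp \<gamma> (v + 2) z + lap2 (par_p \<gamma> (v + 2))" if "0 < v"
  using lap_functional_equation[of "- v"] lap_functional_equation[of "v + 2"] that
    par_reflect(1)[of \<gamma> "- v"] par_reflect(2)[of \<gamma> v] by (simp add: add.commute)

text \<open>Iterating \<open>lap1_step\<close> and \<open>lap2_step\<close>, which move the parameter away
  from the interval between 0 and 1; the remainders tend to zero.\<close>

lemma hfun_series:
  assumes v: "0 < v" "v < 1"
  shows "hfun v = exp_sum \<gamma> 4 (h_nodes v) h_coeff z"
proof -
  define f where "f j n = par_exp \<gamma> (h_nodes v j n) z" for j n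
  have summ: "summable (f j)" for j
    using exp_series_summable[OF spread_h_nodes[of v j] poly_bounded_const[of _ 1], of z \<gamma>] v z_pos
    by (simp add: f_def[abs_def] s0_def)
  have ex: "exp_sum \<gamma> 4 (h_nodes v) h_coeff z = suminf (f 0) + suminf (f 1) - suminf (f 2) - suminf (f 3)"
    using suminf_minus[OF summ[of 2]] suminf_minus[OF summ[of 3]]
    by (simp add: exp_sum_def exp_series_def h_coeff_def f_def[abs_def] eval_nat_numeral)
  have A: "lap1 (par_q \<gamma> v) = (\<Sum>n<N. f 2 n) - (\<Sum>n<N. f 1 n) + lap1 (par_q \<gamma> (v - 2 * real N))" for N
  proof (induction N)
    case (Suc N)
    have "lap1 (par_q \<gamma> (v - 2 * real N)) = f 2 N - f 1 N + lap1 (par_q \<gamma> (v - 2 * real (Suc N)))"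
      using lap1_step[of "v - 2 * real N"] v by (simp add: f_def h_nodes_def algebra_simps)
    then show ?case using Suc by simp
  qed simp
  have B: "lap2 (par_p \<gamma> v) = (\<Sum>n<N. f 3 n) - (\<Sum>n<N. f 0 (Suc n)) + lap2 (par_p \<gamma> (v + 2 * real N))" for N
  proof (induction N)
    case (Suc N)
    have "lap2 (par_p \<gamma> (v + 2 * real N)) = f 3 N - f 0 (Suc N) + lap2 (par_p \<gamma> (v + 2 * real (Suc N)))"
      using lap2_step[of "v + 2 * real N"] v by (simp add: f_def h_nodes_def algebra_simps)
    then show ?case using Suc by simp
  qed simp
  have s0': "summable (\<lambda>n. f 0 (Suc n))" using summ[of 0] summable_Suc_iff[of "f 0"] by simp
  have "(\<lambda>N. (\<Sum>n<N. f 2 n) - (\<Sum>n<N. f 1 n) + lap1 (par_q \<gamma> (v - 2 * real N))) \<longlonglongrightarrow> suminf (f 2) - suminf (f 1) + 0"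
    using v by (intro tendsto_intros summable_LIMSEQ summ lap1_tendsto_0) auto
  then have "lap1 (par_q \<gamma> v) = suminf (f 2) - suminf (f 1)"
    unfolding A[symmetric] by (simp add: LIMSEQ_const_iff)
  moreover have "(\<lambda>N. (\<Sum>n<N. f 3 n) - (\<Sum>n<N. f 0 (Suc n)) + lap2 (par_p \<gamma> (v + 2 * real N)))
      \<longlonglongrightarrow> suminf (f 3) - (\<Sum>n. f 0 (Suc n)) + 0"
    using v by (intro tendsto_intros summable_LIMSEQ summ s0' lap2_tendsto_0) auto
  then have "lap2 (par_p \<gamma> v) = suminf (f 3) - (\<Sum>n. f 0 (Suc n))"
    unfolding B[symmetric] by (simp add: LIMSEQ_const_iff)
  moreover have "suminf (f 0) = par_exp \<gamma> v z + (\<Sum>n. f 0 (Suc n))"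
    using suminf_split_head[OF summ[of 0]] by (simp add: f_def h_nodes_def)
  ultimately show ?thesis unfolding ex hfun_def by simp
qed

definition gauss_scale :: real where
  "gauss_scale = exp ((\<gamma>\<^sup>2 * fst z + ((1 - \<gamma>)\<^sup>2 - 1) * snd z) / 2 + (snd z)\<^sup>2 / (2 * s0))"

text \<open>The two even families of nodes add up to one periodic sum and the two odd families to another.\<close>

lemma hfun_gauss:
  assumes v: "0 < v" "v < 1"
  shows "hfun v = gauss_scale * (periodic_gauss s0 (snd z - s0 * v) - periodic_gauss s0 (snd z + s0 * v))"
proof -
  define f where "f j n = par_exp \<gamma> (h_nodes v j n) z" for j n
  have summ: "summable (f j)" for j
    using exp_series_summable[OF spread_h_nodes[of v j] poly_bounded_const[of _ 1], of z \<gamma>] v z_pos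
    by (simp add: f_def[abs_def] s0_def)
  have ex: "hfun v = suminf (f 0) + suminf (f 1) - suminf (f 2) - suminf (f 3)"
    unfolding hfun_series[OF v] using suminf_minus[OF summ[of 2]] suminf_minus[OF summ[of 3]]
    by (simp add: exp_sum_def exp_series_def h_coeff_def f_def[abs_def] eval_nat_numeral)
  have pe: "par_exp \<gamma> w z = gauss_scale * exp (- (snd z - s0 * w)\<^sup>2 / (2 * s0))" for w
    using par_exp_gauss[of z \<gamma> w] z_pos by (simp add: gauss_scale_def s0_def)
  have sqr: "x = y \<or> x = - y \<Longrightarrow> exp (- x\<^sup>2 / (2 * s0)) = exp (- y\<^sup>2 / (2 * s0))" for x y :: real by auto
  define a b where "a = snd z - s0 * v" and "b = - (snd z + s0 * v)"
  have f: "f 0 n = gauss_scale * exp (- (a - 2 * s0 * real n)\<^sup>2 / (2 * s0))"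
    "f 1 n = gauss_scale * exp (- (a + 2 * s0 + 2 * s0 * real n)\<^sup>2 / (2 * s0))"
    "f 2 n = gauss_scale * exp (- (b + 2 * s0 + 2 * s0 * real n)\<^sup>2 / (2 * s0))"
    "f 3 n = gauss_scale * exp (- (b - 2 * s0 * real n)\<^sup>2 / (2 * s0))" for n
    unfolding f_def h_nodes_def pe by (rule arg_cong[where f="\<lambda>x. gauss_scale * x"], rule sqr, simp add: a_def b_def algebra_simps)+
  note ser = periodic_gauss_series[OF z_pos(3)]
  have fs: "suminf (f 0) = gauss_scale * (\<Sum>n. exp (- (a - 2 * s0 * real n)\<^sup>2 / (2 * s0)))"
    "suminf (f 1) = gauss_scale * (\<Sum>n. exp (- (a + 2 * s0 + 2 * s0 * real n)\<^sup>2 / (2 * s0)))"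
    "suminf (f 2) = gauss_scale * (\<Sum>n. exp (- (b + 2 * s0 + 2 * s0 * real n)\<^sup>2 / (2 * s0)))"
    "suminf (f 3) = gauss_scale * (\<Sum>n. exp (- (b - 2 * s0 * real n)\<^sup>2 / (2 * s0)))"
    unfolding f[abs_def] by (rule suminf_mult, rule ser)+
  have "suminf (f 0) + suminf (f 1) = gauss_scale * periodic_gauss s0 a"
    unfolding fs ser(3) by (simp add: distrib_left)
  moreover have "suminf (f 2) + suminf (f 3) = gauss_scale * periodic_gauss s0 b"
    unfolding fs ser(3) by (simp add: distrib_left)
  moreover have "periodic_gauss s0 b = periodic_gauss s0 (snd z + s0 * v)"
    unfolding b_def by (rule periodic_gauss_reflect(2)[OF z_pos(3)])
  ultimately show ?thesis unfolding ex by (simp add: a_def algebra_simps)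
qed

lemma hfun_pos: "0 < v \<Longrightarrow> v < 1 \<Longrightarrow> 0 < hfun v"
  using periodic_gauss_compare[of "snd z" s0 v] z_pos
  by (simp add: hfun_gauss gauss_scale_def s0_def)

lemma lap1_mono: "q \<le> q' \<Longrightarrow> q' < (1 - \<gamma>)\<^sup>2 / 2 \<Longrightarrow> lap1 q \<le> lap1 q'"
  unfolding lap1_def
proof (rule integral_mono_AE)
  assume "q \<le> q'"
  then show "AE y in law1. exp (q * y) \<le> exp (q' * y)"
    using AE_laws(1) z_pos by (auto elim!: eventually_mono intro!: mult_right_mono)
qed (auto intro!: exp_moment_integrable)

lemma lap2_mono: "p \<le> p' \<Longrightarrow> p' < \<gamma>\<^sup>2 / 2 \<Longrightarrow> lap2 p \<le> lap2 p'"
  unfolding lap2_def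
proof (rule integral_mono_AE)
  assume "p \<le> p'"
  then show "AE y in law2. exp (p * y) \<le> exp (p' * y)"
    using AE_laws(2) z_pos by (auto elim!: eventually_mono intro!: mult_right_mono)
qed (auto intro!: exp_moment_integrable)

text \<open>The functional equation at \<open>- v\<close> or at \<open>2 - v\<close> replaces one of the two
  transforms in \<open>hfun\<close>; the other one only gets smaller under the replacement,
  because the transforms are increasing.\<close>

lemma hfun_le:
  assumes v: "0 < v" "v < 1"
  shows "hfun v \<le> par_exp \<gamma> v z - par_exp \<gamma> (- v) z" "hfun v \<le> par_exp \<gamma> v z - par_exp \<gamma> (2 - v) z"
proof -
  have "lap1 (par_q \<gamma> (- v)) \<le> lap1 (par_q \<gamma> v)"
  proof (intro lap1_mono par_less)
    have "(1 - v)\<^sup>2 \<le> (1 + v)\<^sup>2" using v by (intro power_mono) auto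
    then show "par_q \<gamma> (- v) \<le> par_q \<gamma> v" by (simp add: par_q_def)
  qed (use v in auto)
  then show "hfun v \<le> par_exp \<gamma> v z - par_exp \<gamma> (- v) z"
    using lap_functional_equation[of "- v"] v by (simp add: hfun_def par_reflect)
  have "lap2 (par_p \<gamma> (2 - v)) \<le> lap2 (par_p \<gamma> v)"
  proof (intro lap2_mono par_less)
    have "v\<^sup>2 \<le> (2 - v)\<^sup>2" using v by (intro power_mono) auto
    then show "par_p \<gamma> (2 - v) \<le> par_p \<gamma> v" by (simp add: par_p_def)
  qed (use v in auto)
  then show "hfun v \<le> par_exp \<gamma> v z - par_exp \<gamma> (2 - v) z"
    using lap_functional_equation[of "2 - v"] v by (simp add: hfun_def par_reflect)
qed

lemma lap2_deriv:
  assumes p: "p < 0"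
  shows "(lap2 has_real_derivative (LINT x|law2. x * exp (p * x))) (at p)"
proof -
  interpret L: finite_measure law2 by (rule finite_laws)
  have "((\<lambda>h. (lap2 (p + h) - lap2 p) / h) \<longlongrightarrow> (LINT x|law2. x * exp (p * x))) (at 0)"
    unfolding tendsto_at_iff_sequentially comp_def
  proof (intro allI impI)
    fix h :: "nat \<Rightarrow> real" assume h: "\<forall>n. h n \<in> UNIV - {0}" "h \<longlonglongrightarrow> 0"
    have "\<forall>\<^sub>F n in sequentially. \<bar>h n\<bar> < - p / 2"
      using h(2) p by (intro order_tendstoD(2)[of _ 0] tendsto_rabs_zero) auto
    then obtain N where N: "\<And>n. N \<le> n \<Longrightarrow> \<bar>h n\<bar> < - p / 2" by (auto simp: eventually_sequentially)
    define k where "k n = h (n + N)" for n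
    have k: "\<bar>k n\<bar> < - p / 2" "k n \<noteq> 0" for n using N[of "n + N"] h(1) by (auto simp: k_def)
    have klim: "k \<longlonglongrightarrow> 0" unfolding k_def by (rule LIMSEQ_ignore_initial_segment[OF h(2)])
    have int: "integrable law2 (\<lambda>x. exp (q * x))" if "q < 0" for q
      using that by (intro exp_moment_integrable nonpos_in_range) simp
    have q: "(lap2 (p + k n) - lap2 p) / k n = (LINT x|law2. (exp ((p + k n) * x) - exp (p * x)) / k n)" for n
      unfolding lap2_def using k[of n] p
      by (subst Bochner_Integration.integral_diff[symmetric]) (auto intro!: int simp: abs_less_iff)
    have "(\<lambda>n. LINT x|law2. (exp ((p + k n) * x) - exp (p * x)) / k n) \<longlonglongrightarrow> (LINT x|law2. x * exp (p * x))"
    proof (rule integral_dominated_convergence[where w="\<lambda>_. 1 / (- p / 2)"])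
      show "AE x in law2. (\<lambda>n. (exp ((p + k n) * x) - exp (p * x)) / k n) \<longlonglongrightarrow> x * exp (p * x)"
      proof (rule AE_I2)
        fix x :: real
        have "((\<lambda>p. exp (p * x)) has_real_derivative x * exp (p * x)) (at p)"
          by (auto intro!: derivative_eq_intros)
        then have "((\<lambda>h. (exp ((p + h) * x) - exp (p * x)) / h) \<longlongrightarrow> x * exp (p * x)) (at 0)" by (simp add: DERIV_def)
        then show "(\<lambda>n. (exp ((p + k n) * x) - exp (p * x)) / k n) \<longlonglongrightarrow> x * exp (p * x)"
          unfolding tendsto_at_iff_sequentially comp_def using klim k(2) by auto
      qed
      fix n
      show "AE x in law2. norm ((exp ((p + k n) * x) - exp (p * x)) / k n) \<le> 1 / (- p / 2)"
        using AE_laws(2)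
      proof eventually_elim
        fix x assume "s0 < x"
        then have x: "0 < x" using z_pos by simp
        have "\<bar>exp ((p + k n) * x) - exp (p * x)\<bar> \<le> \<bar>(p + k n) * x - p * x\<bar> * exp (max (p * x) ((p + k n) * x))"
          by (rule abs_exp_diff_le)
        also have "\<bar>(p + k n) * x - p * x\<bar> = \<bar>k n\<bar> * x" using x by (simp add: algebra_simps abs_mult)
        also have "\<bar>k n\<bar> * x * exp (max (p * x) ((p + k n) * x)) \<le> \<bar>k n\<bar> * x * exp (- (- p / 2) * x)"
        proof (intro mult_left_mono)
          have le: "p \<le> p / 2" "p + k n \<le> p / 2" using k(1)[of n] p by (auto simp: abs_less_iff)
          have "p * x \<le> p / 2 * x" by (rule mult_right_mono[OF le(1) less_imp_le[OF x]])
          moreover have "(p + k n) * x \<le> p / 2 * x" by (rule mult_right_mono[OF le(2) less_imp_le[OF x]])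
          ultimately show "exp (max (p * x) ((p + k n) * x)) \<le> exp (- (- p / 2) * x)" by simp
        qed (use x in auto)
        also have "\<dots> \<le> \<bar>k n\<bar> * (1 / (- p / 2))"
          using mult_exp_neg_le[of "- p / 2" x] p unfolding mult.assoc by (intro mult_left_mono) auto
        finally show "norm ((exp ((p + k n) * x) - exp (p * x)) / k n) \<le> 1 / (- p / 2)"
          using k(2)[of n] by (simp add: abs_divide pos_divide_le_eq mult.commute)
      qed
    qed (simp_all add: L.finite_measure_axioms)
    then have "(\<lambda>n. (lap2 (p + k n) - lap2 p) / k n) \<longlonglongrightarrow> (LINT x|law2. x * exp (p * x))"
      by (simp only: q)
    then have "(\<lambda>n. (lap2 (p + h (n + N)) - lap2 p) / h (n + N)) \<longlonglongrightarrow> (LINT x|law2. x * exp (p * x))"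
      by (simp only: k_def)
    then show "(\<lambda>n. (lap2 (p + h n) - lap2 p) / h n) \<longlonglongrightarrow> (LINT x|law2. x * exp (p * x))"
      by (rule LIMSEQ_offset)
  qed
  then show ?thesis by (simp add: DERIV_def)
qed

definition h_end :: real where
  "h_end = fst z * par_exp \<gamma> 1 z - (LINT x|law2. x * exp (par_p \<gamma> 1 * x))"

text \<open>The derivative of \<open>hfun\<close> at \<open>v = 1\<close>, which lies outside its series
  representation, is reached by symmetry: \<open>hfun v\<close> is \<open>\<phi> v - \<phi> (2 -
  v)\<close> for a function \<open>\<phi>\<close> with derivative \<open>- h_end\<close> at 1,
  and also \<open>\<psi> v - \<psi> (2 - v)\<close> for a periodic sum \<open>\<psi>\<close>. So
  the two derivatives agree, and that of \<open>\<psi>\<close> has the sign given by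
  \<open>theta_slope_pos\<close>.\<close>

lemma h_end_pos: "0 < h_end"
proof -
  have "\<gamma>\<^sup>2 < 1" using gamma by (simp add: power_less_one_iff)
  then have p1: "par_p \<gamma> 1 < 0" by (simp add: par_p_def)
  define \<phi> where "\<phi> u = par_exp \<gamma> u z - lap2 (par_p \<gamma> u)" for u
  define \<psi> where "\<psi> u = gauss_scale * periodic_gauss s0 (s0 * u - snd z)" for u
  have p': "(par_p \<gamma> has_real_derivative - 1) (at 1)" "(par_q \<gamma> has_real_derivative 0) (at 1)"
    unfolding par_p_def[abs_def] par_q_def[abs_def] by (auto intro!: derivative_eq_intros)
  have "((\<lambda>u. lap2 (par_p \<gamma> u)) has_real_derivative (LINT x|law2. x * exp (par_p \<gamma> 1 * x)) * (- 1)) (at 1)"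
    by (rule DERIV_chain2[OF lap2_deriv[OF p1] p'(1)])
  moreover have "((\<lambda>u. par_exp \<gamma> u z) has_real_derivative - fst z * par_exp \<gamma> 1 z) (at 1)"
    unfolding par_exp_def by (auto intro!: derivative_eq_intros p')
  ultimately have d\<phi>: "(\<phi> has_real_derivative - h_end) (at 1)"
    unfolding \<phi>_def[abs_def] h_end_def by (auto intro!: derivative_eq_intros)
  define d where "d = - (exp (- (s0 - snd z)\<^sup>2 / (2 * s0)) * theta_slope s0 (s0 - snd z) / s0)"
  have "(periodic_gauss s0 has_real_derivative d) (at (s0 * 1 - snd z))"
    using periodic_gauss_deriv[OF z_pos(3), of "s0 - snd z"] by (simp add: d_def)
  moreover have "((\<lambda>u. s0 * u - snd z) has_real_derivative s0) (at 1)" by (auto intro!: derivative_eq_intros)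
  ultimately have "((\<lambda>u. periodic_gauss s0 (s0 * u - snd z)) has_real_derivative d * s0) (at 1)"
    by (rule DERIV_chain2)
  then have d\<psi>: "(\<psi> has_real_derivative gauss_scale * (d * s0)) (at 1)"
    unfolding \<psi>_def[abs_def] by (rule DERIV_cmult)
  have eq: "\<phi> v - \<phi> (2 - v) = \<psi> v - \<psi> (2 - v)" if v: "0 < v" "v < 1" for v
  proof -
    have "\<phi> v - \<phi> (2 - v) = hfun v"
      using lap_functional_equation[of "2 - v"] v by (simp add: \<phi>_def hfun_def par_reflect)
    moreover have "periodic_gauss s0 (s0 * v - snd z) = periodic_gauss s0 (snd z - s0 * v)"
      using periodic_gauss_reflect(2)[OF z_pos(3), of "snd z - s0 * v"] by simp
    moreover have "periodic_gauss s0 (s0 * (2 - v) - snd z) = periodic_gauss s0 (snd z + s0 * v)"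
      using periodic_gauss_reflect(1)[OF z_pos(3), of "snd z + s0 * v"] by (simp add: algebra_simps)
    ultimately show ?thesis using hfun_gauss[OF v] by (simp add: \<psi>_def right_diff_distrib)
  qed
  define F where "F v = (\<phi> v - \<phi> (2 - v)) - (\<psi> v - \<psi> (2 - v))" for v
  have F0: "F v = 0" if "v \<in> {0<..<2}" for v
    using eq[of v] eq[of "2 - v"] that by (cases v "1 :: real" rule: linorder_cases) (auto simp: F_def)
  have sub: "((\<lambda>v :: real. 2 - v) has_real_derivative - 1) (at 1)" by (auto intro!: derivative_eq_intros)
  have "((\<lambda>v. \<phi> (2 - v)) has_real_derivative - h_end * - 1) (at 1)"
    by (rule DERIV_chain2[OF _ sub]) (use d\<phi> in simp)
  moreover have "((\<lambda>v. \<psi> (2 - v)) has_real_derivative gauss_scale * (d * s0) * - 1) (at 1)"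
    by (rule DERIV_chain2[OF _ sub]) (use d\<psi> in simp)
  ultimately have D1: "(F has_real_derivative (- h_end - - h_end * - 1) - (gauss_scale * (d * s0) - gauss_scale * (d * s0) * - 1)) (at 1)"
    unfolding F_def[abs_def] by (intro DERIV_diff d\<phi> d\<psi>)
  have D2: "(F has_real_derivative 0) (at 1)"
    by (rule has_field_derivative_transform_within_open[of "\<lambda>_. 0" _ _ "{0<..<2}"]) (auto simp: F0)
  have "h_end = - (gauss_scale * (d * s0))" using DERIV_unique[OF D1 D2] by linarith
  moreover have "0 < theta_slope s0 (s0 - snd z)"
    using z_pos by (intro theta_slope_pos) (auto simp: s0_def)
  then have "0 < exp (- (s0 - snd z)\<^sup>2 / (2 * s0)) * theta_slope s0 (s0 - snd z) / s0"
    using z_pos(3) by simp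
  then have "d < 0" unfolding d_def by linarith
  moreover have "0 < gauss_scale" by (simp add: gauss_scale_def)
  ultimately show ?thesis using z_pos by (simp add: mult_pos_neg mult_neg_pos)
qed

end

section \<open>The Green's density as a free density minus a loss\<close>

text \<open>Occupation density of the unrestricted process. The sum of the coordinates of \<open>w\<close>
  determines the only time \<open>t\<close> at which \<open>w\<close> can be visited, so no
  integral over time is left.\<close>

definition free_green :: "real \<Rightarrow> real \<times> real \<Rightarrow> real \<times> real \<Rightarrow> real" where
  "free_green \<gamma> z w = (let t = fst w + snd w - fst z - snd z
     in if 0 < t then normal_density (snd z + \<gamma> * t) (sqrt t) (snd w) else 0)"

lemma free_green_nonneg: "0 \<le> free_green \<gamma> z w"
  by (simp add: free_green_def Let_def)

lemma free_green_measurable [measurable]: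
  assumes [measurable]: "a \<in> borel_measurable N" "b \<in> borel_measurable N" "w \<in> borel_measurable N"
  shows "(\<lambda>x. free_green \<gamma> (a x, b x) (w x)) \<in> borel_measurable N"
proof -
  have [measurable]: "w \<in> measurable N (borel \<Otimes>\<^sub>M borel)" by (simp add: borel_prod)
  have [measurable]: "(\<lambda>x. fst (w x)) \<in> borel_measurable N" "(\<lambda>x. snd (w x)) \<in> borel_measurable N"
    by measurable
  show ?thesis unfolding free_green_def Let_def normal_density_def fst_conv snd_conv by measurable
qed

lemma indicator_ray_measurable [measurable]:
  fixes u y :: "'b \<Rightarrow> real"
  assumes [measurable]: "u \<in> borel_measurable N" "y \<in> borel_measurable N"
  shows "(\<lambda>x. indicator {..u x} (y x) :: ennreal) \<in> borel_measurable N"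
    "(\<lambda>x. indicator {u x<..} (y x) :: ennreal) \<in> borel_measurable N"
proof -
  have "(\<lambda>x. indicator {..u x} (y x) :: ennreal) = (\<lambda>x. if y x \<le> u x then 1 else 0)"
    "(\<lambda>x. indicator {u x<..} (y x) :: ennreal) = (\<lambda>x. if u x < y x then 1 else 0)"
    by (auto simp: indicator_def)
  then show "(\<lambda>x. indicator {..u x} (y x) :: ennreal) \<in> borel_measurable N"
    "(\<lambda>x. indicator {u x<..} (y x) :: ennreal) \<in> borel_measurable N" by simp_all
qed

lemma gauss_substitution:
  assumes [measurable]: "F \<in> borel_measurable borel" and s: "0 < s"
  shows "(\<integral>\<^sup>+x. F (m + s * x) \<partial>std_normal_distribution) = (\<integral>\<^sup>+y. F y * ennreal (normal_density m s y) \<partial>lborel)"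
proof -
  have e: "s * normal_density m s (m + s * x) = std_normal_density x" for x
    using s by (simp add: normal_density_def real_sqrt_mult field_simps)
  have "(\<integral>\<^sup>+y. F y * ennreal (normal_density m s y) \<partial>lborel)
    = ennreal \<bar>s\<bar> * (\<integral>\<^sup>+x. F (m + s * x) * ennreal (normal_density m s (m + s * x)) \<partial>lborel)"
    using s by (intro nn_integral_real_affine) auto
  also have "\<dots> = (\<integral>\<^sup>+x. ennreal \<bar>s\<bar> * (F (m + s * x) * ennreal (normal_density m s (m + s * x))) \<partial>lborel)"
    by (rule nn_integral_cmult[symmetric]) measurable
  also have "\<dots> = (\<integral>\<^sup>+x. ennreal (std_normal_density x) * F (m + s * x) \<partial>lborel)"
  proof (rule nn_integral_cong)
    fix x
    have "ennreal \<bar>s\<bar> * ennreal (normal_density m s (m + s * x)) = ennreal (std_normal_density x)"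
      using s by (simp add: ennreal_mult'[symmetric] e)
    then show "ennreal \<bar>s\<bar> * (F (m + s * x) * ennreal (normal_density m s (m + s * x))) = ennreal (std_normal_density x) * F (m + s * x)"
      by (metis mult.assoc mult.commute)
  qed
  also have "\<dots> = (\<integral>\<^sup>+x. F (m + s * x) \<partial>std_normal_distribution)"
    by (rule nn_integral_density[symmetric]) measurable
  finally show ?thesis ..
qed

text \<open>The change of variables from time and position on the Gaussian line to the two coordinates has
  determinant one.\<close>

lemma free_occupation:
  fixes h :: "real \<times> real \<Rightarrow> ennreal"
  assumes h[measurable]: "h \<in> borel_measurable borel"
  shows "(\<integral>\<^sup>+r. (\<integral>\<^sup>+x. h (free_pos \<gamma> z r x) \<partial>std_normal_distribution) * indicator {0<..} r \<partial>lborel)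
    = (\<integral>\<^sup>+w. h w * ennreal (free_green \<gamma> z w) \<partial>lborel)"
proof -
  define a b where "a = fst z" and "b = snd z"
  have z: "z = (a, b)" by (simp add: a_def b_def)
  have hp[measurable]: "h \<in> borel_measurable (borel \<Otimes>\<^sub>M borel)" using h by (simp add: borel_prod)
  define k where "k r y = h (a + b + r - y, y) * ennreal (normal_density (b + \<gamma> * r) (sqrt r) y) * indicator {0<..} r" for r y
  have k: "(\<lambda>(r, y). k r y) \<in> borel_measurable (borel \<Otimes>\<^sub>M borel)"
    unfolding k_def normal_density_def by measurable
  have "(\<integral>\<^sup>+r. (\<integral>\<^sup>+x. h (free_pos \<gamma> z r x) \<partial>std_normal_distribution) * indicator {0<..} r \<partial>lborel)
    = (\<integral>\<^sup>+r. (\<integral>\<^sup>+y. k r y \<partial>lborel) \<partial>lborel)"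
  proof (rule nn_integral_cong)
    fix r :: real
    show "(\<integral>\<^sup>+x. h (free_pos \<gamma> z r x) \<partial>std_normal_distribution) * indicator {0<..} r = (\<integral>\<^sup>+y. k r y \<partial>lborel)"
    proof (cases "0 < r")
      case True
      have "(\<integral>\<^sup>+x. h (free_pos \<gamma> z r x) \<partial>std_normal_distribution)
        = (\<integral>\<^sup>+x. h (a + b + r - ((b + \<gamma> * r) + sqrt r * x), (b + \<gamma> * r) + sqrt r * x) \<partial>std_normal_distribution)"
        by (simp add: free_pos_def z algebra_simps)
      also have "\<dots> = (\<integral>\<^sup>+y. h (a + b + r - y, y) * ennreal (normal_density (b + \<gamma> * r) (sqrt r) y) \<partial>lborel)"
        by (rule gauss_substitution) (use True in auto)
      finally show ?thesis using True by (simp add: k_def)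
    qed (simp add: k_def)
  qed
  also have "\<dots> = (\<integral>\<^sup>+y. (\<integral>\<^sup>+r. k r y \<partial>lborel) \<partial>lborel)"
    using k by (intro lborel_pair.Fubini'[symmetric]) simp
  also have "\<dots> = (\<integral>\<^sup>+y. (\<integral>\<^sup>+x. h (x, y) * ennreal (free_green \<gamma> z (x, y)) \<partial>lborel) \<partial>lborel)"
  proof (rule nn_integral_cong)
    fix y :: real
    have [measurable]: "(\<lambda>r. k r y) \<in> borel_measurable borel"
      unfolding k_def normal_density_def by measurable
    have "(\<integral>\<^sup>+r. k r y \<partial>lborel) = (\<integral>\<^sup>+x. k ((y - a - b) + 1 * x) y \<partial>lborel)"
      by (subst nn_integral_real_affine[of _ 1 "y - a - b"]) auto
    also have "\<dots> = (\<integral>\<^sup>+x. h (x, y) * ennreal (free_green \<gamma> z (x, y)) \<partial>lborel)"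
      by (intro nn_integral_cong) (auto simp: k_def free_green_def z Let_def indicator_def algebra_simps)
    finally show "(\<integral>\<^sup>+r. k r y \<partial>lborel) = (\<integral>\<^sup>+x. h (x, y) * ennreal (free_green \<gamma> z (x, y)) \<partial>lborel)" .
  qed
  also have "\<dots> = (\<integral>\<^sup>+w. h w * ennreal (free_green \<gamma> z w) \<partial>(lborel \<Otimes>\<^sub>M lborel))"
    using lborel_pair.nn_integral_snd[of "\<lambda>w. h w * ennreal (free_green \<gamma> z w)"]
    by (simp add: z lborel_prod case_prod_beta)
  finally show ?thesis by (simp add: lborel_prod)
qed

context quadrant_process
begin

definition green_loss :: "real \<times> real \<Rightarrow> ennreal" where
  "green_loss w = (\<integral>\<^sup>+y. ennreal (free_green \<gamma> (0, y) w) \<partial>law1) + (\<integral>\<^sup>+a. ennreal (free_green \<gamma> (a, 0) w) \<partial>law2)"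

lemma sigma_finite_laws: "sigma_finite_measure law1" "sigma_finite_measure law2"
  using finite_laws by (auto intro: finite_measure.axioms)

lemma green_loss_measurable [measurable]: "green_loss \<in> borel_measurable borel"
proof -
  interpret L1: sigma_finite_measure law1 by (rule sigma_finite_laws)
  interpret L2: sigma_finite_measure law2 by (rule sigma_finite_laws)
  show ?thesis unfolding green_loss_def[abs_def] by measurable
qed

lemma loss_after_exit:
  fixes h :: "real \<times> real \<Rightarrow> ennreal" and \<rho> :: "real measure" and a b :: "real \<Rightarrow> real"
  assumes h[measurable]: "h \<in> borel_measurable borel"
    and [simp, measurable_cong]: "sets \<rho> = sets borel" and \<rho>: "sigma_finite_measure \<rho>" "AE y in \<rho>. s0 < y"
    and [measurable]: "a \<in> borel_measurable borel" "b \<in> borel_measurable borel"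
  shows "(\<integral>\<^sup>+t. (\<integral>\<^sup>+y. (\<integral>\<^sup>+x. h (free_pos \<gamma> (a y, b y) (s0 + t - y) x) \<partial>std_normal_distribution) * indicator {..s0 + t} y \<partial>\<rho>) * indicator {0<..} t \<partial>lborel)
    = (\<integral>\<^sup>+w. h w * (\<integral>\<^sup>+y. ennreal (free_green \<gamma> (a y, b y) w) \<partial>\<rho>) \<partial>lborel)"
proof -
  interpret G: prob_space std_normal_distribution by (rule prob_space_std_normal)
  interpret R: sigma_finite_measure \<rho> by fact
  interpret LR: pair_sigma_finite lborel \<rho> ..
  have LR2: "pair_sigma_finite (lborel :: (real \<times> real) measure) \<rho>"
    by (intro pair_sigma_finite.intro sigma_finite_lborel \<rho>)
  have [measurable]: "(\<lambda>q. free_pos \<gamma> (a (snd (fst q)), b (snd (fst q))) (s0 + fst (fst q) - snd (fst q)) (snd q))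
      \<in> borel_measurable ((lborel \<Otimes>\<^sub>M \<rho>) \<Otimes>\<^sub>M std_normal_distribution)"
    unfolding free_pos_def by measurable
  have H: "(\<lambda>p. \<integral>\<^sup>+x. h (free_pos \<gamma> (a (snd p), b (snd p)) (s0 + fst p - snd p) x) \<partial>std_normal_distribution)
     \<in> borel_measurable (lborel \<Otimes>\<^sub>M \<rho>)"
    by (rule G.borel_measurable_nn_integral) (simp add: case_prod_beta)
  define k where "k t y = (\<integral>\<^sup>+x. h (free_pos \<gamma> (a y, b y) (s0 + t - y) x) \<partial>std_normal_distribution) * indicator {..s0 + t} y * indicator {0<..} t" for t y
  have k: "(\<lambda>(t, y). k t y) \<in> borel_measurable (lborel \<Otimes>\<^sub>M \<rho>)"
    unfolding k_def case_prod_beta by (intro borel_measurable_times_ennreal H indicator_ray_measurable) measurable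
  have "(\<integral>\<^sup>+t. (\<integral>\<^sup>+y. (\<integral>\<^sup>+x. h (free_pos \<gamma> (a y, b y) (s0 + t - y) x) \<partial>std_normal_distribution) * indicator {..s0 + t} y \<partial>\<rho>) * indicator {0<..} t \<partial>lborel)
    = (\<integral>\<^sup>+t. (\<integral>\<^sup>+y. k t y \<partial>\<rho>) \<partial>lborel)"
    by (intro nn_integral_cong) (auto simp: k_def indicator_def)
  also have "\<dots> = (\<integral>\<^sup>+y. (\<integral>\<^sup>+t. k t y \<partial>lborel) \<partial>\<rho>)"
    using k by (rule LR.Fubini'[symmetric])
  also have "\<dots> = (\<integral>\<^sup>+y. (\<integral>\<^sup>+w. h w * ennreal (free_green \<gamma> (a y, b y) w) \<partial>lborel) \<partial>\<rho>)"
  proof (rule nn_integral_cong_AE)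
    show "AE y in \<rho>. (\<integral>\<^sup>+t. k t y \<partial>lborel) = (\<integral>\<^sup>+w. h w * ennreal (free_green \<gamma> (a y, b y) w) \<partial>lborel)"
      using \<rho>(2)
    proof eventually_elim
      fix y assume y: "s0 < y"
      have [measurable]: "(\<lambda>t. k t y) \<in> borel_measurable borel"
        using measurable_compose[OF measurable_Pair2'[of y \<rho> lborel] k] sets_eq_imp_space_eq[of \<rho> borel] by simp
      have "(\<integral>\<^sup>+t. k t y \<partial>lborel) = (\<integral>\<^sup>+r. k ((y - s0) + 1 * r) y \<partial>lborel)"
        by (subst nn_integral_real_affine[of _ 1 "y - s0"]) auto
      also have "\<dots> = (\<integral>\<^sup>+r. (\<integral>\<^sup>+x. h (free_pos \<gamma> (a y, b y) r x) \<partial>std_normal_distribution) * indicator {0<..} r \<partial>lborel)"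
      proof (rule nn_integral_cong_AE)
        show "AE r in lborel. k ((y - s0) + 1 * r) y = (\<integral>\<^sup>+x. h (free_pos \<gamma> (a y, b y) r x) \<partial>std_normal_distribution) * indicator {0<..} r"
          using AE_lborel_singleton[of 0] by eventually_elim (use y in \<open>auto simp: k_def indicator_def\<close>)
      qed
      also have "\<dots> = (\<integral>\<^sup>+w. h w * ennreal (free_green \<gamma> (a y, b y) w) \<partial>lborel)"
        by (rule free_occupation[OF h])
      finally show "(\<integral>\<^sup>+t. k t y \<partial>lborel) = (\<integral>\<^sup>+w. h w * ennreal (free_green \<gamma> (a y, b y) w) \<partial>lborel)" .
    qed
  qed
  also have "\<dots> = (\<integral>\<^sup>+w. (\<integral>\<^sup>+y. h w * ennreal (free_green \<gamma> (a y, b y) w) \<partial>\<rho>) \<partial>lborel)"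
    by (rule pair_sigma_finite.Fubini'[OF LR2]) measurable
  also have "\<dots> = (\<integral>\<^sup>+w. h w * (\<integral>\<^sup>+y. ennreal (free_green \<gamma> (a y, b y) w) \<partial>\<rho>) \<partial>lborel)"
    by (intro nn_integral_cong nn_integral_cmult) measurable
  finally show ?thesis .
qed

text \<open>The occupation time of the free process splits into the time before and the time after the exit;
  the latter is the occupation time of the process restarted at the exit position.\<close>

lemma green_measure_decomposition:
  assumes S[measurable]: "S \<in> sets borel"
  shows "green_measure M \<gamma> W z S + (\<integral>\<^sup>+w. indicator S w * green_loss w \<partial>lborel)
    = (\<integral>\<^sup>+w. indicator S w * ennreal (free_green \<gamma> z w) \<partial>lborel)"
proof -
  interpret G: prob_space std_normal_distribution by (rule prob_space_std_normal)
  interpret L1: sigma_finite_measure law1 by (rule sigma_finite_laws)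
  interpret L2: sigma_finite_measure law2 by (rule sigma_finite_laws)
  define h :: "real \<times> real \<Rightarrow> ennreal" where "h = indicator S"
  have h[measurable]: "h \<in> borel_measurable borel" by (simp add: h_def)
  define A where "A t = emeasure M {\<omega> \<in> space M. proc \<gamma> W z t \<omega> \<in> S \<and> ereal t < exit_time \<gamma> W z \<omega>} * indicator {0<..} t" for t
  define B1 where "B1 t = (\<integral>\<^sup>+y. (\<integral>\<^sup>+x. h (free_pos \<gamma> (0, y) (s0 + t - y) x) \<partial>std_normal_distribution) * indicator {..s0 + t} y \<partial>law1) * indicator {0<..} t" for t
  define B2 where "B2 t = (\<integral>\<^sup>+y. (\<integral>\<^sup>+x. h (free_pos \<gamma> (y, 0) (s0 + t - y) x) \<partial>std_normal_distribution) * indicator {..s0 + t} y \<partial>law2) * indicator {0<..} t" for t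
  define D where "D t = (\<integral>\<^sup>+x. h (free_pos \<gamma> z t x) \<partial>std_normal_distribution) * indicator {0<..} t" for t
  have eq: "A t + (B1 t + B2 t) = D t" for t
  proof (cases "0 < t")
    case True
    have [measurable]: "proc \<gamma> W z t \<in> borel_measurable M" using True by simp
    have "(\<integral>\<^sup>+x. h (free_pos \<gamma> z t x) \<partial>std_normal_distribution) = (\<integral>\<^sup>+\<omega>. h (proc \<gamma> W z t \<omega>) \<partial>M)"
    proof -
      have "(\<integral>\<^sup>+\<omega>. (\<lambda>w. h (fst z - w + (1 - \<gamma>) * t, snd z + w + \<gamma> * t)) (W t \<omega>) \<partial>M)
        = (\<integral>\<^sup>+x. h (fst z - sqrt t * x + (1 - \<gamma>) * t, snd z + sqrt t * x + \<gamma> * t) \<partial>std_normal_distribution)"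
        using True by (intro law_of_W) auto
      then show ?thesis by (simp add: proc_def free_pos_def)
    qed
    also have "\<dots> = (\<integral>\<^sup>+\<omega>. indicator {\<omega> \<in> space M. proc \<gamma> W z t \<omega> \<in> S \<and> ereal t < exit_time \<gamma> W z \<omega>} \<omega>
        + h (proc \<gamma> W z t \<omega>) * indicator (exits_by t) \<omega> \<partial>M)"
      by (intro nn_integral_cong) (auto simp: h_def indicator_def exits_by_def not_le)
    also have "\<dots> = emeasure M {\<omega> \<in> space M. proc \<gamma> W z t \<omega> \<in> S \<and> ereal t < exit_time \<gamma> W z \<omega>}
        + (\<integral>\<^sup>+\<omega>. h (proc \<gamma> W z t \<omega>) * indicator (exits_by t) \<omega> \<partial>M)"
      by (subst nn_integral_add) auto
    finally show ?thesis using True by (simp add: A_def B1_def B2_def D_def proc_after_exit[OF h True])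
  qed (simp add: A_def B1_def B2_def D_def)
  have pos_meas: "(\<lambda>(t, y). (\<integral>\<^sup>+x. h (free_pos \<gamma> (a y, b y) (s0 + t - y) x) \<partial>std_normal_distribution) * indicator {..s0 + t} y)
      \<in> borel_measurable (borel \<Otimes>\<^sub>M \<rho>)"
    if [measurable]: "a \<in> borel_measurable borel" "b \<in> borel_measurable borel" and [measurable_cong]: "sets \<rho> = sets borel" for a b :: "real \<Rightarrow> real" and \<rho> :: "real measure"
  proof -
    have [measurable]: "(\<lambda>q. free_pos \<gamma> (a (snd (fst q)), b (snd (fst q))) (s0 + fst (fst q) - snd (fst q)) (snd q))
      \<in> borel_measurable ((borel \<Otimes>\<^sub>M \<rho>) \<Otimes>\<^sub>M std_normal_distribution)"
      unfolding free_pos_def by measurable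
    have [measurable]: "(\<lambda>p. \<integral>\<^sup>+x. h (free_pos \<gamma> (a (snd p), b (snd p)) (s0 + fst p - snd p) x) \<partial>std_normal_distribution)
     \<in> borel_measurable (borel \<Otimes>\<^sub>M \<rho>)"
      by (rule G.borel_measurable_nn_integral) (simp add: case_prod_beta)
    show ?thesis unfolding case_prod_beta by (intro borel_measurable_times_ennreal indicator_ray_measurable) measurable
  qed
  have B[measurable]: "B1 \<in> borel_measurable borel" "B2 \<in> borel_measurable borel"
  proof -
    have "(\<lambda>t. \<integral>\<^sup>+y. (\<integral>\<^sup>+x. h (free_pos \<gamma> (0, y) (s0 + t - y) x) \<partial>std_normal_distribution) * indicator {..s0 + t} y \<partial>law1) \<in> borel_measurable borel"
      by (rule L1.borel_measurable_nn_integral[OF pos_meas[of "\<lambda>_. 0" "\<lambda>y. y" law1]]) simp_all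
    then show "B1 \<in> borel_measurable borel" unfolding B1_def[abs_def] by (intro borel_measurable_times_ennreal) auto
    have "(\<lambda>t. \<integral>\<^sup>+y. (\<integral>\<^sup>+x. h (free_pos \<gamma> (y, 0) (s0 + t - y) x) \<partial>std_normal_distribution) * indicator {..s0 + t} y \<partial>law2) \<in> borel_measurable borel"
      by (rule L2.borel_measurable_nn_integral[OF pos_meas[of "\<lambda>y. y" "\<lambda>_. 0" law2]]) simp_all
    then show "B2 \<in> borel_measurable borel" unfolding B2_def[abs_def] by (intro borel_measurable_times_ennreal) auto
  qed
  have A: "A t = D t - (B1 t + B2 t)" for t
  proof -
    have "D t \<le> 1"
      unfolding D_def using nn_integral_mono[of std_normal_distribution "\<lambda>x. h (free_pos \<gamma> z t x)" "\<lambda>_. 1"] G.emeasure_space_1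
      by (auto simp: h_def indicator_def)
    moreover have "B1 t + B2 t \<le> D t" unfolding eq[symmetric] by (rule add_increasing) auto
    ultimately have "B1 t + B2 t \<le> 1" by (rule order_trans[rotated])
    then have "B1 t + B2 t \<noteq> \<top>" by (auto simp: top_unique)
    then show ?thesis unfolding eq[symmetric] by (rule ennreal_add_diff_cancel_right[symmetric])
  qed
  have "D \<in> borel_measurable borel"
  proof -
    have [measurable]: "(\<lambda>q. free_pos \<gamma> z (fst q) (snd q)) \<in> borel_measurable (borel \<Otimes>\<^sub>M std_normal_distribution)"
      unfolding free_pos_def by measurable
    have "(\<lambda>t. \<integral>\<^sup>+x. h (free_pos \<gamma> z t x) \<partial>std_normal_distribution) \<in> borel_measurable borel"
      by (rule G.borel_measurable_nn_integral) (simp add: case_prod_beta)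
    then show ?thesis unfolding D_def[abs_def] by measurable
  qed
  then have Am[measurable]: "A \<in> borel_measurable borel"
    unfolding A[abs_def] by measurable
  have "green_measure M \<gamma> W z S = (\<integral>\<^sup>+t. A t \<partial>lborel)"
    unfolding green_measure_def
  proof (rule nn_integral_cong_AE)
    show "AE t in lborel. emeasure M {\<omega> \<in> space M. proc \<gamma> W z t \<omega> \<in> S \<and> ereal t < exit_time \<gamma> W z \<omega>} * indicator {0..} t = A t"
      using AE_lborel_singleton[of 0] by eventually_elim (auto simp: A_def indicator_def)
  qed
  moreover have "(\<integral>\<^sup>+w. indicator S w * green_loss w \<partial>lborel) = (\<integral>\<^sup>+t. B1 t \<partial>lborel) + (\<integral>\<^sup>+t. B2 t \<partial>lborel)"
  proof -
    have "(\<integral>\<^sup>+t. B1 t \<partial>lborel) = (\<integral>\<^sup>+w. h w * (\<integral>\<^sup>+y. ennreal (free_green \<gamma> (0, y) w) \<partial>law1) \<partial>lborel)"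
      unfolding B1_def by (rule loss_after_exit[OF h _ sigma_finite_laws(1) AE_laws(1)]) auto
    moreover have "(\<integral>\<^sup>+t. B2 t \<partial>lborel) = (\<integral>\<^sup>+w. h w * (\<integral>\<^sup>+y. ennreal (free_green \<gamma> (y, 0) w) \<partial>law2) \<partial>lborel)"
      unfolding B2_def by (rule loss_after_exit[OF h _ sigma_finite_laws(2) AE_laws(2)]) auto
    ultimately show ?thesis
      unfolding green_loss_def h_def distrib_left by (subst nn_integral_add) auto
  qed
  moreover have "(\<integral>\<^sup>+t. D t \<partial>lborel) = (\<integral>\<^sup>+w. indicator S w * ennreal (free_green \<gamma> z w) \<partial>lborel)"
    unfolding D_def using free_occupation[OF h] by (simp add: h_def)
  moreover have "(\<integral>\<^sup>+t. D t \<partial>lborel) = (\<integral>\<^sup>+t. A t \<partial>lborel) + ((\<integral>\<^sup>+t. B1 t \<partial>lborel) + (\<integral>\<^sup>+t. B2 t \<partial>lborel))"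
    unfolding eq[symmetric] by (subst nn_integral_add, (simp_all)[2])+ (simp add: nn_integral_add)
  ultimately show ?thesis by simp
qed

lemma green_density_formula:
  assumes g: "is_density_on quadrant (green_measure M \<gamma> W z) g"
  shows "AE w in lborel. w \<in> quadrant \<longrightarrow>
    g w = free_green \<gamma> z w - (LINT y|law1. free_green \<gamma> (0, y) w) - (LINT a|law2. free_green \<gamma> (a, 0) w)"
proof -
  have Q[measurable]: "quadrant \<in> sets borel" using open_quadrant by simp
  define f where "f w = ennreal (g w) * indicator quadrant w" for w
  have fm[measurable]: "f \<in> borel_measurable borel"
  proof -
    have "g \<in> borel_measurable (restrict_space borel quadrant)" using g by (simp add: is_density_on_def)
    then have "(\<lambda>w. ennreal (g w)) \<in> borel_measurable (restrict_space borel quadrant)" by measurable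
    then show ?thesis using borel_measurable_restrict_space_iff_ennreal[of quadrant borel "\<lambda>w. ennreal (g w)"] by (simp add: f_def[abs_def])
  qed
  define F1 where "F1 w = f w + green_loss w * indicator quadrant w" for w
  define F2 where "F2 w = ennreal (free_green \<gamma> z w) * indicator quadrant w" for w
  have [measurable]: "free_green \<gamma> z \<in> borel_measurable borel"
    using free_green_measurable[of "\<lambda>_. fst z" borel "\<lambda>_. snd z" "\<lambda>w. w"] by simp
  have [measurable]: "F1 \<in> borel_measurable borel" "F2 \<in> borel_measurable borel"
    unfolding F1_def[abs_def] F2_def[abs_def] by measurable
  have "density lborel F1 = density lborel F2"
  proof (rule measure_eqI)
    fix A assume "A \<in> sets (density lborel F1)"
    then have [measurable]: "A \<in> sets borel" by simp
    let ?S = "A \<inter> quadrant"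
    have "emeasure (density lborel F1) A = (\<integral>\<^sup>+w. F1 w * indicator A w \<partial>lborel)"
      by (rule emeasure_density) auto
    also have "\<dots> = (\<integral>\<^sup>+w. ennreal (g w) * indicator ?S w + indicator ?S w * green_loss w \<partial>lborel)"
      by (intro nn_integral_cong) (auto simp: F1_def f_def indicator_def)
    also have "\<dots> = (\<integral>\<^sup>+w. ennreal (g w) * indicator ?S w \<partial>lborel) + (\<integral>\<^sup>+w. indicator ?S w * green_loss w \<partial>lborel)"
    proof (rule nn_integral_add)
      have "(\<lambda>w. f w * indicator A w) \<in> borel_measurable lborel" by measurable
      then show "(\<lambda>w. ennreal (g w) * indicator ?S w) \<in> borel_measurable lborel"
        by (rule measurable_cong[THEN iffD1, rotated]) (auto simp: f_def indicator_def)
    qed measurable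
    also have "(\<integral>\<^sup>+w. ennreal (g w) * indicator ?S w \<partial>lborel) = green_measure M \<gamma> W z ?S"
      using g by (auto simp: is_density_on_def)
    also have "\<dots> + (\<integral>\<^sup>+w. indicator ?S w * green_loss w \<partial>lborel) = (\<integral>\<^sup>+w. indicator ?S w * ennreal (free_green \<gamma> z w) \<partial>lborel)"
      by (rule green_measure_decomposition) simp
    also have "\<dots> = (\<integral>\<^sup>+w. F2 w * indicator A w \<partial>lborel)"
      by (intro nn_integral_cong) (auto simp: F2_def indicator_def)
    also have "\<dots> = emeasure (density lborel F2) A"
      by (rule emeasure_density[symmetric]) auto
    finally show "emeasure (density lborel F1) A = emeasure (density lborel F2) A" .
  qed simp
  then have "AE w in lborel. F1 w = F2 w" by (intro sigma_finite_measure.density_unique[OF sigma_finite_lborel]) auto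
  then show ?thesis
  proof eventually_elim
    fix w assume eq: "F1 w = F2 w"
    show "w \<in> quadrant \<longrightarrow>
      g w = free_green \<gamma> z w - (LINT y|law1. free_green \<gamma> (0, y) w) - (LINT a|law2. free_green \<gamma> (a, 0) w)"
    proof
      assume w: "w \<in> quadrant"
      have g0: "0 \<le> g w" using g w by (simp add: is_density_on_def)
      let ?I1 = "\<integral>\<^sup>+y. ennreal (free_green \<gamma> (0, y) w) \<partial>law1" and ?I2 = "\<integral>\<^sup>+a. ennreal (free_green \<gamma> (a, 0) w) \<partial>law2"
      have e: "ennreal (g w) + (?I1 + ?I2) = ennreal (free_green \<gamma> z w)"
        using eq w by (simp add: F1_def F2_def f_def green_loss_def)
      then have "ennreal (g w) + (?I1 + ?I2) < \<top>" by simp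
      then have fin: "?I1 < \<infinity>" "?I2 < \<infinity>" by (auto simp: less_top)
      have i1: "integrable law1 (\<lambda>y. free_green \<gamma> (0, y) w)" and i2: "integrable law2 (\<lambda>a. free_green \<gamma> (a, 0) w)"
        using fin by (auto intro!: integrableI_nonneg simp: free_green_nonneg)
      have "ennreal (g w) + (ennreal (LINT y|law1. free_green \<gamma> (0, y) w) + ennreal (LINT a|law2. free_green \<gamma> (a, 0) w))
        = ennreal (free_green \<gamma> z w)"
        using e i1 i2 by (simp add: nn_integral_eq_integral free_green_nonneg)
      then show "g w = free_green \<gamma> z w - (LINT y|law1. free_green \<gamma> (0, y) w) - (LINT a|law2. free_green \<gamma> (a, 0) w)"
        using g0 by (simp add: ennreal_plus[symmetric] free_green_nonneg Bochner_Integration.integral_nonneg del: ennreal_plus)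
    qed
  qed
qed

end

section \<open>The Green's density divided by its Gaussian factor\<close>

text \<open>The quotient of \<open>free_green \<gamma> (a, b)\<close> by the Gaussian factor common to all
  starting points, as a function of the direction \<open>u\<close> and the inverse
  \<open>r\<close> of the coordinate sum of the target.\<close>

definition green_ratio :: "real \<Rightarrow> real \<Rightarrow> real \<Rightarrow> real \<Rightarrow> real \<Rightarrow> real" where
  "green_ratio \<gamma> u r a b = (if r * (a + b) < 1 then sqrt (1 / (1 - r * (a + b))) *
     exp (par_p \<gamma> u * a + par_q \<gamma> u * b - r * (u * a - (1 - u) * b)\<^sup>2 / (2 * (1 - r * (a + b)))) else 0)"

lemma green_ratio_measurable [measurable]:
  assumes [measurable]: "a \<in> borel_measurable N" "b \<in> borel_measurable N"
  shows "(\<lambda>x. green_ratio \<gamma> u r (a x) (b x)) \<in> borel_measurable N"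
  unfolding green_ratio_def by measurable

lemma free_green_ratio:
  assumes \<sigma>: "\<sigma> = fst w + snd w" "0 < \<sigma>"
  shows "free_green \<gamma> (a, b) w = green_ratio \<gamma> (snd w / \<sigma>) (1 / \<sigma>) a b
    * (exp (- (snd w - \<gamma> * \<sigma>)\<^sup>2 / (2 * \<sigma>)) / sqrt (2 * pi * \<sigma>))"
proof -
  define u t y where "u = snd w / \<sigma>" and "t = \<sigma> - a - b" and "y = snd w"
  have y: "y = u * \<sigma>" using \<sigma> by (simp add: u_def y_def)
  have st: "\<sigma> = t + a + b" by (simp add: t_def)
  have iff: "1 / \<sigma> * (a + b) < 1 \<longleftrightarrow> 0 < t" using \<sigma> by (simp add: t_def field_simps)
  show ?thesis
  proof (cases "0 < t")
    case False
    then show ?thesis using iff \<sigma> by (simp add: free_green_def green_ratio_def t_def Let_def)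
  next
    case True
    have r: "1 - 1 / \<sigma> * (a + b) = t / \<sigma>" using \<sigma> by (simp add: t_def field_simps)
    define c where "c = u * a - (1 - u) * b"
    have "1 / x * q / (2 * (t / x)) = q / (2 * t)" if "0 < x" for x q :: real
      using True that by (simp add: field_simps)
    then have e1: "1 / \<sigma> * c\<^sup>2 / (2 * (t / \<sigma>)) = c\<^sup>2 / (2 * t)" using \<sigma>(2) by blast
    have yt: "y - (b + \<gamma> * t) = (u - \<gamma>) * t + c" "y - \<gamma> * \<sigma> = (u - \<gamma>) * \<sigma>"
      unfolding y c_def st by (simp_all add: algebra_simps)
    have sq1: "((u - \<gamma>) * t + c)\<^sup>2 / (2 * t) = (u - \<gamma>)\<^sup>2 * t / 2 + (u - \<gamma>) * c + c\<^sup>2 / (2 * t)"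
      using True by (simp add: power2_eq_square field_simps)
    have sq2: "((u - \<gamma>) * \<sigma>)\<^sup>2 / (2 * \<sigma>) = (u - \<gamma>)\<^sup>2 * (t + a + b) / 2"
    proof -
      have "((u - \<gamma>) * x)\<^sup>2 / (2 * x) = (u - \<gamma>)\<^sup>2 * x / 2" if "0 < x" for x
        using that by (simp add: power2_eq_square)
      from this[OF \<sigma>(2)] show ?thesis by (simp only: st[symmetric])
    qed
    have lin: "par_p \<gamma> u * a + par_q \<gamma> u * b = (u - \<gamma>)\<^sup>2 * (a + b) / 2 - (u - \<gamma>) * c"
      unfolding par_p_def par_q_def c_def by (simp add: power2_eq_square field_simps)
    have ex: "- (y - (b + \<gamma> * t))\<^sup>2 / (2 * t)
      = (par_p \<gamma> u * a + par_q \<gamma> u * b - c\<^sup>2 / (2 * t)) + - (y - \<gamma> * \<sigma>)\<^sup>2 / (2 * \<sigma>)"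
      unfolding yt minus_divide_left[symmetric] sq1 sq2 lin by (simp add: field_simps)
    have nd: "free_green \<gamma> (a, b) w = 1 / sqrt (2 * pi * t) * exp (- (y - (b + \<gamma> * t))\<^sup>2 / (2 * t))"
      using True by (simp add: free_green_def Let_def t_def \<sigma>(1) normal_density_def y_def algebra_simps)
    have "1 / sqrt (2 * pi * t) = sqrt (1 / (t / \<sigma>)) / sqrt (2 * pi * \<sigma>)"
    proof -
      have "1 / sqrt (2 * pi * t) = sqrt (1 / (t / x)) / sqrt (2 * pi * x)" if "0 < x" for x
        using that True by (simp add: real_sqrt_mult real_sqrt_divide)
      from this[OF \<sigma>(2)] show ?thesis .
    qed
    moreover have "green_ratio \<gamma> u (1 / \<sigma>) a b = sqrt (1 / (t / \<sigma>)) * exp (par_p \<gamma> u * a + par_q \<gamma> u * b - c\<^sup>2 / (2 * t))"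
      unfolding green_ratio_def r c_def[symmetric] e1 using True iff by simp
    ultimately show ?thesis
      unfolding nd ex exp_add u_def[symmetric] unfolding y_def[symmetric] by simp
  qed
qed

text \<open>The square root blows up when the starting point comes close to the line through the target
  where the elapsed time is zero; the exponential factor compensates, because \<open>d\<close>
  keeps the direction away from the axis. This gives an integrable bound that is uniform near
  \<open>r = 0\<close>.\<close>

lemma ratio_bound:
  assumes d: "0 < d" and m: "0 < m" "m \<le> y" and r: "0 < r" "r * y < 1" and D: "d \<le> D"
  shows "sqrt (1 / (1 - r * y)) * exp (- (r * (D * y)\<^sup>2 / (2 * (1 - r * y)))) \<le> 2 + 4 / (d\<^sup>2 * m)"
proof -
  define \<rho> where "\<rho> = 1 - r * y"
  have y: "0 < y" using m by simp
  have \<rho>: "0 < \<rho>" "\<rho> < 1" using r y by (auto simp: \<rho>_def)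
  have pos: "0 < 4 / (d\<^sup>2 * m)" using d m by simp
  show ?thesis
  proof (cases "r * y \<le> 1 / 2")
    case True
    then have "1 / \<rho> \<le> 4" using \<rho> by (simp add: \<rho>_def field_simps)
    then have "sqrt (1 / \<rho>) \<le> 2" by (simp add: real_le_lsqrt)
    moreover have "exp (- (r * (D * y)\<^sup>2 / (2 * \<rho>))) \<le> 1" using r \<rho> by simp
    ultimately have "sqrt (1 / \<rho>) * exp (- (r * (D * y)\<^sup>2 / (2 * \<rho>))) \<le> 2 * 1"
      using \<rho> by (intro mult_mono) auto
    then show ?thesis using pos unfolding \<rho>_def by linarith
  next
    case False
    define k where "k = d\<^sup>2 * m / 4"
    have k: "0 < k" using d m by (simp add: k_def)
    have "k * (1 / \<rho>) \<le> r * (D * y)\<^sup>2 / (2 * \<rho>)"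
    proof -
      have "d\<^sup>2 \<le> D\<^sup>2" using d D by (intro power_mono) auto
      then have "d\<^sup>2 * m * (1 / 2) \<le> D\<^sup>2 * y * (r * y)" using False m y r by (intro mult_mono) auto
      then have "d\<^sup>2 * m * (1 / 2) / (2 * \<rho>) \<le> D\<^sup>2 * y * (r * y) / (2 * \<rho>)" using \<rho> by (intro divide_right_mono) auto
      then show ?thesis by (simp add: k_def power2_eq_square algebra_simps)
    qed
    then have e: "exp (- (r * (D * y)\<^sup>2 / (2 * \<rho>))) \<le> exp (- k * (1 / \<rho>))" by simp
    have "1 \<le> 1 / \<rho>" using \<rho> by simp
    then have "sqrt (1 / \<rho>) \<le> 1 / \<rho>" using mult_left_mono[of 1 "1/\<rho>" "1/\<rho>"] \<rho>
      by (intro real_le_lsqrt) (auto simp: power2_eq_square)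
    then have "sqrt (1 / \<rho>) * exp (- (r * (D * y)\<^sup>2 / (2 * \<rho>))) \<le> 1 / \<rho> * exp (- k * (1 / \<rho>))"
      using e \<rho> by (intro mult_mono) auto
    also have "\<dots> \<le> 1 / k" by (rule mult_exp_neg_le[OF k])
    also have "\<dots> \<le> 2 + 4 / (d\<^sup>2 * m)" by (simp add: k_def)
    finally show ?thesis by (simp add: \<rho>_def)
  qed
qed

lemma green_ratio_tendsto:
  assumes u: "u \<longlonglongrightarrow> v" and r: "r \<longlonglongrightarrow> 0"
  shows "(\<lambda>n. green_ratio \<gamma> (u n) (r n) a b) \<longlonglongrightarrow> exp (par_p \<gamma> v * a + par_q \<gamma> v * b)"
proof -
  have "(\<lambda>n. r n * (a + b)) \<longlonglongrightarrow> 0 * (a + b)" by (intro tendsto_intros r)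
  then have "\<forall>\<^sub>F n in sequentially. r n * (a + b) < 1" by (intro order_tendstoD) auto
  then have ev: "\<forall>\<^sub>F n in sequentially. green_ratio \<gamma> (u n) (r n) a b = sqrt (1 / (1 - r n * (a + b))) *
     exp (par_p \<gamma> (u n) * a + par_q \<gamma> (u n) * b - r n * (u n * a - (1 - u n) * b)\<^sup>2 / (2 * (1 - r n * (a + b))))"
    by eventually_elim (simp add: green_ratio_def)
  have "(\<lambda>n. sqrt (1 / (1 - r n * (a + b))) *
     exp (par_p \<gamma> (u n) * a + par_q \<gamma> (u n) * b - r n * (u n * a - (1 - u n) * b)\<^sup>2 / (2 * (1 - r n * (a + b)))))
     \<longlonglongrightarrow> sqrt (1 / (1 - 0 * (a + b))) *
     exp (par_p \<gamma> v * a + par_q \<gamma> v * b - 0 * (v * a - (1 - v) * b)\<^sup>2 / (2 * (1 - 0 * (a + b))))"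
    unfolding par_p_def par_q_def by (intro tendsto_intros u r) auto
  then show ?thesis using tendsto_cong[OF ev] by simp
qed

text \<open>A violation would persist on a nonempty open set, which has positive Lebesgue measure. This
  upgrades density identities, which hold almost everywhere, to statements about a continuous
  version.\<close>

lemma AE_continuous_closed:
  fixes f :: "'b::euclidean_space \<Rightarrow> real"
  assumes U: "open U" and f: "continuous_on U f" and ae: "AE w in lborel. w \<in> U \<longrightarrow> f w \<in> C"
    and C: "closed C" and w: "w \<in> U"
  shows "f w \<in> C"
proof (rule ccontr)
  assume "f w \<notin> C"
  define V where "V = U \<inter> f -` (- C)"
  have "open V" unfolding V_def using U C by (intro continuous_open_preimage[OF f]) auto
  moreover have "AE x\<in>V in lebesgue. x \<in> {}"
  proof (rule AE_completion)
    show "AE x\<in>V in lborel. x \<in> {}" using ae by eventually_elim (auto simp: V_def)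
  qed
  ultimately have "w \<in> {}"
    using \<open>f w \<notin> C\<close> w by (intro mem_closed_if_AE_lebesgue_open[of V "{}"]) (auto simp: V_def)
  then show False by simp
qed

context quadrant_process
begin

definition green_factor :: "real \<Rightarrow> real \<Rightarrow> real" where
  "green_factor u r = green_ratio \<gamma> u r (fst z) (snd z)
     - (LINT y|law1. green_ratio \<gamma> u r 0 y) - (LINT a|law2. green_ratio \<gamma> u r a 0)"

lemma green_density_factor:
  assumes g: "is_density_on quadrant (green_measure M \<gamma> W z) g"
  shows "AE w in lborel. w \<in> quadrant \<longrightarrow>
    g w = green_factor (snd w / (fst w + snd w)) (1 / (fst w + snd w))
      * (exp (- (snd w - \<gamma> * (fst w + snd w))\<^sup>2 / (2 * (fst w + snd w))) / sqrt (2 * pi * (fst w + snd w)))"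
  using green_density_formula[OF g]
proof eventually_elim
  fix w :: "real \<times> real"
  assume f: "w \<in> quadrant \<longrightarrow>
    g w = free_green \<gamma> z w - (LINT y|law1. free_green \<gamma> (0, y) w) - (LINT a|law2. free_green \<gamma> (a, 0) w)"
  show "w \<in> quadrant \<longrightarrow>
    g w = green_factor (snd w / (fst w + snd w)) (1 / (fst w + snd w))
      * (exp (- (snd w - \<gamma> * (fst w + snd w))\<^sup>2 / (2 * (fst w + snd w))) / sqrt (2 * pi * (fst w + snd w)))"
  proof
    assume w: "w \<in> quadrant"
    define \<sigma> where "\<sigma> = fst w + snd w"
    have "0 < \<sigma>" using w by (auto simp: \<sigma>_def quadrant_def)
    note fg = free_green_ratio[OF \<sigma>_def this, of \<gamma>]
    show "g w = green_factor (snd w / (fst w + snd w)) (1 / (fst w + snd w))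
      * (exp (- (snd w - \<gamma> * (fst w + snd w))\<^sup>2 / (2 * (fst w + snd w))) / sqrt (2 * pi * (fst w + snd w)))"
      using f[rule_format, OF w]
      unfolding fg fg[of "fst z" "snd z", unfolded prod.collapse] \<sigma>_def[symmetric] green_factor_def
      by (simp only: integral_mult_left_zero left_diff_distrib)
  qed
qed

text \<open>Dominated convergence under both exit laws. The directions \<open>u\<close> stay between two
  numbers \<open>lo\<close> and \<open>hi\<close> strictly between 0 and 1, and the exponential
  moments at these two parameters are finite.\<close>

lemma green_factor_tendsto:
  assumes v: "0 < v" "v < 1" and u: "u \<longlonglongrightarrow> v" and r: "r \<longlonglongrightarrow> 0" "\<And>n. 0 < r n"
  shows "(\<lambda>n. green_factor (u n) (r n)) \<longlonglongrightarrow> hfun v"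
proof -
  define hi lo where "hi = (1 + v) / 2" and "lo = v / 2"
  have hl: "v < hi" "hi < 1" "0 < lo" "lo < v" using v by (auto simp: hi_def lo_def)
  have "\<forall>\<^sub>F n in sequentially. lo < u n \<and> u n < hi"
    using order_tendstoD[OF u] hl by (intro eventually_conj) auto
  then obtain N where N: "\<And>n. N \<le> n \<Longrightarrow> lo < u n \<and> u n < hi" by (auto simp: eventually_sequentially)
  define u' r' where "u' n = u (n + N)" and "r' n = r (n + N)" for n
  have u': "lo < u' n" "u' n < hi" and r': "0 < r' n" for n using N[of "n + N"] r(2) by (auto simp: u'_def r'_def)
  have lim: "u' \<longlonglongrightarrow> v" "r' \<longlonglongrightarrow> 0"
    unfolding u'_def r'_def by (intro LIMSEQ_ignore_initial_segment u r)+
  define K1 K2 where "K1 = 2 + 4 / ((1 - hi)\<^sup>2 * s0)" and "K2 = 2 + 4 / (lo\<^sup>2 * s0)"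
  have K: "0 \<le> K1" "0 \<le> K2" using z_pos by (auto simp: K1_def K2_def)
  have "(\<lambda>n. LINT y|law1. green_ratio \<gamma> (u' n) (r' n) 0 y) \<longlonglongrightarrow> (LINT y|law1. exp (par_p \<gamma> v * 0 + par_q \<gamma> v * y))"
  proof (rule integral_dominated_convergence[where w="\<lambda>y. K1 * exp (par_q \<gamma> hi * y)"])
    show "integrable law1 (\<lambda>y. K1 * exp (par_q \<gamma> hi * y))"
      using hl by (intro integrable_mult_right exp_moment_integrable par_less) auto
    show "AE y in law1. (\<lambda>n. green_ratio \<gamma> (u' n) (r' n) 0 y) \<longlonglongrightarrow> exp (par_p \<gamma> v * 0 + par_q \<gamma> v * y)"
      by (intro AE_I2 green_ratio_tendsto lim)
    fix n
    show "AE y in law1. norm (green_ratio \<gamma> (u' n) (r' n) 0 y) \<le> K1 * exp (par_q \<gamma> hi * y)"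
      using AE_laws(1)
    proof eventually_elim
      fix y assume y: "s0 < y"
      show "norm (green_ratio \<gamma> (u' n) (r' n) 0 y) \<le> K1 * exp (par_q \<gamma> hi * y)"
      proof (cases "r' n * y < 1")
        case True
        have "(1 - hi)\<^sup>2 \<le> (1 - u' n)\<^sup>2" using u'[of n] hl by (intro power_mono) auto
        then have "par_q \<gamma> (u' n) \<le> par_q \<gamma> hi" by (simp add: par_q_def)
        then have q: "exp (par_q \<gamma> (u' n) * y) \<le> exp (par_q \<gamma> hi * y)" using y z_pos by (auto intro!: mult_right_mono)
        have "sqrt (1 / (1 - r' n * y)) * exp (- (r' n * ((1 - u' n) * y)\<^sup>2 / (2 * (1 - r' n * y)))) \<le> K1"
          unfolding K1_def using hl z_pos y r' u'[of n] True by (intro ratio_bound) auto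
        then have "(sqrt (1 / (1 - r' n * y)) * exp (- (r' n * ((1 - u' n) * y)\<^sup>2 / (2 * (1 - r' n * y))))) * exp (par_q \<gamma> (u' n) * y)
          \<le> K1 * exp (par_q \<gamma> hi * y)" using q K by (intro mult_mono) auto
        moreover have "green_ratio \<gamma> (u' n) (r' n) 0 y =
          (sqrt (1 / (1 - r' n * y)) * exp (- (r' n * ((1 - u' n) * y)\<^sup>2 / (2 * (1 - r' n * y))))) * exp (par_q \<gamma> (u' n) * y)"
        proof -
          have "(u' n * 0 - (1 - u' n) * y)\<^sup>2 = ((1 - u' n) * y)\<^sup>2" by (simp add: power2_eq_square)
          then show ?thesis using True unfolding green_ratio_def by (simp add: mult.assoc mult_exp_exp)
        qed
        ultimately show ?thesis using True by simp
      qed (use K in \<open>simp add: green_ratio_def\<close>)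
    qed
  qed auto
  moreover have "(\<lambda>n. LINT a|law2. green_ratio \<gamma> (u' n) (r' n) a 0) \<longlonglongrightarrow> (LINT a|law2. exp (par_p \<gamma> v * a + par_q \<gamma> v * 0))"
  proof (rule integral_dominated_convergence[where w="\<lambda>y. K2 * exp (par_p \<gamma> lo * y)"])
    show "integrable law2 (\<lambda>y. K2 * exp (par_p \<gamma> lo * y))"
      using hl by (intro integrable_mult_right exp_moment_integrable par_less) auto
    show "AE y in law2. (\<lambda>n. green_ratio \<gamma> (u' n) (r' n) y 0) \<longlonglongrightarrow> exp (par_p \<gamma> v * y + par_q \<gamma> v * 0)"
      by (intro AE_I2 green_ratio_tendsto lim)
    fix n
    show "AE y in law2. norm (green_ratio \<gamma> (u' n) (r' n) y 0) \<le> K2 * exp (par_p \<gamma> lo * y)"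
      using AE_laws(2)
    proof eventually_elim
      fix y assume y: "s0 < y"
      show "norm (green_ratio \<gamma> (u' n) (r' n) y 0) \<le> K2 * exp (par_p \<gamma> lo * y)"
      proof (cases "r' n * y < 1")
        case True
        have "lo\<^sup>2 \<le> (u' n)\<^sup>2" using u'[of n] hl by (intro power_mono) auto
        then have "par_p \<gamma> (u' n) \<le> par_p \<gamma> lo" by (simp add: par_p_def)
        then have q: "exp (par_p \<gamma> (u' n) * y) \<le> exp (par_p \<gamma> lo * y)" using y z_pos by (auto intro!: mult_right_mono)
        have "sqrt (1 / (1 - r' n * y)) * exp (- (r' n * (u' n * y)\<^sup>2 / (2 * (1 - r' n * y)))) \<le> K2"
          unfolding K2_def using hl z_pos y r' u'[of n] True by (intro ratio_bound) auto
        then have "(sqrt (1 / (1 - r' n * y)) * exp (- (r' n * (u' n * y)\<^sup>2 / (2 * (1 - r' n * y))))) * exp (par_p \<gamma> (u' n) * y)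
          \<le> K2 * exp (par_p \<gamma> lo * y)" using q K by (intro mult_mono) auto
        moreover have "green_ratio \<gamma> (u' n) (r' n) y 0 =
          (sqrt (1 / (1 - r' n * y)) * exp (- (r' n * (u' n * y)\<^sup>2 / (2 * (1 - r' n * y))))) * exp (par_p \<gamma> (u' n) * y)"
          using True by (simp add: green_ratio_def mult.assoc mult_exp_exp)
        ultimately show ?thesis using True by simp
      qed (use K in \<open>simp add: green_ratio_def\<close>)
    qed
  qed auto
  ultimately have "(\<lambda>n. green_factor (u' n) (r' n)) \<longlonglongrightarrow> exp (par_p \<gamma> v * fst z + par_q \<gamma> v * snd z)
     - (LINT y|law1. exp (par_p \<gamma> v * 0 + par_q \<gamma> v * y)) - (LINT a|law2. exp (par_p \<gamma> v * a + par_q \<gamma> v * 0))"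
    unfolding green_factor_def by (intro tendsto_diff green_ratio_tendsto lim)
  then have "(\<lambda>n. green_factor (u (n + N)) (r (n + N))) \<longlonglongrightarrow> hfun v"
    by (simp add: hfun_def par_exp_def lap1_def lap2_def u'_def r'_def)
  then show ?thesis by (rule LIMSEQ_offset)
qed

lemma green_factor_near:
  assumes v: "0 < v" "v < 1" and e: "0 < e"
  obtains d where "0 < d" "\<And>u r. \<bar>u - v\<bar> < d \<Longrightarrow> 0 < r \<Longrightarrow> r < d \<Longrightarrow> \<bar>green_factor u r - hfun v\<bar> < e"
proof (rule ccontr)
  assume no: "\<not> thesis"
  note delta = that
  have "\<exists>u r. \<bar>u - v\<bar> < d \<and> 0 < r \<and> r < d \<and> \<not> \<bar>green_factor u r - hfun v\<bar> < e" if "0 < d" for d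
    using no delta[of d] that by blast
  then have "\<forall>n. \<exists>u r. \<bar>u - v\<bar> < inverse (real (Suc n)) \<and> 0 < r \<and> r < inverse (real (Suc n)) \<and> \<not> \<bar>green_factor u r - hfun v\<bar> < e"
    by simp
  then obtain u r where ur: "\<And>n. \<bar>u n - v\<bar> < inverse (real (Suc n))" "\<And>n. 0 < r n" "\<And>n. r n < inverse (real (Suc n))"
    "\<And>n. \<not> \<bar>green_factor (u n) (r n) - hfun v\<bar> < e" by metis
  have "r \<longlonglongrightarrow> 0"
    by (rule tendsto_sandwich[OF _ _ tendsto_const LIMSEQ_inverse_real_of_nat])
       (use ur(2,3) in \<open>auto intro!: always_eventually less_imp_le\<close>)
  moreover have "(\<lambda>n. u n - v) \<longlonglongrightarrow> 0"
    by (rule Lim_null_comparison[OF _ LIMSEQ_inverse_real_of_nat])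
       (use ur(1) in \<open>auto intro!: always_eventually less_imp_le\<close>)
  then have "u \<longlonglongrightarrow> v" by (simp add: LIM_zero_iff)
  ultimately have "(\<lambda>n. green_factor (u n) (r n)) \<longlonglongrightarrow> hfun v" using green_factor_tendsto[OF v] ur(2) by blast
  from tendstoD[OF this e] have "\<forall>\<^sub>F n in sequentially. \<bar>green_factor (u n) (r n) - hfun v\<bar> < e" by (simp add: dist_real_def)
  then show False using ur(4) by (auto simp: eventually_sequentially)
qed

end

section \<open>Saddle points and limits along directions\<close>

text \<open>The parameter on the parabola of the saddle point in direction \<open>\<alpha>\<close>.\<close>

definition dir_par :: "real \<Rightarrow> real" where
  "dir_par \<alpha> = sin \<alpha> / (cos \<alpha> + sin \<alpha>)"

text \<open>The parametrisation covers the whole zero set of the kernel.\<close>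

lemma kernel_zero_iff:
  "kernel \<gamma> p q = 0 \<longleftrightarrow> p = par_p \<gamma> (q - p + \<gamma>) \<and> q = par_q \<gamma> (q - p + \<gamma>)"
proof
  assume k: "kernel \<gamma> p q = 0"
  have "par_p \<gamma> (q - p + \<gamma>) = p - kernel \<gamma> p q" "par_q \<gamma> (q - p + \<gamma>) = q - kernel \<gamma> p q"
    by (simp_all add: par_p_def par_q_def kernel_def power2_eq_square field_simps)
  with k show "p = par_p \<gamma> (q - p + \<gamma>) \<and> q = par_q \<gamma> (q - p + \<gamma>)" by simp
next
  assume "p = par_p \<gamma> (q - p + \<gamma>) \<and> q = par_q \<gamma> (q - p + \<gamma>)"
  then show "kernel \<gamma> p q = 0" using kernel_par by metis
qed

text \<open>Along the parabola the objective is a quadratic polynomial in \<open>v\<close>; completing the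
  square shows its unique maximiser.\<close>

lemma saddle_objective:
  assumes "c + s \<noteq> (0 :: real)"
  shows "par_p \<gamma> v * c + par_q \<gamma> v * s
    = (\<gamma>\<^sup>2 * c + (1 - \<gamma>)\<^sup>2 * s - c * s / (c + s) - (c + s) * (v - s / (c + s))\<^sup>2) / 2"
proof -
  define m w where "m = c + s" and "w = s / m"
  have s: "s = w * m" and c: "c = m - w * m" using assms by (auto simp: m_def w_def)
  have cs: "c * s / (c + s) = (m - w * m) * w" "s / (c + s) = w" "c + s = m"
    using c by (simp_all add: m_def w_def)
  show ?thesis unfolding cs unfolding s c
    by (simp add: par_p_def par_q_def power2_eq_square field_simps)
qed

lemma is_saddle_iff:
  assumes "0 < cos \<alpha> + sin \<alpha>"
  shows "is_saddle \<gamma> \<alpha> z \<longleftrightarrow> z = (par_p \<gamma> (dir_par \<alpha>), par_q \<gamma> (dir_par \<alpha>))"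
proof -
  define c s where "c = cos \<alpha>" and "s = sin \<alpha>"
  define v where "v = s / (c + s)"
  have cs: "0 < c + s" using assms by (simp add: c_def s_def)
  define Ob where "Ob w = par_p \<gamma> w * c + par_q \<gamma> w * s" for w
  have Ob: "Ob v - Ob w = (c + s) * (w - v)\<^sup>2 / 2" for w
  proof -
    have "c + s \<noteq> 0" using cs by simp
    then show ?thesis unfolding Ob_def saddle_objective[OF \<open>c + s \<noteq> 0\<close>] v_def[symmetric]
      by (simp only: diff_divide_distrib[symmetric]) simp
  qed
  show ?thesis
  proof
    assume sad: "is_saddle \<gamma> \<alpha> z"
    obtain p q where z: "z = (p, q)" by (cases z)
    have k: "kernel \<gamma> p q = 0" and mx: "\<And>p' q'. kernel \<gamma> p' q' = 0 \<Longrightarrow> \<not> p * c + q * s < p' * c + q' * s"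
      using sad by (auto simp: is_saddle_def is_arg_max_def z c_def s_def)
    define w where "w = q - p + \<gamma>"
    have pq: "p = par_p \<gamma> w" "q = par_q \<gamma> w" using k by (auto simp: kernel_zero_iff w_def)
    have "\<not> Ob w < Ob v" using mx[OF kernel_par[of \<gamma> v]] by (simp add: Ob_def pq)
    then have "(c + s) * (w - v)\<^sup>2 / 2 \<le> 0" using Ob[of w] by linarith
    then have "(w - v)\<^sup>2 \<le> 0" using cs by (simp add: mult_le_0_iff)
    then have "w = v" by simp
    then show "z = (par_p \<gamma> (dir_par \<alpha>), par_q \<gamma> (dir_par \<alpha>))"
      by (simp add: z pq dir_par_def v_def c_def s_def)
  next
    assume z: "z = (par_p \<gamma> (dir_par \<alpha>), par_q \<gamma> (dir_par \<alpha>))"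
    have "p' * c + q' * s \<le> Ob v" if "kernel \<gamma> p' q' = 0" for p' q'
    proof -
      define w where "w = q' - p' + \<gamma>"
      have pq: "p' = par_p \<gamma> w" "q' = par_q \<gamma> w" using that by (auto simp: kernel_zero_iff w_def)
      have "0 \<le> (c + s) * (w - v)\<^sup>2 / 2" using cs by simp
      then show ?thesis using Ob[of w] by (simp add: Ob_def pq)
    qed
    then show "is_saddle \<gamma> \<alpha> z"
      by (auto simp: is_saddle_def is_arg_max_def z kernel_par not_less Ob_def dir_par_def v_def c_def s_def)
  qed
qed

lemma saddle_eq:
  assumes "0 < cos \<alpha> + sin \<alpha>"
  shows "saddle \<gamma> \<alpha> = (par_p \<gamma> (dir_par \<alpha>), par_q \<gamma> (dir_par \<alpha>))"
proof -
  have "saddle \<gamma> \<alpha> = (SOME z. is_saddle \<gamma> \<alpha> z)"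
    by (simp add: saddle_def arg_max_def is_saddle_def)
  then show ?thesis using is_saddle_iff[OF assms] by simp
qed

lemma dir_par_tan:
  assumes "0 < cos \<alpha>"
  shows "dir_par \<alpha> = tan \<alpha> / (1 + tan \<alpha>)"
  using assms by (simp add: dir_par_def tan_def field_simps)

lemma quarter_trig:
  assumes "0 < \<alpha>" "\<alpha> < pi / 2"
  shows "0 < cos \<alpha>" "0 < sin \<alpha>" "0 < tan \<alpha>" "0 < dir_par \<alpha>" "dir_par \<alpha> < 1"
proof -
  show c: "0 < cos \<alpha>" and s: "0 < sin \<alpha>" and "0 < tan \<alpha>"
    using assms by (auto intro: cos_gt_zero sin_gt_zero2 tan_gt_zero)
  show "0 < dir_par \<alpha>" "dir_par \<alpha> < 1" using c s by (auto simp: dir_par_def field_simps)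
qed

text \<open>At the angle of \<open>w\<close> itself, the maximum of the objective is the exponent in the
  Gaussian factor of the density.\<close>

lemma angle_saddle:
  assumes w: "w \<in> quadrant"
  shows "w \<bullet> saddle \<gamma> (angle w) = (snd w - \<gamma> * (fst w + snd w))\<^sup>2 / (2 * (fst w + snd w))"
proof -
  define x y where "x = fst w" and "y = snd w"
  have xy: "0 < x" "0 < y" using w by (auto simp: x_def y_def quadrant_def)
  define \<theta> where "\<theta> = arctan (y / x)"
  have "0 < \<theta>" "\<theta> < pi / 2" using xy arctan_bounded by (auto simp: \<theta>_def zero_less_arctan_iff)
  note t = quarter_trig[OF this]
  have "tan \<theta> = y / x" by (simp add: \<theta>_def tan_arctan)
  then have "dir_par \<theta> = (y / x) / (1 + y / x)" using dir_par_tan[OF t(1)] by simp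
  then have dp: "dir_par \<theta> = y / (x + y)" using xy by (simp add: field_simps)
  have "saddle \<gamma> \<theta> = (par_p \<gamma> (y / (x + y)), par_q \<gamma> (y / (x + y)))"
    using t saddle_eq[of \<theta> \<gamma>] by (simp add: dp)
  then have "w \<bullet> saddle \<gamma> (angle w) = par_p \<gamma> (y / (x + y)) * x + par_q \<gamma> (y / (x + y)) * y"
    by (simp add: angle_def \<theta>_def x_def y_def inner_prod_def mult.commute)
  also have "\<dots> = (\<gamma>\<^sup>2 * x + (1 - \<gamma>)\<^sup>2 * y - x * y / (x + y)) / 2"
    using xy by (subst saddle_objective) auto
  also have "\<dots> = (y - \<gamma> * (x + y))\<^sup>2 / (2 * (x + y))"
    using xy by (simp add: power2_eq_square field_simps)
  finally show ?thesis by (simp add: x_def y_def)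
qed

lemma to_infinity_dir_facts:
  assumes \<alpha>: "0 < \<alpha>" "\<alpha> < pi / 2"
  shows "\<forall>\<^sub>F w in to_infinity_dir \<alpha>. w \<in> quadrant"
    "((\<lambda>w. snd w / fst w) \<longlongrightarrow> tan \<alpha>) (to_infinity_dir \<alpha>)"
    "filterlim norm at_top (to_infinity_dir \<alpha>)"
    "((\<lambda>w. snd w / (fst w + snd w)) \<longlongrightarrow> dir_par \<alpha>) (to_infinity_dir \<alpha>)"
    "((\<lambda>w. 1 / (fst w + snd w)) \<longlongrightarrow> 0) (to_infinity_dir \<alpha>)"
    "((\<lambda>w. (fst w + snd w) / norm w) \<longlongrightarrow> cos \<alpha> + sin \<alpha>) (to_infinity_dir \<alpha>)"
proof -
  let ?F = "to_infinity_dir \<alpha>"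
  note t = quarter_trig[OF \<alpha>]
  have le: "?F \<le> principal quadrant" "?F \<le> at_infinity" "?F \<le> filtercomap (\<lambda>z. snd z / fst z) (nhds (tan \<alpha>))"
    unfolding to_infinity_dir_def by (auto intro: le_infI1 le_infI2)
  show q: "\<forall>\<^sub>F w in ?F. w \<in> quadrant"
    using le(1) by (simp add: le_principal)
  show lim: "((\<lambda>w. snd w / fst w) \<longlongrightarrow> tan \<alpha>) ?F"
    by (rule filterlim_mono[OF filterlim_filtercomap order_refl le(3)])
  show inf: "filterlim norm at_top ?F"
    by (rule filterlim_mono[OF filterlim_norm_at_top order_refl le(2)])
  have "((\<lambda>w. (snd w / fst w) / (1 + snd w / fst w)) \<longlongrightarrow> tan \<alpha> / (1 + tan \<alpha>)) ?F"
    using t(3) by (intro tendsto_intros lim) auto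
  moreover have "\<forall>\<^sub>F w in ?F. (snd w / fst w) / (1 + snd w / fst w) = snd w / (fst w + snd w)"
    using q by eventually_elim (auto simp: quadrant_def field_simps)
  ultimately show "((\<lambda>w. snd w / (fst w + snd w)) \<longlongrightarrow> dir_par \<alpha>) ?F"
    unfolding dir_par_tan[OF t(1)] by (rule Lim_transform_eventually)
  have "filterlim (\<lambda>w :: real \<times> real. fst w + snd w) at_top ?F"
  proof (rule filterlim_at_top_mono[OF inf])
    show "\<forall>\<^sub>F w in ?F. norm w \<le> fst w + snd w"
      using q
    proof eventually_elim
      fix w :: "real \<times> real" assume "w \<in> quadrant"
      then show "norm w \<le> fst w + snd w"
        using norm_Pair_le[of "fst w" "snd w"] by (auto simp: quadrant_def)
    qed
  qed
  from tendsto_inverse_0_at_top[OF this]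
  show "((\<lambda>w. 1 / (fst w + snd w)) \<longlongrightarrow> 0) ?F" by (simp add: inverse_eq_divide)
  have "((\<lambda>w. (1 + snd w / fst w) / sqrt (1 + (snd w / fst w)\<^sup>2)) \<longlongrightarrow> (1 + tan \<alpha>) / sqrt (1 + (tan \<alpha>)\<^sup>2)) ?F"
    by (intro tendsto_intros lim) (auto simp: add_nonneg_eq_0_iff)
  moreover have "(1 + tan \<alpha>) / sqrt (1 + (tan \<alpha>)\<^sup>2) = cos \<alpha> + sin \<alpha>"
  proof -
    have "1 + (tan \<alpha>)\<^sup>2 = (1 / cos \<alpha>)\<^sup>2" using t(1) tan_sec[of \<alpha>] by (simp add: inverse_eq_divide)
    then have "sqrt (1 + (tan \<alpha>)\<^sup>2) = 1 / cos \<alpha>" using t(1) by simp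
    then show ?thesis using t(1) by (simp add: tan_def field_simps)
  qed
  moreover have "\<forall>\<^sub>F w in ?F. (1 + snd w / fst w) / sqrt (1 + (snd w / fst w)\<^sup>2) = (fst w + snd w) / norm w"
    using q
  proof eventually_elim
    fix w :: "real \<times> real" assume "w \<in> quadrant"
    then have xy: "0 < fst w" "0 < snd w" by (auto simp: quadrant_def)
    have "norm w = sqrt ((fst w)\<^sup>2 + (snd w)\<^sup>2)" by (simp add: norm_prod_def)
    also have "(fst w)\<^sup>2 + (snd w)\<^sup>2 = (fst w)\<^sup>2 * (1 + (snd w / fst w)\<^sup>2)"
      using xy by (simp add: field_simps)
    finally have "norm w = fst w * sqrt (1 + (snd w / fst w)\<^sup>2)" using xy by (simp add: real_sqrt_mult)
    then show "(1 + snd w / fst w) / sqrt (1 + (snd w / fst w)\<^sup>2) = (fst w + snd w) / norm w"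
      using xy by (simp add: field_simps)
  qed
  ultimately show "((\<lambda>w. (fst w + snd w) / norm w) \<longlongrightarrow> cos \<alpha> + sin \<alpha>) ?F"
    using Lim_transform_eventually by fastforce
qed

context quadrant_process
begin

lemma green_normalised_tendsto:
  assumes \<alpha>: "0 < \<alpha>" "\<alpha> < pi / 2"
    and g: "is_density_on quadrant (green_measure M \<gamma> W z) g" "continuous_on (quadrant - {z}) g"
  shows "((\<lambda>w. g w * (sqrt (2 * pi * (fst w + snd w)) * exp (w \<bullet> saddle \<gamma> (angle w)))) \<longlongrightarrow> hfun (dir_par \<alpha>)) (to_infinity_dir \<alpha>)"
proof (rule tendstoI)
  fix e :: real assume "0 < e"
  then have e2: "0 < e / 2" by simp
  let ?v = "dir_par \<alpha>"
  note t = quarter_trig[OF \<alpha>] and F = to_infinity_dir_facts[OF \<alpha>]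
  obtain d where d: "0 < d" "\<And>u r. \<bar>u - ?v\<bar> < d \<Longrightarrow> 0 < r \<Longrightarrow> r < d \<Longrightarrow> \<bar>green_factor u r - hfun ?v\<bar> < e / 2"
    using green_factor_near[OF t(4,5) e2] by blast
  define E where "E w = exp ((snd w - \<gamma> * (fst w + snd w))\<^sup>2 / (2 * (fst w + snd w)))" for w :: "real \<times> real"
  define G where "G w = g w * (sqrt (2 * pi * (fst w + snd w)) * E w)" for w
  define Q where "Q = quadrant - {z}"
  \<comment> \<open>The open set of targets to which the uniform estimate of the factor applies; the starting
      point is excluded, since \<open>g\<close> need not be continuous there.\<close>
  define U where "U = Q \<inter> (\<lambda>w. (snd w / (fst w + snd w), 1 / (fst w + snd w))) -` ({?v - d<..<?v + d} \<times> {..<d})"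
  have Qo: "open Q" unfolding Q_def by (intro open_Diff open_quadrant) auto
  have pos: "0 < fst w + snd w" if "w \<in> quadrant" for w using that by (auto simp: quadrant_def)
  have U: "open U" unfolding U_def
  proof (rule continuous_open_preimage[OF _ Qo])
    show "continuous_on Q (\<lambda>w. (snd w / (fst w + snd w), 1 / (fst w + snd w)))"
      using pos by (intro continuous_intros) (force simp: Q_def)+
  qed (intro open_Times open_greaterThanLessThan open_lessThan)
  have contG: "continuous_on Q G"
    unfolding G_def E_def using g(2) pos unfolding Q_def[symmetric]
    by (intro continuous_intros) (force simp: Q_def)+
  have ae: "AE w in lborel. w \<in> U \<longrightarrow> G w \<in> cball (hfun ?v) (e / 2)"
    using green_density_factor[OF g(1)]
  proof eventually_elim
    fix w assume gw: "w \<in> quadrant \<longrightarrow> g w = green_factor (snd w / (fst w + snd w)) (1 / (fst w + snd w))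
      * (exp (- (snd w - \<gamma> * (fst w + snd w))\<^sup>2 / (2 * (fst w + snd w))) / sqrt (2 * pi * (fst w + snd w)))"
    show "w \<in> U \<longrightarrow> G w \<in> cball (hfun ?v) (e / 2)"
    proof
      assume w: "w \<in> U"
      then have wq: "w \<in> quadrant" by (simp add: U_def Q_def)
      have cancel: "f * (exp (- a) / s) * (s * exp a) = f" if "0 < s" for f a s :: real
        using that by (simp add: exp_minus field_simps)
      have "G w = green_factor (snd w / (fst w + snd w)) (1 / (fst w + snd w))"
        unfolding G_def E_def gw[rule_format, OF wq] minus_divide_left[symmetric]
        by (rule cancel) (use pos[OF wq] in simp)
      moreover have "\<bar>snd w / (fst w + snd w) - ?v\<bar> < d" "1 / (fst w + snd w) < d" "0 < 1 / (fst w + snd w)"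
        using w pos[OF wq] by (auto simp: U_def abs_less_iff)
      ultimately have "\<bar>G w - hfun ?v\<bar> < e / 2" using d(2) by simp
      then show "G w \<in> cball (hfun ?v) (e / 2)" by (simp add: dist_real_def abs_minus_commute)
    qed
  qed
  have contU: "continuous_on U G" by (rule continuous_on_subset[OF contG]) (auto simp: U_def)
  have all: "G w \<in> cball (hfun ?v) (e / 2)" if "w \<in> U" for w
    by (rule AE_continuous_closed[OF U contU ae closed_cball that])
  have "\<forall>\<^sub>F w in to_infinity_dir \<alpha>. w \<in> U"
  proof -
    have "\<forall>\<^sub>F w in to_infinity_dir \<alpha>. norm z < norm w" using F(3) by (simp add: filterlim_at_top_dense)
    moreover have "\<forall>\<^sub>F w in to_infinity_dir \<alpha>. snd w / (fst w + snd w) \<in> {?v - d<..<?v + d}"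
      using F(4) d(1) by (intro topological_tendstoD[OF F(4)]) auto
    moreover have "\<forall>\<^sub>F w in to_infinity_dir \<alpha>. 1 / (fst w + snd w) < d"
      using order_tendstoD(2)[OF F(5) d(1)] .
    ultimately show ?thesis using F(1) by eventually_elim (auto simp: U_def Q_def)
  qed
  then show "\<forall>\<^sub>F w in to_infinity_dir \<alpha>. dist (g w * (sqrt (2 * pi * (fst w + snd w)) * exp (w \<bullet> saddle \<gamma> (angle w)))) (hfun ?v) < e"
    using F(1)
  proof eventually_elim
    fix w assume w: "w \<in> U" "w \<in> quadrant"
    have "G w = g w * (sqrt (2 * pi * (fst w + snd w)) * exp (w \<bullet> saddle \<gamma> (angle w)))"
      by (simp add: G_def E_def angle_saddle[OF w(2)])
    then show "dist (g w * (sqrt (2 * pi * (fst w + snd w)) * exp (w \<bullet> saddle \<gamma> (angle w)))) (hfun ?v) < e"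
      using all[OF w(1)] \<open>0 < e\<close> by (simp add: dist_commute)
  qed
qed

end

section \<open>First passage densities and Laplace transforms\<close>

abbreviation std_normal_cdf :: "real \<Rightarrow> real" where "std_normal_cdf \<equiv> cdf std_normal_distribution"

lemma std_normal_cdf_deriv: "(std_normal_cdf has_real_derivative std_normal_density x) (at x)"
proof -
  interpret real_distribution std_normal_distribution by (rule real_dist_normal_dist)
  define a b where "a = x - 1" and "b = x + 1"
  have cont: "continuous_on S std_normal_density" for S
    unfolding normal_density_def by (intro continuous_intros) auto
  have eq: "std_normal_cdf y = std_normal_cdf a + integral {a..y} std_normal_density" if y: "y \<in> {a..b}" for y
  proof (cases "a = y")
    case False
    with y have "a < y" by auto
    have "(std_normal_density has_integral integral {a..y} std_normal_density) {a..y}"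
      by (intro integrable_integral integrable_continuous_interval cont)
    from nn_integral_has_integral_lebesgue[OF _ this]
    have "(\<integral>\<^sup>+u. ennreal (indicator {a..y} u * std_normal_density u) \<partial>lborel) = ennreal (integral {a..y} std_normal_density)"
      by simp
    moreover have "emeasure std_normal_distribution {a<..y} = (\<integral>\<^sup>+u. ennreal (indicator {a..y} u * std_normal_density u) \<partial>lborel)"
    proof (rule trans)
      show "emeasure std_normal_distribution {a<..y} = (\<integral>\<^sup>+u. ennreal (std_normal_density u) * indicator {a<..y} u \<partial>lborel)"
        by (rule emeasure_density) auto
      show "(\<integral>\<^sup>+u. ennreal (std_normal_density u) * indicator {a<..y} u \<partial>lborel) = (\<integral>\<^sup>+u. ennreal (indicator {a..y} u * std_normal_density u) \<partial>lborel)"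
        by (rule nn_integral_cong_AE) (use AE_lborel_singleton[of a] in eventually_elim, auto simp: indicator_def)
    qed
    moreover have "0 \<le> integral {a..y} std_normal_density"
      by (intro integral_nonneg integrable_continuous_interval cont) simp
    ultimately have "measure std_normal_distribution {a<..y} = integral {a..y} std_normal_density"
      by (simp add: measure_def)
    then show ?thesis using cdf_diff_eq[OF \<open>a < y\<close>] by simp
  qed simp
  have "((\<lambda>y. std_normal_cdf a + integral {a..y} std_normal_density) has_real_derivative 0 + std_normal_density x) (at x within {a..b})"
    by (intro DERIV_add DERIV_const integral_has_real_derivative cont) (auto simp: a_def b_def)
  then have "((\<lambda>y. std_normal_cdf a + integral {a..y} std_normal_density) has_real_derivative std_normal_density x) (at x)"
    using at_within_interior[of x "{a..b}"] by (simp add: a_def b_def)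
  then show ?thesis
  proof (rule has_field_derivative_transform_within_open[of _ _ _ "{a<..<b}"])
    show "x \<in> {a<..<b}" by (simp add: a_def b_def)
    fix y assume "y \<in> {a<..<b}"
    then show "std_normal_cdf a + integral {a..y} std_normal_density = std_normal_cdf y" by (intro eq[symmetric]) auto
  qed simp
qed

text \<open>The density of the first time at which a Brownian motion with drift \<open>m\<close> reaches the
  level \<open>a\<close>.\<close>

definition first_passage :: "real \<Rightarrow> real \<Rightarrow> real \<Rightarrow> real" where
  "first_passage m a t = a / (t * sqrt (2 * pi * t)) * exp (- (a - m * t)\<^sup>2 / (2 * t))"

text \<open>The distribution function of the passage time, known from the reflection principle.\<close>

lemma first_passage_primitive:
  assumes t: "0 < t"
  shows "((\<lambda>t. std_normal_cdf ((m * t - a) / sqrt t) + exp (2 * a * m) * std_normal_cdf ((- m * t - a) / sqrt t))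
    has_real_derivative first_passage m a t) (at t)"
proof -
  have sq: "0 < sqrt t" "sqrt t * sqrt t = t" using t by auto
  have d: "((\<lambda>t. (k * t - a) / sqrt t) has_real_derivative (k * t + a) / (2 * t * sqrt t)) (at t)" for k
  proof -
    have "((\<lambda>t. k * t - a) has_real_derivative k) (at t)" by (auto intro!: derivative_eq_intros)
    moreover have "(sqrt has_real_derivative inverse (sqrt t) / 2) (at t)" using t by (rule DERIV_real_sqrt)
    ultimately have "((\<lambda>t. (k * t - a) / sqrt t) has_real_derivative (k * sqrt t - (k * t - a) * (inverse (sqrt t) / 2)) / (sqrt t * sqrt t)) (at t)"
      using sq by (intro DERIV_divide) auto
    moreover have "(k * r - (k * (r * r) - a) * (inverse r / 2)) / (r * r) = (k * (r * r) + a) / (2 * (r * r) * r)" if "0 < r" for r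
      using that by (simp add: field_simps)
    from this[OF sq(1)] have "(k * sqrt t - (k * t - a) * (inverse (sqrt t) / 2)) / (sqrt t * sqrt t) = (k * t + a) / (2 * t * sqrt t)"
      unfolding sq(2) .
    ultimately show ?thesis by simp
  qed
  let ?z1 = "(m * t - a) / sqrt t" and ?z2 = "(- m * t - a) / sqrt t"
  have z2: "exp (2 * a * m) * std_normal_density ?z2 = std_normal_density ?z1"
  proof -
    have "(- m * t - a)\<^sup>2 / t = (m * t - a)\<^sup>2 / t + 4 * a * m"
      using t by (simp add: power2_eq_square field_simps)
    moreover have "?z1\<^sup>2 = (m * t - a)\<^sup>2 / t" "?z2\<^sup>2 = (- m * t - a)\<^sup>2 / t" using t by (simp_all add: power_divide)
    ultimately have "?z2\<^sup>2 = ?z1\<^sup>2 + 4 * a * m" by simp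
    then have "2 * a * m + - ?z2\<^sup>2 / 2 = - ?z1\<^sup>2 / 2" by linarith
    then have "exp (2 * a * m) * exp (- ?z2\<^sup>2 / 2) = exp (- ?z1\<^sup>2 / 2)" unfolding mult_exp_exp by simp
    then show ?thesis by (simp add: std_normal_density_def)
  qed
  have "((\<lambda>t. std_normal_cdf ((m * t - a) / sqrt t) + exp (2 * a * m) * std_normal_cdf ((- m * t - a) / sqrt t))
    has_real_derivative std_normal_density ?z1 * ((m * t + a) / (2 * t * sqrt t))
      + exp (2 * a * m) * (std_normal_density ?z2 * ((- m * t + a) / (2 * t * sqrt t)))) (at t)"
    by (intro DERIV_add DERIV_cmult DERIV_chain2[OF std_normal_cdf_deriv] d)
  moreover have "std_normal_density ?z1 * ((m * t + a) / (2 * t * sqrt t))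
      + exp (2 * a * m) * (std_normal_density ?z2 * ((- m * t + a) / (2 * t * sqrt t)))
    = std_normal_density ?z1 * ((m * t + a) / (2 * t * sqrt t) + (- m * t + a) / (2 * t * sqrt t))"
    unfolding mult.assoc[symmetric] z2 by (simp add: distrib_left)
  moreover have "(m * t + a) / (2 * t * sqrt t) + (- m * t + a) / (2 * t * sqrt t) = a / (t * sqrt t)"
    by (simp add: add_divide_distrib[symmetric])
  moreover have "std_normal_density ?z1 * (a / (t * sqrt t)) = first_passage m a t"
  proof -
    have "(m * t - a)\<^sup>2 = (a - m * t)\<^sup>2" by (simp add: power2_commute)
    then show ?thesis using t
      by (simp add: std_normal_density_def first_passage_def power_divide real_sqrt_mult mult_ac)
  qed
  ultimately show ?thesis by metis
qed

text \<open>With a positive drift the level is reached almost surely. The primitive tends to 1 at infinity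
  and to 0 at zero.\<close>

lemma first_passage_integral:
  assumes a: "0 < a" and m: "0 < m"
  shows "(\<integral>\<^sup>+t. ennreal (first_passage m a t) * indicator {0<..} t \<partial>lborel) = 1"
proof -
  interpret real_distribution std_normal_distribution by (rule real_dist_normal_dist)
  define H where "H t = std_normal_cdf ((m * t - a) / sqrt t) + exp (2 * a * m) * std_normal_cdf ((- m * t - a) / sqrt t)" for t
  have fm[measurable]: "first_passage m a \<in> borel_measurable borel"
    unfolding first_passage_def[abs_def] by measurable
  have sq_top: "filterlim (\<lambda>t. sqrt t) at_top at_top" by (rule sqrt_at_top)
  have ev: "\<forall>\<^sub>F t :: real in at_top. 0 < t" by (rule eventually_gt_at_top)
  have top1: "filterlim (\<lambda>t. (m * t - a) / sqrt t) at_top at_top"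
  proof (rule filterlim_at_top_mono)
    show "filterlim (\<lambda>t. - a + m * sqrt t) at_top at_top"
      by (intro filterlim_tendsto_add_at_top[OF tendsto_const] filterlim_tendsto_pos_mult_at_top[OF tendsto_const m] sq_top)
    show "\<forall>\<^sub>F t in at_top. - a + m * sqrt t \<le> (m * t - a) / sqrt t"
      using eventually_ge_at_top[of 1]
    proof eventually_elim
      fix t :: real assume "1 \<le> t"
      then have s: "1 \<le> sqrt t" "t = sqrt t * sqrt t" by auto
      have "(m * (r * r) - a) / r = m * r - a / r" if "1 \<le> r" for r using that by (simp add: field_simps)
      from this[OF s(1)] have "(m * t - a) / sqrt t = m * sqrt t - a / sqrt t" using s(2) by simp
      moreover have "a / sqrt t \<le> a" using s(1) a by (simp add: divide_le_eq)
      ultimately show "- a + m * sqrt t \<le> (m * t - a) / sqrt t" by linarith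
    qed
  qed
  have bot2: "filterlim (\<lambda>t. (- m * t - a) / sqrt t) at_bot at_top"
    unfolding filterlim_uminus_at_bot
  proof (rule filterlim_at_top_mono[OF top1])
    show "\<forall>\<^sub>F t in at_top. (m * t - a) / sqrt t \<le> - ((- m * t - a) / sqrt t)"
      using ev by eventually_elim (use a in \<open>simp add: divide_right_mono field_simps\<close>)
  qed
  have lim: "(H \<longlongrightarrow> 1 + exp (2 * a * m) * 0) at_top"
    unfolding H_def[abs_def]
    by (intro tendsto_intros filterlim_compose[OF cdf_lim_at_top_prob top1] filterlim_compose[OF cdf_lim_at_bot bot2])
  have ep: "0 < inverse (real (Suc n))" for n by simp
  define e where "e n = inverse (real (Suc n))" for n
  have e: "0 < e n" for n by (simp add: e_def)
  have H0: "(\<lambda>n. H (e n)) \<longlonglongrightarrow> 0 + exp (2 * a * m) * 0"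
  proof -
    have se: "(\<lambda>n. e n) \<longlonglongrightarrow> 0" unfolding e_def by (rule LIMSEQ_inverse_real_of_nat)
    then have "filterlim (\<lambda>n. sqrt (e n)) (at_right 0) sequentially"
      using e by (intro tendsto_imp_filterlim_at_right) (auto intro!: tendsto_eq_intros always_eventually)
    then have inv: "filterlim (\<lambda>n. inverse (sqrt (e n))) at_top sequentially"
      by (rule filterlim_compose[OF filterlim_inverse_at_top_right])
    have b: "filterlim (\<lambda>n. (k * e n - a) / sqrt (e n)) at_bot sequentially" for k
    proof -
      have "(\<lambda>n. k * e n - a) \<longlonglongrightarrow> k * 0 - a" by (intro tendsto_intros se)
      then have "filterlim (\<lambda>n. (k * e n - a) * inverse (sqrt (e n))) at_bot sequentially"
        using a by (intro filterlim_tendsto_neg_mult_at_bot[OF _ _ inv]) auto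
      then show ?thesis by (simp add: divide_inverse)
    qed
    show ?thesis unfolding H_def
      by (intro tendsto_intros filterlim_compose[OF cdf_lim_at_bot b])
  qed
  have nn: "0 \<le> first_passage m a t" if "0 < t" for t using that a by (simp add: first_passage_def)
  have FTC: "(\<integral>\<^sup>+t. ennreal (first_passage m a t) * indicator {e n..} t \<partial>lborel) = ennreal (1 - H (e n))" for n
    unfolding H_def[symmetric]
  proof (rule nn_integral_FTC_atLeast[OF fm])
    fix t assume "e n \<le> t"
    then have "0 < t" using e[of n] by linarith
    then show "(H has_real_derivative first_passage m a t) (at t)" "0 \<le> first_passage m a t"
      unfolding H_def[abs_def] by (rule first_passage_primitive, rule nn)
  qed (use lim in simp)
  have "(\<lambda>n. \<integral>\<^sup>+t. ennreal (first_passage m a t) * indicator {e n..} t \<partial>lborel)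
    \<longlonglongrightarrow> (\<integral>\<^sup>+t. ennreal (first_passage m a t) * indicator {0<..} t \<partial>lborel)"
  proof (rule nn_integral_LIMSEQ)
    have "e (Suc n) \<le> e n" for n by (simp add: e_def)
    then have "decseq e" by (rule decseq_SucI)
    then show "incseq (\<lambda>n t. ennreal (first_passage m a t) * indicator {e n..} t)"
      by (auto simp: incseq_def le_fun_def indicator_def dest: decseqD order_trans)
    fix t :: real
    show "(\<lambda>n. ennreal (first_passage m a t) * indicator {e n..} t) \<longlonglongrightarrow> ennreal (first_passage m a t) * indicator {0<..} t"
    proof (cases "0 < t")
      case True
      then obtain N where "e N < t" using reals_Archimedean unfolding e_def by blast
      then have "e n \<le> t" if "N \<le> n" for n using decseqD[OF \<open>decseq e\<close> that] by simp
      then have "\<forall>\<^sub>F n in sequentially. ennreal (first_passage m a t) * indicator {e n..} t = ennreal (first_passage m a t) * indicator {0<..} t"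
        using True unfolding eventually_sequentially by (intro exI[of _ N]) auto
      then show ?thesis by (rule tendsto_eventually)
    next
      case False
      then have "t < e n" for n using e[of n] by linarith
      then show ?thesis using False by (simp add: not_le[symmetric])
    qed
  qed measurable
  moreover have "(\<lambda>n. ennreal (1 - H (e n))) \<longlonglongrightarrow> ennreal (1 - 0)"
    using H0 by (intro tendsto_ennrealI tendsto_diff tendsto_const) simp
  ultimately show ?thesis unfolding FTC by (metis LIMSEQ_unique diff_zero ennreal_1)
qed

lemma integral_abs_bound_AE:
  fixes f g :: "'b \<Rightarrow> real"
  assumes "integrable M f" "integrable M g" "AE x in M. \<bar>f x\<bar> \<le> g x"
  shows "\<bar>LINT x|M. f x\<bar> \<le> (LINT x|M. g x)"
proof -
  have "\<bar>LINT x|M. f x\<bar> \<le> (LINT x|M. \<bar>f x\<bar>)" by (rule integral_abs_bound)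
  also have "\<dots> \<le> (LINT x|M. g x)" by (intro integral_mono_AE integrable_abs assms)
  finally show ?thesis .
qed

text \<open>Polynomials are uniformly dense among continuous functions on the unit interval, and the
  functions \<open>ramp\<close> determine the measure.\<close>

lemma finite_measure_eqI_moments:
  fixes \<mu> \<nu> :: "real measure"
  assumes sets[measurable_cong]: "sets \<mu> = sets borel" "sets \<nu> = sets borel"
    and fin: "finite_measure \<mu>" "finite_measure \<nu>"
    and supp: "AE u in \<mu>. u \<in> {0..1}" "AE u in \<nu>. u \<in> {0..1}"
    and moments: "\<And>n :: nat. (LINT u|\<mu>. u ^ n) = (LINT u|\<nu>. u ^ n)"
  shows "\<mu> = \<nu>"
proof (rule finite_measure_eqI_ramp[OF sets fin])
  interpret m: finite_measure \<mu> by fact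
  interpret n: finite_measure \<nu> by fact
  fix a k
  let ?f = "ramp a k"
  have "AE u in \<mu>. norm (u ^ i) \<le> 1" for i :: nat
    using supp(1) by eventually_elim (simp add: power_le_one)
  moreover have "AE u in \<nu>. norm (u ^ i) \<le> 1" for i :: nat
    using supp(2) by eventually_elim (simp add: power_le_one)
  ultimately have pow_m: "integrable \<mu> (\<lambda>u. u ^ i)" and pow_n: "integrable \<nu> (\<lambda>u. u ^ i)" for i :: nat
    by (auto intro!: m.integrable_const_bound[where B=1] n.integrable_const_bound[where B=1])
  have f_m: "integrable \<mu> ?f" and f_n: "integrable \<nu> ?f"
    by (auto intro!: m.integrable_const_bound[where B=1] n.integrable_const_bound[where B=1] simp: ramp_bounds)
  define T where "T = measure \<mu> (space \<mu>) + measure \<nu> (space \<nu>)"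
  have "\<bar>(LINT y|\<mu>. ?f y) - (LINT y|\<nu>. ?f y)\<bar> \<le> e * T" if e: "0 < e" for e
  proof -
    obtain g where g: "real_polynomial_function g" "\<And>x. x \<in> {0..1} \<Longrightarrow> \<bar>?f x - g x\<bar> < e"
      using Stone_Weierstrass_real_polynomial_function[of "{0..1::real}" ?f e] e continuous_on_subset[OF ramp_continuous] by auto
    then obtain c N where gs: "g = (\<lambda>x. \<Sum>i\<le>N. c i * x ^ i)" by (auto simp: real_polynomial_function_iff_sum)
    have gi: "integrable \<mu> g" "integrable \<nu> g"
      unfolding gs by (intro Bochner_Integration.integrable_sum integrable_mult_right pow_m pow_n)+
    have geq: "(LINT y|\<mu>. g y) = (LINT y|\<nu>. g y)"
      unfolding gs using pow_m pow_n moments by (simp add: Bochner_Integration.integral_sum)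
    have "\<bar>LINT y|\<mu>. ?f y - g y\<bar> \<le> (LINT y|\<mu>. e)"
    proof (rule integral_abs_bound_AE)
      show "AE y in \<mu>. \<bar>?f y - g y\<bar> \<le> e" using supp(1) by eventually_elim (use g(2) in \<open>auto intro: less_imp_le\<close>)
    qed (auto intro!: f_m gi)
    moreover have "\<bar>LINT y|\<nu>. ?f y - g y\<bar> \<le> (LINT y|\<nu>. e)"
    proof (rule integral_abs_bound_AE)
      show "AE y in \<nu>. \<bar>?f y - g y\<bar> \<le> e" using supp(2) by eventually_elim (use g(2) in \<open>auto intro: less_imp_le\<close>)
    qed (auto intro!: f_n gi)
    ultimately show ?thesis
      using geq f_m f_n gi by (simp add: T_def algebra_simps)
  qed
  note le = this
  show "(LINT y|\<mu>. ?f y) = (LINT y|\<nu>. ?f y)"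
  proof (rule ccontr)
    assume "(LINT y|\<mu>. ?f y) \<noteq> (LINT y|\<nu>. ?f y)"
    then have D: "0 < \<bar>(LINT y|\<mu>. ?f y) - (LINT y|\<nu>. ?f y)\<bar>" (is "0 < ?D") by simp
    have T: "0 \<le> T" by (simp add: T_def)
    then have "?D \<le> ?D / (2 * (T + 1)) * T" using D by (intro le) simp
    also have "\<dots> \<le> ?D / 2" using T D by (simp add: field_simps)
    finally show False using D by simp
  qed
qed

text \<open>Density of the ordinate at which the unrestricted process started at \<open>z\<close> first
  meets the vertical line through the origin. Its abscissa falls to zero when \<open>W\<close>
  with drift \<open>\<gamma> - 1\<close> reaches \<open>fst z\<close>, and the ordinate is then
  the initial coordinate sum plus the elapsed time.\<close>

definition hit_density :: "real \<Rightarrow> real \<times> real \<Rightarrow> real \<Rightarrow> real" where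
  "hit_density \<gamma> z y = (let t = y - fst z - snd z in if 0 < t then first_passage (\<gamma> - 1) (fst z) t else 0)"

lemma hit_density_measurable [measurable]:
  assumes [measurable]: "a \<in> borel_measurable N" "b \<in> borel_measurable N" "y \<in> borel_measurable N"
  shows "(\<lambda>x. hit_density \<gamma> (a x, b x) (y x)) \<in> borel_measurable N"
  unfolding hit_density_def Let_def first_passage_def fst_conv snd_conv by measurable

lemma hit_density_nonneg: "0 \<le> fst z \<Longrightarrow> 0 \<le> hit_density \<gamma> z y"
  by (simp add: hit_density_def Let_def first_passage_def)

lemma square_over_time: "0 < t \<Longrightarrow> (a - k * t)\<^sup>2 / (2 * t) = a\<^sup>2 / (2 * t) - a * k + k\<^sup>2 * t / 2" for a k t :: real
proof -
  assume t: "0 < t"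
  have "(a - k * t)\<^sup>2 = a\<^sup>2 + (2 * t) * (k\<^sup>2 * t / 2 - a * k)" by (simp add: power2_eq_square algebra_simps)
  then have "(a - k * t)\<^sup>2 / (2 * t) = (a\<^sup>2 + (2 * t) * (k\<^sup>2 * t / 2 - a * k)) / (2 * t)" by (rule arg_cong)
  also have "\<dots> = a\<^sup>2 / (2 * t) + (k\<^sup>2 * t / 2 - a * k)"
    using t by (simp only: add_divide_distrib nonzero_mult_div_cancel_left[of "2 * t"] mult_eq_0_iff zero_neq_numeral[symmetric] less_irrefl order_less_imp_not_eq2 simp_thms)
  finally show ?thesis by simp
qed

text \<open>The exponential tilt by \<open>v\<close> turns the drift \<open>\<gamma> - 1\<close> into
  \<open>v - 1\<close>, which is positive, and the tilted density has total mass one.\<close>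

lemma hit_density_laplace:
  assumes a: "0 < a" and v: "1 < v"
  shows "(\<integral>\<^sup>+y. ennreal (exp (par_q \<gamma> v * y)) * ennreal (hit_density \<gamma> (a, b) y) \<partial>lborel)
    = ennreal (exp (par_p \<gamma> v * a + par_q \<gamma> v * b))"
proof -
  let ?E = "exp (par_p \<gamma> v * a + par_q \<gamma> v * b)"
  have [measurable]: "hit_density \<gamma> (a, b) \<in> borel_measurable borel"
    by (rule hit_density_measurable[of "\<lambda>_. a" borel "\<lambda>_. b" "\<lambda>y. y"]) measurable
  have [measurable]: "first_passage (v - 1) a \<in> borel_measurable borel"
    unfolding first_passage_def[abs_def] by measurable
  have tilt: "exp (par_q \<gamma> v * (a + b + t)) * first_passage (\<gamma> - 1) a t = ?E * first_passage (v - 1) a t" if "0 < t" for t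
  proof -
    have "par_q \<gamma> v * (a + b + t) + - (a - (\<gamma> - 1) * t)\<^sup>2 / (2 * t)
      = par_p \<gamma> v * a + par_q \<gamma> v * b + - (a - (v - 1) * t)\<^sup>2 / (2 * t)"
    proof -
      define X where "X = a\<^sup>2 / (2 * t)"
      show ?thesis unfolding minus_divide_left[symmetric] square_over_time[OF that] X_def[symmetric]
        by (simp add: par_p_def par_q_def power2_eq_square field_simps)
    qed
    then have "exp (par_q \<gamma> v * (a + b + t)) * exp (- (a - (\<gamma> - 1) * t)\<^sup>2 / (2 * t))
      = ?E * exp (- (a - (v - 1) * t)\<^sup>2 / (2 * t))"
      unfolding mult_exp_exp by (rule arg_cong[where f=exp])
    then show ?thesis unfolding first_passage_def by (simp add: mult.left_commute)
  qed
  have "(\<integral>\<^sup>+y. ennreal (exp (par_q \<gamma> v * y)) * ennreal (hit_density \<gamma> (a, b) y) \<partial>lborel)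
    = (\<integral>\<^sup>+t. ennreal (exp (par_q \<gamma> v * (a + b + 1 * t))) * ennreal (hit_density \<gamma> (a, b) (a + b + 1 * t)) \<partial>lborel)"
    by (subst nn_integral_real_affine[of _ 1 "a + b"]) auto
  also have "\<dots> = (\<integral>\<^sup>+t. ennreal ?E * (ennreal (first_passage (v - 1) a t) * indicator {0<..} t) \<partial>lborel)"
  proof (rule nn_integral_cong)
    fix t :: real
    show "ennreal (exp (par_q \<gamma> v * (a + b + 1 * t))) * ennreal (hit_density \<gamma> (a, b) (a + b + 1 * t))
      = ennreal ?E * (ennreal (first_passage (v - 1) a t) * indicator {0<..} t)"
    proof (cases "0 < t")
      case True
      then have "hit_density \<gamma> (a, b) (a + b + 1 * t) = first_passage (\<gamma> - 1) a t"
        by (simp add: hit_density_def)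
      then show ?thesis using True tilt[OF True] by (simp add: ennreal_mult'[symmetric])
    qed (simp add: hit_density_def)
  qed
  also have "\<dots> = ennreal ?E * (\<integral>\<^sup>+t. ennreal (first_passage (v - 1) a t) * indicator {0<..} t \<partial>lborel)"
    by (rule nn_integral_cmult) measurable
  also have "\<dots> = ennreal ?E" using a v by (simp add: first_passage_integral)
  finally show ?thesis .
qed

text \<open>Under \<open>u = exp (- y)\<close> the Laplace transform at the positive integers becomes the
  moment sequence of a measure on the unit interval.\<close>

lemma density_eqI_laplace:
  fixes F G :: "real \<Rightarrow> ennreal"
  assumes [measurable]: "F \<in> borel_measurable borel" "G \<in> borel_measurable borel"
    and supp: "\<And>y. y \<le> 0 \<Longrightarrow> F y = 0 \<and> G y = 0"
    and eq: "\<And>n :: nat. (\<integral>\<^sup>+y. ennreal (exp (- real (Suc n) * y)) * F y \<partial>lborel) = (\<integral>\<^sup>+y. ennreal (exp (- real (Suc n) * y)) * G y \<partial>lborel)"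
    and fin: "\<And>n :: nat. (\<integral>\<^sup>+y. ennreal (exp (- real (Suc n) * y)) * F y \<partial>lborel) < \<infinity>"
  shows "AE y in lborel. F y = G y"
proof -
  \<comment> \<open>The additional factor \<open>exp (- y)\<close> makes the measure finite and shifts the
      exponents from \<open>n\<close> to \<open>n + 1\<close>.\<close>
  define \<mu> where "\<mu> F = density lborel (\<lambda>y. ennreal (exp (- y)) * F y)" for F :: "real \<Rightarrow> ennreal"
  define \<nu> where "\<nu> F = distr (\<mu> F) borel (\<lambda>y. exp (- y))" for F :: "real \<Rightarrow> ennreal"
  have m[measurable_cong]: "sets (\<mu> F) = sets borel" for F by (simp add: \<mu>_def)
  have moment: "(\<integral>\<^sup>+u. ennreal (u ^ n) \<partial>(\<nu> F)) = (\<integral>\<^sup>+y. ennreal (exp (- real (Suc n) * y)) * F y \<partial>lborel)"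
    if [measurable]: "F \<in> borel_measurable borel" for n F
  proof -
    have "(\<integral>\<^sup>+u. ennreal (u ^ n) \<partial>(\<nu> F)) = (\<integral>\<^sup>+y. ennreal (exp (- y) ^ n) \<partial>(\<mu> F))"
      unfolding \<nu>_def by (rule nn_integral_distr) auto
    also have "\<dots> = (\<integral>\<^sup>+y. (ennreal (exp (- y)) * F y) * ennreal (exp (- y) ^ n) \<partial>lborel)"
      unfolding \<mu>_def by (rule nn_integral_density) auto
    also have "\<dots> = (\<integral>\<^sup>+y. ennreal (exp (- real (Suc n) * y)) * F y \<partial>lborel)"
    proof (rule nn_integral_cong)
      fix y :: real
      have "exp (- y) * exp (- y) ^ n = exp (- real (Suc n) * y)"
      proof -
        have "exp (- real (Suc n) * y) = exp (real (Suc n) * - y)" by (simp only: mult_minus_left mult_minus_right)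
        then show ?thesis unfolding exp_of_nat_mult by simp
      qed
      then have "ennreal (exp (- real (Suc n) * y)) = ennreal (exp (- y)) * ennreal (exp (- y) ^ n)"
        by (simp only: ennreal_mult'[symmetric] exp_ge_zero)
      then show "(ennreal (exp (- y)) * F y) * ennreal (exp (- y) ^ n) = ennreal (exp (- real (Suc n) * y)) * F y"
        by (simp only: mult_ac)
    qed
    finally show ?thesis .
  qed
  have fnu: "finite_measure (\<nu> F)" if [measurable]: "F \<in> borel_measurable borel"
    and "(\<integral>\<^sup>+y. ennreal (exp (- real (Suc 0) * y)) * F y \<partial>lborel) < \<infinity>" for F
  proof (rule finite_measureI)
    have "emeasure (\<nu> F) (space (\<nu> F)) = (\<integral>\<^sup>+u. ennreal (u ^ 0) \<partial>(\<nu> F))" by simp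
    also have "\<dots> < \<infinity>" unfolding moment[OF that(1)] by (rule that(2))
    finally show "emeasure (\<nu> F) (space (\<nu> F)) \<noteq> \<infinity>" by simp
  qed
  have supp_nu: "AE u in \<nu> F. u \<in> {0..1}" if [measurable]: "F \<in> borel_measurable borel" and "\<And>y. y \<le> 0 \<Longrightarrow> F y = 0" for F
  proof -
    have "AE y in \<mu> F. exp (- y) \<in> {0..1}"
    proof -
      have "exp (- y) \<in> {0..1}" if "0 < ennreal (exp (- y)) * F y" for y
        using that \<open>\<And>y. y \<le> 0 \<Longrightarrow> F y = 0\<close>[of y] by (cases "y \<le> 0") auto
      then show ?thesis unfolding \<mu>_def by (subst AE_density) simp_all
    qed
    then show ?thesis unfolding \<nu>_def by (subst AE_distr_iff) auto
  qed
  have nu: "\<nu> F = \<nu> G"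
  proof (rule finite_measure_eqI_moments)
    show "finite_measure (\<nu> F)" "finite_measure (\<nu> G)" using fnu fin[of 0] eq[of 0] by auto
    show "AE u in \<nu> F. u \<in> {0..1}" by (rule supp_nu) (simp_all add: supp)
    show "AE u in \<nu> G. u \<in> {0..1}" by (rule supp_nu) (simp_all add: supp)
    fix n :: nat
    have "(LINT u|\<nu> H. u ^ n) = enn2real (\<integral>\<^sup>+u. ennreal (u ^ n) \<partial>(\<nu> H))"
      if [measurable]: "H \<in> borel_measurable borel" and "\<And>y. y \<le> 0 \<Longrightarrow> H y = 0" for H
      using supp_nu[OF that] by (intro integral_eq_nn_integral) (auto simp: \<nu>_def elim!: eventually_mono)
    then show "(LINT u|\<nu> F. u ^ n) = (LINT u|\<nu> G. u ^ n)"
      using moment[of F n] moment[of G n] eq[of n] supp by simp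
  qed (simp_all add: \<nu>_def)
  have mu_of_nu: "\<mu> F = distr (\<nu> F) borel (\<lambda>u. - ln u)" for F
    unfolding \<nu>_def by (subst distr_distr) (auto simp: comp_def distr_id2 m)
  have "\<mu> F = \<mu> G" using mu_of_nu[of F] mu_of_nu[of G] nu by simp
  then have "AE y in lborel. ennreal (exp (- y)) * F y = ennreal (exp (- y)) * G y"
    unfolding \<mu>_def by (intro sigma_finite_measure.density_unique[OF sigma_finite_lborel]) auto
  then show ?thesis
    by eventually_elim (simp add: ennreal_mult_cancel_left)
qed

text \<open>With \<open>\<zeta> = y / (y - a)\<close> the product is at most 4 if \<open>a \<le> y /
  2\<close>. Otherwise \<open>y \<ge> 1\<close> makes the exponent at most \<open>- \<zeta> /
  8\<close>, and \<open>\<zeta> * exp (- \<zeta> / 16) \<le> 16\<close>.\<close>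

lemma passage_weight_bound:
  assumes a: "0 < a" "a < y" and y: "1 \<le> y"
  shows "(y / (y - a)) * sqrt (y / (y - a)) * exp (- a\<^sup>2 / (2 * (y - a))) \<le> 260"
proof -
  define t \<zeta> where "t = y - a" and "\<zeta> = y / t"
  have t: "0 < t" "t \<le> y" using a by (auto simp: t_def)
  have \<zeta>: "1 \<le> \<zeta>" using t by (simp add: \<zeta>_def)
  then have sq: "sqrt \<zeta> \<le> \<zeta>" using mult_left_mono[of 1 \<zeta> \<zeta>] by (intro real_le_lsqrt) (auto simp: power2_eq_square)
  have "\<zeta> * sqrt \<zeta> * exp (- a\<^sup>2 / (2 * t)) \<le> 260"
  proof (cases "a \<le> y / 2")
    case True
    then have "\<zeta> \<le> 2" using t y by (simp add: \<zeta>_def t_def field_simps)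
    then have "\<zeta> * sqrt \<zeta> \<le> 2 * 2" using sq \<zeta> by (intro mult_mono) auto
    moreover have "exp (- a\<^sup>2 / (2 * t)) \<le> 1" using t by simp
    ultimately have "\<zeta> * sqrt \<zeta> * exp (- a\<^sup>2 / (2 * t)) \<le> 4 * 1" using \<zeta> by (intro mult_mono) auto
    then show ?thesis by simp
  next
    case False
    have "\<zeta> / 8 \<le> a\<^sup>2 / (2 * t)"
    proof -
      have "(y / 2)\<^sup>2 \<le> a\<^sup>2" using False y by (intro power_mono) auto
      moreover have "y \<le> y\<^sup>2" using y mult_left_mono[of 1 y y] by (simp add: power2_eq_square)
      ultimately have "y / 4 \<le> a\<^sup>2" by (simp add: power_divide)
      then have "y / 4 / (2 * t) \<le> a\<^sup>2 / (2 * t)" using t by (intro divide_right_mono) auto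
      then show ?thesis by (simp add: \<zeta>_def)
    qed
    then have "\<zeta> * sqrt \<zeta> * exp (- a\<^sup>2 / (2 * t)) \<le> \<zeta> * \<zeta> * exp (- (\<zeta> / 8))"
      using sq \<zeta> by (intro mult_mono) auto
    also have "\<dots> = (\<zeta> * exp (- (1/16) * \<zeta>)) * (\<zeta> * exp (- (1/16) * \<zeta>))"
    proof -
      have "exp (- (\<zeta> / 8)) = exp (- (1/16) * \<zeta>) * exp (- (1/16) * \<zeta>)" unfolding mult_exp_exp by simp
      then show ?thesis by simp
    qed
    also have "\<dots> \<le> (1 / (1/16)) * (1 / (1/16))"
      using \<zeta> by (intro mult_mono mult_exp_neg_le) auto
    finally show ?thesis by simp
  qed
  then show ?thesis by (simp add: t_def \<zeta>_def)
qed

text \<open>The quotient of \<open>hit_density\<close> by the decay rate that is common to all starting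
  points.\<close>

definition hit_ratio :: "real \<Rightarrow> real \<times> real \<Rightarrow> real \<Rightarrow> real" where
  "hit_ratio \<gamma> z y = (let t = y - fst z - snd z in if 0 < t
     then fst z * ((y / t) * sqrt (y / t) * exp (par_p \<gamma> 1 * fst z + par_q \<gamma> 1 * snd z - (fst z)\<^sup>2 / (2 * t))) else 0)"

lemma hit_density_ratio:
  assumes "0 < y"
  shows "hit_density \<gamma> z y = hit_ratio \<gamma> z y * (exp (- y * par_q \<gamma> 1) / (y * sqrt y * sqrt (2 * pi)))"
proof -
  define a b t where "a = fst z" and "b = snd z" and "t = y - a - b"
  show ?thesis
  proof (cases "0 < t")
    case False then show ?thesis by (simp add: hit_density_def hit_ratio_def a_def b_def t_def)
  next
    case True
    have "- (a - (\<gamma> - 1) * t)\<^sup>2 / (2 * t) = (par_p \<gamma> 1 * a + par_q \<gamma> 1 * b - a\<^sup>2 / (2 * t)) + (- y * par_q \<gamma> 1)"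
    proof -
      define X where "X = a\<^sup>2 / (2 * t)"
      have y: "y = t + a + b" by (simp add: t_def)
      show ?thesis unfolding minus_divide_left[symmetric] square_over_time[OF True] X_def[symmetric] unfolding y
        by (simp add: par_p_def par_q_def power2_eq_square field_simps)
    qed
    then have e: "exp (- (a - (\<gamma> - 1) * t)\<^sup>2 / (2 * t)) = exp (par_p \<gamma> 1 * a + par_q \<gamma> 1 * b - a\<^sup>2 / (2 * t)) * exp (- y * par_q \<gamma> 1)"
      unfolding mult_exp_exp by (rule arg_cong[where f=exp])
    have c: "a / (t * sqrt (2 * pi * t)) = a * ((y / t) * sqrt (y / t)) / (y * sqrt y * sqrt (2 * pi))"
      using True assms by (simp add: real_sqrt_mult real_sqrt_divide)
    have rearrange: "a * K / D * (e1 * e2) = (a * (K * e1)) * (e2 / D)" for K D e1 e2 :: real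
      by simp
    have "hit_density \<gamma> z y = a / (t * sqrt (2 * pi * t)) * exp (- (a - (\<gamma> - 1) * t)\<^sup>2 / (2 * t))"
      using True by (simp add: hit_density_def first_passage_def a_def b_def t_def Let_def)
    also have "\<dots> = a * ((y / t) * sqrt (y / t)) / (y * sqrt y * sqrt (2 * pi)) * (exp (par_p \<gamma> 1 * a + par_q \<gamma> 1 * b - a\<^sup>2 / (2 * t)) * exp (- y * par_q \<gamma> 1))"
      unfolding c e ..
    also have "\<dots> = (a * ((y / t) * sqrt (y / t) * exp (par_p \<gamma> 1 * a + par_q \<gamma> 1 * b - a\<^sup>2 / (2 * t)))) * (exp (- y * par_q \<gamma> 1) / (y * sqrt y * sqrt (2 * pi)))"
      by (rule rearrange)
    also have "a * ((y / t) * sqrt (y / t) * exp (par_p \<gamma> 1 * a + par_q \<gamma> 1 * b - a\<^sup>2 / (2 * t))) = hit_ratio \<gamma> z y"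
      using True by (simp add: hit_ratio_def a_def b_def t_def Let_def)
    finally show ?thesis .
  qed
qed

lemma hit_ratio_tendsto:
  "((\<lambda>y. hit_ratio \<gamma> z y) \<longlongrightarrow> fst z * exp (par_p \<gamma> 1 * fst z + par_q \<gamma> 1 * snd z)) at_top"
proof -
  define s where "s = fst z + snd z"
  have "((\<lambda>y. fst z * ((y / (y - s)) * sqrt (y / (y - s)) * exp (par_p \<gamma> 1 * fst z + par_q \<gamma> 1 * snd z - (fst z)\<^sup>2 / (2 * (y - s)))))
    \<longlongrightarrow> fst z * (1 * sqrt 1 * exp (par_p \<gamma> 1 * fst z + par_q \<gamma> 1 * snd z - 0))) at_top"
  proof -
    have sub: "filterlim (\<lambda>y. - s + y) at_top at_top" by (intro filterlim_tendsto_add_at_top[OF tendsto_const] filterlim_ident)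
    from tendsto_inverse_0_at_top[OF this] have inv: "((\<lambda>y. inverse (y - s)) \<longlongrightarrow> 0) at_top" by simp
    have "((\<lambda>y. 1 + s * inverse (y - s)) \<longlongrightarrow> 1 + s * 0) at_top" by (intro tendsto_intros inv)
    moreover have "\<forall>\<^sub>F y in at_top. 1 + s * inverse (y - s) = y / (y - s)"
      using eventually_gt_at_top[of s] by eventually_elim (simp add: field_simps)
    ultimately have l: "((\<lambda>y. y / (y - s)) \<longlongrightarrow> 1) at_top" using Lim_transform_eventually by fastforce
    have "((\<lambda>y. (fst z)\<^sup>2 / 2 * inverse (y - s)) \<longlongrightarrow> (fst z)\<^sup>2 / 2 * 0) at_top" by (intro tendsto_intros inv)
    then have l2: "((\<lambda>y. (fst z)\<^sup>2 / (2 * (y - s))) \<longlongrightarrow> 0) at_top"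
      by (simp only: divide_inverse inverse_mult_distrib mult.assoc mult_zero_right)
    show ?thesis by (intro tendsto_intros l l2)
  qed
  moreover have "\<forall>\<^sub>F y in at_top. fst z * ((y / (y - s)) * sqrt (y / (y - s)) * exp (par_p \<gamma> 1 * fst z + par_q \<gamma> 1 * snd z - (fst z)\<^sup>2 / (2 * (y - s)))) = hit_ratio \<gamma> z y"
    using eventually_gt_at_top[of s] by eventually_elim (auto simp: hit_ratio_def s_def Let_def diff_diff_eq)
  ultimately show ?thesis using Lim_transform_eventually by fastforce
qed

section \<open>The exit density and its decay\<close>

context quadrant_process
begin

lemma exit_density_law:
  assumes f1: "is_density_on {0<..} (exit_measure1 M \<gamma> W z) f1"
  defines "f \<equiv> \<lambda>y. ennreal (f1 y) * indicator {0<..} y"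
  shows "f \<in> borel_measurable borel" "law1 = density lborel f"
proof -
  have "f1 \<in> borel_measurable (restrict_space borel {0<..})" using f1 by (simp add: is_density_on_def)
  then have "(\<lambda>y. ennreal (f1 y)) \<in> borel_measurable (restrict_space borel {0<..})" by measurable
  then show fm[measurable]: "f \<in> borel_measurable borel"
    using borel_measurable_restrict_space_iff_ennreal[of "{0<..}" borel "\<lambda>y. ennreal (f1 y)"] by (simp add: f_def)
  show "law1 = density lborel f"
  proof (rule measure_eqI)
    fix A assume "A \<in> sets law1"
    then have A[measurable]: "A \<in> sets borel" by simp
    have "AE y in law1. y \<in> A \<longleftrightarrow> y \<in> A \<inter> {0<..}" using AE_laws(1)
      by eventually_elim (use z_pos(3) in auto)
    then have "emeasure law1 A = emeasure law1 (A \<inter> {0<..})"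
      by (rule emeasure_eq_AE) (use A in auto)
    also have "\<dots> = exit_measure1 M \<gamma> W z (A \<inter> {0<..})" by (rule exit_measure_law[symmetric]) simp
    also have "\<dots> = (\<integral>\<^sup>+y. ennreal (f1 y) * indicator (A \<inter> {0<..}) y \<partial>lborel)"
      using f1 A by (auto simp: is_density_on_def)
    also have "\<dots> = (\<integral>\<^sup>+y. f y * indicator A y \<partial>lborel)"
      by (intro nn_integral_cong) (auto simp: f_def indicator_def)
    also have "\<dots> = emeasure (density lborel f) A" by (rule emeasure_density[symmetric]) auto
    finally show "emeasure law1 A = emeasure (density lborel f) A" .
  qed simp
qed

text \<open>A path that reaches the vertical line does so either as the first exit from the quadrant or
  after having left through the horizontal axis. The identity is verified on Laplace transforms:
  by \<open>hit_density_laplace\<close> it then becomes the functional equation.\<close>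

lemma exit_density_formula:
  assumes f1: "is_density_on {0<..} (exit_measure1 M \<gamma> W z) f1"
  shows "AE y in lborel. 0 < y \<longrightarrow> f1 y = hit_density \<gamma> z y - (LINT a|law2. hit_density \<gamma> (a, 0) y)"
proof -
  interpret L2: sigma_finite_measure law2 by (rule sigma_finite_laws)
  interpret P: pair_sigma_finite lborel law2 by (simp add: pair_sigma_finite_def sigma_finite_laws sigma_finite_lborel)
  define f where "f y = ennreal (f1 y) * indicator {0<..} y" for y
  note fl = exit_density_law[OF f1, folded f_def[abs_def]]
  have fm[measurable]: "f \<in> borel_measurable borel" by (rule fl)
  have apos: "AE a in law2. 0 < a" using AE_laws(2) by eventually_elim (use z_pos(3) in auto)
  define R where "R y = (\<integral>\<^sup>+a. ennreal (hit_density \<gamma> (a, 0) y) \<partial>law2)" for y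
  have hm[measurable]: "(\<lambda>(y, a). ennreal (hit_density \<gamma> (a, 0) y)) \<in> borel_measurable (lborel \<Otimes>\<^sub>M law2)"
  proof -
    have "(\<lambda>x :: real \<times> real. hit_density \<gamma> (snd x, 0) (fst x)) \<in> borel_measurable (lborel \<Otimes>\<^sub>M law2)"
      by (rule hit_density_measurable) measurable
    then show ?thesis by (simp add: case_prod_beta')
  qed
  have Rm[measurable]: "R \<in> borel_measurable borel"
  proof -
    have "R \<in> borel_measurable lborel" unfolding R_def[abs_def]
      using L2.borel_measurable_nn_integral[OF hm] by simp
    then show ?thesis by simp
  qed
  have zm[measurable]: "hit_density \<gamma> z \<in> borel_measurable borel"
  proof -
    have "(\<lambda>y. hit_density \<gamma> (fst z, snd z) y) \<in> borel_measurable borel" by (rule hit_density_measurable) measurable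
    then show ?thesis by (simp only: prod.collapse)
  qed
  have "AE y in lborel. f y + R y = ennreal (hit_density \<gamma> z y)"
  proof (rule density_eqI_laplace)
    fix y :: real assume y: "y \<le> 0"
    have "R y = (\<integral>\<^sup>+a. 0 \<partial>law2)" unfolding R_def
      by (rule nn_integral_cong_AE, use apos in eventually_elim) (use y in \<open>auto simp: hit_density_def\<close>)
    then show "f y + R y = 0 \<and> ennreal (hit_density \<gamma> z y) = 0"
      using y z_pos by (simp add: f_def hit_density_def Let_def)
  next
    fix n :: nat
    have q: "- real (Suc n) < (1 - \<gamma>)\<^sup>2 / 2" using zero_le_power2[of "1 - \<gamma>"] of_nat_0_le_iff[of n, where 'a = real] unfolding of_nat_Suc by linarith
    then obtain v where v: "1 < v" "par_q \<gamma> v = - real (Suc n)" by (rule par_roots)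
    have "(\<integral>\<^sup>+y. ennreal (exp (par_q \<gamma> v * y)) * R y \<partial>lborel)
      = (\<integral>\<^sup>+y. \<integral>\<^sup>+a. ennreal (exp (par_q \<gamma> v * y)) * ennreal (hit_density \<gamma> (a, 0) y) \<partial>law2 \<partial>lborel)"
    proof (rule nn_integral_cong)
      fix y :: real
      have "(\<lambda>a. hit_density \<gamma> (a, 0) y) \<in> borel_measurable law2" by (rule hit_density_measurable) measurable
      then show "ennreal (exp (par_q \<gamma> v * y)) * R y = (\<integral>\<^sup>+a. ennreal (exp (par_q \<gamma> v * y)) * ennreal (hit_density \<gamma> (a, 0) y) \<partial>law2)"
        unfolding R_def by (intro nn_integral_cmult[symmetric]) measurable
    qed
    also have "\<dots> = (\<integral>\<^sup>+a. \<integral>\<^sup>+y. ennreal (exp (par_q \<gamma> v * y)) * ennreal (hit_density \<gamma> (a, 0) y) \<partial>lborel \<partial>law2)"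
    proof (rule P.Fubini'[symmetric])
      have "(\<lambda>x. ennreal (exp (par_q \<gamma> v * fst x)) * (case x of (y, a) \<Rightarrow> ennreal (hit_density \<gamma> (a, 0) y))) \<in> borel_measurable (lborel \<Otimes>\<^sub>M law2)"
        by measurable
      then show "(\<lambda>(y, a). ennreal (exp (par_q \<gamma> v * y)) * ennreal (hit_density \<gamma> (a, 0) y)) \<in> borel_measurable (lborel \<Otimes>\<^sub>M law2)"
        by (simp add: case_prod_beta')
    qed
    also have "\<dots> = (\<integral>\<^sup>+a. ennreal (exp (par_p \<gamma> v * a)) \<partial>law2)"
    proof (rule nn_integral_cong_AE, use apos in eventually_elim)
      fix a :: real assume "0 < a"
      then show "(\<integral>\<^sup>+y. ennreal (exp (par_q \<gamma> v * y)) * ennreal (hit_density \<gamma> (a, 0) y) \<partial>lborel) = ennreal (exp (par_p \<gamma> v * a))"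
        using hit_density_laplace[of a v \<gamma> 0] v(1) by simp
    qed
    finally have LR: "(\<integral>\<^sup>+y. ennreal (exp (par_q \<gamma> v * y)) * R y \<partial>lborel) = (\<integral>\<^sup>+a. ennreal (exp (par_p \<gamma> v * a)) \<partial>law2)" .
    have "(\<integral>\<^sup>+y. ennreal (exp (par_q \<gamma> v * y)) \<partial>law1) = (\<integral>\<^sup>+y. f y * ennreal (exp (par_q \<gamma> v * y)) \<partial>lborel)"
      unfolding fl(2) by (rule nn_integral_density) auto
    then have Lf: "(\<integral>\<^sup>+y. ennreal (exp (par_q \<gamma> v * y)) * f y \<partial>lborel) = (\<integral>\<^sup>+y. ennreal (exp (par_q \<gamma> v * y)) \<partial>law1)"
      by (simp add: mult.commute)
    have "(\<integral>\<^sup>+y. ennreal (exp (par_q \<gamma> v * y)) * (f y + R y) \<partial>lborel)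
      = (\<integral>\<^sup>+y. ennreal (exp (par_q \<gamma> v * y)) * f y + ennreal (exp (par_q \<gamma> v * y)) * R y \<partial>lborel)"
      by (simp only: distrib_left)
    also have "\<dots> = (\<integral>\<^sup>+y. ennreal (exp (par_q \<gamma> v * y)) * f y \<partial>lborel) + (\<integral>\<^sup>+y. ennreal (exp (par_q \<gamma> v * y)) * R y \<partial>lborel)"
      by (rule nn_integral_add) measurable
    also have "\<dots> = ennreal (par_exp \<gamma> v z)"
      unfolding LR Lf using laplace_functional_equation[of v] v(1) by simp
    finally have L: "(\<integral>\<^sup>+y. ennreal (exp (- real (Suc n) * y)) * (f y + R y) \<partial>lborel) = ennreal (par_exp \<gamma> v z)"
      unfolding v(2) .
    have "(\<integral>\<^sup>+y. ennreal (exp (- real (Suc n) * y)) * ennreal (hit_density \<gamma> z y) \<partial>lborel) = ennreal (par_exp \<gamma> v z)"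
      using hit_density_laplace[of "fst z" v \<gamma> "snd z"] v z_pos unfolding par_exp_def by (simp only: prod.collapse)
    with L show "(\<integral>\<^sup>+y. ennreal (exp (- real (Suc n) * y)) * (f y + R y) \<partial>lborel)
      = (\<integral>\<^sup>+y. ennreal (exp (- real (Suc n) * y)) * ennreal (hit_density \<gamma> z y) \<partial>lborel)" by simp
    show "(\<integral>\<^sup>+y. ennreal (exp (- real (Suc n) * y)) * (f y + R y) \<partial>lborel) < \<infinity>" unfolding L by simp
  qed measurable
  then show ?thesis
  proof eventually_elim
    fix y assume eq: "f y + R y = ennreal (hit_density \<gamma> z y)"
    show "0 < y \<longrightarrow> f1 y = hit_density \<gamma> z y - (LINT a|law2. hit_density \<gamma> (a, 0) y)"
    proof
      assume y: "0 < y"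
      have f0: "0 \<le> f1 y" using f1 y by (simp add: is_density_on_def)
      have nn: "AE a in law2. 0 \<le> hit_density \<gamma> (a, 0) y" using apos by eventually_elim (simp add: hit_density_nonneg)
      have "R y \<le> ennreal (hit_density \<gamma> z y)" unfolding eq[symmetric] by simp
      also have "\<dots> < \<infinity>" by simp
      finally have fin: "R y < \<infinity>" .
      have m: "(\<lambda>a. hit_density \<gamma> (a, 0) y) \<in> borel_measurable law2" by (rule hit_density_measurable) measurable
      have i: "integrable law2 (\<lambda>a. hit_density \<gamma> (a, 0) y)"
        by (rule integrableI_nonneg[OF m nn]) (use fin in \<open>simp add: R_def\<close>)
      have "R y = ennreal (LINT a|law2. hit_density \<gamma> (a, 0) y)"
        unfolding R_def by (rule nn_integral_eq_integral[OF i nn])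
      moreover have "0 \<le> (LINT a|law2. hit_density \<gamma> (a, 0) y)" by (rule integral_nonneg_AE[OF nn])
      ultimately have "ennreal (f1 y + (LINT a|law2. hit_density \<gamma> (a, 0) y)) = ennreal (hit_density \<gamma> z y)"
        using eq y f0 by (simp add: f_def)
      then show "f1 y = hit_density \<gamma> z y - (LINT a|law2. hit_density \<gamma> (a, 0) y)"
        using f0 \<open>0 \<le> (LINT a|law2. hit_density \<gamma> (a, 0) y)\<close> hit_density_nonneg[of z \<gamma> y] z_pos(1)
        by (subst (asm) ennreal_inj) (simp_all del: ennreal_plus)
    qed
  qed
qed

text \<open>\<open>par_p \<gamma> 1\<close> is negative, so the factor \<open>a * exp (par_p \<gamma> 1 *
  a)\<close> is bounded uniformly in \<open>a\<close>.\<close>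

lemma hit_ratio_bound:
  assumes "0 < a" "1 \<le> y"
  shows "\<bar>hit_ratio \<gamma> (a, 0) y\<bar> \<le> 260 / (- par_p \<gamma> 1)"
proof (cases "a < y")
  case False
  have "par_p \<gamma> 1 < 0" using gamma by (simp add: par_p_def power_less_one_iff)
  then show ?thesis using False by (simp add: hit_ratio_def divide_nonneg_neg)
next
  case True
  define t where "t = y - a"
  have t: "0 < t" using True by (simp add: t_def)
  have p: "0 < - par_p \<gamma> 1" using gamma by (simp add: par_p_def power_less_one_iff)
  have "hit_ratio \<gamma> (a, 0) y = a * ((y / t) * sqrt (y / t) * exp (par_p \<gamma> 1 * a - a\<^sup>2 / (2 * t)))"
    using t by (simp add: hit_ratio_def t_def Let_def)
  also have "exp (par_p \<gamma> 1 * a - a\<^sup>2 / (2 * t)) = exp (- a\<^sup>2 / (2 * t)) * exp (- (- par_p \<gamma> 1) * a)"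
    unfolding mult_exp_exp by simp
  also have "a * ((y / t) * sqrt (y / t) * (exp (- a\<^sup>2 / (2 * t)) * exp (- (- par_p \<gamma> 1) * a)))
    = ((y / t) * sqrt (y / t) * exp (- a\<^sup>2 / (2 * t))) * (a * exp (- (- par_p \<gamma> 1) * a))"
    by (simp only: mult_ac)
  finally have e: "hit_ratio \<gamma> (a, 0) y = ((y / t) * sqrt (y / t) * exp (- a\<^sup>2 / (2 * t))) * (a * exp (- (- par_p \<gamma> 1) * a))" .
  have "hit_ratio \<gamma> (a, 0) y \<le> 260 * (1 / (- par_p \<gamma> 1))" unfolding e
    using passage_weight_bound[OF assms(1) True assms(2)] mult_exp_neg_le[OF p, of a] assms p
    by (intro mult_mono) (auto simp: t_def)
  moreover have "0 \<le> hit_ratio \<gamma> (a, 0) y" unfolding e using assms t by (intro mult_nonneg_nonneg) auto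
  ultimately show ?thesis by simp
qed

lemma exit_ratio_tendsto:
  "((\<lambda>y. hit_ratio \<gamma> z y - (LINT a|law2. hit_ratio \<gamma> (a, 0) y)) \<longlongrightarrow> h_end) at_top"
proof -
  have apos: "AE a in law2. 0 < a" using AE_laws(2) by eventually_elim (use z_pos(3) in auto)
  have "((\<lambda>y. LINT a|law2. hit_ratio \<gamma> (a, 0) y) \<longlongrightarrow> (LINT a|law2. a * exp (par_p \<gamma> 1 * a))) at_top"
  proof (rule integral_dominated_convergence_at_top[where w = "\<lambda>_. 260 / (- par_p \<gamma> 1)"])
    show "(\<lambda>a. hit_ratio \<gamma> (a, 0) y) \<in> borel_measurable law2" for y
      unfolding hit_ratio_def Let_def fst_conv snd_conv by measurable
    show "(\<lambda>a. a * exp (par_p \<gamma> 1 * a)) \<in> borel_measurable law2" by measurable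
    show "integrable law2 (\<lambda>_. 260 / (- par_p \<gamma> 1))"
      using finite_laws(2) by (rule finite_measure.integrable_const)
    show "\<forall>\<^sub>F y in at_top. AE a in law2. norm (hit_ratio \<gamma> (a, 0) y) \<le> 260 / (- par_p \<gamma> 1)"
      using eventually_ge_at_top[of 1]
    proof eventually_elim
      fix y :: real assume "1 \<le> y"
      then show "AE a in law2. norm (hit_ratio \<gamma> (a, 0) y) \<le> 260 / (- par_p \<gamma> 1)"
        using apos by (elim eventually_mono) (simp only: real_norm_def hit_ratio_bound)
    qed
    show "AE a in law2. ((\<lambda>y. hit_ratio \<gamma> (a, 0) y) \<longlongrightarrow> a * exp (par_p \<gamma> 1 * a)) at_top"
      using hit_ratio_tendsto[of \<gamma> "(_, 0)"] by simp
  qed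
  with hit_ratio_tendsto[of \<gamma> z] show ?thesis
    unfolding h_end_def par_exp_def by (rule tendsto_diff)
qed

lemma exit_density_asymptotics:
  assumes f1: "is_density_on {0<..} (exit_measure1 M \<gamma> W z) f1" and cont: "continuous_on {0<..} f1"
  shows "((\<lambda>y. f1 y * (y * sqrt y * sqrt (2 * pi) * exp (y * par_q \<gamma> 1))) \<longlongrightarrow> h_end) at_top"
proof (rule tendstoI)
  fix e :: real assume e: "0 < e"
  let ?w = "\<lambda>y. y * sqrt y * sqrt (2 * pi) * exp (y * par_q \<gamma> 1)"
  have "\<forall>\<^sub>F y in at_top. dist (hit_ratio \<gamma> z y - (LINT a|law2. hit_ratio \<gamma> (a, 0) y)) h_end < e / 2"
    using e by (intro tendstoD[OF exit_ratio_tendsto]) simp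
  then obtain Y0 where Y0: "\<And>y. Y0 \<le> y \<Longrightarrow> dist (hit_ratio \<gamma> z y - (LINT a|law2. hit_ratio \<gamma> (a, 0) y)) h_end < e / 2"
    by (auto simp: eventually_at_top_linorder)
  define Y where "Y = max 0 Y0"
  have ae: "AE y in lborel. y \<in> {Y<..} \<longrightarrow> f1 y * ?w y \<in> cball h_end (e / 2)"
    using exit_density_formula[OF f1]
  proof eventually_elim
    fix y assume eq: "0 < y \<longrightarrow> f1 y = hit_density \<gamma> z y - (LINT a|law2. hit_density \<gamma> (a, 0) y)"
    show "y \<in> {Y<..} \<longrightarrow> f1 y * ?w y \<in> cball h_end (e / 2)"
    proof
      assume "y \<in> {Y<..}"
      then have y: "0 < y" "Y0 \<le> y" by (auto simp: Y_def)
      define c where "c = exp (- y * par_q \<gamma> 1) / (y * sqrt y * sqrt (2 * pi))"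
      have "c * ?w y = exp (- y * par_q \<gamma> 1) * exp (y * par_q \<gamma> 1)" using y by (simp add: c_def)
      also have "\<dots> = 1" unfolding mult_exp_exp by simp
      finally have cw: "c * ?w y = 1" .
      have "f1 y = (hit_ratio \<gamma> z y - (LINT a|law2. hit_ratio \<gamma> (a, 0) y)) * c"
        using eq y unfolding hit_density_ratio[OF y(1)] c_def[symmetric] by (simp add: left_diff_distrib)
      then have "f1 y * ?w y = (hit_ratio \<gamma> z y - (LINT a|law2. hit_ratio \<gamma> (a, 0) y)) * (c * ?w y)"
        by (simp only: mult.assoc)
      also have "\<dots> = hit_ratio \<gamma> z y - (LINT a|law2. hit_ratio \<gamma> (a, 0) y)" unfolding cw by simp
      finally show "f1 y * ?w y \<in> cball h_end (e / 2)" using Y0[OF y(2)] by (simp add: dist_commute)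
    qed
  qed
  have "f1 y * ?w y \<in> cball h_end (e / 2)" if "Y < y" for y
  proof (rule AE_continuous_closed[OF _ _ ae])
    have "continuous_on {Y<..} f1" by (rule continuous_on_subset[OF cont]) (auto simp: Y_def)
    then show "continuous_on {Y<..} (\<lambda>y. f1 y * ?w y)" by (intro continuous_intros)
  qed (use that in auto)
  then show "\<forall>\<^sub>F y in at_top. dist (f1 y * ?w y) h_end < e"
    using e by (intro eventually_mono[OF eventually_gt_at_top[of Y]]) (force simp: dist_commute)
qed

end

section \<open>From limits to asymptotic equivalences\<close>

lemma saddle_at_0: "saddle \<gamma> 0 = (par_p \<gamma> 0, par_q \<gamma> 0)"
  using saddle_eq[of 0 \<gamma>] by (simp add: dir_par_def)

lemma saddle_at_pi2: "saddle \<gamma> (pi / 2) = (par_p \<gamma> 1, par_q \<gamma> 1)"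
  using saddle_eq[of "pi / 2" \<gamma>] by (simp add: dir_par_def)

lemma saddle_explicit:
  assumes "0 < \<alpha>" "\<alpha> < pi / 2"
  shows "saddle \<gamma> \<alpha> = (\<gamma>\<^sup>2 / 2 - 1 / (2 * (1 + 1 / tan \<alpha>)\<^sup>2), (1 - \<gamma>)\<^sup>2 / 2 - 1 / (2 * (1 + tan \<alpha>)\<^sup>2))"
proof -
  note t = quarter_trig[OF assms]
  have v: "dir_par \<alpha> = tan \<alpha> / (1 + tan \<alpha>)" using t by (intro dir_par_tan)
  then have v1: "dir_par \<alpha> = 1 / (1 + 1 / tan \<alpha>)" and v2: "1 - dir_par \<alpha> = 1 / (1 + tan \<alpha>)"
    using t(3) by (simp_all add: field_simps)
  have "par_p \<gamma> (dir_par \<alpha>) = \<gamma>\<^sup>2 / 2 - 1 / (2 * (1 + 1 / tan \<alpha>)\<^sup>2)"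
    unfolding par_p_def v1 by (simp add: power_divide diff_divide_distrib)
  moreover have "par_q \<gamma> (dir_par \<alpha>) = (1 - \<gamma>)\<^sup>2 / 2 - 1 / (2 * (1 + tan \<alpha>)\<^sup>2)"
    unfolding par_q_def v2 by (simp add: power_divide diff_divide_distrib)
  ultimately show ?thesis using saddle_eq[of \<alpha> \<gamma>] t by simp
qed

text \<open>The two exponents are values of the same quadratic polynomial in \<open>v\<close>, at its
  maximiser and at \<open>dir_par \<alpha>\<close>; their difference is the completed square.\<close>

lemma saddle_difference:
  assumes w: "w \<in> quadrant" and \<alpha>: "0 < \<alpha>" "\<alpha> < pi / 2"
  shows "w \<bullet> saddle \<gamma> (angle w) - w \<bullet> saddle \<gamma> \<alpha>
    = ((snd w - tan \<alpha> * fst w) / sqrt (norm w))\<^sup>2 * (1 / ((fst w + snd w) / norm w)) * (1 / (2 * (1 + tan \<alpha>)\<^sup>2))"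
proof -
  define x y \<tau> \<sigma> v where "x = fst w" and "y = snd w" and "\<tau> = tan \<alpha>" and "\<sigma> = x + y" and "v = dir_par \<alpha>"
  note t = quarter_trig[OF \<alpha>]
  have xy: "0 < x" "0 < y" "0 < \<sigma>" using w by (auto simp: quadrant_def x_def y_def \<sigma>_def)
  have \<tau>: "0 < \<tau>" using t by (simp add: \<tau>_def)
  have "w \<noteq> 0" using xy(1) by (auto simp: x_def)
  then have n: "0 < norm w" by simp
  have "w \<bullet> saddle \<gamma> \<alpha> = par_p \<gamma> v * x + par_q \<gamma> v * y"
    using saddle_eq[of \<alpha> \<gamma>] t by (simp add: inner_prod_def x_def y_def v_def mult.commute)
  moreover have "w \<bullet> saddle \<gamma> (angle w) = (y - \<gamma> * \<sigma>)\<^sup>2 / (2 * \<sigma>)"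
    using angle_saddle[OF w] by (simp add: x_def y_def \<sigma>_def)
  moreover have "(y - \<gamma> * \<sigma>)\<^sup>2 / (2 * \<sigma>) - (par_p \<gamma> v * x + par_q \<gamma> v * y) = (y - v * \<sigma>)\<^sup>2 / (2 * \<sigma>)"
  proof -
    have x: "x = \<sigma> - y" by (simp add: \<sigma>_def)
    have gen: "par_p \<gamma> v * (s - y) + par_q \<gamma> v * y = (r - (y - v * s)\<^sup>2) / (2 * s)"
      if "0 < s" and r: "r = (y - \<gamma> * s)\<^sup>2" for s r :: real
    proof -
      have "2 * (par_p \<gamma> v * (s - y) + par_q \<gamma> v * y) = (\<gamma>\<^sup>2 - v\<^sup>2) * (s - y) + ((1 - \<gamma>)\<^sup>2 - (1 - v)\<^sup>2) * y"
        unfolding par_p_def par_q_def by simp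
      then have "(par_p \<gamma> v * (s - y) + par_q \<gamma> v * y) * (2 * s) = s * ((\<gamma>\<^sup>2 - v\<^sup>2) * (s - y) + ((1 - \<gamma>)\<^sup>2 - (1 - v)\<^sup>2) * y)"
        by (simp add: mult.commute mult.left_commute)
      also have "\<dots> = r - (y - v * s)\<^sup>2" unfolding r by (simp add: power2_eq_square algebra_simps)
      finally show ?thesis using that(1) by (simp add: eq_divide_eq)
    qed
    have "par_p \<gamma> v * x + par_q \<gamma> v * y = ((y - \<gamma> * \<sigma>)\<^sup>2 - (y - v * \<sigma>)\<^sup>2) / (2 * \<sigma>)"
      unfolding x by (rule gen[OF xy(3) refl])
    then show ?thesis by (simp add: diff_divide_distrib)
  qed
  moreover have "y - v * \<sigma> = (y - \<tau> * x) / (1 + \<tau>)"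
  proof -
    have "v = \<tau> / (1 + \<tau>)" unfolding v_def \<tau>_def using t by (intro dir_par_tan)
    moreover have "b - k / (1 + k) * (a + b) = (b - k * a) / (1 + k)" if "0 < k" for a b k :: real
      using that by (simp add: field_simps)
    ultimately show ?thesis using \<tau> by (simp add: \<sigma>_def)
  qed
  ultimately have d: "w \<bullet> saddle \<gamma> (angle w) - w \<bullet> saddle \<gamma> \<alpha> = ((y - \<tau> * x) / (1 + \<tau>))\<^sup>2 / (2 * \<sigma>)" by simp
  have gen: "(N / T)\<^sup>2 / (2 * s) = (N / sqrt m)\<^sup>2 * (1 / (s / m)) * (1 / (2 * T\<^sup>2))" if "0 < m" for N T s m :: real
    using that by (simp add: power_divide)
  show ?thesis unfolding d gen[OF n] by (simp add: x_def y_def \<tau>_def \<sigma>_def)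
qed

text \<open>Replaces the coordinate sum under the square root by its equivalent \<open>c * norm w\<close>.\<close>

lemma normalised_asymp_equiv:
  assumes A: "((\<lambda>w. g w * (sqrt (2 * pi * (fst w + snd w)) * exp (e w))) \<longlongrightarrow> h) F" and h: "h \<noteq> 0"
    and r: "((\<lambda>w :: real \<times> real. (fst w + snd w) / norm w) \<longlongrightarrow> c) F" and c: "0 < c"
  shows "g \<sim>[F] (\<lambda>w. h / sqrt (norm w) * exp (- e w) / sqrt (2 * pi * c))"
proof (rule asymp_equivI')
  have "((\<lambda>w. g w * (sqrt (2 * pi * (fst w + snd w)) * exp (e w)) / h * sqrt (c / ((fst w + snd w) / norm w))) \<longlongrightarrow> h / h * sqrt (c / c)) F"
    using h c by (intro tendsto_intros A r) auto
  then have "((\<lambda>w. g w * (sqrt (2 * pi * (fst w + snd w)) * exp (e w)) / h * sqrt (c / ((fst w + snd w) / norm w))) \<longlongrightarrow> 1) F"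
    using h c by simp
  moreover have "\<forall>\<^sub>F w in F. g w * (sqrt (2 * pi * (fst w + snd w)) * exp (e w)) / h * sqrt (c / ((fst w + snd w) / norm w))
      = g w / (h / sqrt (norm w) * exp (- e w) / sqrt (2 * pi * c))"
    using order_tendstoD(1)[OF r c]
  proof eventually_elim
    fix w :: "real \<times> real" assume pos: "0 < (fst w + snd w) / norm w"
    then have n: "0 < norm w" using norm_ge_zero[of w] by (cases "norm w = 0") auto
    with pos have s: "0 < fst w + snd w" by (simp add: zero_less_divide_iff)
    have gen: "G * (sqrt (2 * pi * s) * E) / h * sqrt (c / (s / n)) = G / (h / sqrt n * (1 / E) / sqrt (2 * pi * c))"
      if "0 < s" "0 < n" "E \<noteq> 0" for G E s n :: real
      using that c h by (simp add: real_sqrt_mult real_sqrt_divide)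
    show "g w * (sqrt (2 * pi * (fst w + snd w)) * exp (e w)) / h * sqrt (c / ((fst w + snd w) / norm w))
      = g w / (h / sqrt (norm w) * exp (- e w) / sqrt (2 * pi * c))"
      unfolding exp_minus inverse_eq_divide by (rule gen[OF s n]) simp
  qed
  ultimately show "((\<lambda>w. g w / (h / sqrt (norm w) * exp (- e w) / sqrt (2 * pi * c))) \<longlongrightarrow> 1) F"
    by (rule Lim_transform_eventually)
qed

context quadrant_process
begin

lemma h_dir_eq_hfun:
  assumes "0 < \<alpha>" "\<alpha> < pi / 2"
  shows "h_dir M \<gamma> W \<alpha> z = hfun (dir_par \<alpha>)"
proof -
  note t = quarter_trig[OF assms]
  have "saddle \<gamma> \<alpha> = (par_p \<gamma> (dir_par \<alpha>), par_q \<gamma> (dir_par \<alpha>))" using t by (intro saddle_eq) simp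
  then show ?thesis
    using L1_eq_lap1[OF par_less(1), of "dir_par \<alpha>"] L2_eq_lap2[OF par_less(2), of "dir_par \<alpha>"] t
    by (simp add: h_dir_def hfun_def par_exp_def)
qed

text \<open>The saddle point of the vertical direction has the parameter \<open>v = 1\<close>, where
  \<open>par_p\<close> is negative and \<open>L2\<close> is the transform of the exit law, which
  may be differentiated under the integral.\<close>

lemma h_pi2_eq_h_end: "h_pi2 M \<gamma> W z = h_end"
proof -
  have p: "par_p \<gamma> 1 < 0" using gamma by (simp add: par_p_def power_less_one_iff)
  have "(L2 M \<gamma> W z has_real_derivative (LINT x|law2. x * exp (par_p \<gamma> 1 * x))) (at (par_p \<gamma> 1))"
  proof (rule has_field_derivative_transform_within_open[OF lap2_deriv[OF p], of "{..<0}"])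
    show "lap2 x = L2 M \<gamma> W z x" if "x \<in> {..<0}" for x
      using that by (intro L2_eq_lap2[symmetric] nonpos_in_range) auto
  qed (use p in auto)
  then have "deriv (L2 M \<gamma> W z) (par_p \<gamma> 1) = (LINT x|law2. x * exp (par_p \<gamma> 1 * x))" by (rule DERIV_imp_deriv)
  then show ?thesis by (simp add: h_pi2_def saddle_at_pi2 h_end_def par_exp_def mult.commute)
qed

text \<open>The second claim follows from the first: by \<open>saddle_difference\<close> the condition on
  \<open>F\<close> says that the two exponents differ by a null sequence.\<close>

lemma green_asymptotics:
  assumes \<alpha>: "0 < \<alpha>" "\<alpha> < pi / 2"
    and g: "is_density_on quadrant (green_measure M \<gamma> W z) g" "continuous_on (quadrant - {z}) g"
  shows "g \<sim>[to_infinity_dir \<alpha>] (\<lambda>w. h_dir M \<gamma> W \<alpha> z / sqrt (norm w) * exp (- (w \<bullet> saddle \<gamma> (angle w)))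
             / sqrt (2 * pi * (cos \<alpha> + sin \<alpha>)))"
    and "\<And>F. F \<le> to_infinity_dir \<alpha> \<Longrightarrow> ((\<lambda>w. (snd w - tan \<alpha> * fst w) / sqrt (norm w)) \<longlongrightarrow> 0) F \<Longrightarrow>
      g \<sim>[F] (\<lambda>w. h_dir M \<gamma> W \<alpha> z / sqrt (norm w) * exp (- (w \<bullet> saddle \<gamma> \<alpha>))
                / sqrt (2 * pi * (cos \<alpha> + sin \<alpha>)))"
proof -
  note t = quarter_trig[OF \<alpha>]
  note A = green_normalised_tendsto[OF \<alpha> g, folded h_dir_eq_hfun[OF \<alpha>]]
  have h: "h_dir M \<gamma> W \<alpha> z \<noteq> 0" using hfun_pos[of "dir_par \<alpha>"] h_dir_eq_hfun[OF \<alpha>] t by simp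
  note r = to_infinity_dir_facts(6)[OF \<alpha>]
  have c: "0 < cos \<alpha> + sin \<alpha>" using t by simp
  show "g \<sim>[to_infinity_dir \<alpha>] (\<lambda>w. h_dir M \<gamma> W \<alpha> z / sqrt (norm w) * exp (- (w \<bullet> saddle \<gamma> (angle w)))
             / sqrt (2 * pi * (cos \<alpha> + sin \<alpha>)))"
    by (rule normalised_asymp_equiv[OF A h r c])
  fix F assume F: "F \<le> to_infinity_dir \<alpha>" and D: "((\<lambda>w. (snd w - tan \<alpha> * fst w) / sqrt (norm w)) \<longlongrightarrow> 0) F"
  have rF: "((\<lambda>w. (fst w + snd w) / norm w) \<longlongrightarrow> cos \<alpha> + sin \<alpha>) F" by (rule tendsto_mono[OF F r])
  have "((\<lambda>w. ((snd w - tan \<alpha> * fst w) / sqrt (norm w))\<^sup>2 * (1 / ((fst w + snd w) / norm w)) * (1 / (2 * (1 + tan \<alpha>)\<^sup>2)))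
    \<longlongrightarrow> 0\<^sup>2 * (1 / (cos \<alpha> + sin \<alpha>)) * (1 / (2 * (1 + tan \<alpha>)\<^sup>2))) F"
    using c by (intro tendsto_mult tendsto_power tendsto_divide tendsto_const D rF) auto
  moreover have q: "\<forall>\<^sub>F w in F. w \<in> quadrant" using to_infinity_dir_facts(1)[OF \<alpha>] F by (rule filter_leD[rotated])
  then have "\<forall>\<^sub>F w in F. ((snd w - tan \<alpha> * fst w) / sqrt (norm w))\<^sup>2 * (1 / ((fst w + snd w) / norm w)) * (1 / (2 * (1 + tan \<alpha>)\<^sup>2))
    = w \<bullet> saddle \<gamma> (angle w) - w \<bullet> saddle \<gamma> \<alpha>"
    by eventually_elim (rule saddle_difference[OF _ \<alpha>, symmetric])
  ultimately have "((\<lambda>w. w \<bullet> saddle \<gamma> (angle w) - w \<bullet> saddle \<gamma> \<alpha>) \<longlongrightarrow> 0) F"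
    using Lim_transform_eventually by fastforce
  then have "((\<lambda>w. exp (- (w \<bullet> saddle \<gamma> (angle w) - w \<bullet> saddle \<gamma> \<alpha>))) \<longlongrightarrow> exp (- 0)) F"
    by (intro tendsto_exp tendsto_minus)
  with tendsto_mono[OF F A] have "((\<lambda>w. g w * (sqrt (2 * pi * (fst w + snd w)) * exp (w \<bullet> saddle \<gamma> (angle w)))
      * exp (- (w \<bullet> saddle \<gamma> (angle w) - w \<bullet> saddle \<gamma> \<alpha>))) \<longlongrightarrow> h_dir M \<gamma> W \<alpha> z * exp (- 0)) F"
    by (rule tendsto_mult)
  moreover have "g w * (sqrt (2 * pi * (fst w + snd w)) * exp E) * exp (- (E - E')) = g w * (sqrt (2 * pi * (fst w + snd w)) * exp E')" for w E E'
  proof -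
    have "exp E * exp (- (E - E')) = exp E'" unfolding mult_exp_exp by simp
    then show ?thesis by (simp only: mult.assoc)
  qed
  ultimately have "((\<lambda>w. g w * (sqrt (2 * pi * (fst w + snd w)) * exp (w \<bullet> saddle \<gamma> \<alpha>))) \<longlongrightarrow> h_dir M \<gamma> W \<alpha> z) F"
    unfolding minus_zero exp_zero mult_1_right by (simp only:)
  from normalised_asymp_equiv[OF this h rF c]
  show "g \<sim>[F] (\<lambda>w. h_dir M \<gamma> W \<alpha> z / sqrt (norm w) * exp (- (w \<bullet> saddle \<gamma> \<alpha>)) / sqrt (2 * pi * (cos \<alpha> + sin \<alpha>)))" .
qed

lemma exit_density_asymp_equiv:
  assumes f1: "is_density_on {0<..} (exit_measure1 M \<gamma> W z) f1" "continuous_on {0<..} f1"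
  shows "f1 \<sim>[at_top] (\<lambda>y. h_pi2 M \<gamma> W z / y powr (3 / 2) * exp (- y * snd (saddle \<gamma> (pi / 2))) / sqrt (2 * pi))"
proof (rule asymp_equivI')
  have h: "h_end \<noteq> 0" using h_end_pos by simp
  have "((\<lambda>y. f1 y * (y * sqrt y * sqrt (2 * pi) * exp (y * par_q \<gamma> 1)) / h_end) \<longlongrightarrow> h_end / h_end) at_top"
    using h by (intro tendsto_divide exit_density_asymptotics[OF f1] tendsto_const)
  then have "((\<lambda>y. f1 y * (y * sqrt y * sqrt (2 * pi) * exp (y * par_q \<gamma> 1)) / h_end) \<longlongrightarrow> 1) at_top" using h by simp
  moreover have "\<forall>\<^sub>F y in at_top. f1 y * (y * sqrt y * sqrt (2 * pi) * exp (y * par_q \<gamma> 1)) / h_end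
    = f1 y / (h_pi2 M \<gamma> W z / y powr (3 / 2) * exp (- y * snd (saddle \<gamma> (pi / 2))) / sqrt (2 * pi))"
    using eventually_gt_at_top[of 0]
  proof eventually_elim
    fix y :: real assume y: "0 < y"
    have "y powr (3 / 2) = y powr 1 * y powr (1 / 2)" unfolding powr_add[symmetric] by simp
    then have yp: "y powr (3 / 2) = y * sqrt y" using y by (simp add: powr_half_sqrt)
    have gen: "f * (a * s * E) / h = f / (h / a * (1 / E) / s)" if "a \<noteq> 0" "s \<noteq> 0" "E \<noteq> 0" for f a s E h :: real
      using that by simp
    have e: "exp (- y * par_q \<gamma> 1) = 1 / exp (y * par_q \<gamma> 1)" by (simp add: exp_minus inverse_eq_divide)
    show "f1 y * (y * sqrt y * sqrt (2 * pi) * exp (y * par_q \<gamma> 1)) / h_end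
      = f1 y / (h_pi2 M \<gamma> W z / y powr (3 / 2) * exp (- y * snd (saddle \<gamma> (pi / 2))) / sqrt (2 * pi))"
      unfolding yp h_pi2_eq_h_end saddle_at_pi2 snd_conv e using y by (intro gen) auto
  qed
  ultimately show "((\<lambda>y. f1 y / (h_pi2 M \<gamma> W z / y powr (3 / 2) * exp (- y * snd (saddle \<gamma> (pi / 2))) / sqrt (2 * pi))) \<longlongrightarrow> 1) at_top"
    by (rule Lim_transform_eventually)
qed

end

section \<open>Harmonicity and boundary values\<close>

text \<open>A start on an open axis exits at once at its starting point, while the other axis has a positive
  distance.\<close>

lemma (in brownian_motion) axis_start_laplace:
  assumes "0 < x"
  shows "exit_laplace1 M \<gamma> W (x, 0) q = 0" "exit_laplace2 M \<gamma> W (x, 0) p = exp (p * x)"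
    "exit_laplace1 M \<gamma> W (0, x) q = exp (q * x)" "exit_laplace2 M \<gamma> W (0, x) p = 0"
proof -
  have zero: "hit \<gamma> W z C \<omega> = 0" if "\<omega> \<in> space M" "z \<in> C" for z C \<omega>
  proof (rule antisym)
    have "proc \<gamma> W z 0 \<omega> = z" using that by (simp add: proc_def start_zero)
    then show "hit \<gamma> W z C \<omega> \<le> 0" unfolding hit_def using that
      by (intro INF_lower2[of 0]) (auto simp: zero_ereal_def)
  qed (rule hit_nonneg)
  have X: "hit2 \<gamma> W (x, 0) \<omega> = 0" "0 < hit1 \<gamma> W (x, 0) \<omega>" if "\<omega> \<in> space M" for \<omega>
    unfolding hit1_eq hit2_eq using that assms
    by (auto intro!: zero hit_pos closed_axes simp: x_axis_def) (auto simp: y_axis_def)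
  have Y: "hit1 \<gamma> W (0, x) \<omega> = 0" "0 < hit2 \<gamma> W (0, x) \<omega>" if "\<omega> \<in> space M" for \<omega>
    unfolding hit1_eq hit2_eq using that assms
    by (auto intro!: zero hit_pos closed_axes simp: y_axis_def) (auto simp: x_axis_def)
  have X': "hit2 \<gamma> W (x, 0) \<omega> < hit1 \<gamma> W (x, 0) \<omega>" if "\<omega> \<in> space M" for \<omega> using X[OF that] by simp
  have Y': "hit1 \<gamma> W (0, x) \<omega> < hit2 \<gamma> W (0, x) \<omega>" if "\<omega> \<in> space M" for \<omega> using Y[OF that] by simp
  have "exit_laplace1 M \<gamma> W (x, 0) q = (LINT \<omega>|M. 0)" unfolding exit_laplace1_def
    by (intro Bochner_Integration.integral_cong) (simp_all add: less_imp_not_less[OF X'])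
  then show "exit_laplace1 M \<gamma> W (x, 0) q = 0" by simp
  have "exit_laplace2 M \<gamma> W (0, x) p = (LINT \<omega>|M. 0)" unfolding exit_laplace2_def
    by (intro Bochner_Integration.integral_cong) (simp_all add: less_imp_not_less[OF Y'])
  then show "exit_laplace2 M \<gamma> W (0, x) p = 0" by simp
  have "exit_laplace2 M \<gamma> W (x, 0) p = (LINT \<omega>|M. exp (p * x))" unfolding exit_laplace2_def
    by (intro Bochner_Integration.integral_cong) (simp_all add: X indicator_def exit_X_def proc_def start_zero)
  then show "exit_laplace2 M \<gamma> W (x, 0) p = exp (p * x)" by (simp add: prob_space)
  have "exit_laplace1 M \<gamma> W (0, x) q = (LINT \<omega>|M. exp (q * x))" unfolding exit_laplace1_def
    by (intro Bochner_Integration.integral_cong) (simp_all add: Y indicator_def exit_Y_def proc_def start_zero)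
  then show "exit_laplace1 M \<gamma> W (0, x) q = exp (q * x)" by (simp add: prob_space)
qed

lemma (in brownian_motion) h_dir_axis_zero:
  assumes "z \<in> {0<..} \<times> {0} \<union> {0} \<times> {0<..}"
  shows "h_dir M \<gamma> W \<alpha> z = 0"
  using assms by (auto simp: h_dir_def L1_def L2_def axis_start_laplace split: prod.split)

text \<open>Inside the quadrant the function is given by the series. Near the horizontal axis it is squeezed
  by \<open>par_exp \<gamma> v - par_exp \<gamma> (- v)\<close>, near the vertical axis by
  \<open>par_exp \<gamma> v - par_exp \<gamma> (2 - v)\<close>; these are continuous on the
  plane and vanish on the respective axis, so the corner is included.\<close>

theorem (in brownian_motion) killed_harmonic_h_dir:
  assumes gamma: "0 < \<gamma>" "\<gamma> < 1" and \<alpha>: "0 < \<alpha>" "\<alpha> < pi / 2"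
  shows "killed_harmonic \<gamma> (h_dir M \<gamma> W \<alpha>)"
proof -
  define v where "v = dir_par \<alpha>"
  have v: "0 < v" "v < 1" using quarter_trig[OF \<alpha>] by (simp_all add: v_def)
  have qp: "quadrant_process M W \<gamma> z" if "z \<in> quadrant" for z
    using that gamma by unfold_locales
  have h: "h_dir M \<gamma> W \<alpha> z = quadrant_process.hfun M W \<gamma> z v" if "z \<in> quadrant" for z
    using quadrant_process.h_dir_eq_hfun[OF qp[OF that] \<alpha>] by (simp add: v_def)
  have series: "h_dir M \<gamma> W \<alpha> z = exp_sum \<gamma> 4 (h_nodes v) h_coeff z" if "z \<in> quadrant" for z
    using quadrant_process.hfun_series[OF qp[OF that] v] h[OF that] by simp
  have spread: "\<And>j. spread (h_nodes v j)" using v by (intro spread_h_nodes) auto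
  note harm = harmonic_exp_sum[OF spread poly_bounded_h_coeff series]
  have lim: "((h_dir M \<gamma> W \<alpha>) \<longlongrightarrow> 0) (at b within quadrant)"
    if b: "par_exp \<gamma> v b - par_exp \<gamma> w b = 0" and w: "w = - v \<or> w = 2 - v" for b w
  proof (rule tendsto_sandwich[OF _ _ tendsto_const])
    have "continuous (at b within quadrant) (\<lambda>z. par_exp \<gamma> v z - par_exp \<gamma> w z)"
      unfolding par_exp_def by (intro continuous_intros)
    then show "((\<lambda>z. par_exp \<gamma> v z - par_exp \<gamma> w z) \<longlongrightarrow> 0) (at b within quadrant)"
      using b by (simp add: continuous_within)
    have ev: "\<forall>\<^sub>F z in at b within quadrant. z \<in> quadrant" by (simp add: eventually_at_filter)
    then show "\<forall>\<^sub>F z in at b within quadrant. 0 \<le> h_dir M \<gamma> W \<alpha> z"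
      by eventually_elim (use quadrant_process.hfun_pos[OF qp v] h in \<open>auto intro: less_imp_le\<close>)
    from ev show "\<forall>\<^sub>F z in at b within quadrant. h_dir M \<gamma> W \<alpha> z \<le> par_exp \<gamma> v z - par_exp \<gamma> w z"
      by eventually_elim (use quadrant_process.hfun_le[OF qp v] h w in auto)
  qed
  have "((h_dir M \<gamma> W \<alpha>) \<longlongrightarrow> 0) (at b within quadrant)" if "b \<in> {0..} \<times> {0} \<union> {0} \<times> {0..}" for b
  proof (cases "snd b = 0")
    case True
    then show ?thesis by (intro lim[of _ "- v"]) (auto simp: par_exp_def par_p_def)
  next
    case False
    then have "fst b = 0" using that by auto
    then show ?thesis by (intro lim[of _ "2 - v"]) (auto simp: par_exp_def par_q_def power2_eq_square algebra_simps)
  qed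
  with harm h_dir_axis_zero show ?thesis unfolding killed_harmonic_def by blast
qed

text \<open>Exchanging the coordinates amounts to the replacement of \<open>W\<close> by \<open>- W\<close>
  and of \<open>\<gamma>\<close> by \<open>1 - \<gamma>\<close>. Hence every statement about the
  vertical axis has a mirror image for the horizontal one.\<close>

lemma (in brownian_motion) brownian_motion_uminus: "brownian_motion M (\<lambda>t \<omega>. - W t \<omega>)"
proof unfold_locales
  fix s t :: real assume st: "0 \<le> s" "s < t"
  show "distributed M lborel (\<lambda>\<omega>. - W t \<omega> - - W s \<omega>) (normal_density 0 (sqrt (t - s)))"
    using normal_density_affine[OF normal_increments[OF st], of "-1" 0] st by simp
next
  fix \<tau> :: "nat \<Rightarrow> real" and n
  assume "0 \<le> \<tau> 0" "strict_mono \<tau>"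
  from indep_vars_compose2[OF indep_increments[OF this, of n], of "\<lambda>_ x. - x" "\<lambda>_. borel"]
  show "indep_vars (\<lambda>_. borel) (\<lambda>i \<omega>. - W (\<tau> (Suc i)) \<omega> - - W (\<tau> i) \<omega>) {..<n}" by simp
qed (auto simp: start_zero intro!: continuous_on_minus continuous_paths)

lemma proc_reflect: "proc (1 - \<gamma>) (\<lambda>t \<omega>. - W t \<omega>) (prod.swap z) t \<omega> = prod.swap (proc \<gamma> W z t \<omega>)"
  by (simp add: proc_def)

lemma hit_reflect:
  "hit1 (1 - \<gamma>) (\<lambda>t \<omega>. - W t \<omega>) (prod.swap z) = hit2 \<gamma> W z"
  "hit2 (1 - \<gamma>) (\<lambda>t \<omega>. - W t \<omega>) (prod.swap z) = hit1 \<gamma> W z"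
proof -
  have "prod.swap u \<in> A \<times> B \<longleftrightarrow> u \<in> B \<times> A" for u :: "real \<times> real" and A B by (cases u) auto
  then show "hit1 (1 - \<gamma>) (\<lambda>t \<omega>. - W t \<omega>) (prod.swap z) = hit2 \<gamma> W z"
    "hit2 (1 - \<gamma>) (\<lambda>t \<omega>. - W t \<omega>) (prod.swap z) = hit1 \<gamma> W z"
    by (simp_all only: hit1_def[abs_def] hit2_def[abs_def] proc_reflect)
qed

lemma exit_position_reflect:
  "exit_Y (1 - \<gamma>) (\<lambda>t \<omega>. - W t \<omega>) (prod.swap z) = exit_X \<gamma> W z"
  "exit_X (1 - \<gamma>) (\<lambda>t \<omega>. - W t \<omega>) (prod.swap z) = exit_Y \<gamma> W z"
  by (simp_all only: exit_Y_def[abs_def] exit_X_def[abs_def] hit_reflect proc_reflect fst_swap snd_swap)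

lemma exit_measure_reflect:
  "exit_measure1 M (1 - \<gamma>) (\<lambda>t \<omega>. - W t \<omega>) (prod.swap z) = exit_measure2 M \<gamma> W z"
  by (simp only: exit_measure1_def[abs_def] exit_measure2_def[abs_def] exit_position_reflect hit_reflect)

lemma L2_reflect: "L2 M (1 - \<gamma>) (\<lambda>t \<omega>. - W t \<omega>) (prod.swap z) = L1 M \<gamma> W z"
proof -
  have Q: "Q_minus (1 - \<gamma>) p = P_minus \<gamma> p" for p by (simp add: Q_minus_def P_minus_def)
  show ?thesis
    unfolding L1_def[abs_def] L2_def[abs_def] exit_laplace1_def exit_laplace2_def exit_position_reflect hit_reflect
      Q fst_swap snd_swap by (auto simp: fun_eq_iff add.commute)
qed

lemma h_pi2_reflect: "h_pi2 M (1 - \<gamma>) (\<lambda>t \<omega>. - W t \<omega>) (prod.swap z) = h_0 M \<gamma> W z"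
  by (simp add: h_pi2_def h_0_def saddle_at_0 saddle_at_pi2 L2_reflect par_p_def par_q_def add.commute)

theorem theorem4:
  fixes M :: "'a measure" and W :: "real \<Rightarrow> 'a \<Rightarrow> real"
    and \<gamma> \<alpha> :: real and z\<^sub>0 :: "real \<times> real"
    and g :: "real \<times> real \<Rightarrow> real" and f1 f2 :: "real \<Rightarrow> real"
  assumes bm: "brownian_motion M W"
    and gamma: "0 < \<gamma>" "\<gamma> < 1"
    and z0: "z\<^sub>0 \<in> quadrant"
    and alpha: "0 < \<alpha>" "\<alpha> < pi / 2"
    and g: "is_density_on quadrant (green_measure M \<gamma> W z\<^sub>0) g"
           "continuous_on (quadrant - {z\<^sub>0}) g"
    and f1: "is_density_on {0<..} (exit_measure1 M \<gamma> W z\<^sub>0) f1" "continuous_on {0<..} f1"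
    and f2: "is_density_on {0<..} (exit_measure2 M \<gamma> W z\<^sub>0) f2" "continuous_on {0<..} f2"
  shows
    "{z. is_saddle \<gamma> \<alpha> z} = {saddle \<gamma> \<alpha>} \<and>
     saddle \<gamma> \<alpha> = (\<gamma>\<^sup>2 / 2 - 1 / (2 * (1 + 1 / tan \<alpha>)\<^sup>2),
                   (1 - \<gamma>)\<^sup>2 / 2 - 1 / (2 * (1 + tan \<alpha>)\<^sup>2)) \<and>
     saddle \<gamma> 0 = (\<gamma>\<^sup>2 / 2, - \<gamma> + \<gamma>\<^sup>2 / 2) \<and>
     saddle \<gamma> (pi / 2) = ((\<gamma>\<^sup>2 - 1) / 2, (1 - \<gamma>)\<^sup>2 / 2) \<and>
     killed_harmonic \<gamma> (h_dir M \<gamma> W \<alpha>) \<and>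
     g \<sim>[to_infinity_dir \<alpha>]
       (\<lambda>z. h_dir M \<gamma> W \<alpha> z\<^sub>0 / sqrt (norm z) * exp (- (z \<bullet> saddle \<gamma> (angle z)))
             / sqrt (2 * pi * (cos \<alpha> + sin \<alpha>))) \<and>
     (\<forall>F \<le> to_infinity_dir \<alpha>.
        ((\<lambda>z. (snd z - tan \<alpha> * fst z) / sqrt (norm z)) \<longlongrightarrow> 0) F \<longrightarrow>
        g \<sim>[F]
          (\<lambda>z. h_dir M \<gamma> W \<alpha> z\<^sub>0 / sqrt (norm z) * exp (- (z \<bullet> saddle \<gamma> \<alpha>))
                / sqrt (2 * pi * (cos \<alpha> + sin \<alpha>)))) \<and>
     f1 \<sim>[at_top]
       (\<lambda>y. h_pi2 M \<gamma> W z\<^sub>0 / y powr (3 / 2) * exp (- y * snd (saddle \<gamma> (pi / 2))) / sqrt (2 * pi)) \<and>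
     f2 \<sim>[at_top]
       (\<lambda>x. h_0 M \<gamma> W z\<^sub>0 / x powr (3 / 2) * exp (- x * fst (saddle \<gamma> 0)) / sqrt (2 * pi))"
proof -
  interpret brownian_motion M W by (rule bm)
  interpret Q: quadrant_process M W \<gamma> z\<^sub>0 using gamma z0 by unfold_locales
  interpret R: brownian_motion M "\<lambda>t \<omega>. - W t \<omega>" by (rule brownian_motion_uminus)
  interpret R: quadrant_process M "\<lambda>t \<omega>. - W t \<omega>" "1 - \<gamma>" "prod.swap z\<^sub>0"
    using gamma z0 by unfold_locales (auto simp: quadrant_def)
  have cs: "0 < cos \<alpha> + sin \<alpha>" using quarter_trig[OF alpha] by simp
  have "f2 \<sim>[at_top] (\<lambda>x. h_0 M \<gamma> W z\<^sub>0 / x powr (3 / 2) * exp (- x * snd (saddle (1 - \<gamma>) (pi / 2))) / sqrt (2 * pi))"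
    using R.exit_density_asymp_equiv[unfolded exit_measure_reflect, OF f2] unfolding h_pi2_reflect .
  moreover have "snd (saddle (1 - \<gamma>) (pi / 2)) = fst (saddle \<gamma> 0)"
    by (simp add: saddle_at_0 saddle_at_pi2 par_p_def par_q_def)
  ultimately have f2_asymp: "f2 \<sim>[at_top] (\<lambda>x. h_0 M \<gamma> W z\<^sub>0 / x powr (3 / 2) * exp (- x * fst (saddle \<gamma> 0)) / sqrt (2 * pi))"
    by simp
  have s0: "saddle \<gamma> 0 = (\<gamma>\<^sup>2 / 2, - \<gamma> + \<gamma>\<^sup>2 / 2)"
    unfolding saddle_at_0 par_p_def par_q_def by (simp add: power2_eq_square field_simps)
  have s1: "saddle \<gamma> (pi / 2) = ((\<gamma>\<^sup>2 - 1) / 2, (1 - \<gamma>)\<^sup>2 / 2)"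
    unfolding saddle_at_pi2 par_p_def par_q_def by simp
  have "{z. is_saddle \<gamma> \<alpha> z} = {saddle \<gamma> \<alpha>}"
    unfolding saddle_eq[OF cs] using is_saddle_iff[OF cs] by blast
  then show ?thesis
    using saddle_explicit[OF alpha] s0 s1 killed_harmonic_h_dir[OF gamma alpha] Q.green_asymptotics[OF alpha g]
      Q.exit_density_asymp_equiv[OF f1] f2_asymp
    by (intro conjI allI impI) assumption+
qed

end
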